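(* Let $(J,\eta)$ be a quasi-integrable structure (a quasi-integrable $\mathrm{U}(3)$-structure or $\mathrm{U}(1,2)$-structure) on a $6$-manifold $M$ and let $E\to M$ be a rank $r$ complex vector bundle endowed with a Hermitian structure $h$. The overdetermined system $$(\nabla^2)^{0,2}=\mathrm{tr}_\eta(\nabla^2)=0$$ for $h$-compatible connections $\nabla$ on $E$ is involutive, with Cartan characters $$(s_0,s_1,s_2,s_3,s_4,s_5,s_6)=(0,0,0,0,2r^2,3r^2,r^2).$$
   Context: For an almost complex structure $J$ on a $6$-manifold $M$, a complex-valued $1$-form $\alpha$ is of type $(1,0)$ iff $\alpha(Jv)=i\,\alpha(v)$. The exterior derivative decomposes by type as $d=d^{2,-1}+\partial+\bar\partial+d^{-1,2}$, with $d^{r,s}$ of bidegree $(r,s)$. For a local $J$-linear coframing $\alpha=(\alpha^1,\alpha^2,\alpha^3)$ on $U$ (a column of pointwise linearly independent $(1,0)$-forms), $N(\alpha):U\to M_{3\times3}(\mathbb{C})$ is defined by $$d^{-1,2}\alpha=N(\alpha)\begin{pmatrix}\overline{\alpha^2\wedge\alpha^3}\\ \overline{\alpha^3\wedge\alpha^1}\\ \overline{\alpha^1\wedge\alpha^2}\end{pmatrix}.$$ A $\mathrm{U}(3)$-structure (resp. $\mathrm{U}(1,2)$-structure) on $M$ is a pair $(J,\eta)$ with $J$ an almost complex structure and $\eta$ a real $(1,1)$-form that is positive (resp. nondegenerate of Hermitian signature $(1,2)$). A $J$-linear coframing is $(J,\eta)$-unitary if $\eta=\tfrac{i}{2}(\alpha^1\wedge\overline{\alpha^1}\pm\alpha^2\wedge\overline{\alpha^2}\pm\alpha^3\wedge\overline{\alpha^3})$,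 with both signs $+$ (resp. both $-$). $(J,\eta)$ is quasi-integrable if for every local unitary coframing $N(\alpha)=\lambda I_3$ (resp. $N(\alpha)=\mathrm{diag}(\lambda,-\lambda,-\lambda)$) for some complex function $\lambda$. $\mathrm{tr}_\eta$ is contraction with $\eta$: $\phi\wedge\eta^2=\tfrac13\mathrm{tr}_\eta(\phi)\,\eta^3$ for a $(1,1)$-form $\phi$ (for forms with values in $\mathrm{End}(E)$, apply it coefficientwise; $\mathrm{tr}_\eta(\nabla^2)$ is the trace of the $(1,1)$-part). Involutivity and Cartan characters are in the sense of Cartan's theory of exterior differential systems, for the system encoded locally as follows. Over an open set $U$ with a unitary coframing $\alpha$ and an $h$-unitary frame of $E$, an $h$-compatible connection has connection form $\pi-{}^t\bar\pi$ with $\pi=p_1\alpha^1+p_2\alpha^2+p_3\alpha^3$, $p_i:U\to M_{r\times r}(\mathbb{C})$. On $X=U\times(M_{r\times r}(\mathbb{C}))^3$ with coordinate functions $p_i$, put $\pi=p_i\alpha^i$, $F=d(\pi-{}^t\bar\pi)+(\pi-{}^t\bar\pi)\wedge(\pi-{}^t\bar\pi)$, and let $\mathcal{I}$ be the ideal generated algebraically by the components of $F\wedge\alpha^1\wedge\alpha^2\wedge\alpha^3$ (and their conjugates) and of $F\wedge\eta^2$; the independence condition is $i\,\alpha^1\wedge\alpha^2\wedge\alpha^3\wedge\overline{\alpha^1\wedge\alpha^2\wedge\alpha^3}\neq0$. Integral manifolds are locally the graphs of solutions of the system. *)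

theory Defs
  imports "HOL-Analysis.Analysis"
begin

section \<open>Differential forms on open subsets of a normed space\<close>

text \<open>
  Every set \<open>S\<close>, \<open>X\<close>, \<open>W\<close> used as a domain of smooth objects is open, so derivatives
  are taken with respect to \<open>at x\<close>.
\<close>

primrec Ck_on ::
  "nat \<Rightarrow> 'a::real_normed_vector set \<Rightarrow> ('a \<Rightarrow> 'b::real_normed_vector) \<Rightarrow> bool" where
  "Ck_on 0 S f \<longleftrightarrow> continuous_on S f"
| "Ck_on (Suc k) S f \<longleftrightarrow>
     (\<forall>x\<in>S. f differentiable (at x)) \<and>
     (\<forall>v. Ck_on k S (\<lambda>x. frechet_derivative f (at x) v))"

definition smooth_on ::
  "'a::real_normed_vector set \<Rightarrow> ('a \<Rightarrow> 'b::real_normed_vector) \<Rightarrow> bool" where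
  "smooth_on S f \<longleftrightarrow> (\<forall>k. Ck_on k S f)"

text \<open>
  A \<open>k\<close>-covector takes a sequence of vectors of which it only reads the entries
  \<open>0, \<dots>, k - 1\<close>; so \<open>\<phi> x e\<close> is the value of the form \<open>\<phi>\<close> at the point \<open>x\<close> on
  \<open>(e 0, \<dots>, e (k - 1))\<close>. The degree \<open>k\<close> is passed to the operations explicitly.
\<close>

type_synonym ('v, 'a) form = "'v \<Rightarrow> (nat \<Rightarrow> 'v) \<Rightarrow> 'a"

definition covector ::
  "nat \<Rightarrow> ((nat \<Rightarrow> 'v::real_vector) \<Rightarrow> 'a::real_vector) \<Rightarrow> bool" where
  "covector k f \<longleftrightarrow>
     (\<forall>e e'. (\<forall>i<k. e i = e' i) \<longrightarrow> f e = f e') \<and>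
     (\<forall>i<k. \<forall>e. linear (\<lambda>v. f (e(i := v)))) \<and>
     (\<forall>i<k. \<forall>j<k. \<forall>e. i \<noteq> j \<and> e i = e j \<longrightarrow> f e = 0)"

definition smooth_form ::
  "'v::real_normed_vector set \<Rightarrow> nat \<Rightarrow> ('v, 'a::real_normed_vector) form \<Rightarrow> bool" where
  "smooth_form X k \<phi> \<longleftrightarrow>
     (\<forall>x\<in>X. covector k (\<phi> x)) \<and> (\<forall>e. smooth_on X (\<lambda>x. \<phi> x e))"

definition wedge ::
  "nat \<Rightarrow> nat \<Rightarrow> ('v, 'a::real_normed_field) form \<Rightarrow> ('v, 'a) form \<Rightarrow> ('v, 'a) form" where
  "wedge k l \<phi> \<psi> x e =
     (\<Sum>\<sigma> | \<sigma> permutes {..<k + l}.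
        of_int (sign \<sigma>) * \<phi> x (\<lambda>i. e (\<sigma> i)) * \<psi> x (\<lambda>i. e (\<sigma> (k + i))))
     / (fact k * fact l)"

text \<open>The invariant formula for \<open>d\<phi>\<close> on constant vector fields.\<close>

definition ext_d ::
  "nat \<Rightarrow> ('v::real_normed_vector, 'a::real_normed_vector) form \<Rightarrow> ('v, 'a) form" where
  "ext_d k \<phi> x e =
     (\<Sum>i\<le>k. (-1) ^ i *\<^sub>R
        frechet_derivative (\<lambda>y. \<phi> y (\<lambda>j. if j < i then e j else e (Suc j))) (at x) (e i))"

abbreviation cnj_form :: "('v, complex) form \<Rightarrow> ('v, complex) form" where
  "cnj_form \<phi> \<equiv> \<lambda>x e. cnj (\<phi> x e)"

abbreviation Re_form :: "('v, complex) form \<Rightarrow> ('v, real) form" where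
  "Re_form \<phi> \<equiv> \<lambda>x e. Re (\<phi> x e)"

abbreviation Im_form :: "('v, complex) form \<Rightarrow> ('v, real) form" where
  "Im_form \<phi> \<equiv> \<lambda>x e. Im (\<phi> x e)"

abbreviation cplx_form :: "('v, real) form \<Rightarrow> ('v, complex) form" where
  "cplx_form \<phi> \<equiv> \<lambda>x e. complex_of_real (\<phi> x e)"

text \<open>Pullback along the projection \<open>V \<times> P \<rightarrow> V\<close>.\<close>

definition pull_fst :: "('v, 'a) form \<Rightarrow> ('v \<times> 'p, 'a) form" where
  "pull_fst \<phi> z e = \<phi> (fst z) (\<lambda>i. fst (e i))"


section \<open>Exterior differential systems\<close>

text \<open>
  Throughout, \<open>X\<close> is an open subset of a Euclidean space, and a homogeneous ideal \<open>I\<close> of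
  real forms on \<open>X\<close> is given by its graded pieces: \<open>I k \<phi>\<close> says that \<open>\<phi>\<close> is a \<open>k\<close>-form in
  the ideal.  Only the values of a form on \<open>X\<close> matter, hence the rule \<open>cong\<close>. Because of
  graded commutativity, one-sided multiples suffice.
\<close>

inductive alg_ideal ::
  "'v::real_normed_vector set \<Rightarrow> (nat \<times> ('v, real) form) set \<Rightarrow> nat \<Rightarrow> ('v, real) form \<Rightarrow> bool"
  for X G where
  gen: "(k, \<phi>) \<in> G \<Longrightarrow> alg_ideal X G k \<phi>"
| zero: "alg_ideal X G k (\<lambda>x e. 0)"
| add: "alg_ideal X G k \<phi> \<Longrightarrow> alg_ideal X G k \<psi> \<Longrightarrow> alg_ideal X G k (\<lambda>x e. \<phi> x e + \<psi> x e)"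
| mult: "smooth_form X l \<beta> \<Longrightarrow> alg_ideal X G k \<phi> \<Longrightarrow> alg_ideal X G (l + k) (wedge l k \<beta> \<phi>)"
| cong: "alg_ideal X G k \<phi> \<Longrightarrow> smooth_form X k \<psi> \<Longrightarrow> \<forall>x\<in>X. \<psi> x = \<phi> x \<Longrightarrow> alg_ideal X G k \<psi>"

definition d_closed :: "(nat \<Rightarrow> ('v::real_normed_vector, real) form \<Rightarrow> bool) \<Rightarrow> bool" where
  "d_closed I \<longleftrightarrow> (\<forall>k \<phi>. I k \<phi> \<longrightarrow> I (Suc k) (ext_d k \<phi>))"

definition integral_element ::
  "'v::euclidean_space set \<Rightarrow> (nat \<Rightarrow> ('v, real) form \<Rightarrow> bool) \<Rightarrow> 'v \<Rightarrow> 'v set \<Rightarrow> bool" where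
  "integral_element X I x E \<longleftrightarrow>
     x \<in> X \<and> subspace E \<and>
     (\<forall>k \<phi>. I k \<phi> \<longrightarrow> (\<forall>e. (\<forall>i. e i \<in> E) \<longrightarrow> \<phi> x e = 0))"

text \<open>
  The polar space \<open>H(E) = {v. \<phi>(v, e\<^sub>1, \<dots>, e\<^sub>p) = 0 for all \<phi> \<in> I\<^sup>p\<^sup>+\<^sup>1}\<close>, where \<open>p = dim E\<close>;
  \<open>case_nat v e\<close> is the sequence \<open>v, e 0, e 1, \<dots>\<close>.
\<close>

definition polar_space ::
  "(nat \<Rightarrow> ('v::euclidean_space, real) form \<Rightarrow> bool) \<Rightarrow> 'v \<Rightarrow> 'v set \<Rightarrow> 'v set" where
  "polar_space I x E =
     {v. \<forall>\<phi>. I (Suc (dim E)) \<phi> \<longrightarrow> (\<forall>e. (\<forall>i. e i \<in> E) \<longrightarrow> \<phi> x (case_nat v e) = 0)}"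

text \<open>
  The next two notions concern neighbourhoods of \<open>E\<close> in the Grassmann bundle
  \<open>G\<^sub>p(TX)\<close>. They are expressed on the bundle of \<open>p\<close>-frames \<open>(y, b)\<close>, which submerses onto
  \<open>G\<^sub>p(TX)\<close> via \<open>(y, b) \<mapsto> (y, span b)\<close>; functions on \<open>G\<^sub>p(TX, \<Omega>)\<close> have independent
  differentials iff their pullbacks to the frame bundle do. The entries \<open>b p, b (p + 1), \<dots>\<close>
  of a frame are irrelevant; \<open>nat \<Rightarrow> 'v\<close> carries the product topology.
\<close>

definition independent_differentials ::
  "nat \<Rightarrow> (nat \<Rightarrow> 'v::real_normed_vector \<Rightarrow> (nat \<Rightarrow> 'v) \<Rightarrow> real) \<Rightarrow> 'v \<Rightarrow> (nat \<Rightarrow> 'v) \<Rightarrow> bool" where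
  "independent_differentials q g y b \<longleftrightarrow>
     (\<forall>c :: nat \<Rightarrow> real.
        (\<forall>\<xi> \<beta>. ((\<lambda>t. \<Sum>i<q. c i * g i (y + t *\<^sub>R \<xi>) (\<lambda>j. b j + t *\<^sub>R \<beta> j))
                 has_real_derivative 0) (at 0))
        \<longrightarrow> (\<forall>i<q. c i = 0))"

text \<open>
  An integral element \<open>E\<close> is Kaehler-ordinary if, for some \<open>p\<close>-form \<open>\<Omega>\<close> with \<open>\<Omega>\<^sub>E \<noteq> 0\<close>, it is an
  ordinary zero of the functions \<open>\<phi>\<^sub>\<Omega> = \<phi> / \<Omega>\<close> on \<open>G\<^sub>p(TX, \<Omega>)\<close> with \<open>\<phi> \<in> I\<^sup>p\<close>: near \<open>E\<close> their
  common zeros are those of finitely many among them, with independent differentials.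
\<close>

definition kaehler_ordinary ::
  "'v::euclidean_space set \<Rightarrow> (nat \<Rightarrow> ('v, real) form \<Rightarrow> bool) \<Rightarrow> 'v \<Rightarrow> 'v set \<Rightarrow> bool" where
  "kaehler_ordinary X I x E \<longleftrightarrow>
     integral_element X I x E \<and>
     (\<exists>\<Omega> e q f N.
        smooth_form X (dim E) \<Omega> \<and> span (e ` {..<dim E}) = E \<and> \<Omega> x e \<noteq> 0 \<and>
        (\<forall>i<q. I (dim E) (f i)) \<and>
        open N \<and> (x, e) \<in> N \<and>
        (\<forall>(y, b)\<in>N.
           y \<in> X \<and> \<Omega> y b \<noteq> 0 \<and>
           ((\<forall>\<phi>. I (dim E) \<phi> \<longrightarrow> \<phi> y b / \<Omega> y b = 0) \<longleftrightarrow> (\<forall>i<q. f i y b / \<Omega> y b = 0)) \<and>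
           independent_differentials q (\<lambda>i z a. f i z a / \<Omega> z a) y b))"

text \<open>
  Kaehler-regular: in addition, the dimension of the polar space is constant on the integral
  elements of dimension \<open>dim E\<close> near \<open>E\<close>.
\<close>

definition kaehler_regular ::
  "'v::euclidean_space set \<Rightarrow> (nat \<Rightarrow> ('v, real) form \<Rightarrow> bool) \<Rightarrow> 'v \<Rightarrow> 'v set \<Rightarrow> bool" where
  "kaehler_regular X I x E \<longleftrightarrow>
     kaehler_ordinary X I x E \<and>
     (\<exists>e N. span (e ` {..<dim E}) = E \<and> open N \<and> (x, e) \<in> N \<and>
        (\<forall>(y, b)\<in>N.
           integral_element X I y (span (b ` {..<dim E})) \<and>
           dim (span (b ` {..<dim E})) = dim E \<longrightarrow>
           dim (polar_space I y (span (b ` {..<dim E}))) = dim (polar_space I x E)))"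

definition integral_flag ::
  "'v::euclidean_space set \<Rightarrow> (nat \<Rightarrow> ('v, real) form \<Rightarrow> bool) \<Rightarrow> nat \<Rightarrow> 'v \<Rightarrow> (nat \<Rightarrow> 'v set) \<Rightarrow> bool"
  where
  "integral_flag X I n x Fl \<longleftrightarrow>
     (\<forall>k\<le>n. integral_element X I x (Fl k) \<and> dim (Fl k) = k) \<and>
     (\<forall>k<n. Fl k \<subseteq> Fl (Suc k))"

definition ordinary_flag ::
  "'v::euclidean_space set \<Rightarrow> (nat \<Rightarrow> ('v, real) form \<Rightarrow> bool) \<Rightarrow> nat \<Rightarrow> 'v \<Rightarrow> (nat \<Rightarrow> 'v set) \<Rightarrow> bool"
  where
  "ordinary_flag X I n x Fl \<longleftrightarrow>
     integral_flag X I n x Fl \<and> (\<forall>k<n. kaehler_regular X I x (Fl k))"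

text \<open>
  Integral elements of the system with independence condition \<open>\<Omega> \<noteq> 0\<close>, where \<open>\<Omega>\<close> is an
  \<open>n\<close>-form.
\<close>

definition admissible_element ::
  "'v::euclidean_space set \<Rightarrow> (nat \<Rightarrow> ('v, real) form \<Rightarrow> bool) \<Rightarrow> nat \<Rightarrow> ('v, real) form \<Rightarrow>
   'v \<Rightarrow> 'v set \<Rightarrow> bool" where
  "admissible_element X I n \<Omega> x E \<longleftrightarrow>
     integral_element X I x E \<and> dim E = n \<and> (\<exists>e. (\<forall>i. e i \<in> E) \<and> \<Omega> x e \<noteq> 0)"

definition involutive ::
  "'v::euclidean_space set \<Rightarrow> (nat \<Rightarrow> ('v, real) form \<Rightarrow> bool) \<Rightarrow> nat \<Rightarrow> ('v, real) form \<Rightarrow> bool"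
  where
  "involutive X I n \<Omega> \<longleftrightarrow>
     d_closed I \<and>
     (\<forall>x\<in>X. \<exists>E. admissible_element X I n \<Omega> x E) \<and>
     (\<forall>x E. admissible_element X I n \<Omega> x E \<longrightarrow> (\<exists>Fl. ordinary_flag X I n x Fl \<and> Fl n = E))"

text \<open>
  The codimensions \<open>c\<^sub>k\<close> of the polar spaces of a flag, with \<open>c\<^sub>n = dim X - n\<close>, and the
  characters \<open>s\<^sub>k = c\<^sub>k - c\<^sub>k\<^sub>-\<^sub>1\<close>, \<open>c\<^sub>-\<^sub>1 = 0\<close>.
\<close>

definition polar_codim ::
  "(nat \<Rightarrow> ('v::euclidean_space, real) form \<Rightarrow> bool) \<Rightarrow> nat \<Rightarrow> 'v \<Rightarrow> (nat \<Rightarrow> 'v set) \<Rightarrow> nat \<Rightarrow> int"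
  where
  "polar_codim I n x Fl k =
     (if k < n then int DIM('v) - int (dim (polar_space I x (Fl k))) else int DIM('v) - int n)"

definition flag_character ::
  "(nat \<Rightarrow> ('v::euclidean_space, real) form \<Rightarrow> bool) \<Rightarrow> nat \<Rightarrow> 'v \<Rightarrow> (nat \<Rightarrow> 'v set) \<Rightarrow> nat \<Rightarrow> int"
  where
  "flag_character I n x Fl k =
     polar_codim I n x Fl k - (if k = 0 then 0 else polar_codim I n x Fl (k - 1))"

definition has_cartan_characters ::
  "'v::euclidean_space set \<Rightarrow> (nat \<Rightarrow> ('v, real) form \<Rightarrow> bool) \<Rightarrow> nat \<Rightarrow> ('v, real) form \<Rightarrow>
   int list \<Rightarrow> bool" where
  "has_cartan_characters X I n \<Omega> s \<longleftrightarrow>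
     (\<forall>x Fl. ordinary_flag X I n x Fl \<and> admissible_element X I n \<Omega> x (Fl n) \<longrightarrow>
        map (flag_character I n x Fl) [0..<Suc n] = s)"


section \<open>Smooth 6-manifolds, vector bundles and Hermitian structures\<close>

text \<open>
  A chart is a pair of its domain and its coordinate map (only relevant on the domain).
  Tensor fields are families of component functions, one for each chart of the atlas,
  related by the transition maps.
\<close>

type_synonym 'm chart = "'m set \<times> ('m \<Rightarrow> real^6)"

definition chart_inv :: "'m chart \<Rightarrow> real^6 \<Rightarrow> 'm" where
  "chart_inv c = inv_into (fst c) (snd c)"

definition chart_image :: "'m chart \<Rightarrow> (real^6) set" where
  "chart_image c = snd c ` fst c"

definition transition :: "'m chart \<Rightarrow> 'm chart \<Rightarrow> real^6 \<Rightarrow> real^6" where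
  "transition c c' = snd c' \<circ> chart_inv c"

definition smooth_atlas :: "'m::{t2_space, second_countable_topology} chart set \<Rightarrow> bool" where
  "smooth_atlas A \<longleftrightarrow>
     (\<Union>c\<in>A. fst c) = UNIV \<and>
     (\<forall>c\<in>A. open (fst c) \<and> open (chart_image c) \<and>
        homeomorphism (fst c) (chart_image c) (snd c) (chart_inv c)) \<and>
     (\<forall>c\<in>A. \<forall>c'\<in>A. smooth_on (snd c ` (fst c \<inter> fst c')) (transition c c'))"

text \<open>Smoothness of a function defined on an open subset of the manifold.\<close>

definition smooth_on_mfd ::
  "'m chart set \<Rightarrow> 'm set \<Rightarrow> ('m \<Rightarrow> 'b::real_normed_vector) \<Rightarrow> bool" where
  "smooth_on_mfd A S f \<longleftrightarrow> (\<forall>c\<in>A. smooth_on (snd c ` (fst c \<inter> S)) (f \<circ> chart_inv c))"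

definition almost_complex_structure ::
  "'m chart set \<Rightarrow> ('m chart \<Rightarrow> real^6 \<Rightarrow> real^6 \<Rightarrow> real^6) \<Rightarrow> bool" where
  "almost_complex_structure A J \<longleftrightarrow>
     (\<forall>c\<in>A. (\<forall>x\<in>chart_image c. linear (J c x) \<and> (\<forall>v. J c x (J c x v) = - v)) \<and>
        (\<forall>v. smooth_on (chart_image c) (\<lambda>x. J c x v))) \<and>
     (\<forall>c\<in>A. \<forall>c'\<in>A. \<forall>m\<in>fst c \<inter> fst c'. \<forall>v.
        let T = frechet_derivative (transition c c') (at (snd c m))
        in T (J c (snd c m) v) = J c' (snd c' m) (T v))"

definition smooth_2form_mfd ::
  "'m chart set \<Rightarrow> ('m chart \<Rightarrow> (real^6, real) form) \<Rightarrow> bool" where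
  "smooth_2form_mfd A \<eta> \<longleftrightarrow>
     (\<forall>c\<in>A. smooth_form (chart_image c) 2 (\<eta> c)) \<and>
     (\<forall>c\<in>A. \<forall>c'\<in>A. \<forall>m\<in>fst c \<inter> fst c'. \<forall>e.
        let T = frechet_derivative (transition c c') (at (snd c m))
        in \<eta> c' (snd c' m) (\<lambda>i. T (e i)) = \<eta> c (snd c m) e)"

text \<open>
  The \<open>(p, q)\<close>-component of a complex-valued \<open>(p + q)\<close>-covector: extend it complex-multilinearly
  to the complexified space and sum, over the sets \<open>S\<close> of \<open>p\<close> positions, its values on the
  projections \<open>(v - \<i> J v) / 2\<close> (positions in \<open>S\<close>) and \<open>(v + \<i> J v) / 2\<close> (the others). The
  sum over \<open>T\<close> is the multilinear expansion.
\<close>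

definition type_part ::
  "('v \<Rightarrow> 'v) \<Rightarrow> nat \<Rightarrow> nat \<Rightarrow> ((nat \<Rightarrow> 'v) \<Rightarrow> complex) \<Rightarrow> (nat \<Rightarrow> 'v) \<Rightarrow> complex" where
  "type_part J p q \<phi> e =
     (\<Sum>S | S \<subseteq> {..<p + q} \<and> card S = p.
        (\<Sum>T \<in> Pow {..<p + q}.
           (\<Prod>i\<in>T. if i \<in> S then - \<i> else \<i>) * \<phi> (\<lambda>i. if i \<in> T then J (e i) else e i))
        / 2 ^ (p + q))"

text \<open>
  The real quadratic form \<open>v \<mapsto> \<eta>(v, J v)\<close>, equal to \<open>\<bar>\<alpha>\<^sup>1(v)\<bar>\<^sup>2 \<plusminus> \<bar>\<alpha>\<^sup>2(v)\<bar>\<^sup>2 \<plusminus> \<bar>\<alpha>\<^sup>3(v)\<bar>\<^sup>2\<close> for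
  \<open>\<eta> = (\<i>/2)(\<alpha>\<^sup>1 \<and> cnj \<alpha>\<^sup>1 \<plusminus> \<alpha>\<^sup>2 \<and> cnj \<alpha>\<^sup>2 \<plusminus> \<alpha>\<^sup>3 \<and> cnj \<alpha>\<^sup>3)\<close>.
\<close>

definition herm_quad :: "('v \<Rightarrow> 'v) \<Rightarrow> ((nat \<Rightarrow> 'v) \<Rightarrow> real) \<Rightarrow> 'v \<Rightarrow> real" where
  "herm_quad J \<eta> v = \<eta> (\<lambda>i. if i = 0 then v else J v)"

definition hermitian_pair ::
  "'m chart set \<Rightarrow> ('m chart \<Rightarrow> real^6 \<Rightarrow> real^6 \<Rightarrow> real^6) \<Rightarrow> ('m chart \<Rightarrow> (real^6, real) form) \<Rightarrow> bool"
  where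
  "hermitian_pair A J \<eta> \<longleftrightarrow>
     almost_complex_structure A J \<and> smooth_2form_mfd A \<eta> \<and>
     (\<forall>c\<in>A. \<forall>x\<in>chart_image c. type_part (J c x) 1 1 (cplx_form (\<eta> c) x) = cplx_form (\<eta> c) x)"

definition U3_structure ::
  "'m chart set \<Rightarrow> ('m chart \<Rightarrow> real^6 \<Rightarrow> real^6 \<Rightarrow> real^6) \<Rightarrow> ('m chart \<Rightarrow> (real^6, real) form) \<Rightarrow> bool"
  where
  "U3_structure A J \<eta> \<longleftrightarrow>
     hermitian_pair A J \<eta> \<and>
     (\<forall>c\<in>A. \<forall>x\<in>chart_image c. \<forall>v. v \<noteq> 0 \<longrightarrow> herm_quad (J c x) (\<eta> c x) v > 0)"

text \<open>
  Hermitian signature \<open>(1, 2)\<close>: positive definite on a complex line and negative definite on a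
  complex plane (by Sylvester's law, this includes nondegeneracy).
\<close>

definition U12_structure ::
  "'m chart set \<Rightarrow> ('m chart \<Rightarrow> real^6 \<Rightarrow> real^6 \<Rightarrow> real^6) \<Rightarrow> ('m chart \<Rightarrow> (real^6, real) form) \<Rightarrow> bool"
  where
  "U12_structure A J \<eta> \<longleftrightarrow>
     hermitian_pair A J \<eta> \<and>
     (\<forall>c\<in>A. \<forall>x\<in>chart_image c. \<exists>P Q.
        subspace P \<and> J c x ` P \<subseteq> P \<and> dim P = 2 \<and>
        (\<forall>v\<in>P. v \<noteq> 0 \<longrightarrow> herm_quad (J c x) (\<eta> c x) v > 0) \<and>
        subspace Q \<and> J c x ` Q \<subseteq> Q \<and> dim Q = 4 \<and>
        (\<forall>v\<in>Q. v \<noteq> 0 \<longrightarrow> herm_quad (J c x) (\<eta> c x) v < 0))"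

text \<open>
  \<open>\<alpha> 1\<close>, \<open>\<alpha> 2\<close>, \<open>\<alpha> 3\<close> are indexed by the type \<open>3\<close>, whose arithmetic is modulo 3; so
  \<open>\<alpha> (j + 1)\<close>, \<open>\<alpha> (j + 2)\<close> are the cyclic successors of \<open>\<alpha> j\<close>. Below, \<open>\<epsilon> = 1\<close> is the case of
  \<open>U(3)\<close>-structures and \<open>\<epsilon> = - 1\<close> that of \<open>U(1,2)\<close>-structures.
\<close>

definition J_linear_coframing ::
  "(real^6 \<Rightarrow> real^6 \<Rightarrow> real^6) \<Rightarrow> (real^6) set \<Rightarrow> (3 \<Rightarrow> (real^6, complex) form) \<Rightarrow> bool" where
  "J_linear_coframing J W \<alpha> \<longleftrightarrow>
     (\<forall>j. smooth_form W 1 (\<alpha> j)) \<and>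
     (\<forall>x\<in>W. \<forall>j v. \<alpha> j x (\<lambda>_. J x v) = \<i> * \<alpha> j x (\<lambda>_. v)) \<and>
     (\<forall>x\<in>W. \<forall>a :: 3 \<Rightarrow> complex.
        (\<forall>v. (\<Sum>j\<in>UNIV. a j * \<alpha> j x (\<lambda>_. v)) = 0) \<longrightarrow> (\<forall>j. a j = 0))"

definition sig :: "real \<Rightarrow> 3 \<Rightarrow> complex" where
  "sig \<epsilon> j = (if j = 1 then 1 else complex_of_real \<epsilon>)"

definition unitary_coframing ::
  "real \<Rightarrow> (real^6 \<Rightarrow> real^6 \<Rightarrow> real^6) \<Rightarrow> (real^6, real) form \<Rightarrow> (real^6) set \<Rightarrow>
   (3 \<Rightarrow> (real^6, complex) form) \<Rightarrow> bool" where
  "unitary_coframing \<epsilon> J \<eta> W \<alpha> \<longleftrightarrow>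
     J_linear_coframing J W \<alpha> \<and>
     (\<forall>x\<in>W. \<forall>e. complex_of_real (\<eta> x e) =
        \<i> / 2 * (\<Sum>j\<in>UNIV. sig \<epsilon> j * wedge 1 1 (\<alpha> j) (cnj_form (\<alpha> j)) x e))"

text \<open>The defining relation of the matrix \<open>N = N(\<alpha>)(x)\<close>, where \<open>d\<^sup>-\<^sup>1\<^sup>,\<^sup>2 \<alpha> = (d\<alpha>)\<^sup>0\<^sup>,\<^sup>2\<close>.\<close>

definition is_torsion_matrix ::
  "(real^6 \<Rightarrow> real^6 \<Rightarrow> real^6) \<Rightarrow> (3 \<Rightarrow> (real^6, complex) form) \<Rightarrow> real^6 \<Rightarrow> complex^3^3 \<Rightarrow> bool"
  where
  "is_torsion_matrix J \<alpha> x N \<longleftrightarrow>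
     (\<forall>j e. type_part (J x) 0 2 (ext_d 1 (\<alpha> j) x) e =
        (\<Sum>k\<in>UNIV. N $ j $ k * cnj (wedge 1 1 (\<alpha> (k + 1)) (\<alpha> (k + 2)) x e)))"

definition quasi_integrable ::
  "real \<Rightarrow> 'm chart set \<Rightarrow> ('m chart \<Rightarrow> real^6 \<Rightarrow> real^6 \<Rightarrow> real^6) \<Rightarrow>
   ('m chart \<Rightarrow> (real^6, real) form) \<Rightarrow> bool" where
  "quasi_integrable \<epsilon> A J \<eta> \<longleftrightarrow>
     (\<forall>c\<in>A. \<forall>W \<alpha>. open W \<and> W \<subseteq> chart_image c \<and> unitary_coframing \<epsilon> (J c) (\<eta> c) W \<alpha> \<longrightarrow>
        (\<exists>\<mu> :: real^6 \<Rightarrow> complex. \<forall>x\<in>W.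
           is_torsion_matrix (J c) \<alpha> x (\<chi> j k. if j = k then sig \<epsilon> j * \<mu> x else 0)))"

text \<open>
  A complex vector bundle of rank \<open>CARD('r)\<close> with total space \<open>'e\<close>: a local trivialization
  \<open>(O, \<tau>)\<close> consists of an open set \<open>O\<close> and the fibre component \<open>\<tau>\<close> of an isomorphism of the
  part over \<open>O\<close> with \<open>O \<times> \<complex>\<^sup>r\<close>.
\<close>

type_synonym ('m, 'e, 'r) triv = "'m set \<times> ('e \<Rightarrow> complex^'r)"

definition vector_bundle ::
  "'m::topological_space chart set \<Rightarrow> ('e \<Rightarrow> 'm) \<Rightarrow> ('m, 'e, 'r::finite) triv set \<Rightarrow> bool" where
  "vector_bundle A pr \<T> \<longleftrightarrow>
     (\<Union>t\<in>\<T>. fst t) = UNIV \<and>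
     (\<forall>t\<in>\<T>. open (fst t) \<and> (\<forall>m\<in>fst t. bij_betw (snd t) (pr -` {m}) UNIV)) \<and>
     (\<forall>t\<in>\<T>. \<forall>t'\<in>\<T>. \<exists>g :: 'm \<Rightarrow> complex^'r^'r.
        smooth_on_mfd A (fst t \<inter> fst t') g \<and>
        (\<forall>u. pr u \<in> fst t \<inter> fst t' \<longrightarrow> snd t' u = g (pr u) *v snd t u))"

definition hermitian_metric ::
  "'m chart set \<Rightarrow> ('e \<Rightarrow> 'm) \<Rightarrow> ('m, 'e, 'r::finite) triv set \<Rightarrow> ('e \<Rightarrow> 'e \<Rightarrow> complex) \<Rightarrow> bool" where
  "hermitian_metric A pr \<T> h \<longleftrightarrow>
     (\<forall>t\<in>\<T>. \<exists>H :: 'm \<Rightarrow> complex^'r^'r.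
        smooth_on_mfd A (fst t) H \<and>
        (\<forall>m\<in>fst t. (\<forall>a b. H m $ b $ a = cnj (H m $ a $ b)) \<and>
           (\<forall>z. z \<noteq> 0 \<longrightarrow> Re (\<Sum>a\<in>UNIV. \<Sum>b\<in>UNIV. z $ a * H m $ a $ b * cnj (z $ b)) > 0)) \<and>
        (\<forall>u w. pr u = pr w \<and> pr u \<in> fst t \<longrightarrow>
           h u w = (\<Sum>a\<in>UNIV. \<Sum>b\<in>UNIV. snd t u $ a * H (pr u) $ a $ b * cnj (snd t w $ b))))"

definition unitary_frame ::
  "'m chart set \<Rightarrow> ('e \<Rightarrow> 'm) \<Rightarrow> ('m, 'e, 'r::finite) triv set \<Rightarrow> ('e \<Rightarrow> 'e \<Rightarrow> complex) \<Rightarrow>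
   'm set \<Rightarrow> ('r \<Rightarrow> 'm \<Rightarrow> 'e) \<Rightarrow> bool" where
  "unitary_frame A pr \<T> h U \<sigma> \<longleftrightarrow>
     (\<forall>m\<in>U. \<forall>a. pr (\<sigma> a m) = m) \<and>
     (\<forall>t\<in>\<T>. \<forall>a. smooth_on_mfd A (U \<inter> fst t) (\<lambda>m. snd t (\<sigma> a m))) \<and>
     (\<forall>m\<in>U. \<forall>a b. h (\<sigma> a m) (\<sigma> b m) = (if a = b then 1 else 0))"


section \<open>The system for Hermitian connections\<close>

text \<open>
  Over a coordinate domain \<open>W\<close> with unitary coframing \<open>\<alpha>\<close>, the system lives on
  \<open>W \<times> M\<^sub>r\<^sub>\<times>\<^sub>r(\<complex>)\<^sup>3\<close> with coordinates \<open>(x, p)\<close>. A choice of unitary frame of the bundle over \<open>W\<close>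
  identifies the \<open>h\<close>-compatible connections with the functions \<open>p\<close> on \<open>W\<close>; with respect to such a
  frame, the system is always the following one. Matrix-valued forms are given by their entries
  \<open>a b\<close>.
\<close>

type_synonym 'r total = "(real^6) \<times> (complex^'r^'r^3)"

definition conn_pi ::
  "(3 \<Rightarrow> (real^6, complex) form) \<Rightarrow> 'r::finite \<Rightarrow> 'r \<Rightarrow> ('r total, complex) form" where
  "conn_pi \<alpha> a b z e = (\<Sum>i\<in>UNIV. snd z $ i $ a $ b * pull_fst (\<alpha> i) z e)"

definition conn_form ::
  "(3 \<Rightarrow> (real^6, complex) form) \<Rightarrow> 'r::finite \<Rightarrow> 'r \<Rightarrow> ('r total, complex) form" where
  "conn_form \<alpha> a b z e = conn_pi \<alpha> a b z e - cnj (conn_pi \<alpha> b a z e)"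

definition curv_form ::
  "(3 \<Rightarrow> (real^6, complex) form) \<Rightarrow> 'r::finite \<Rightarrow> 'r \<Rightarrow> ('r total, complex) form" where
  "curv_form \<alpha> a b z e =
     ext_d 1 (conn_form \<alpha> a b) z e +
     (\<Sum>k\<in>UNIV. wedge 1 1 (conn_form \<alpha> a k) (conn_form \<alpha> k b) z e)"

definition alpha123 :: "(3 \<Rightarrow> (real^6, complex) form) \<Rightarrow> (real^6, complex) form" where
  "alpha123 \<alpha> = wedge 2 1 (wedge 1 1 (\<alpha> 1) (\<alpha> 2)) (\<alpha> 3)"

definition F_alpha ::
  "(3 \<Rightarrow> (real^6, complex) form) \<Rightarrow> 'r::finite \<Rightarrow> 'r \<Rightarrow> ('r total, complex) form" where
  "F_alpha \<alpha> a b = wedge 2 3 (curv_form \<alpha> a b) (pull_fst (alpha123 \<alpha>))"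

definition F_eta ::
  "(3 \<Rightarrow> (real^6, complex) form) \<Rightarrow> (real^6, real) form \<Rightarrow> 'r::finite \<Rightarrow> 'r \<Rightarrow>
   ('r total, complex) form" where
  "F_eta \<alpha> \<eta> a b =
     wedge 2 4 (curv_form \<alpha> a b) (pull_fst (wedge 2 2 (cplx_form \<eta>) (cplx_form \<eta>)))"

text \<open>
  \<open>F \<and> \<alpha>\<^sup>1 \<and> \<alpha>\<^sup>2 \<and> \<alpha>\<^sup>3 = 0\<close> expresses \<open>F\<^sup>0\<^sup>,\<^sup>2 = 0\<close>, and \<open>F \<and> \<eta>\<^sup>2 = 0\<close> expresses \<open>tr\<^sub>\<eta> F = 0\<close>.
  The real ideal generated by the real and imaginary parts of complex forms has as
  complexification the ideal generated by these forms and their conjugates.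
\<close>

definition system_generators ::
  "(3 \<Rightarrow> (real^6, complex) form) \<Rightarrow> (real^6, real) form \<Rightarrow>
   (nat \<times> ('r::finite total, real) form) set" where
  "system_generators \<alpha> \<eta> =
     (\<Union>a. \<Union>b. {(5, Re_form (F_alpha \<alpha> a b)), (5, Im_form (F_alpha \<alpha> a b)),
               (6, Re_form (F_eta \<alpha> \<eta> a b)), (6, Im_form (F_eta \<alpha> \<eta> a b))})"

definition system_domain :: "(real^6) set \<Rightarrow> ('r::finite total) set" where
  "system_domain W = W \<times> UNIV"

definition system_ideal ::
  "(real^6) set \<Rightarrow> (3 \<Rightarrow> (real^6, complex) form) \<Rightarrow> (real^6, real) form \<Rightarrow>
   nat \<Rightarrow> ('r::finite total, real) form \<Rightarrow> bool" where
  "system_ideal W \<alpha> \<eta> = alg_ideal (system_domain W) (system_generators \<alpha> \<eta>)"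

text \<open>The form \<open>\<i> \<alpha>\<^sup>1 \<and> \<alpha>\<^sup>2 \<and> \<alpha>\<^sup>3 \<and> cnj (\<alpha>\<^sup>1 \<and> \<alpha>\<^sup>2 \<and> \<alpha>\<^sup>3)\<close> is real, so \<open>Re\<close> only changes its type.\<close>

definition indep_form ::
  "(3 \<Rightarrow> (real^6, complex) form) \<Rightarrow> ('r::finite total, real) form" where
  "indep_form \<alpha> =
     pull_fst (\<lambda>x e. Re (\<i> * wedge 3 3 (alpha123 \<alpha>) (cnj_form (alpha123 \<alpha>)) x e))"

end

theory Submission
  imports Defs
begin

text \<open>
  Quasi-integrability says that \<open>(d\<alpha>\<^sup>j)\<^sup>0\<^sup>,\<^sup>2\<close> is \<open>\<lambda>\<close> times the coefficient of \<open>\<alpha>\<^sup>j\<close> in \<open>\<eta>\<close> times the wedge of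
  the other two conjugates. Hence \<open>d(\<alpha>\<^sup>1 \<and> \<alpha>\<^sup>2 \<and> \<alpha>\<^sup>3)\<close> is a multiple of \<open>\<eta>\<^sup>2\<close> modulo forms of type \<open>(3,1)\<close>.
  Every 5-form on the base has type \<open>(3,2)\<close> or \<open>(2,3)\<close>, so \<open>F \<and> d(\<eta>\<^sup>2)\<close> is generated by
  \<open>F \<and> \<alpha>\<^sup>1 \<and> \<alpha>\<^sup>2 \<and> \<alpha>\<^sup>3\<close> and its conjugate. With the Bianchi identity, the ideal is differentially closed.

  Adding the vertical vector \<open>p\<close> to a tangent vector changes \<open>\<iota>F\<close> by \<open>p\<^sub>j \<alpha>\<^sup>j\<close> minus its conjugate
  transpose. Since \<open>F\<close> is skew-Hermitian, this can be used to make \<open>F\<close> vanish on the graph of a linear map,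
  so integral elements exist over every point. The ideal is zero in degrees below 5. On a 4-plane
  its polar equations express \<open>p\<^sub>j\<close> for one \<open>j\<close> (\<open>2r\<^sup>2\<close> conditions) as soon as some
  \<open>cnj \<alpha>\<^sup>j \<and> \<alpha>\<^sup>1 \<and> \<alpha>\<^sup>2 \<and> \<alpha>\<^sup>3\<close> does not vanish on the plane. On a 5-plane with conormal of \<open>(1,0)\<close>-coefficients
  \<open>\<kappa>\<^sub>j\<close> that is not isotropic for \<open>\<eta>\<close>, the vertical solutions are \<open>p\<^sub>j = cnj \<kappa>\<^sub>j s\<close> with \<open>s\<close> Hermitian,
  so the polar space has dimension \<open>6 + r\<^sup>2\<close>. Both conditions are open and polynomial in the frame of
  the plane; so every 6-dimensional integral element has a flag satisfying them, and by
  regularity the polar spaces of every ordinary flag have the same codimensions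
  \<open>0, 0, 0, 0, 2r\<^sup>2, 5r\<^sup>2, 6r\<^sup>2\<close>.
\<close>

section \<open>Smooth functions\<close>

text \<open>The codimension \<open>5r^2\<close> on a 5-plane has the following origin. In degree 6
  the ideal contains the multiples of \<open>F \<and> \<alpha>\<^sup>1 \<and> \<alpha>\<^sup>2
  \<and> \<alpha>\<^sup>3\<close> by the three forms \<open>cnj \<alpha>\<^sup>j\<close>. On
  vertical vectors these are the components of a cross product with the vector
  \<open>\<kappa>\<close>. Wedging with the conormal gives one complex matrix relation among the
  three, so \<open>4r^2\<close> real conditions remain. The skew-Hermitian
  \<open>F \<and> \<eta>\<^sup>2\<close> adds \<open>r^2\<close>, and these are independent of the
  others on vertical vectors because the conormal is not isotropic. Two obstacles shape the proof.
  Multipliers in the ideal must be smooth, whereas types are decomposed pointwise: smooth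
  coefficients are recovered by wedging with complementary monomials and dividing by the volume
  form. And the characters are claimed for every ordinary flag, even one in special position for the
  formulas: its frame is moved along a line inside the 6-dimensional integral element, where both
  conditions become polynomials in one real variable.\<close>

lemma Ck_on_cong:
  assumes "open S" "Ck_on k S f" "\<And>x. x \<in> S \<Longrightarrow> f x = g x"
  shows "Ck_on k S g"
  using assms(2,3)
proof (induction k arbitrary: f g)
  case 0
  then show ?case by (simp cong: continuous_on_cong)
next
  case (Suc k)
  have "g differentiable (at x)" if "x \<in> S" for x
  proof -
    obtain f' where "(f has_derivative f') (at x)"
      using Suc.prems(1) \<open>x \<in> S\<close> by (auto simp: differentiable_def)
    then have "(g has_derivative f') (at x)"
      using has_derivative_transform_within_open assms(1) that Suc.prems(2) by blast
    then show ?thesis by (auto simp: differentiable_def)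
  qed
  moreover have "Ck_on k S (\<lambda>x. frechet_derivative g (at x) v)" for v
  proof (rule Suc.IH)
    show "Ck_on k S (\<lambda>x. frechet_derivative f (at x) v)"
      using Suc.prems(1) by simp
    show "frechet_derivative f (at x) v = frechet_derivative g (at x) v" if "x \<in> S" for x
      using frechet_derivative_transform_within_open[of f x S g] Suc.prems that assms(1) by simp
  qed
  ultimately show ?case by simp
qed

text \<open>The recursion constrains only directional derivatives, so passing from
  \<open>Suc k\<close> to \<open>k\<close> takes an induction. The product and inverse rules use it
  for the factor that is not differentiated.\<close>

lemma Ck_on_SucD: "Ck_on (Suc k) S f \<Longrightarrow> Ck_on k S f"
proof (induction k arbitrary: f)
  case 0
  then show ?case
    by (simp add: continuous_at_imp_continuous_on differentiable_imp_continuous_within)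
next
  case (Suc k)
  have "Ck_on k S (\<lambda>x. frechet_derivative f (at x) v)" for v
    using Suc.prems by (intro Suc.IH) simp
  then show ?case using Suc.prems by simp
qed

lemma Ck_on_const [simp]: "Ck_on k S (\<lambda>x. c)"
  by (induction k arbitrary: c) simp_all

lemma frechet_derivative_eq: "(f has_derivative f') (at x) \<Longrightarrow> frechet_derivative f (at x) v = f' v"
  by (metis frechet_derivative_at)

lemma differentiable_has_frechet:
  "f differentiable (at x) \<Longrightarrow> (f has_derivative frechet_derivative f (at x)) (at x)"
  by (simp add: frechet_derivative_works)

lemma Ck_on_add:
  assumes "open S" "Ck_on k S f" "Ck_on k S g"
  shows "Ck_on k S (\<lambda>x. f x + g x)"
  using assms(2,3)
proof (induction k arbitrary: f g)
  case 0
  then show ?case by (simp add: continuous_on_add)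
next
  case (Suc k)
  have "Ck_on k S (\<lambda>x. frechet_derivative (\<lambda>x. f x + g x) (at x) v)" for v
  proof (rule Ck_on_cong[OF assms(1)])
    show "Ck_on k S (\<lambda>x. frechet_derivative f (at x) v + frechet_derivative g (at x) v)"
      using Suc by simp
    show "frechet_derivative f (at x) v + frechet_derivative g (at x) v
        = frechet_derivative (\<lambda>x. f x + g x) (at x) v" if "x \<in> S" for x
      using Suc.prems that
      by (intro frechet_derivative_eq[symmetric] has_derivative_add differentiable_has_frechet) auto
  qed
  then show ?case using Suc.prems by simp
qed

lemma Ck_on_linear:
  assumes "open S" "Ck_on k S f" "bounded_linear L"
  shows "Ck_on k S (\<lambda>x. L (f x))"
  using assms(2)
proof (induction k arbitrary: f)
  case 0
  then show ?case using assms(3) by (simp add: bounded_linear.continuous_on)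
next
  case (Suc k)
  have d: "((\<lambda>x. L (f x)) has_derivative (\<lambda>v. L (frechet_derivative f (at x) v))) (at x)"
    if "x \<in> S" for x
    using Suc.prems that
    by (intro bounded_linear.has_derivative[OF assms(3)] differentiable_has_frechet) auto
  have "Ck_on k S (\<lambda>x. frechet_derivative (\<lambda>x. L (f x)) (at x) v)" for v
    by (rule Ck_on_cong[OF assms(1), of k "\<lambda>x. L (frechet_derivative f (at x) v)"])
       (use Suc in \<open>simp_all add: frechet_derivative_eq[OF d]\<close>)
  then show ?case using d by (auto simp: differentiable_def)
qed

lemma Ck_on_bilinear:
  assumes "open S" "Ck_on k S f" "Ck_on k S g" "bounded_bilinear B"
  shows "Ck_on k S (\<lambda>x. B (f x) (g x))"
  using assms(2,3)
proof (induction k arbitrary: f g)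
  case 0
  then show ?case using assms(4) by (simp add: bounded_bilinear.continuous_on)
next
  case (Suc k)
  have d: "((\<lambda>x. B (f x) (g x)) has_derivative
      (\<lambda>v. B (f x) (frechet_derivative g (at x) v) + B (frechet_derivative f (at x) v) (g x))) (at x)"
    if "x \<in> S" for x
    using Suc.prems that
    by (intro bounded_bilinear.FDERIV[OF assms(4)] differentiable_has_frechet) auto
  have "Ck_on k S (\<lambda>x. frechet_derivative (\<lambda>x. B (f x) (g x)) (at x) v)" for v
  proof (rule Ck_on_cong[OF assms(1)])
    have "Ck_on k S f" "Ck_on k S g" using Suc.prems Ck_on_SucD by blast+
    then show "Ck_on k S (\<lambda>x. B (f x) (frechet_derivative g (at x) v) +
        B (frechet_derivative f (at x) v) (g x))"
      using Suc by (intro Ck_on_add[OF assms(1)]) simp_all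
  qed (simp add: frechet_derivative_eq[OF d])
  then show ?case using d by (auto simp: differentiable_def)
qed

lemma Ck_on_inverse:
  fixes f :: "'a::real_normed_vector \<Rightarrow> 'b::real_normed_field"
  assumes "open S" "Ck_on k S f" "\<And>x. x \<in> S \<Longrightarrow> f x \<noteq> 0"
  shows "Ck_on k S (\<lambda>x. inverse (f x))"
  using assms(2)
proof (induction k)
  case 0
  then show ?case using assms(3) by (simp add: continuous_on_inverse)
next
  case (Suc k)
  have d: "((\<lambda>x. inverse (f x)) has_derivative
      (\<lambda>v. - (inverse (f x) * frechet_derivative f (at x) v * inverse (f x)))) (at x)"
    if "x \<in> S" for x
    using Suc.prems that assms(3)
    by (intro Deriv.has_derivative_inverse differentiable_has_frechet) auto
  have "Ck_on k S (\<lambda>x. frechet_derivative (\<lambda>x. inverse (f x)) (at x) v)" for v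
  proof (rule Ck_on_cong[OF assms(1)])
    have i: "Ck_on k S (\<lambda>x. inverse (f x))" using Suc Ck_on_SucD by blast
    show "Ck_on k S (\<lambda>x. - (inverse (f x) * frechet_derivative f (at x) v * inverse (f x)))"
      using Suc.prems
      by (intro Ck_on_linear[OF assms(1) _ bounded_linear_minus[OF bounded_linear_ident]]
          Ck_on_bilinear[OF assms(1) _ _ bounded_bilinear_mult] i) auto
  qed (simp add: frechet_derivative_eq[OF d])
  then show ?case using d by (auto simp: differentiable_def)
qed

lemma Ck_on_fst:
  fixes f :: "'a::real_normed_vector \<Rightarrow> 'c::real_normed_vector"
  assumes "open W" "Ck_on k W f"
  shows "Ck_on k (W \<times> (UNIV :: 'b::real_normed_vector set)) (\<lambda>z. f (fst z))"
  using assms(2)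
proof (induction k arbitrary: f)
  case 0
  then have "continuous_on W f" by simp
  then show ?case
    by (auto intro: continuous_on_compose2[OF _ continuous_on_fst[OF continuous_on_id]])
next
  case (Suc k)
  have o: "open (W \<times> (UNIV :: 'b set))" using assms(1) by (simp add: open_Times)
  have d: "((\<lambda>z. f (fst z)) has_derivative (\<lambda>v. frechet_derivative f (at (fst z)) (fst v))) (at z)"
    if "z \<in> W \<times> UNIV" for z :: "'a \<times> 'b"
  proof -
    have "(f has_derivative frechet_derivative f (at (fst z))) (at (fst z))"
      using Suc.prems that by (intro differentiable_has_frechet) auto
    from has_derivative_compose[OF has_derivative_fst[OF has_derivative_ident] this]
    show ?thesis by simp
  qed
  have "Ck_on k (W \<times> UNIV) (\<lambda>z. frechet_derivative (\<lambda>z. f (fst z)) (at z) v)" for v :: "'a \<times> 'b"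
    by (rule Ck_on_cong[OF o, of k "\<lambda>z. frechet_derivative f (at (fst z)) (fst v)"])
       (use Suc.IH[of "\<lambda>x. frechet_derivative f (at x) (fst v)"] Suc.prems in
        \<open>simp_all add: frechet_derivative_eq[OF d]\<close>)
  moreover have "\<forall>z\<in>W \<times> (UNIV :: 'b set). (\<lambda>z. f (fst z)) differentiable (at z)"
    using d unfolding differentiable_def by blast
  ultimately show ?case by simp
qed

section \<open>Calculus of smooth functions\<close>

lemma smooth_on_cong:
  "open S \<Longrightarrow> smooth_on S f \<Longrightarrow> (\<And>x. x \<in> S \<Longrightarrow> f x = g x) \<Longrightarrow> smooth_on S g"
  unfolding smooth_on_def using Ck_on_cong by blast

lemma smooth_on_const [simp]: "smooth_on S (\<lambda>x. c)"
  by (simp add: smooth_on_def)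

lemma smooth_on_add: "open S \<Longrightarrow> smooth_on S f \<Longrightarrow> smooth_on S g \<Longrightarrow> smooth_on S (\<lambda>x. f x + g x)"
  by (simp add: smooth_on_def Ck_on_add)

lemma smooth_on_linear: "open S \<Longrightarrow> bounded_linear L \<Longrightarrow> smooth_on S f \<Longrightarrow> smooth_on S (\<lambda>x. L (f x))"
  by (simp add: smooth_on_def Ck_on_linear)

lemma smooth_on_minus: "open S \<Longrightarrow> smooth_on S f \<Longrightarrow> smooth_on S (\<lambda>x. - f x)"
  by (rule smooth_on_linear[of S uminus]) (simp_all add: bounded_linear_minus bounded_linear_ident)

lemma smooth_on_diff: "open S \<Longrightarrow> smooth_on S f \<Longrightarrow> smooth_on S g \<Longrightarrow> smooth_on S (\<lambda>x. f x - g x)"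
  using smooth_on_add[of S f "\<lambda>x. - g x"] smooth_on_minus[of S g] by simp

lemma smooth_on_scaleR: "open S \<Longrightarrow> smooth_on S f \<Longrightarrow> smooth_on S (\<lambda>x. c *\<^sub>R f x)"
  by (rule smooth_on_linear[of S "\<lambda>y. c *\<^sub>R y"]) (simp_all add: bounded_linear_scaleR_right)

lemma smooth_on_mult:
  fixes f :: "'a::real_normed_vector \<Rightarrow> 'b::real_normed_algebra"
  shows "open S \<Longrightarrow> smooth_on S f \<Longrightarrow> smooth_on S g \<Longrightarrow> smooth_on S (\<lambda>x. f x * g x)"
  by (simp add: smooth_on_def Ck_on_bilinear bounded_bilinear_mult)

lemma smooth_on_divide:
  fixes f :: "'a::real_normed_vector \<Rightarrow> 'b::real_normed_field"
  assumes "open S" "smooth_on S f" "smooth_on S g" "\<And>x. x \<in> S \<Longrightarrow> g x \<noteq> 0"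
  shows "smooth_on S (\<lambda>x. f x / g x)"
  unfolding divide_inverse using assms
  by (intro smooth_on_mult) (simp_all add: smooth_on_def Ck_on_inverse)

lemma smooth_on_sum:
  "open S \<Longrightarrow> (\<And>i. i \<in> I \<Longrightarrow> smooth_on S (f i)) \<Longrightarrow> smooth_on S (\<lambda>x. \<Sum>i\<in>I. f i x)"
  by (induction I rule: infinite_finite_induct) (auto intro: smooth_on_add)

lemma smooth_on_fst: "open W \<Longrightarrow> smooth_on W f \<Longrightarrow> smooth_on (W \<times> UNIV) (\<lambda>z. f (fst z))"
  by (simp add: smooth_on_def Ck_on_fst)

lemma smooth_on_bounded_linear:
  assumes "bounded_linear L" shows "smooth_on S L"
proof -
  have d: "(L has_derivative L) (at x)" for x
    using assms by (simp add: bounded_linear_imp_has_derivative)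
  have "Ck_on k S L" for k
    by (cases k) (use d assms in
      \<open>auto simp: differentiable_def frechet_derivative_eq[OF d] linear_continuous_on\<close>)
  then show ?thesis by (simp add: smooth_on_def)
qed

lemma smooth_on_frechet: "smooth_on S f \<Longrightarrow> smooth_on S (\<lambda>x. frechet_derivative f (at x) v)"
  unfolding smooth_on_def using Ck_on.simps(2) by blast

lemma smooth_on_differentiable: "smooth_on S f \<Longrightarrow> x \<in> S \<Longrightarrow> f differentiable (at x)"
  unfolding smooth_on_def using Ck_on.simps(2) by blast

lemma smooth_on_has_derivative:
  "smooth_on S f \<Longrightarrow> x \<in> S \<Longrightarrow> (f has_derivative frechet_derivative f (at x)) (at x)"
  by (simp add: differentiable_has_frechet smooth_on_differentiable)

lemma smooth_on_continuous: "smooth_on S f \<Longrightarrow> continuous_on S f"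
  unfolding smooth_on_def using Ck_on.simps(1) by blast

text \<open>Both mixed derivatives are limits of the same second difference quotient.\<close>

lemma frechet_derivative_commute_real:
  fixes f :: "'a::real_normed_vector \<Rightarrow> real"
  assumes S: "open S" "x \<in> S" and f: "smooth_on S f"
  shows "frechet_derivative (\<lambda>y. frechet_derivative f (at y) v) (at x) w =
         frechet_derivative (\<lambda>y. frechet_derivative f (at y) w) (at x) v"
proof -
  define D where "D v y = frechet_derivative f (at y) v" for v y
  define H where "H v w y = frechet_derivative (D v) (at y) w" for v w y
  have D: "(f has_derivative (\<lambda>v. D v y)) (at y)" if "y \<in> S" for y
    using smooth_on_has_derivative[OF f that] by (simp add: D_def)
  have sD: "smooth_on S (D v)" for v unfolding D_def by (rule smooth_on_frechet[OF f])
  have H: "(D v has_derivative (\<lambda>w. H v w y)) (at y)" if "y \<in> S" for v y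
    using smooth_on_has_derivative[OF sD that] by (simp add: H_def)
  have cH: "isCont (H v w) x" for v w
    using smooth_on_continuous[OF smooth_on_frechet[OF sD]] S
    by (simp add: H_def[abs_def] continuous_on_eq_continuous_at)
  have Dlin: "linear (\<lambda>v. D v y)" if "y \<in> S" for y
    using D[OF that] has_derivative_linear by blast
  have Hlin: "linear (\<lambda>w. H v w y)" if "y \<in> S" for v y
    using H[OF that] has_derivative_linear by blast
  obtain r where r: "r > 0" "ball x r \<subseteq> S" using S openE by blast
  text \<open>the second difference is \<open>h\<^sup>2\<close> times a mixed derivative near \<open>x\<close>\<close>
  have key: "\<exists>y. dist y x \<le> h * (norm v + norm w) \<and>
      f (x + h *\<^sub>R v + h *\<^sub>R w) - f (x + h *\<^sub>R v) - f (x + h *\<^sub>R w) + f x = h * h * H v w y"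
    if h: "h > 0" "h * (norm v + norm w) < r" for h v w
  proof -
    have inS: "x + s *\<^sub>R v + t *\<^sub>R w \<in> S" if "0 \<le> s" "s \<le> h" "0 \<le> t" "t \<le> h" for s t
    proof -
      have "dist (x + s *\<^sub>R v + t *\<^sub>R w) x \<le> s * norm v + t * norm w"
        unfolding dist_norm using norm_triangle_ineq[of "s *\<^sub>R v" "t *\<^sub>R w"] that by (simp add: algebra_simps)
      also have "\<dots> \<le> h * norm v + h * norm w"
        using that by (intro add_mono mult_right_mono) auto
      finally show ?thesis using h r by (auto simp: algebra_simps dist_commute)
    qed
    \<comment> \<open>Two mean value theorems: the first, along \<open>v\<close>, is applied to the
      difference of \<open>f\<close> between the points with and without
      \<open>h *\<^sub>R w\<close>; the second, along \<open>w\<close>, turns the resulting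
      difference of \<open>D v\<close> into a value of \<open>H v w\<close>.\<close>
    have 1: "((\<lambda>s. f (x + s *\<^sub>R v + h *\<^sub>R w) - f (x + s *\<^sub>R v)) has_real_derivative
        D v (x + s *\<^sub>R v + h *\<^sub>R w) - D v (x + s *\<^sub>R v)) (at s)" if "0 \<le> s" "s \<le> h" for s
    proof -
      have "((\<lambda>s. f (x + s *\<^sub>R v + t *\<^sub>R w)) has_derivative (\<lambda>q. D (q *\<^sub>R v) (x + s *\<^sub>R v + t *\<^sub>R w))) (at s)"
        if "0 \<le> t" "t \<le> h" for t
        by (rule has_derivative_compose[where f="\<lambda>s. x + s *\<^sub>R v + t *\<^sub>R w" and g=f and g'="\<lambda>q. D q (x + s *\<^sub>R v + t *\<^sub>R w)"])
           (use that \<open>0 \<le> s\<close> \<open>s \<le> h\<close> in \<open>auto intro!: derivative_eq_intros D inS\<close>)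
      note q = this[of h] this[of 0]
      have "((\<lambda>s. f (x + s *\<^sub>R v + h *\<^sub>R w) - f (x + s *\<^sub>R v)) has_derivative
        (\<lambda>q. D (q *\<^sub>R v) (x + s *\<^sub>R v + h *\<^sub>R w) - D (q *\<^sub>R v) (x + s *\<^sub>R v))) (at s)"
        using has_derivative_diff[OF q(1) q(2)] h by simp
      moreover have "(\<lambda>q. D (q *\<^sub>R v) (x + s *\<^sub>R v + h *\<^sub>R w) - D (q *\<^sub>R v) (x + s *\<^sub>R v)) =
          (*) (D v (x + s *\<^sub>R v + h *\<^sub>R w) - D v (x + s *\<^sub>R v))"
        using linear_cmul[OF Dlin[OF inS, of s h]] linear_cmul[OF Dlin[OF inS, of s 0]] that h
        by (auto simp: algebra_simps)
      ultimately show ?thesis by (simp add: has_field_derivative_def)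
    qed
    obtain s where s: "0 < s" "s < h"
      "f (x + h *\<^sub>R v + h *\<^sub>R w) - f (x + h *\<^sub>R v) - (f (x + 0 *\<^sub>R v + h *\<^sub>R w) - f (x + 0 *\<^sub>R v)) =
        (h - 0) * (D v (x + s *\<^sub>R v + h *\<^sub>R w) - D v (x + s *\<^sub>R v))"
      using MVT2[of 0 h, OF h(1) 1] by blast
    have 2: "((\<lambda>t. D v (x + s *\<^sub>R v + t *\<^sub>R w)) has_real_derivative H v w (x + s *\<^sub>R v + t *\<^sub>R w)) (at t)"
      if "0 \<le> t" "t \<le> h" for t
    proof -
      have "((\<lambda>t. D v (x + s *\<^sub>R v + t *\<^sub>R w)) has_derivative (\<lambda>q. H v (q *\<^sub>R w) (x + s *\<^sub>R v + t *\<^sub>R w))) (at t)"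
        by (rule has_derivative_compose[where f="\<lambda>t. x + s *\<^sub>R v + t *\<^sub>R w" and g="D v" and g'="\<lambda>q. H v q (x + s *\<^sub>R v + t *\<^sub>R w)"])
           (use that s in \<open>auto intro!: derivative_eq_intros H inS\<close>)
      moreover have "(\<lambda>q. H v (q *\<^sub>R w) (x + s *\<^sub>R v + t *\<^sub>R w)) = (*) (H v w (x + s *\<^sub>R v + t *\<^sub>R w))"
        using linear_cmul[OF Hlin[OF inS, of s t]] that s by (auto simp: algebra_simps)
      ultimately show ?thesis by (simp add: has_field_derivative_def)
    qed
    obtain t where t: "0 < t" "t < h"
      "D v (x + s *\<^sub>R v + h *\<^sub>R w) - D v (x + s *\<^sub>R v + 0 *\<^sub>R w) = (h - 0) * H v w (x + s *\<^sub>R v + t *\<^sub>R w)"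
      using MVT2[of 0 h, OF h(1) 2] by blast
    have "dist (x + s *\<^sub>R v + t *\<^sub>R w) x \<le> s * norm v + t * norm w"
      unfolding dist_norm using norm_triangle_ineq[of "s *\<^sub>R v" "t *\<^sub>R w"] s t by (simp add: algebra_simps)
    also have "\<dots> \<le> h * norm v + h * norm w"
      using s t by (intro add_mono mult_right_mono) auto
    finally have "dist (x + s *\<^sub>R v + t *\<^sub>R w) x \<le> h * (norm v + norm w)" by (simp add: algebra_simps)
    then show ?thesis using s(3) t(3) by (intro exI[of _ "x + s *\<^sub>R v + t *\<^sub>R w"]) simp
  qed
  have "\<bar>H v w x - H w v x\<bar> \<le> e" if "e > 0" for e
  proof -
    obtain d1 where d1: "d1 > 0" "\<And>y. dist y x < d1 \<Longrightarrow> dist (H v w y) (H v w x) < e/2"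
      using cH[of v w] \<open>e > 0\<close> unfolding continuous_at_eps_delta
      by (metis half_gt_zero)
    obtain d2 where d2: "d2 > 0" "\<And>y. dist y x < d2 \<Longrightarrow> dist (H w v y) (H w v x) < e/2"
      using cH[of w v] \<open>e > 0\<close> unfolding continuous_at_eps_delta
      by (metis half_gt_zero)
    \<comment> \<open>This step size keeps both intermediate points inside the ball of radius
      \<open>r\<close> and within both moduli of continuity; the \<open>+ 1\<close> in
      \<open>h\<close> covers \<open>v = w = 0\<close>.\<close>
    define m where "m = min r (min d1 d2)"
    define h where "h = m / (norm v + norm w + 1)"
    have m: "m > 0" using r d1 d2 by (simp add: m_def)
    have np: "norm v + norm w + 1 > 0" by (simp add: add_nonneg_pos)
    have h: "h > 0" using m np by (simp add: h_def)
    have hm: "h * (norm v + norm w) < m"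
      using m np by (simp add: h_def field_simps)
    have hm': "h * (norm w + norm v) < m" using hm by (simp add: add.commute)
    obtain y where y: "dist y x \<le> h * (norm v + norm w)"
      "f (x + h *\<^sub>R v + h *\<^sub>R w) - f (x + h *\<^sub>R v) - f (x + h *\<^sub>R w) + f x = h * h * H v w y"
      using key[of h v w] h hm m_def by auto
    obtain y' where y': "dist y' x \<le> h * (norm w + norm v)"
      "f (x + h *\<^sub>R w + h *\<^sub>R v) - f (x + h *\<^sub>R w) - f (x + h *\<^sub>R v) + f x = h * h * H w v y'"
      using key[of h w v] h hm' m_def by auto
    \<comment> \<open>The second difference is symmetric in \<open>v\<close> and \<open>w\<close>,
      so the two mixed derivatives agree at the points \<open>y\<close> and
      \<open>y'\<close>.\<close>
    have "h * h * H v w y = h * h * H w v y'"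
      unfolding y(2)[symmetric] y'(2)[symmetric] by (simp add: algebra_simps)
    then have "H v w y = H w v y'" using h by simp
    moreover have "dist (H v w y) (H v w x) < e/2" using d1(2) y(1) hm m_def by auto
    moreover have "dist (H w v y') (H w v x) < e/2" using d2(2) y'(1) hm' m_def by auto
    ultimately show ?thesis unfolding dist_real_def by linarith
  qed
  then have "\<bar>H v w x - H w v x\<bar> \<le> 0" by (rule field_le_epsilon) simp
  then show ?thesis by (simp add: H_def D_def[abs_def])
qed

lemma frechet_derivative_linear:
  assumes "bounded_linear L" "f differentiable (at x)"
  shows "frechet_derivative (\<lambda>y. L (f y)) (at x) v = L (frechet_derivative f (at x) v)"
proof -
  have "((\<lambda>y. L (f y)) has_derivative (\<lambda>v. L (frechet_derivative f (at x) v))) (at x)"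
    by (rule bounded_linear.has_derivative[OF assms(1) differentiable_has_frechet[OF assms(2)]])
  from frechet_derivative_eq[OF this] show ?thesis .
qed

text \<open>The mean value argument needs real values; the coordinates \<open>y \<bullet> i\<close>
  commute with differentiation and reduce the vector-valued case to it.\<close>

lemma frechet_derivative_commute:
  fixes f :: "'a::real_normed_vector \<Rightarrow> 'b::euclidean_space"
  assumes S: "open S" "x \<in> S" and f: "smooth_on S f"
  shows "frechet_derivative (\<lambda>y. frechet_derivative f (at y) v) (at x) w =
         frechet_derivative (\<lambda>y. frechet_derivative f (at y) w) (at x) v"
proof (rule euclidean_eqI)
  fix i :: 'b assume "i \<in> Basis"
  have L: "bounded_linear (\<lambda>y. y \<bullet> i)" by (rule bounded_linear_inner_left)
  note Lf = smooth_on_linear[OF S(1) L f]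
  have *: "frechet_derivative (\<lambda>y. frechet_derivative f (at y) v) (at x) w \<bullet> i =
        frechet_derivative (\<lambda>y. frechet_derivative (\<lambda>y. f y \<bullet> i) (at y) v) (at x) w" for v w
  proof -
    have "frechet_derivative (\<lambda>y. frechet_derivative f (at y) v) (at x) w \<bullet> i
      = frechet_derivative (\<lambda>y. frechet_derivative f (at y) v \<bullet> i) (at x) w"
      by (rule frechet_derivative_linear[OF L, symmetric])
         (rule smooth_on_differentiable[OF smooth_on_frechet[OF f] S(2)])
    also have "\<dots> = frechet_derivative (\<lambda>y. frechet_derivative (\<lambda>y. f y \<bullet> i) (at y) v) (at x) w"
    proof (rule arg_cong[where f="\<lambda>F. F w"], rule frechet_derivative_transform_within_open[OF _ S])
      show "(\<lambda>y. frechet_derivative f (at y) v \<bullet> i) differentiable at x"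
        by (rule smooth_on_differentiable[OF smooth_on_linear[OF S(1) L smooth_on_frechet[OF f]] S(2)])
      show "frechet_derivative f (at y) v \<bullet> i = frechet_derivative (\<lambda>y. f y \<bullet> i) (at y) v" if "y \<in> S" for y
        by (rule frechet_derivative_linear[OF L, symmetric]) (rule smooth_on_differentiable[OF f that])
    qed
    finally show ?thesis .
  qed
  show "frechet_derivative (\<lambda>y. frechet_derivative f (at y) v) (at x) w \<bullet> i =
        frechet_derivative (\<lambda>y. frechet_derivative f (at y) w) (at x) v \<bullet> i"
    unfolding * by (rule frechet_derivative_commute_real[OF S Lf])
qed

section \<open>Alternating forms and the exterior derivative\<close>

lemma covector_cong: "covector k f \<Longrightarrow> (\<And>i. i < k \<Longrightarrow> e i = e' i) \<Longrightarrow> f e = f e'"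
  unfolding covector_def by blast

lemma covector_linear: "covector k f \<Longrightarrow> i < k \<Longrightarrow> linear (\<lambda>v. f (e(i := v)))"
  unfolding covector_def by blast

lemma covector_alt: "covector k f \<Longrightarrow> i < k \<Longrightarrow> j < k \<Longrightarrow> i \<noteq> j \<Longrightarrow> e i = e j \<Longrightarrow> f e = 0"
  unfolding covector_def by blast

text \<open>Polarization: \<open>h\<close> vanishes on the pair \<open>(u + w, u + w)\<close>, and
  expanding it leaves only the two mixed terms.\<close>

lemma covector_swap:
  assumes f: "covector k f" and ij: "i < k" "j < k" "i \<noteq> j"
  shows "f (e \<circ> Transposition.transpose i j) = - f e"
proof -
  define h where "h u w = f (e(i := u, j := w))" for u w
  have h0: "h u u = 0" for u unfolding h_def using ij by (intro covector_alt[OF f ij]) auto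
  have l2: "linear (\<lambda>w. h u w)" for u unfolding h_def by (rule covector_linear[OF f ij(2)])
  have l1: "linear (\<lambda>u. h u w)" for w
    using covector_linear[OF f ij(1), of "e(j := w)"] ij by (simp add: h_def fun_upd_twist)
  have "h (u + w) (u + w) = h u u + h u w + (h w u + h w w)" for u w
    by (simp add: linear_add[OF l1] linear_add[OF l2])
  then have hs: "h u w = - h w u" for u w by (simp add: h0 eq_neg_iff_add_eq_0)
  have "e \<circ> Transposition.transpose i j = e(i := e j, j := e i)" by (auto simp: fun_eq_iff Transposition.transpose_def)
  then have "f (e \<circ> Transposition.transpose i j) = h (e j) (e i)" by (simp add: h_def)
  also have "\<dots> = - h (e i) (e j)" by (rule hs)
  also have "h (e i) (e j) = f e" by (simp add: h_def)
  finally show ?thesis .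
qed

lemma covector_permute:
  assumes f: "covector k f" and s: "\<sigma> permutes {..<k}"
  shows "f (\<lambda>i. e (\<sigma> i)) = real_of_int (sign \<sigma>) *\<^sub>R f e"
  using s finite_lessThan
proof (induction arbitrary: e rule: permutes_induct)
  case id then show ?case by simp
next
  case (swap a b p)
  have "f (\<lambda>i. e ((Transposition.transpose a b \<circ> p) i)) = f (\<lambda>i. (e \<circ> Transposition.transpose a b) (p i))" by simp
  also have "\<dots> = real_of_int (sign p) *\<^sub>R f (e \<circ> Transposition.transpose a b)" by (rule swap.IH)
  also have "f (e \<circ> Transposition.transpose a b) = - f e" using swap.hyps by (intro covector_swap[OF f]) auto
  moreover have "sign (Transposition.transpose a b \<circ> p) = - sign p"
  proof -
    have "permutation p" using swap.hyps permutation_permutes by blast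
    then show ?thesis using swap.hyps by (simp add: sign_compose permutation_swap_id sign_swap_id)
  qed
  ultimately show ?case by (simp add: o_def)
qed

lemma covectorI:
  assumes "\<And>e e'. (\<And>i. i < k \<Longrightarrow> e i = e' i) \<Longrightarrow> f e = f e'"
    and "\<And>i e. i < k \<Longrightarrow> linear (\<lambda>v. f (e(i := v)))"
    and "\<And>i j e. i < k \<Longrightarrow> j < k \<Longrightarrow> i \<noteq> j \<Longrightarrow> e i = e j \<Longrightarrow> f e = 0"
  shows "covector k f"
  unfolding covector_def using assms by blast

lemma covector_zero [simp]: "covector k (\<lambda>e. 0)"
  by (rule covectorI) (simp_all add: linear_zero)

lemma covector_add: "covector k f \<Longrightarrow> covector k g \<Longrightarrow> covector k (\<lambda>e. f e + g e)"
proof (rule covectorI)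
  assume f: "covector k f" and g: "covector k g"
  show "f e + g e = f e' + g e'" if "\<And>i. i < k \<Longrightarrow> e i = e' i" for e e'
    using covector_cong[OF f that] covector_cong[OF g that] by simp
  show "linear (\<lambda>v. f (e(i := v)) + g (e(i := v)))" if "i < k" for i e
    using that f g by (intro linear_compose_add covector_linear)
  show "f e + g e = 0" if "i < k" "j < k" "i \<noteq> j" "e i = e j" for i j e
    using covector_alt[OF f that] covector_alt[OF g that] by simp
qed

lemma covector_linear_comp:
  assumes "covector k f" "linear L" shows "covector k (\<lambda>e. L (f e))"
proof (rule covectorI)
  show "L (f e) = L (f e')" if "\<And>i. i < k \<Longrightarrow> e i = e' i" for e e'
    using covector_cong[OF assms(1) that] by simp
  show "linear (\<lambda>v. L (f (e(i := v))))" if "i < k" for i e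
    using linear_compose[OF covector_linear[OF assms(1) that] assms(2)] by (simp add: o_def)
  show "L (f e) = 0" if "i < k" "j < k" "i \<noteq> j" "e i = e j" for i j e
    using covector_alt[OF assms(1) that] linear_0[OF assms(2)] by simp
qed

lemma covector_mult_left:
  fixes c :: "'a::real_algebra"
  shows "covector k f \<Longrightarrow> covector k (\<lambda>e. c * f e)"
  by (rule covector_linear_comp) (auto intro!: linearI simp: algebra_simps)

lemma covector_minus: "covector k f \<Longrightarrow> covector k (\<lambda>e. - f e)"
  by (rule covector_linear_comp) (auto intro!: linearI)

lemma covector_diff: "covector k f \<Longrightarrow> covector k g \<Longrightarrow> covector k (\<lambda>e. f e - g e)"
  using covector_add[of k f "\<lambda>e. - g e"] covector_minus[of k g] by simp

lemma covector_sum: "(\<And>i. i \<in> I \<Longrightarrow> covector k (f i)) \<Longrightarrow> covector k (\<lambda>e. \<Sum>i\<in>I. f i e)"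
  by (induction I rule: infinite_finite_induct) (auto intro: covector_add)

text \<open>Inserting \<open>v\<close> into the first slot is the interior product. Most identities
  of the exterior algebra below are proved by contracting both sides and induction on the
  degree.\<close>

lemma covector_contract: "covector (Suc k) f \<Longrightarrow> covector k (\<lambda>e. f (case_nat v e))"
proof (rule covectorI)
  assume f: "covector (Suc k) f"
  show "f (case_nat v e) = f (case_nat v e')" if "\<And>i. i < k \<Longrightarrow> e i = e' i" for e e'
    using that by (intro covector_cong[OF f]) (auto split: nat.splits)
  have *: "case_nat v (e(i := w)) = (case_nat v e)(Suc i := w)" for e i w
    by (auto simp: fun_eq_iff split: nat.splits)
  show "linear (\<lambda>w. f (case_nat v (e(i := w))))" if "i < k" for i e
    unfolding * using that by (intro covector_linear[OF f]) auto
  show "f (case_nat v e) = 0" if "i < k" "j < k" "i \<noteq> j" "e i = e j" for i j e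
    using that by (intro covector_alt[OF f, of "Suc i" "Suc j"]) auto
qed

lemma case_nat_eta: "case_nat (e 0) (\<lambda>i. e (Suc i)) = e"
  by (auto simp: fun_eq_iff split: nat.splits)

lemma covector_1: "linear f \<Longrightarrow> covector 1 (\<lambda>e. f (e 0))"
  by (rule covectorI) auto

lemma covector_1_arg: "covector 1 f \<Longrightarrow> f e = f (\<lambda>_. e 0)"
  by (erule covector_cong) auto

lemma covector_1_linear: "covector 1 f \<Longrightarrow> linear (\<lambda>v. f (\<lambda>_. v))"
proof -
  assume f: "covector 1 f"
  have "f (e(0 := v)) = f (\<lambda>_. v)" for e v by (rule covector_cong[OF f]) simp
  then show ?thesis using covector_linear[OF f, of 0 undefined] by simp
qed

section \<open>The wedge product at a point\<close>

definition ewedge ::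
  "nat \<Rightarrow> nat \<Rightarrow> ((nat \<Rightarrow> 'v) \<Rightarrow> 'a::real_normed_field) \<Rightarrow> ((nat \<Rightarrow> 'v) \<Rightarrow> 'a) \<Rightarrow> (nat \<Rightarrow> 'v) \<Rightarrow> 'a" where
  "ewedge k l f g e =
     (\<Sum>\<sigma> | \<sigma> permutes {..<k + l}.
        of_int (sign \<sigma>) * f (\<lambda>i. e (\<sigma> i)) * g (\<lambda>i. e (\<sigma> (k + i)))) / (fact k * fact l)"

text \<open>The wedge of two forms uses the base point only through the two covectors there, so its
  algebra is that of \<open>ewedge\<close> and involves neither smoothness nor a domain.\<close>

lemma wedge_ewedge: "wedge k l \<phi> \<psi> x = ewedge k l (\<phi> x) (\<psi> x)"
  by (simp add: wedge_def ewedge_def fun_eq_iff)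

text \<open>Reindexing by \<open>\<sigma> \<mapsto> \<tau> \<circ> \<sigma>\<close> moves
  \<open>\<tau>\<close> from the arguments into the sign. This yields the alternation of the wedge
  product.\<close>

lemma ewedge_permute:
  fixes f g :: "(nat \<Rightarrow> 'a) \<Rightarrow> 'b::real_normed_field"
  assumes q: "\<tau> permutes {..<k + l}"
  shows "ewedge k l f g (e \<circ> \<tau>) = of_int (sign \<tau>) * ewedge k l f g e"
proof -
  let ?h = "\<lambda>\<sigma>. of_int (sign \<sigma>) * f (\<lambda>i. e (\<sigma> i)) * g (\<lambda>i. e (\<sigma> (k + i)))"
  have pt: "permutation \<tau>" using q permutation_permutes by blast
  have "(\<Sum>\<sigma> | \<sigma> permutes {..<k + l}. ?h \<sigma>) = (\<Sum>\<sigma> | \<sigma> permutes {..<k + l}. ?h (\<tau> \<circ> \<sigma>))"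
    by (rule setum_permutations_compose_left[OF q])
  also have "\<dots> = (\<Sum>\<sigma> | \<sigma> permutes {..<k + l}. of_int (sign \<tau>) *
      (of_int (sign \<sigma>) * f (\<lambda>i. (e \<circ> \<tau>) (\<sigma> i)) * g (\<lambda>i. (e \<circ> \<tau>) (\<sigma> (k + i)))))"
  proof (rule sum.cong, simp)
    fix \<sigma> assume "\<sigma> \<in> {\<sigma>. \<sigma> permutes {..<k + l}}"
    then have "permutation \<sigma>" using permutation_permutes by blast
    then show "?h (\<tau> \<circ> \<sigma>) = of_int (sign \<tau>) *
      (of_int (sign \<sigma>) * f (\<lambda>i. (e \<circ> \<tau>) (\<sigma> i)) * g (\<lambda>i. (e \<circ> \<tau>) (\<sigma> (k + i))))"
      using pt by (simp add: sign_compose mult.assoc)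
  qed
  finally have "ewedge k l f g e = of_int (sign \<tau>) * ewedge k l f g (e \<circ> \<tau>)"
    by (simp add: ewedge_def sum_distrib_left)
  then have "of_int (sign \<tau>) * ewedge k l f g e =
      (of_int (sign \<tau>) * of_int (sign \<tau>)) * ewedge k l f g (e \<circ> \<tau>)" by simp
  moreover have "of_int (sign \<tau>) * of_int (sign \<tau>) = (1 :: 'b)"
    unfolding of_int_mult[symmetric] by simp
  ultimately show ?thesis by simp
qed

lemma covector_ewedge:
  fixes f g :: "(nat \<Rightarrow> 'a::real_vector) \<Rightarrow> 'b::real_normed_field"
  assumes f: "covector k f" and g: "covector l g"
  shows "covector (k + l) (ewedge k l f g)"
proof (rule covectorI)
  show "ewedge k l f g e = ewedge k l f g e'" if "\<And>i. i < k + l \<Longrightarrow> e i = e' i" for e e'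
  proof -
    have "f (\<lambda>i. e (\<sigma> i)) = f (\<lambda>i. e' (\<sigma> i)) \<and> g (\<lambda>i. e (\<sigma> (k + i))) = g (\<lambda>i. e' (\<sigma> (k + i)))"
      if s: "\<sigma> permutes {..<k + l}" for \<sigma>
    proof -
      have "\<And>i. i < k + l \<Longrightarrow> \<sigma> i < k + l" using s permutes_in_image[OF s] by auto
      then show ?thesis using \<open>\<And>i. i < k + l \<Longrightarrow> e i = e' i\<close>
        by (auto intro!: covector_cong[OF f] covector_cong[OF g])
    qed
    then show ?thesis unfolding ewedge_def by (intro arg_cong2[of _ _ _ _ "(/)"] sum.cong) auto
  qed
  show "linear (\<lambda>v. ewedge k l f g (e(i := v)))" if i: "i < k + l" for i e
  proof -
    have "linear (\<lambda>v. of_int (sign \<sigma>) * f (\<lambda>j. (e(i := v)) (\<sigma> j)) * g (\<lambda>j. (e(i := v)) (\<sigma> (k + j))))"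
      if s: "\<sigma> permutes {..<k + l}" for \<sigma>
    proof -
      \<comment> \<open>The only position to which this permutation sends the varied entry; it is a
        slot of \<open>f\<close> or, after subtracting \<open>k\<close>, a slot of
        \<open>g\<close>.\<close>
      define m where "m = inv \<sigma> i"
      have m: "\<sigma> j = i \<longleftrightarrow> j = m" for j
        unfolding m_def using permutes_inverses[OF s] by metis
      have mk: "m < k + l" using i permutes_in_image[OF permutes_inv[OF s], of i] by (simp add: m_def)
      show ?thesis
      proof (cases "m < k")
        case True
        have "(\<lambda>j. (e(i := v)) (\<sigma> j)) = (\<lambda>j. e (\<sigma> j))(m := v)" for v using m by auto
        moreover have "(\<lambda>j. (e(i := v)) (\<sigma> (k + j))) = (\<lambda>j. e (\<sigma> (k + j)))" for v using m True by auto
        ultimately show ?thesis using covector_linear[OF f True]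
          by (auto simp: linear_iff algebra_simps)
      next
        case False
        have "g (\<lambda>j. (e(i := v)) (\<sigma> (k + j))) = g ((\<lambda>j. e (\<sigma> (k + j)))(m - k := v))" for v
          using m False by (intro arg_cong[of _ _ g]) (auto simp: fun_eq_iff)
        moreover have "f (\<lambda>j. (e(i := v)) (\<sigma> j)) = f (\<lambda>j. e (\<sigma> j))" for v
          using m False by (intro covector_cong[OF f]) auto
        moreover have "m - k < l" using mk False by auto
        ultimately show ?thesis using covector_linear[OF g, of "m - k"]
          by (auto simp: linear_iff algebra_simps)
      qed
    qed
    then have "linear (\<lambda>v. \<Sum>\<sigma> | \<sigma> permutes {..<k + l}.
      of_int (sign \<sigma>) * f (\<lambda>j. (e(i := v)) (\<sigma> j)) * g (\<lambda>j. (e(i := v)) (\<sigma> (k + j))))"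
      by (intro linear_compose_sum) auto
    moreover have "linear (\<lambda>x. x / (fact k * fact l) :: 'b)"
      by (rule linearI) (simp_all add: add_divide_distrib scaleR_conv_of_real)
    ultimately show ?thesis unfolding ewedge_def by (rule linear_compose[unfolded o_def])
  qed
  show "ewedge k l f g e = 0" if "i < k + l" "j < k + l" "i \<noteq> j" "e i = e j" for i j e
  proof -
    have "e \<circ> Transposition.transpose i j = e" using that by (auto simp: fun_eq_iff Transposition.transpose_def)
    moreover have "Transposition.transpose i j permutes {..<k + l}" using that by (intro permutes_swap_id) auto
    ultimately have "ewedge k l f g e = - ewedge k l f g e"
      using ewedge_permute[of "Transposition.transpose i j" k l f g e] that by (simp add: sign_swap_id)
    then have "2 * ewedge k l f g e = 0" by (metis add.right_inverse mult_2)
    then show ?thesis by simp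
  qed
qed

text \<open>Embeds the permutations of \<open>n\<close> points as the stabilizer of \<open>0\<close>
  among those of \<open>Suc n\<close> points. These are the permutations left over when the
  contracted vector occupies slot \<open>0\<close>.\<close>

definition shift_perm :: "(nat \<Rightarrow> nat) \<Rightarrow> nat \<Rightarrow> nat" where
  "shift_perm \<tau> = case_nat 0 (\<lambda>i. Suc (\<tau> i))"

lemma shift_perm_map_permutation:
  assumes "\<tau> permutes {..<n}"
  shows "shift_perm \<tau> = map_permutation {..<n} Suc \<tau>"
proof
  fix i show "shift_perm \<tau> i = map_permutation {..<n} Suc \<tau> i"
  proof (cases i)
    case 0 then show ?thesis by (auto simp: shift_perm_def map_permutation_def restrict_id_def)
  next
    case (Suc j)
    show ?thesis
    proof (cases "j < n")
      case True
      then show ?thesis using Suc by (simp add: shift_perm_def map_permutation_apply)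
    next
      case False
      then have "\<tau> j = j" using assms by (auto simp: permutes_def)
      then show ?thesis using Suc False by (auto simp: shift_perm_def map_permutation_def restrict_id_def)
    qed
  qed
qed

lemma sign_shift_perm: "\<tau> permutes {..<n} \<Longrightarrow> sign (shift_perm \<tau>) = sign \<tau>"
  by (simp add: shift_perm_map_permutation sign_map_permutation)

lemma shift_perm_permutes:
  assumes "\<tau> permutes {..<n}" shows "shift_perm \<tau> permutes {..<Suc n}"
proof -
  have "shift_perm \<tau> permutes Suc ` {..<n}"
    using assms by (simp add: shift_perm_map_permutation map_permutation_permutes)
  then show ?thesis by (rule permutes_subset) auto
qed

lemma sum_permutes_fix0:
  "(\<Sum>\<sigma> | \<sigma> permutes {..<Suc n} \<and> \<sigma> 0 = 0. h \<sigma>) = (\<Sum>\<tau> | \<tau> permutes {..<n}. h (shift_perm \<tau>))"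
proof (rule sum.reindex_cong[of shift_perm])
  show "inj_on shift_perm {\<tau>. \<tau> permutes {..<n}}"
    by (auto simp: inj_on_def shift_perm_def fun_eq_iff split: nat.splits)
  show "{\<sigma>. \<sigma> permutes {..<Suc n} \<and> \<sigma> 0 = 0} = shift_perm ` {\<tau>. \<tau> permutes {..<n}}"
  proof (intro equalityI subsetI)
    fix \<sigma> assume "\<sigma> \<in> {\<sigma>. \<sigma> permutes {..<Suc n} \<and> \<sigma> 0 = 0}"
    then have s: "\<sigma> permutes {..<Suc n}" "\<sigma> 0 = 0" by auto
    have nz: "\<sigma> (Suc i) \<noteq> 0" for i using s permutes_inj[OF s(1)] by (metis injD nat.distinct(1))
    define \<tau> where "\<tau> i = \<sigma> (Suc i) - 1" for i
    have st: "\<sigma> = shift_perm \<tau>"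
      using s nz by (auto simp: shift_perm_def \<tau>_def fun_eq_iff split: nat.splits)
    have "\<tau> permutes {..<n}"
      unfolding permutes_def
    proof (intro conjI allI impI)
      show "\<tau> x = x" if "x \<notin> {..<n}" for x
        using s that by (auto simp: \<tau>_def permutes_def)
      show "\<exists>!x. \<tau> x = y" for y
      proof -
        obtain x where x: "\<sigma> x = Suc y" using permutes_surj[OF s(1)] by (metis surjD)
        then obtain x' where x': "x = Suc x'" using s by (cases x) auto
        show ?thesis
        proof (rule ex1I[of _ x'])
          show "\<tau> x' = y" using x x' by (simp add: \<tau>_def)
          show "z = x'" if "\<tau> z = y" for z
          proof -
            have "\<sigma> (Suc z) = Suc y" using that nz[of z] by (simp add: \<tau>_def)
            then show ?thesis using x x' permutes_inj[OF s(1)] by (metis injD nat.inject)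
          qed
        qed
      qed
    qed
    then show "\<sigma> \<in> shift_perm ` {\<tau>. \<tau> permutes {..<n}}" using st by auto
  qed (auto simp: shift_perm_permutes, simp add: shift_perm_def)
qed simp

text \<open>The cycle \<open>0, 1, ..., k\<close>: its sign is the price for moving the contracted
  vector past the \<open>k\<close> slots of the first factor.\<close>

definition cycle_perm :: "nat \<Rightarrow> nat \<Rightarrow> nat" where
  "cycle_perm k i = (if i < k then Suc i else if i = k then 0 else i)"

lemma cycle_perm: "cycle_perm k permutes {..k} \<and> sign (cycle_perm k) = (-1) ^ k"
proof (induction k)
  case 0
  have eq: "cycle_perm 0 = id" by (auto simp: cycle_perm_def fun_eq_iff)
  have "cycle_perm 0 permutes {..0}" unfolding eq by (rule permutes_id)
  moreover have "sign (cycle_perm 0) = 1" unfolding eq by (rule sign_id)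
  ultimately show ?case by (simp only: power_0 simp_thms)
next
  case (Suc k)
  have eq: "cycle_perm (Suc k) = cycle_perm k \<circ> Transposition.transpose k (Suc k)"
    by (auto simp: cycle_perm_def fun_eq_iff Transposition.transpose_def)
  have p: "cycle_perm k permutes {..Suc k}" using Suc by (auto intro: permutes_subset)
  have t: "Transposition.transpose k (Suc k) permutes {..Suc k}" by (intro permutes_swap_id) auto
  have "permutation (cycle_perm k)" using p permutation_permutes by blast
  then have "sign (cycle_perm (Suc k)) = - sign (cycle_perm k)"
    by (simp add: eq sign_compose permutation_swap_id sign_swap_id)
  then have "sign (cycle_perm (Suc k)) = (-1) ^ Suc k" using Suc by simp
  moreover have "cycle_perm (Suc k) permutes {..Suc k}"
    unfolding eq by (rule permutes_compose[OF t p])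
  ultimately show ?case by blast
qed

lemma sum_permutes_by_preimage:
  "(\<Sum>\<sigma> | \<sigma> permutes {..<Suc n}. h \<sigma>) = (\<Sum>j<Suc n. \<Sum>\<sigma> | \<sigma> permutes {..<Suc n} \<and> \<sigma> j = (0::nat). h \<sigma>)"
proof -
  have eq: "{\<sigma>. \<sigma> permutes {..<Suc n}} = (\<Union>j<Suc n. {\<sigma>. \<sigma> permutes {..<Suc n} \<and> \<sigma> j = (0::nat)})"
  proof (intro equalityI subsetI)
    fix \<sigma> assume "\<sigma> \<in> {\<sigma>. \<sigma> permutes {..<Suc n}}"
    then have s: "\<sigma> permutes {..<Suc n}" by simp
    have "inv \<sigma> 0 < Suc n" using permutes_in_image[OF permutes_inv[OF s], of 0] by simp
    moreover have "\<sigma> (inv \<sigma> 0) = 0" using permutes_inverses[OF s] by simp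
    ultimately show "\<sigma> \<in> (\<Union>j<Suc n. {\<sigma>. \<sigma> permutes {..<Suc n} \<and> \<sigma> j = 0})" using s by auto
  qed auto
  show ?thesis
    unfolding eq
  proof (rule sum.UNION_disjoint)
    show "\<forall>i\<in>{..<Suc n}. finite {\<sigma>. \<sigma> permutes {..<Suc n} \<and> \<sigma> i = 0}"
      by (auto intro: finite_subset[OF _ finite_permutations[of "{..<Suc n}"]])
    show "\<forall>i\<in>{..<Suc n}. \<forall>j\<in>{..<Suc n}. i \<noteq> j \<longrightarrow>
        {\<sigma>. \<sigma> permutes {..<Suc n} \<and> \<sigma> i = 0} \<inter> {\<sigma>. \<sigma> permutes {..<Suc n} \<and> \<sigma> j = 0} = {}"
      by auto (metis injD permutes_inj)
  qed simp
qed

text \<open>The interior product is an antiderivation. The permutations are sorted by the slot that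
  receives \<open>v\<close>. By alternation all slots of \<open>f\<close> contribute the same, and
  so do all slots of \<open>g\<close>; the sum is \<open>k\<close> times one representative plus
  \<open>l\<close> times another, which lowers the factorials by one.\<close>

lemma ewedge_contract:
  fixes f g :: "(nat \<Rightarrow> 'a::real_vector) \<Rightarrow> 'b::real_normed_field"
  assumes f: "covector k f" and g: "covector l g" and kl: "k + l = Suc n"
  shows "ewedge k l f g (case_nat v e) =
    (if k = 0 then 0 else ewedge (k - 1) l (\<lambda>e. f (case_nat v e)) g e) +
    (-1) ^ k * (if l = 0 then 0 else ewedge k (l - 1) f (\<lambda>e. g (case_nat v e)) e)"
proof -
  let ?e = "case_nat v e"
  define h where "h \<sigma> = of_int (sign \<sigma>) * f (\<lambda>i. ?e (\<sigma> i)) * g (\<lambda>i. ?e (\<sigma> (k + i)))" for \<sigma>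
  define T where "T j = (\<Sum>\<sigma> | \<sigma> permutes {..<Suc n} \<and> \<sigma> j = 0. h \<sigma>)" for j
  have reindex: "T i = (\<Sum>\<sigma> | \<sigma> permutes {..<Suc n} \<and> \<sigma> j = 0. h (\<sigma> \<circ> \<rho>))"
    if r: "\<rho> permutes {..<Suc n}" "\<rho> i = j" for i j \<rho>
    unfolding T_def
  proof (rule sum.reindex_cong[of "\<lambda>\<sigma>. \<sigma> \<circ> \<rho>"])
    show "inj_on (\<lambda>\<sigma>. \<sigma> \<circ> \<rho>) {\<sigma>. \<sigma> permutes {..<Suc n} \<and> \<sigma> j = 0}"
      using permutes_surj[OF r(1)] by (auto simp: inj_on_def fun_eq_iff) (metis surjD)
    show "{\<sigma>. \<sigma> permutes {..<Suc n} \<and> \<sigma> i = 0} = (\<lambda>\<sigma>. \<sigma> \<circ> \<rho>) ` {\<sigma>. \<sigma> permutes {..<Suc n} \<and> \<sigma> j = 0}"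
    proof (intro equalityI subsetI)
      fix \<sigma> assume "\<sigma> \<in> {\<sigma>. \<sigma> permutes {..<Suc n} \<and> \<sigma> i = 0}"
      then have s: "\<sigma> permutes {..<Suc n}" "\<sigma> i = 0" by auto
      have "\<sigma> = (\<sigma> \<circ> inv \<rho>) \<circ> \<rho>" using permutes_inv_o[OF r(1)] by (simp add: o_assoc[symmetric])
      moreover have "(\<sigma> \<circ> inv \<rho>) permutes {..<Suc n}"
        using permutes_compose[OF permutes_inv[OF r(1)] s(1)] .
      moreover have "(\<sigma> \<circ> inv \<rho>) j = 0" using s r permutes_inverses[OF r(1)] by auto
      ultimately show "\<sigma> \<in> (\<lambda>\<sigma>. \<sigma> \<circ> \<rho>) ` {\<sigma>. \<sigma> permutes {..<Suc n} \<and> \<sigma> j = 0}" by blast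
    next
      fix \<sigma> assume "\<sigma> \<in> (\<lambda>\<sigma>. \<sigma> \<circ> \<rho>) ` {\<sigma>. \<sigma> permutes {..<Suc n} \<and> \<sigma> j = 0}"
      then show "\<sigma> \<in> {\<sigma>. \<sigma> permutes {..<Suc n} \<and> \<sigma> i = 0}"
        using permutes_compose[OF r(1)] r(2) by auto
    qed
  qed simp
  \<comment> \<open>Exchanging two slots of the same factor reverses both the sign of the
    permutation and the value of that factor, so the summand \<open>h\<close> does not
    change.\<close>
  have swap: "h (\<sigma> \<circ> Transposition.transpose i j) = h \<sigma>"
    if s: "\<sigma> permutes {..<Suc n}" and ij: "i < k \<and> j < k \<or> k \<le> i \<and> i < Suc n \<and> k \<le> j \<and> j < Suc n" for \<sigma> i j
  proof (cases "i = j")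
    case False
    have ps: "permutation \<sigma>" using s permutation_permutes by blast
    have sg: "sign (\<sigma> \<circ> Transposition.transpose i j) = - sign \<sigma>"
      using False by (simp add: sign_compose[OF ps permutation_swap_id] sign_swap_id)
    show ?thesis
    proof (cases "i < k")
      case True
      then have j: "j < k" using ij by auto
      have "f (\<lambda>m. ?e ((\<sigma> \<circ> Transposition.transpose i j) m)) = - f (\<lambda>m. ?e (\<sigma> m))"
        using covector_swap[OF f True j False, of "\<lambda>m. ?e (\<sigma> m)"] by (simp add: o_def)
      moreover have "(\<lambda>m. ?e ((\<sigma> \<circ> Transposition.transpose i j) (k + m))) = (\<lambda>m. ?e (\<sigma> (k + m)))"
        using True j by (auto simp: Transposition.transpose_def)
      ultimately show ?thesis using sg by (simp add: h_def)
    next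
      case F2: False
      then have j: "k \<le> i" "k \<le> j" "i < Suc n" "j < Suc n" using ij by auto
      have "f (\<lambda>m. ?e ((\<sigma> \<circ> Transposition.transpose i j) m)) = f (\<lambda>m. ?e (\<sigma> m))"
        using j by (intro covector_cong[OF f]) (auto simp: Transposition.transpose_def)
      moreover have "g (\<lambda>m. ?e ((\<sigma> \<circ> Transposition.transpose i j) (k + m))) = - g (\<lambda>m. ?e (\<sigma> (k + m)))"
      proof -
        have "(\<lambda>m. ?e ((\<sigma> \<circ> Transposition.transpose i j) (k + m))) = (\<lambda>m. ?e (\<sigma> (k + m))) \<circ> Transposition.transpose (i - k) (j - k)"
          using j by (auto simp: fun_eq_iff Transposition.transpose_def)
        then show ?thesis
          using covector_swap[OF g, of "i - k" "j - k" "\<lambda>m. ?e (\<sigma> (k + m))"] j False kl by auto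
      qed
      ultimately show ?thesis using sg by (simp add: h_def)
    qed
  qed simp
  have Teq: "T i = T j"
    if ij: "i < k \<and> j < k \<or> k \<le> i \<and> i < Suc n \<and> k \<le> j \<and> j < Suc n" for i j
  proof -
    have "Transposition.transpose i j permutes {..<Suc n}" using ij kl by (intro permutes_swap_id) auto
    from reindex[OF this, of i j] show ?thesis
      using swap ij by (simp add: T_def)
  qed
  have "(\<Sum>\<sigma> | \<sigma> permutes {..<k + l}. h \<sigma>) = (\<Sum>j<k + l. T j)"
    unfolding kl T_def by (rule sum_permutes_by_preimage)
  also have "\<dots> = (\<Sum>j<k. T j) + (\<Sum>j<l. T (k + j))"
    by (induction l) (auto simp: algebra_simps)
  also have "(\<Sum>j<k. T j) = (\<Sum>j<k. T 0)"
    by (rule sum.cong[OF refl], rule Teq) auto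
  also have "(\<Sum>j<l. T (k + j)) = (\<Sum>j<l. T k)"
    by (rule sum.cong[OF refl], rule Teq) (use kl in auto)
  finally have tot: "(\<Sum>\<sigma> | \<sigma> permutes {..<k + l}. h \<sigma>) = of_nat k * T 0 + of_nat l * T k" by simp
  \<comment> \<open>The branch \<open>k = 0\<close> is vacuous: there \<open>T 0\<close> will be
    multiplied by \<open>of_nat k = 0\<close>. The same applies to \<open>T k\<close> and
    \<open>l = 0\<close> below.\<close>
  have T0: "T 0 = (if k = 0 then T 0 else (fact (k - 1) * fact l) * ewedge (k - 1) l (\<lambda>e. f (case_nat v e)) g e)"
  proof (cases k)
    case (Suc k')
    have "h (shift_perm \<tau>) = of_int (sign \<tau>) * f (case_nat v (\<lambda>i. e (\<tau> i))) * g (\<lambda>i. e (\<tau> (k' + i)))"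
      if t: "\<tau> permutes {..<n}" for \<tau>
    proof -
      have "(\<lambda>i. ?e (shift_perm \<tau> i)) = case_nat v (\<lambda>i. e (\<tau> i))"
        by (auto simp: shift_perm_def fun_eq_iff split: nat.splits)
      moreover have "(\<lambda>i. ?e (shift_perm \<tau> (k + i))) = (\<lambda>i. e (\<tau> (k' + i)))"
        using Suc by (auto simp: shift_perm_def)
      ultimately show ?thesis using sign_shift_perm[OF t] by (simp add: h_def)
    qed
    then have "T 0 = (\<Sum>\<tau> | \<tau> permutes {..<n}. of_int (sign \<tau>) * f (case_nat v (\<lambda>i. e (\<tau> i))) * g (\<lambda>i. e (\<tau> (k' + i))))"
      unfolding T_def sum_permutes_fix0 by (intro sum.cong) auto
    moreover have "n = k' + l" using Suc kl by simp
    ultimately show ?thesis using Suc by (simp add: ewedge_def)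
  qed simp
  have Tk: "T k = (if l = 0 then T k else (fact k * fact (l - 1)) * ((-1) ^ k * ewedge k (l - 1) f (\<lambda>e. g (case_nat v e)) e))"
  proof (cases l)
    case (Suc l')
    have n: "n = k + l'" using Suc kl by simp
    have c: "cycle_perm k permutes {..<Suc n}"
      using cycle_perm[of k] n by (auto intro: permutes_subset)
    have pc: "permutation (cycle_perm k)" using c permutation_permutes by blast
    have 1: "T k = (\<Sum>\<sigma> | \<sigma> permutes {..<Suc n} \<and> \<sigma> 0 = 0. h (\<sigma> \<circ> cycle_perm k))"
      by (rule reindex[OF c]) (simp add: cycle_perm_def)
    have "h (shift_perm \<tau> \<circ> cycle_perm k) =
      (-1)^k * (of_int (sign \<tau>) * f (\<lambda>i. e (\<tau> i)) * g (case_nat v (\<lambda>i. e (\<tau> (k + i)))))"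
      if t: "\<tau> permutes {..<n}" for \<tau>
    proof -
      have "f (\<lambda>i. ?e ((shift_perm \<tau> \<circ> cycle_perm k) i)) = f (\<lambda>i. e (\<tau> i))"
        by (rule covector_cong[OF f]) (auto simp: shift_perm_def cycle_perm_def)
      moreover have "(\<lambda>i. ?e ((shift_perm \<tau> \<circ> cycle_perm k) (k + i))) = case_nat v (\<lambda>i. e (\<tau> (k + i)))"
        by (auto simp: shift_perm_def cycle_perm_def fun_eq_iff split: nat.splits)
      moreover have "sign (shift_perm \<tau> \<circ> cycle_perm k) = (-1)^k * sign \<tau>"
      proof -
        have "permutation (shift_perm \<tau>)" using shift_perm_permutes[OF t] permutation_permutes by blast
        then show ?thesis using sign_shift_perm[OF t] cycle_perm[of k] by (simp add: sign_compose pc)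
      qed
      ultimately show ?thesis by (simp add: h_def)
    qed
    then have "T k = (-1)^k * (\<Sum>\<tau> | \<tau> permutes {..<n}.
      of_int (sign \<tau>) * f (\<lambda>i. e (\<tau> i)) * g (case_nat v (\<lambda>i. e (\<tau> (k + i)))))"
      unfolding 1 sum_permutes_fix0 sum_distrib_left by (intro sum.cong) auto
    then show ?thesis using Suc n by (simp add: ewedge_def)
  qed simp
  have "ewedge k l f g ?e = (of_nat k * T 0 + of_nat l * T k) / (fact k * fact l)"
    using tot by (simp add: ewedge_def h_def)
  also have "\<dots> = of_nat k * T 0 / (fact k * fact l) + of_nat l * T k / (fact k * fact l)"
    by (simp add: add_divide_distrib)
  also have "of_nat k * T 0 / (fact k * fact l) = (if k = 0 then 0 else ewedge (k - 1) l (\<lambda>e. f (case_nat v e)) g e)"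
  proof (cases k)
    case (Suc k')
    then have [simp]: "(of_nat k :: 'b) \<noteq> 0" by (metis of_nat_neq_0)
    have fk: "(fact k :: 'b) = of_nat k * fact (k - 1)" using Suc by simp
    have k0: "k \<noteq> 0" using Suc by simp
    show ?thesis unfolding fk by (subst T0) (simp add: k0)
  qed simp
  also have "of_nat l * T k / (fact k * fact l) = (-1) ^ k * (if l = 0 then 0 else ewedge k (l - 1) f (\<lambda>e. g (case_nat v e)) e)"
  proof (cases l)
    case (Suc l')
    then have [simp]: "(of_nat l :: 'b) \<noteq> 0" by (metis of_nat_neq_0)
    have fk: "(fact l :: 'b) = of_nat l * fact (l - 1)" using Suc by simp
    have k0: "l \<noteq> 0" using Suc by simp
    show ?thesis unfolding fk by (subst Tk) (simp add: k0)
  qed simp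
  finally show ?thesis .
qed

text \<open>Degrees are explicit arguments of the wedge and have to agree literally: the degree
  \<open>1\<close> stays a numeral, and \<open>1 + k\<close> and \<open>k + 1\<close> are both
  normalized to \<open>Suc k\<close>.\<close>

declare One_nat_def [simp del]
declare plus_1_eq_Suc [simp]

lemma add_1_eq_Suc [simp]: "k + 1 = Suc k"
  by simp

lemma ewedge_zero_left [simp]: "ewedge k l (\<lambda>e. 0) g = (\<lambda>e. 0)"
  by (simp add: ewedge_def fun_eq_iff)

lemma ewedge_zero_right [simp]: "ewedge k l f (\<lambda>e. 0) = (\<lambda>e. 0)"
  by (simp add: ewedge_def fun_eq_iff)

lemma ewedge_add_left: "ewedge k l (\<lambda>e. f e + f' e) g e = ewedge k l f g e + ewedge k l f' g e"
  by (simp add: ewedge_def algebra_simps sum.distrib add_divide_distrib)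

lemma ewedge_add_right: "ewedge k l f (\<lambda>e. g e + g' e) e = ewedge k l f g e + ewedge k l f g' e"
  by (simp add: ewedge_def algebra_simps sum.distrib add_divide_distrib)

lemma ewedge_mult_left: "ewedge k l (\<lambda>e. c * f e) g e = c * ewedge k l f g e"
  by (simp add: ewedge_def sum_distrib_left algebra_simps)

lemma ewedge_mult_right: "ewedge k l f (\<lambda>e. c * g e) e = c * ewedge k l f g e"
  by (simp add: ewedge_def sum_distrib_left algebra_simps)

lemma ewedge_minus_left: "ewedge k l (\<lambda>e. - f e) g e = - ewedge k l f g e"
  using ewedge_mult_left[of k l "-1" f g e] by simp

lemma ewedge_minus_right: "ewedge k l f (\<lambda>e. - g e) e = - ewedge k l f g e"
  using ewedge_mult_right[of k l f "-1" g e] by simp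

lemma ewedge_diff_left: "ewedge k l (\<lambda>e. f e - f' e) g e = ewedge k l f g e - ewedge k l f' g e"
  using ewedge_add_left[of k l f "\<lambda>e. - f' e" g e] by (simp add: ewedge_minus_left)

lemma ewedge_diff_right: "ewedge k l f (\<lambda>e. g e - g' e) e = ewedge k l f g e - ewedge k l f g' e"
  using ewedge_add_right[of k l f g "\<lambda>e. - g' e" e] by (simp add: ewedge_minus_right)

lemma ewedge_sum_left: "ewedge k l (\<lambda>e. \<Sum>i\<in>I. f i e) g e = (\<Sum>i\<in>I. ewedge k l (f i) g e)"
  by (induction I rule: infinite_finite_induct) (simp_all add: ewedge_add_left)

lemma ewedge_sum_right: "ewedge k l f (\<lambda>e. \<Sum>i\<in>I. g i e) e = (\<Sum>i\<in>I. ewedge k l f (g i) e)"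
  by (induction I rule: infinite_finite_induct) (simp_all add: ewedge_add_right)

lemma ewedge_0_0: "ewedge 0 0 f g e = f e * g e"
  by (simp add: ewedge_def)

lemma covector_0: "covector 0 f \<Longrightarrow> f e = f e'"
  by (rule covector_cong) auto

lemma covector_0_const: "covector 0 (\<lambda>e. c)"
  by (rule covectorI) auto

lemma ewedge_0_left:
  fixes f g :: "(nat \<Rightarrow> 'a::real_vector) \<Rightarrow> 'b::real_normed_field"
  assumes f: "covector 0 f" and g: "covector l g"
  shows "ewedge 0 l f g e = f e * g e"
  using g
proof (induction l arbitrary: g e)
  case 0 then show ?case by (rule_tac ewedge_0_0)
next
  case (Suc l)
  let ?v = "e 0" and ?e = "\<lambda>i. e (Suc i)"
  have "ewedge 0 (Suc l) f g (case_nat ?v ?e) = ewedge 0 l f (\<lambda>e. g (case_nat ?v e)) ?e"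
    by (subst ewedge_contract[OF f Suc.prems]) auto
  also have "\<dots> = f ?e * g (case_nat ?v ?e)"
    using Suc.IH[OF covector_contract[OF Suc.prems]] by simp
  finally show ?case using covector_0[OF f, of ?e e] by (simp add: case_nat_eta)
qed

lemma ewedge_0_right:
  fixes f g :: "(nat \<Rightarrow> 'a::real_vector) \<Rightarrow> 'b::real_normed_field"
  assumes f: "covector k f" and g: "covector 0 g"
  shows "ewedge k 0 f g e = f e * g e"
  using f
proof (induction k arbitrary: f e)
  case 0 then show ?case by (rule_tac ewedge_0_0)
next
  case (Suc k)
  let ?v = "e 0" and ?e = "\<lambda>i. e (Suc i)"
  have "ewedge (Suc k) 0 f g (case_nat ?v ?e) = ewedge k 0 (\<lambda>e. f (case_nat ?v e)) g ?e"
    by (subst ewedge_contract[OF Suc.prems g]) auto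
  also have "\<dots> = f (case_nat ?v ?e) * g ?e"
    using Suc.IH[OF covector_contract[OF Suc.prems]] by simp
  finally show ?case using covector_0[OF g, of ?e e] by (simp add: case_nat_eta)
qed

text \<open>Every sequence has the form \<open>case_nat v e\<close>, so functions of sequences agree
  as soon as all their contractions do. With \<open>ewedge_contract\<close> this is the induction
  scheme for the algebra of wedge products.\<close>

lemma covector_contract_ext:
  assumes "\<And>v e. f (case_nat v e) = g (case_nat v e)" shows "f = g"
proof
  fix e show "f e = g e" using assms[of "e 0" "\<lambda>i. e (Suc i)"] by (simp add: case_nat_eta)
qed

text \<open>Induction on the total degree. Both sides contract to
  \<open>A + (-1)^k * B + (-1)^(k + l) * C\<close>, where \<open>A\<close>, \<open>B\<close>,
  \<open>C\<close> are the triple products with the vector contracted into \<open>f\<close>,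
  \<open>g\<close>, \<open>h\<close>.\<close>

lemma ewedge_assoc:
  fixes f g h :: "(nat \<Rightarrow> 'a::real_vector) \<Rightarrow> 'b::real_normed_field"
  assumes "covector k f" "covector l g" "covector m h"
  shows "ewedge (k + l) m (ewedge k l f g) h = ewedge k (l + m) f (ewedge l m g h)"
  using assms
proof (induction "k + l + m" arbitrary: k l m f g h)
  case 0
  then show ?case by (auto simp: ewedge_0_0 fun_eq_iff)
next
  case (Suc n)
  note f = \<open>covector k f\<close> and g = \<open>covector l g\<close> and h = \<open>covector m h\<close>
  note fg = covector_ewedge[OF f g] and gh = covector_ewedge[OF g h]
  have kl: "k + l + m = Suc n" and kl': "k + (l + m) = Suc n" using Suc.hyps(2) by simp_all
  show ?case
  proof (rule covector_contract_ext)
    fix v and e :: "nat \<Rightarrow> 'a"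
    let ?i = "\<lambda>(f :: (nat \<Rightarrow> 'a) \<Rightarrow> 'b) e. f (case_nat v e)"
    define A where "A = (if k = 0 then 0 else ewedge (k - 1) (l + m) (?i f) (ewedge l m g h) e)"
    define B where "B = (if l = 0 then 0 else ewedge k (l - 1 + m) f (ewedge (l - 1) m (?i g) h) e)"
    define C where "C = (if m = 0 then 0 else ewedge k (l + (m - 1)) f (ewedge l (m - 1) g (?i h)) e)"
    have A': "A = (if k = 0 then 0 else ewedge (k - 1 + l) m (ewedge (k - 1) l (?i f) g) h e)"
      using Suc.hyps(1)[of "k - 1" l m "?i f" g h] Suc.hyps(2) covector_contract[of "k - 1" f v] f g h
      by (auto simp: A_def)
    have B': "B = (if l = 0 then 0 else ewedge (k + (l - 1)) m (ewedge k (l - 1) f (?i g)) h e)"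
      using Suc.hyps(1)[of k "l - 1" m f "?i g" h] Suc.hyps(2) covector_contract[of "l - 1" g v] f g h
      by (auto simp: B_def)
    have C': "C = (if m = 0 then 0 else ewedge (k + l) (m - 1) (ewedge k l f g) (?i h) e)"
      using Suc.hyps(1)[of k l "m - 1" f g "?i h"] Suc.hyps(2) covector_contract[of "m - 1" h v] f g h
      by (auto simp: C_def)
    have fg_i: "?i (ewedge k l f g) = (\<lambda>e. (if k = 0 then 0 else ewedge (k - 1) l (?i f) g e) +
        (-1) ^ k * (if l = 0 then 0 else ewedge k (l - 1) f (?i g) e))" if "k + l \<noteq> 0"
      using ewedge_contract[OF f g, of "k + l - 1" v] that by (auto simp: fun_eq_iff)
    have gh_i: "?i (ewedge l m g h) = (\<lambda>e. (if l = 0 then 0 else ewedge (l - 1) m (?i g) h e) +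
        (-1) ^ l * (if m = 0 then 0 else ewedge l (m - 1) g (?i h) e))" if "l + m \<noteq> 0"
      using ewedge_contract[OF g h, of "l + m - 1" v] that by (auto simp: fun_eq_iff)
    have "ewedge (k + l) m (ewedge k l f g) h (case_nat v e) = A + (-1) ^ k * B + (-1) ^ (k + l) * C"
      unfolding ewedge_contract[OF fg h kl] A' B' C'
      using fg_i by (cases k; cases l) (auto simp: ewedge_add_left ewedge_diff_left ewedge_mult_left ewedge_minus_left)
    moreover have "ewedge k (l + m) f (ewedge l m g h) (case_nat v e) = A + (-1) ^ k * B + (-1) ^ (k + l) * C"
      unfolding ewedge_contract[OF f gh kl'] A_def B_def C_def
      using gh_i by (cases l; cases m) (auto simp: ewedge_add_right ewedge_diff_right ewedge_mult_right ewedge_minus_right power_add algebra_simps)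
    ultimately show "ewedge (k + l) m (ewedge k l f g) h (case_nat v e) =
        ewedge k (l + m) f (ewedge l m g h) (case_nat v e)" by simp
  qed
qed

text \<open>Again by contraction and induction on the degree: contracting \<open>f\<close> lowers
  the exponent \<open>k * l\<close> by \<open>l\<close>, which is the sign with which the vector
  passes \<open>g\<close> on the other side.\<close>

lemma ewedge_commute:
  fixes f g :: "(nat \<Rightarrow> 'a::real_vector) \<Rightarrow> 'b::real_normed_field"
  assumes "covector k f" "covector l g"
  shows "ewedge k l f g = (\<lambda>e. (-1) ^ (k * l) * ewedge l k g f e)"
  using assms
proof (induction "k + l" arbitrary: k l f g)
  case 0
  then show ?case by (auto simp: ewedge_0_0 fun_eq_iff)
next
  case (Suc n)
  note f = \<open>covector k f\<close> and g = \<open>covector l g\<close>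
  have kl: "k + l = Suc n" and lk: "l + k = Suc n" using Suc.hyps(2) by simp_all
  show ?case
  proof (rule covector_contract_ext)
    fix v and e :: "nat \<Rightarrow> 'a"
    let ?i = "\<lambda>(f :: (nat \<Rightarrow> 'a) \<Rightarrow> 'b) e. f (case_nat v e)"
    have A: "ewedge (k - 1) l (?i f) g e = (-1) ^ ((k - 1) * l) * ewedge l (k - 1) g (?i f) e" if "k \<noteq> 0"
      using Suc.hyps(1)[of "k - 1" l "?i f" g] Suc.hyps(2) covector_contract[of "k - 1" f v] f g that
      by auto
    have B: "ewedge k (l - 1) f (?i g) e = (-1) ^ (k * (l - 1)) * ewedge (l - 1) k (?i g) f e" if "l \<noteq> 0"
      using Suc.hyps(1)[of k "l - 1" f "?i g"] Suc.hyps(2) covector_contract[of "l - 1" g v] f g that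
      by auto
    show "ewedge k l f g (case_nat v e) = (-1) ^ (k * l) * ewedge l k g f (case_nat v e)"
      unfolding ewedge_contract[OF f g kl] ewedge_contract[OF g f lk] using A B
      by (cases k; cases l) (auto simp: power_add algebra_simps uminus_power_if)
  qed
qed

lemma ewedge_Re: "Re (ewedge k l f g e) =
    ewedge k l (\<lambda>e. Re (f e)) (\<lambda>e. Re (g e)) e - ewedge k l (\<lambda>e. Im (f e)) (\<lambda>e. Im (g e)) e"
proof -
  have "(fact k * fact l :: complex) = of_real (fact k * fact l)" by simp
  then show ?thesis
    by (simp only: ewedge_def Re_divide_of_real)
       (simp add: sum_subtractf algebra_simps diff_divide_distrib)
qed

lemma ewedge_Im: "Im (ewedge k l f g e) =
    ewedge k l (\<lambda>e. Re (f e)) (\<lambda>e. Im (g e)) e + ewedge k l (\<lambda>e. Im (f e)) (\<lambda>e. Re (g e)) e"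
proof -
  have "(fact k * fact l :: complex) = of_real (fact k * fact l)" by simp
  then show ?thesis
    by (simp only: ewedge_def Im_divide_of_real)
       (simp add: sum.distrib algebra_simps add_divide_distrib)
qed

lemma ewedge_cnj: "cnj (ewedge k l f g e) = ewedge k l (\<lambda>e. cnj (f e)) (\<lambda>e. cnj (g e)) e"
  by (simp add: ewedge_def)

lemma covector_cnj: "covector k f \<Longrightarrow> covector k (\<lambda>e. cnj (f e))"
  by (rule covector_linear_comp) (auto intro: linearI)

lemma covector_Re: "covector k f \<Longrightarrow> covector k (\<lambda>e. Re (f e))"
  by (rule covector_linear_comp) (auto intro: linearI)

lemma covector_Im: "covector k f \<Longrightarrow> covector k (\<lambda>e. Im (f e))"
  by (rule covector_linear_comp) (auto intro: linearI)

lemma covector_of_real: "covector k f \<Longrightarrow> covector k (\<lambda>e. complex_of_real (f e))"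
  by (rule covector_linear_comp) (auto intro!: linearI simp: scaleR_conv_of_real)

lemma covector_pull:
  assumes f: "covector k f" shows "covector k (\<lambda>e. f (\<lambda>i. fst (e i)))"
proof (rule covectorI)
  show "f (\<lambda>i. fst (e i)) = f (\<lambda>i. fst (e' i))" if "\<And>i. i < k \<Longrightarrow> e i = e' i" for e e' :: "nat \<Rightarrow> 'a \<times> 'c"
    using that by (intro covector_cong[OF f]) simp
  have eq: "(\<lambda>j. fst ((e(i := v)) j)) = (\<lambda>j. fst (e j))(i := fst v)" for e :: "nat \<Rightarrow> 'a \<times> 'c" and i v
    by auto
  show "linear (\<lambda>v. f (\<lambda>j. fst ((e(i := v)) j)))" if "i < k" for i and e :: "nat \<Rightarrow> 'a \<times> 'c"
    unfolding eq using linear_compose[OF linear_fst covector_linear[OF f that]] by (simp add: o_def)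
  show "f (\<lambda>i. fst (e i)) = 0" if "i < k" "j < k" "i \<noteq> j" "e i = e j" for i j and e :: "nat \<Rightarrow> 'a \<times> 'c"
    using that by (intro covector_alt[OF f, of i j]) auto
qed

section \<open>Smooth differential forms\<close>

lemma smooth_formD: "smooth_form X k \<phi> \<Longrightarrow> x \<in> X \<Longrightarrow> covector k (\<phi> x)"
  by (simp add: smooth_form_def)

lemma smooth_form_smooth: "smooth_form X k \<phi> \<Longrightarrow> smooth_on X (\<lambda>x. \<phi> x e)"
  by (simp add: smooth_form_def)

lemma smooth_form_const: "covector k f \<Longrightarrow> smooth_form X k (\<lambda>x. f)"
  by (simp add: smooth_form_def)

lemma smooth_form_zero [simp]: "smooth_form X k (\<lambda>x e. 0)"
  by (simp add: smooth_form_def)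

lemma smooth_form_contract: "smooth_form X (Suc k) \<phi> \<Longrightarrow> smooth_form X k (\<lambda>x e. \<phi> x (case_nat v e))"
  by (simp add: smooth_form_def covector_contract)

context
  fixes X :: "'v::real_normed_vector set"
  assumes X: "open X"
begin

lemma smooth_form_add: "smooth_form X k \<phi> \<Longrightarrow> smooth_form X k \<psi> \<Longrightarrow> smooth_form X k (\<lambda>x e. \<phi> x e + \<psi> x e)"
  using X by (simp add: smooth_form_def covector_add smooth_on_add)

lemma smooth_form_diff: "smooth_form X k \<phi> \<Longrightarrow> smooth_form X k \<psi> \<Longrightarrow> smooth_form X k (\<lambda>x e. \<phi> x e - \<psi> x e)"
  using X by (simp add: smooth_form_def covector_diff smooth_on_diff)

lemma smooth_form_minus: "smooth_form X k \<phi> \<Longrightarrow> smooth_form X k (\<lambda>x e. - \<phi> x e)"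
  using X by (simp add: smooth_form_def covector_minus smooth_on_minus)

lemma smooth_form_sum:
  "(\<And>i. i \<in> I \<Longrightarrow> smooth_form X k (\<phi> i)) \<Longrightarrow> smooth_form X k (\<lambda>x e. \<Sum>i\<in>I. \<phi> i x e)"
  using X by (simp add: smooth_form_def covector_sum smooth_on_sum)

lemma smooth_form_scale:
  fixes \<phi> :: "('v, 'a::real_normed_field) form"
  shows "smooth_on X c \<Longrightarrow> smooth_form X k \<phi> \<Longrightarrow> smooth_form X k (\<lambda>x e. c x * \<phi> x e)"
  using X by (simp add: smooth_form_def covector_mult_left smooth_on_mult)

lemma smooth_form_0: "smooth_on X c \<Longrightarrow> smooth_form X 0 (\<lambda>x e. c x)"
  by (simp add: smooth_form_def covector_0_const)

lemma smooth_form_wedge: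
  fixes \<phi> \<psi> :: "('v, 'a::real_normed_field) form"
  assumes "smooth_form X k \<phi>" "smooth_form X l \<psi>"
  shows "smooth_form X (k + l) (wedge k l \<phi> \<psi>)"
proof -
  have "smooth_on X (\<lambda>x. wedge k l \<phi> \<psi> x e)" for e
    unfolding wedge_def using assms X
    by (intro smooth_on_divide smooth_on_sum smooth_on_mult smooth_form_smooth smooth_on_const) auto
  then show ?thesis using assms by (simp add: smooth_form_def wedge_ewedge covector_ewedge)
qed

lemma smooth_form_cnj: "smooth_form X k \<phi> \<Longrightarrow> smooth_form X k (cnj_form \<phi>)"
  using X smooth_on_linear[OF X bounded_linear_cnj] by (simp add: smooth_form_def covector_cnj)

lemma smooth_form_Re: "smooth_form X k \<phi> \<Longrightarrow> smooth_form X k (Re_form \<phi>)"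
  using X smooth_on_linear[OF X bounded_linear_Re] by (simp add: smooth_form_def covector_Re)

lemma smooth_form_Im: "smooth_form X k \<phi> \<Longrightarrow> smooth_form X k (Im_form \<phi>)"
  using X smooth_on_linear[OF X bounded_linear_Im] by (simp add: smooth_form_def covector_Im)

lemma smooth_form_of_real: "smooth_form X k \<phi> \<Longrightarrow> smooth_form X k (cplx_form \<phi>)"
  using X smooth_on_linear[OF X bounded_linear_of_real[where 'a=complex]] by (simp add: smooth_form_def covector_of_real)

lemma smooth_form_pull:
  "smooth_form X k \<phi> \<Longrightarrow> smooth_form (X \<times> (UNIV :: 'p::real_normed_vector set)) k (pull_fst \<phi>)"
  using smooth_on_fst[OF X] by (auto simp: smooth_form_def pull_fst_def[abs_def] covector_pull)

lemma smooth_form_cong: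
  "smooth_form X k \<phi> \<Longrightarrow> (\<And>x. x \<in> X \<Longrightarrow> \<psi> x = \<phi> x) \<Longrightarrow> smooth_form X k \<psi>"
  unfolding smooth_form_def using smooth_on_cong[OF X] by (metis (no_types, lifting))

end

section \<open>The exterior derivative\<close>

definition dir_deriv :: "'v \<Rightarrow> ('v::real_normed_vector, 'a::real_normed_vector) form \<Rightarrow> ('v, 'a) form" where
  "dir_deriv v \<phi> x e = frechet_derivative (\<lambda>y. \<phi> y e) (at x) v"

lemma frechet_derivative_cong:
  assumes "open X" "x \<in> X" "smooth_on X f" "\<And>y. y \<in> X \<Longrightarrow> g y = f y"
  shows "frechet_derivative g (at x) v = frechet_derivative f (at x) v"
  using frechet_derivative_transform_within_open[OF smooth_on_differentiable[OF assms(3,2)] assms(1,2)] assms(4)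
  by metis

lemma frechet_derivative_add:
  "f differentiable (at x) \<Longrightarrow> g differentiable (at x) \<Longrightarrow>
   frechet_derivative (\<lambda>y. f y + g y) (at x) v = frechet_derivative f (at x) v + frechet_derivative g (at x) v"
  by (rule frechet_derivative_eq[OF has_derivative_add[OF differentiable_has_frechet differentiable_has_frechet]])

text \<open>Every law of a covector is an identity between functions on the open set
  \<open>X\<close>, and such identities may be differentiated.\<close>

lemma smooth_form_dir_deriv:
  fixes \<phi> :: "('v::real_normed_vector, 'a::real_normed_vector) form"
  assumes X: "open X" and \<phi>: "smooth_form X k \<phi>"
  shows "smooth_form X k (dir_deriv v \<phi>)"
  unfolding smooth_form_def
proof (intro conjI ballI allI)
  show "smooth_on X (\<lambda>x. dir_deriv v \<phi> x e)" for e
    unfolding dir_deriv_def by (rule smooth_on_frechet[OF smooth_form_smooth[OF \<phi>]])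
  fix x assume x: "x \<in> X"
  have d: "(\<lambda>y. \<phi> y e) differentiable (at x)" for e
    by (rule smooth_on_differentiable[OF smooth_form_smooth[OF \<phi>] x])
  show "covector k (dir_deriv v \<phi> x)"
  proof (rule covectorI)
    show "dir_deriv v \<phi> x e = dir_deriv v \<phi> x e'" if "\<And>i. i < k \<Longrightarrow> e i = e' i" for e e'
      unfolding dir_deriv_def
      by (rule frechet_derivative_cong[OF X x smooth_form_smooth[OF \<phi>]])
         (rule covector_cong[OF smooth_formD[OF \<phi>] that])
    show "linear (\<lambda>w. dir_deriv v \<phi> x (e(i := w)))" if i: "i < k" for i e
    proof (rule linearI)
      fix a b
      have "dir_deriv v \<phi> x (e(i := a + b)) =
        frechet_derivative (\<lambda>y. \<phi> y (e(i := a)) + \<phi> y (e(i := b))) (at x) v"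
        unfolding dir_deriv_def
        by (rule frechet_derivative_cong[OF X x smooth_on_add[OF X smooth_form_smooth[OF \<phi>] smooth_form_smooth[OF \<phi>]]])
           (rule linear_add[OF covector_linear[OF smooth_formD[OF \<phi>] i]])
      then show "dir_deriv v \<phi> x (e(i := a + b)) = dir_deriv v \<phi> x (e(i := a)) + dir_deriv v \<phi> x (e(i := b))"
        by (simp add: frechet_derivative_add[OF d d] dir_deriv_def)
    next
      fix r b
      have "dir_deriv v \<phi> x (e(i := r *\<^sub>R b)) = frechet_derivative (\<lambda>y. r *\<^sub>R \<phi> y (e(i := b))) (at x) v"
        unfolding dir_deriv_def
        by (rule frechet_derivative_cong[OF X x smooth_on_scaleR[OF X smooth_form_smooth[OF \<phi>]]])
           (rule linear_cmul[OF covector_linear[OF smooth_formD[OF \<phi>] i]])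
      then show "dir_deriv v \<phi> x (e(i := r *\<^sub>R b)) = r *\<^sub>R dir_deriv v \<phi> x (e(i := b))"
        by (simp add: frechet_derivative_linear[OF bounded_linear_scaleR_right d] dir_deriv_def)
    qed
    show "dir_deriv v \<phi> x e = 0" if "i < k" "j < k" "i \<noteq> j" "e i = e j" for i j e
    proof -
      have "dir_deriv v \<phi> x e = frechet_derivative (\<lambda>y. 0) (at x) v"
        unfolding dir_deriv_def
        by (rule frechet_derivative_cong[OF X x smooth_on_const])
           (rule covector_alt[OF smooth_formD[OF \<phi>] that])
      then show ?thesis by simp
    qed
  qed
qed

text \<open>Cartan's formula for a constant vector field: \<open>dir_deriv v\<close> is the Lie
  derivative along \<open>v\<close>. It opens the exterior derivative to induction by
  contraction.\<close>

lemma ext_d_contract: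
  "ext_d (Suc k) \<phi> x (case_nat v e) = dir_deriv v \<phi> x e - ext_d k (\<lambda>y e. \<phi> y (case_nat v e)) x e"
proof -
  have 1: "(\<lambda>j. if j < Suc i then case_nat v e j else case_nat v e (Suc j)) =
      case_nat v (\<lambda>j. if j < i then e j else e (Suc j))" for i
    by (auto simp: fun_eq_iff split: nat.splits)
  show ?thesis
    unfolding ext_d_def sum.atMost_Suc_shift 1
    by (simp add: dir_deriv_def sum_negf)
qed

lemma ext_d_0: "ext_d 0 \<phi> x e = dir_deriv (e 0) \<phi> x (\<lambda>j. e (Suc j))"
  by (simp add: ext_d_def dir_deriv_def)

definition dx :: "'v::euclidean_space \<Rightarrow> (nat \<Rightarrow> 'v) \<Rightarrow> 'a::real_normed_field" where
  "dx b e = of_real (e 0 \<bullet> b)"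

lemma covector_dx: "covector 1 (dx b)"
proof -
  have "covector 1 (\<lambda>e. of_real (e 0 \<bullet> b) :: 'b)"
    by (rule covector_1) (auto intro!: linearI simp: inner_left_distrib scaleR_conv_of_real)
  then show ?thesis by (simp add: dx_def[abs_def])
qed

lemma dir_deriv_basis:
  fixes \<phi> :: "('v::euclidean_space, 'a::real_normed_field) form"
  assumes "smooth_form X k \<phi>" "x \<in> X"
  shows "dir_deriv v \<phi> x e = (\<Sum>b\<in>Basis. of_real (v \<bullet> b) * dir_deriv b \<phi> x e)"
proof -
  have l: "linear (frechet_derivative (\<lambda>y. \<phi> y e) (at x))"
    using smooth_on_has_derivative[OF smooth_form_smooth[OF assms(1)] assms(2)] has_derivative_linear by blast
  have "dir_deriv v \<phi> x e = frechet_derivative (\<lambda>y. \<phi> y e) (at x) (\<Sum>b\<in>Basis. (v \<bullet> b) *\<^sub>R b)"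
    by (simp add: dir_deriv_def euclidean_representation)
  also have "\<dots> = (\<Sum>b\<in>Basis. (v \<bullet> b) *\<^sub>R dir_deriv b \<phi> x e)"
    by (simp add: linear_sum[OF l] linear_cmul[OF l] dir_deriv_def)
  finally show ?thesis by (simp add: scaleR_conv_of_real)
qed

text \<open>The coordinate expression of \<open>d\<close>, by Cartan's formula and induction on the
  degree. In this form the Leibniz rule and \<open>d d = 0\<close> become identities between wedge
  products.\<close>

lemma ext_d_ewedge:
  fixes \<phi> :: "('v::euclidean_space, 'a::real_normed_field) form"
  assumes X: "open X" "x \<in> X" and \<phi>: "smooth_form X k \<phi>"
  shows "ext_d k \<phi> x = (\<lambda>e. \<Sum>b\<in>Basis. ewedge 1 k (dx b) (dir_deriv b \<phi> x) e)"
  using \<phi>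
proof (induction k arbitrary: \<phi>)
  case 0
  have c: "covector 0 (dir_deriv b \<phi> x)" for b
    using smooth_formD[OF smooth_form_dir_deriv[OF X(1) 0] X(2)] .
  show ?case
  proof
    fix e
    have "dir_deriv b \<phi> x (\<lambda>j. e (Suc j)) = dir_deriv b \<phi> x e" for b by (rule covector_0[OF c])
    then show "ext_d 0 \<phi> x e = (\<Sum>b\<in>Basis. ewedge 1 0 (dx b) (dir_deriv b \<phi> x) e)"
      unfolding ext_d_0 dir_deriv_basis[OF 0 X(2), of "e 0"]
      by (simp add: ewedge_0_right[OF covector_dx c] dx_def)
  qed
next
  case (Suc k)
  have c: "covector (Suc k) (dir_deriv b \<phi> x)" for b
    using smooth_formD[OF smooth_form_dir_deriv[OF X(1) Suc.prems] X(2)] .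
  show ?case
  proof (rule covector_contract_ext)
    fix v and e :: "nat \<Rightarrow> 'v"
    have "ext_d (Suc k) \<phi> x (case_nat v e) = dir_deriv v \<phi> x e -
      (\<Sum>b\<in>Basis. ewedge 1 k (dx b) (dir_deriv b (\<lambda>y e. \<phi> y (case_nat v e)) x) e)"
      unfolding ext_d_contract Suc.IH[OF smooth_form_contract[OF Suc.prems]] ..
    also have "\<dots> = (\<Sum>b\<in>Basis. of_real (v \<bullet> b) * dir_deriv b \<phi> x e -
      ewedge 1 k (dx b) (\<lambda>e. dir_deriv b \<phi> x (case_nat v e)) e)"
      unfolding dir_deriv_basis[OF Suc.prems X(2), of v] sum_subtractf
      by (simp add: dir_deriv_def[abs_def])
    also have "\<dots> = (\<Sum>b\<in>Basis. ewedge 1 (Suc k) (dx b) (dir_deriv b \<phi> x) (case_nat v e))"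
    proof (rule sum.cong[OF refl])
      fix b
      have 0: "covector 0 (\<lambda>e. dx b (case_nat v e) :: 'a)"
        by (rule covector_contract, fold One_nat_def) (rule covector_dx)
      have "ewedge 1 (Suc k) (dx b) (dir_deriv b \<phi> x) (case_nat v e) =
        ewedge 0 (Suc k) (\<lambda>e. dx b (case_nat v e)) (dir_deriv b \<phi> x) e -
        ewedge 1 k (dx b) (\<lambda>e. dir_deriv b \<phi> x (case_nat v e)) e"
        by (subst ewedge_contract[OF covector_dx c, of "Suc k"]) auto
      also have "ewedge 0 (Suc k) (\<lambda>e. dx b (case_nat v e)) (dir_deriv b \<phi> x) e =
        of_real (v \<bullet> b) * dir_deriv b \<phi> x e"
        by (subst ewedge_0_left[OF 0 c]) (simp add: dx_def)
      finally show "of_real (v \<bullet> b) * dir_deriv b \<phi> x e -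
          ewedge 1 k (dx b) (\<lambda>e. dir_deriv b \<phi> x (case_nat v e)) e =
          ewedge 1 (Suc k) (dx b) (dir_deriv b \<phi> x) (case_nat v e)" by simp
    qed
    finally show "ext_d (Suc k) \<phi> x (case_nat v e) =
      (\<Sum>b\<in>Basis. ewedge 1 (Suc k) (dx b) (dir_deriv b \<phi> x) (case_nat v e))" .
  qed
qed

lemma smooth_form_ext_d:
  fixes \<phi> :: "('v::euclidean_space, 'a::real_normed_field) form"
  assumes X: "open X" and \<phi>: "smooth_form X k \<phi>"
  shows "smooth_form X (Suc k) (ext_d k \<phi>)"
proof -
  have "smooth_form X (Suc k) (\<lambda>x e. \<Sum>b\<in>Basis. wedge 1 k (\<lambda>_. dx b) (dir_deriv b \<phi>) x e)"
    using smooth_form_wedge[OF X smooth_form_const[OF covector_dx] smooth_form_dir_deriv[OF X \<phi>]]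
    by (intro smooth_form_sum[OF X]) simp
  then show ?thesis
    by (rule smooth_form_cong[OF X]) (simp add: ext_d_ewedge[OF X _ \<phi>] wedge_ewedge)
qed

lemma dir_deriv_wedge:
  fixes \<phi> \<psi> :: "('v::real_normed_vector, 'a::real_normed_field) form"
  assumes X: "x \<in> X" and \<phi>: "smooth_form X k \<phi>" and \<psi>: "smooth_form X l \<psi>"
  shows "dir_deriv v (wedge k l \<phi> \<psi>) x e =
    wedge k l (dir_deriv v \<phi>) \<psi> x e + wedge k l \<phi> (dir_deriv v \<psi>) x e"
proof -
  note d\<phi> = smooth_on_has_derivative[OF smooth_form_smooth[OF \<phi>] X]
  note d\<psi> = smooth_on_has_derivative[OF smooth_form_smooth[OF \<psi>] X]
  let ?s = "\<lambda>\<sigma>. of_int (sign \<sigma>) :: 'a"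
  let ?a = "\<lambda>\<sigma> i. e (\<sigma> i)" and ?b = "\<lambda>\<sigma> i. e (\<sigma> (k + i))"
  have t: "((\<lambda>y. ?s \<sigma> * \<phi> y (?a \<sigma>) * \<psi> y (?b \<sigma>)) has_derivative
     (\<lambda>v. ?s \<sigma> * dir_deriv v \<phi> x (?a \<sigma>) * \<psi> x (?b \<sigma>) + ?s \<sigma> * \<phi> x (?a \<sigma>) * dir_deriv v \<psi> x (?b \<sigma>))) (at x)" for \<sigma>
    unfolding dir_deriv_def
    by (rule has_derivative_eq_rhs[OF has_derivative_mult[OF has_derivative_mult_right[OF d\<phi>] d\<psi>]])
       (auto simp: algebra_simps)
  have "((\<lambda>y. wedge k l \<phi> \<psi> y e) has_derivative
     (\<lambda>v. (\<Sum>\<sigma> | \<sigma> permutes {..<k + l}. ?s \<sigma> * dir_deriv v \<phi> x (?a \<sigma>) * \<psi> x (?b \<sigma>) +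
        ?s \<sigma> * \<phi> x (?a \<sigma>) * dir_deriv v \<psi> x (?b \<sigma>)) / (fact k * fact l))) (at x)"
    unfolding wedge_def divide_inverse
    by (rule has_derivative_mult_left[OF has_derivative_sum[OF t]])
  from frechet_derivative_eq[OF this] show ?thesis
    unfolding dir_deriv_def[of v "wedge k l \<phi> \<psi>"]
    by (simp add: wedge_def sum.distrib add_divide_distrib)
qed

text \<open>The product rule for coordinate derivatives gives two sums; in the second, moving
  \<open>dx b\<close> past the \<open>k\<close>-form \<open>\<phi>\<close> produces the
  sign.\<close>

lemma ext_d_wedge:
  fixes \<phi> \<psi> :: "('v::euclidean_space, 'a::real_normed_field) form"
  assumes X: "open X" "x \<in> X" and \<phi>: "smooth_form X k \<phi>" and \<psi>: "smooth_form X l \<psi>"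
  shows "ext_d (k + l) (wedge k l \<phi> \<psi>) x e =
    wedge (Suc k) l (ext_d k \<phi>) \<psi> x e + (-1) ^ k * wedge k (Suc l) \<phi> (ext_d l \<psi>) x e"
proof -
  note c\<phi> = smooth_formD[OF \<phi> X(2)] and c\<psi> = smooth_formD[OF \<psi> X(2)]
  note D\<phi> = smooth_formD[OF smooth_form_dir_deriv[OF X(1) \<phi>] X(2)]
  note D\<psi> = smooth_formD[OF smooth_form_dir_deriv[OF X(1) \<psi>] X(2)]
  have D: "dir_deriv b (wedge k l \<phi> \<psi>) x =
      (\<lambda>e. ewedge k l (dir_deriv b \<phi> x) (\<psi> x) e + ewedge k l (\<phi> x) (dir_deriv b \<psi> x) e)" for b
    using dir_deriv_wedge[OF X(2) \<phi> \<psi>] by (simp add: wedge_ewedge fun_eq_iff)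
  have 1: "ewedge 1 (k + l) (dx b) (ewedge k l (dir_deriv b \<phi> x) (\<psi> x)) e =
      ewedge (Suc k) l (ewedge 1 k (dx b) (dir_deriv b \<phi> x)) (\<psi> x) e" for b
    using ewedge_assoc[OF covector_dx D\<phi> c\<psi>] by simp
  have 2: "ewedge 1 (k + l) (dx b) (ewedge k l (\<phi> x) (dir_deriv b \<psi> x)) e =
      (-1) ^ k * ewedge k (Suc l) (\<phi> x) (ewedge 1 l (dx b) (dir_deriv b \<psi> x)) e" for b
  proof -
    have "ewedge 1 (k + l) (dx b) (ewedge k l (\<phi> x) (dir_deriv b \<psi> x)) =
      ewedge (Suc k) l (ewedge 1 k (dx b) (\<phi> x)) (dir_deriv b \<psi> x)"
      using ewedge_assoc[OF covector_dx c\<phi> D\<psi>, of b b] by simp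
    also have "ewedge 1 k (dx b) (\<phi> x) = (\<lambda>e. (-1) ^ k * ewedge k 1 (\<phi> x) (dx b) e)"
      using ewedge_commute[OF covector_dx c\<phi>] by simp
    finally show ?thesis
      using ewedge_assoc[OF c\<phi> covector_dx D\<psi>, of b b] by (simp add: ewedge_mult_left)
  qed
  have "ext_d (k + l) (wedge k l \<phi> \<psi>) x e =
    (\<Sum>b\<in>Basis. ewedge (Suc k) l (ewedge 1 k (dx b) (dir_deriv b \<phi> x)) (\<psi> x) e +
     (-1) ^ k * ewedge k (Suc l) (\<phi> x) (ewedge 1 l (dx b) (dir_deriv b \<psi> x)) e)"
    unfolding ext_d_ewedge[OF X smooth_form_wedge[OF X(1) \<phi> \<psi>]] D
    by (simp add: ewedge_add_right 1 2)
  then show ?thesis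
    unfolding wedge_ewedge ext_d_ewedge[OF X \<phi>] ext_d_ewedge[OF X \<psi>]
    by (simp add: ewedge_sum_left ewedge_sum_right sum.distrib sum_distrib_left)
qed

lemma ext_d_add:
  fixes \<phi> \<psi> :: "('v::real_normed_vector, 'a::real_normed_vector) form"
  assumes "x \<in> X" "smooth_form X k \<phi>" "smooth_form X k \<psi>"
  shows "ext_d k (\<lambda>x e. \<phi> x e + \<psi> x e) x e = ext_d k \<phi> x e + ext_d k \<psi> x e"
  using smooth_on_differentiable[OF smooth_form_smooth[OF assms(2)] assms(1)]
    smooth_on_differentiable[OF smooth_form_smooth[OF assms(3)] assms(1)]
  by (simp add: ext_d_def frechet_derivative_add sum.distrib scaleR_add_right)

lemma ext_d_linear:
  fixes \<phi> :: "('v::real_normed_vector, 'a::real_normed_vector) form"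
  assumes "bounded_linear L" "x \<in> X" "smooth_form X k \<phi>"
  shows "ext_d k (\<lambda>x e. L (\<phi> x e)) x e = L (ext_d k \<phi> x e)"
proof -
  have "linear L" using assms(1) bounded_linear.linear by blast
  then show ?thesis
    using smooth_on_differentiable[OF smooth_form_smooth[OF assms(3)] assms(2)]
    by (simp add: ext_d_def frechet_derivative_linear[OF assms(1)] linear_sum linear_cmul)
qed

lemma ext_d_sum:
  fixes \<phi> :: "'i \<Rightarrow> ('v::real_normed_vector, 'a::real_normed_vector) form"
  assumes X: "open X" "x \<in> X" and "\<And>i. i \<in> I \<Longrightarrow> smooth_form X k (\<phi> i)"
  shows "ext_d k (\<lambda>x e. \<Sum>i\<in>I. \<phi> i x e) x e = (\<Sum>i\<in>I. ext_d k (\<phi> i) x e)"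
  using assms(3)
proof (induction I rule: infinite_finite_induct)
  case (insert i I)
  then show ?case
    using ext_d_add[OF X(2), of k "\<phi> i" "\<lambda>x e. \<Sum>i\<in>I. \<phi> i x e"] smooth_form_sum[OF X(1), of I k \<phi>] by simp
qed (simp_all add: ext_d_def)

lemma ext_d_cong:
  fixes \<phi> \<psi> :: "('v::real_normed_vector, 'a::real_normed_vector) form"
  assumes X: "open X" "x \<in> X" and \<phi>: "smooth_form X k \<phi>" and eq: "\<And>y. y \<in> X \<Longrightarrow> \<psi> y = \<phi> y"
  shows "ext_d k \<psi> x = ext_d k \<phi> x"
proof
  fix e
  have "frechet_derivative (\<lambda>y. \<psi> y a) (at x) v = frechet_derivative (\<lambda>y. \<phi> y a) (at x) v" for a v
    by (rule frechet_derivative_cong[OF X smooth_form_smooth[OF \<phi>]]) (simp add: eq)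
  then show "ext_d k \<psi> x e = ext_d k \<phi> x e" by (simp add: ext_d_def)
qed

lemma ext_d_pull:
  fixes \<phi> :: "('v::real_normed_vector, 'a::real_normed_vector) form"
  assumes \<phi>: "smooth_form W k \<phi>" and z: "fst z \<in> W"
  shows "ext_d k (pull_fst \<phi>) z = pull_fst (ext_d k \<phi>) z"
proof
  fix e
  have 1: "frechet_derivative (\<lambda>y. \<phi> (fst y) a) (at z) v = frechet_derivative (\<lambda>y. \<phi> y a) (at (fst z)) (fst v)" for a v
    by (rule frechet_derivative_eq[OF has_derivative_compose[OF has_derivative_fst[OF has_derivative_ident]
          smooth_on_has_derivative[OF smooth_form_smooth[OF \<phi>] z]]])
  show "ext_d k (pull_fst \<phi>) z e = pull_fst (ext_d k \<phi>) z e"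
    unfolding ext_d_def pull_fst_def 1 by (simp add: if_distrib)
qed

lemma wedge_pull: "wedge k l (pull_fst \<phi>) (pull_fst \<psi>) = pull_fst (wedge k l \<phi> \<psi>)"
  by (simp add: wedge_def pull_fst_def fun_eq_iff)

text \<open>The second derivatives \<open>DD b c\<close> are symmetric in \<open>b\<close> and
  \<open>c\<close>, while \<open>dx b\<close> and \<open>dx c\<close> anticommute; so the double sum
  \<open>S\<close> equals its negative.\<close>

lemma ext_d_ext_d:
  fixes \<phi> :: "('v::euclidean_space, 'a::{real_normed_field, euclidean_space}) form"
  assumes X: "open X" "x \<in> X" and \<phi>: "smooth_form X k \<phi>"
  shows "ext_d (Suc k) (ext_d k \<phi>) x e = 0"
proof -
  note sD = smooth_form_dir_deriv[OF X(1)]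
  define DD where "DD b c = dir_deriv b (dir_deriv c \<phi>) x" for b c
  have cDD: "covector k (DD b c)" for b c
    unfolding DD_def by (rule smooth_formD[OF sD[OF sD[OF \<phi>]] X(2)])
  have sym: "DD b c = DD c b" for b c
    unfolding DD_def dir_deriv_def fun_eq_iff
    using frechet_derivative_commute[OF X smooth_form_smooth[OF \<phi>]] by blast
  have D: "dir_deriv b (ext_d k \<phi>) x e = (\<Sum>c\<in>Basis. ewedge 1 k (dx c) (DD b c) e)" for b e
  proof -
    let ?w = "\<lambda>c. wedge 1 k (\<lambda>_. dx c) (dir_deriv c \<phi>)"
    have sw: "smooth_form X (1 + k) (?w c)" for c
      by (rule smooth_form_wedge[OF X(1) smooth_form_const[OF covector_dx] sD[OF \<phi>]])
    have 0: "dir_deriv b (\<lambda>_. dx c) x = (\<lambda>e. 0 :: 'a)" for c :: 'v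
      by (simp add: dir_deriv_def fun_eq_iff)
    have "dir_deriv b (ext_d k \<phi>) x e = dir_deriv b (\<lambda>x e. \<Sum>c\<in>Basis. ?w c x e) x e"
      unfolding dir_deriv_def[of b]
      by (rule frechet_derivative_cong[OF X smooth_on_sum[OF X(1) smooth_form_smooth[OF sw]]])
         (simp add: ext_d_ewedge[OF X(1) _ \<phi>] wedge_ewedge)
    also have "\<dots> = (\<Sum>c\<in>Basis. dir_deriv b (?w c) x e)"
    proof -
      have "((\<lambda>y. \<Sum>c\<in>Basis. ?w c y e) has_derivative (\<lambda>v. \<Sum>c\<in>Basis. dir_deriv v (?w c) x e)) (at x)"
        unfolding dir_deriv_def[of _ "?w c" for c]
        by (rule has_derivative_sum) (rule smooth_on_has_derivative[OF smooth_form_smooth[OF sw] X(2)])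
      from frechet_derivative_eq[OF this] show ?thesis unfolding dir_deriv_def[of b "\<lambda>x e. \<Sum>c\<in>Basis. ?w c x e"] .
    qed
    also have "\<dots> = (\<Sum>c\<in>Basis. ewedge 1 k (dx c) (DD b c) e)"
      by (subst dir_deriv_wedge[OF X(2) smooth_form_const[OF covector_dx] sD[OF \<phi>]])
         (simp add: wedge_ewedge 0 DD_def)
    finally show ?thesis .
  qed
  define S where "S = (\<Sum>b\<in>Basis. \<Sum>c\<in>Basis. ewedge 1 (Suc k) (dx b) (ewedge 1 k (dx c) (DD b c)) e)"
  have anti: "ewedge 1 (Suc k) (dx b) (ewedge 1 k (dx c) (DD b c)) e =
      - ewedge 1 (Suc k) (dx c) (ewedge 1 k (dx b) (DD c b)) e" for b c
  proof -
    have a: "ewedge 1 (Suc k) (dx b) (ewedge 1 k (dx c) g) = ewedge 2 k (ewedge 1 1 (dx b) (dx c)) g"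
      if "covector k g" for g and b c :: 'v
      using ewedge_assoc[OF covector_dx covector_dx that, of b c] by (simp add: numeral_2_eq_2)
    have m: "ewedge 1 1 (dx b) (dx c) = (\<lambda>e. - ewedge 1 1 (dx c) (dx b) e :: 'a)"
      using ewedge_commute[OF covector_dx covector_dx] by simp
    show ?thesis
      unfolding a[OF cDD] sym[of c b] m by (simp add: ewedge_minus_left)
  qed
  have "S = - S"
    unfolding S_def
    by (subst anti, subst sum.swap) (simp add: sum_negf)
  then have "2 * S = 0" by (metis add.right_inverse mult_2)
  then have "S = 0" by simp
  moreover have "ext_d (Suc k) (ext_d k \<phi>) x e = S"
    unfolding ext_d_ewedge[OF X smooth_form_ext_d[OF X(1) \<phi>]] S_def D[abs_def]
    by (simp add: ewedge_sum_right)
  ultimately show ?thesis by simp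
qed

section \<open>Wedge products of coframings\<close>

text \<open>Linearity is used one slot at a time: \<open>m\<close> counts the slots that still range
  over the whole span, the others already lie in \<open>B\<close>.\<close>

lemma covector_on_span_zero:
  assumes f: "covector k f" and B: "\<And>e. (\<And>i. i < k \<Longrightarrow> e i \<in> B) \<Longrightarrow> f e = 0"
    and e: "\<And>i. i < k \<Longrightarrow> e i \<in> span B"
  shows "f e = 0"
proof -
  have "f e = 0" if "m \<le> k" "\<And>i. i < m \<Longrightarrow> e i \<in> span B" "\<And>i. m \<le> i \<Longrightarrow> i < k \<Longrightarrow> e i \<in> B" for m e
    using that
  proof (induction m arbitrary: e)
    case 0 then show ?case using B by simp
  next
    case (Suc m)
    have l: "linear (\<lambda>v. f (e(m := v)))" using covector_linear[OF f] Suc.prems(1) by simp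
    have "f (e(m := v)) = 0" if "v \<in> B" for v
    proof (rule Suc.IH)
      show "m \<le> k" using Suc.prems(1) by simp
      show "(e(m := v)) i \<in> span B" if "i < m" for i using Suc.prems(2)[of i] that by auto
      show "(e(m := v)) i \<in> B" if "m \<le> i" "i < k" for i using Suc.prems(3)[of i] that \<open>v \<in> B\<close> by auto
    qed
    then have "f (e(m := v)) = 0" if "v \<in> span B" for v
      by (rule linear_eq_0_on_span[OF l _ that])
    from this[of "e m"] show ?case using Suc.prems(2)[of m] by simp
  qed
  from this[of k e] e show ?thesis by simp
qed

text \<open>On a \<open>k\<close>-plane a \<open>k\<close>-covector is a multiple of the
  determinant: a tuple of frame vectors either repeats an entry or permutes the frame. Hence
  conditions on a plane can be tested on a single frame.\<close>

lemma covector_frame_zero: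
  assumes f: "covector k f" and b: "f b = 0" and e: "\<And>i. i < k \<Longrightarrow> e i \<in> span (b ` {..<k})"
  shows "f e = 0"
proof (rule covector_on_span_zero[OF f _ e])
  fix e assume e: "\<And>i. i < k \<Longrightarrow> e i \<in> b ` {..<k}"
  then have "\<forall>i. \<exists>j. i < k \<longrightarrow> j < k \<and> e i = b j" by force
  then obtain g where g: "\<And>i. i < k \<Longrightarrow> g i < k \<and> e i = b (g i)" by metis
  show "f e = 0"
  proof (cases "inj_on g {..<k}")
    case True
    define \<sigma> where "\<sigma> i = (if i < k then g i else i)" for i
    have "inj_on \<sigma> {..<k}" using True by (auto simp: inj_on_def \<sigma>_def)
    moreover have "\<sigma> ` {..<k} \<subseteq> {..<k}" using g by (auto simp: \<sigma>_def)
    ultimately have "bij_betw \<sigma> {..<k} {..<k}"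
      by (simp add: bij_betw_def endo_inj_surj)
    then have s: "\<sigma> permutes {..<k}" by (intro bij_imp_permutes) (auto simp: \<sigma>_def)
    have "f e = f (\<lambda>i. b (\<sigma> i))" using g by (intro covector_cong[OF f]) (auto simp: \<sigma>_def)
    also have "\<dots> = 0" using covector_permute[OF f s, of b] b by simp
    finally show ?thesis .
  next
    case False
    then obtain i j where ij: "i < k" "j < k" "i \<noteq> j" "g i = g j" by (auto simp: inj_on_def)
    then show ?thesis using g[of i] g[of j] by (intro covector_alt[OF f ij(1-3)]) simp
  qed
qed simp

text \<open>All entries lie in the span of fewer than \<open>k\<close> vectors, so after multilinear
  expansion some vector is repeated.\<close>

lemma covector_dependent_zero:
  fixes f :: "(nat \<Rightarrow> 'v::euclidean_space) \<Rightarrow> 'a::real_vector"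
  assumes f: "covector k f" and d: "dim (e ` {..<k}) < k"
  shows "f e = 0"
proof -
  let ?S = "e ` {..<k}"
  obtain B where B: "B \<subseteq> ?S" "independent B" "?S \<subseteq> span B" "card B = dim ?S"
    using basis_exists[of ?S] by blast
  have fB: "finite B" using B(1) finite_subset by blast
  show ?thesis
  proof (rule covector_on_span_zero[OF f])
    show "e i \<in> span B" if "i < k" for i using B(3) that by auto
    fix e' assume e': "\<And>i. i < k \<Longrightarrow> e' i \<in> B"
    have "\<not> inj_on e' {..<k}"
    proof
      assume "inj_on e' {..<k}"
      then have "k \<le> card B" using card_inj_on_le[of e' "{..<k}" B] fB e' by auto
      then show False using B(4) d by simp
    qed
    then obtain i j where ij: "i < k" "j < k" "i \<noteq> j" "e' i = e' j" by (auto simp: inj_on_def)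
    then show "f e' = 0" by (rule covector_alt[OF f])
  qed
qed

section \<open>Monomials in a coframing, encoded by lists of indices\<close>

primrec word :: "(nat \<Rightarrow> ('v, 'a::real_normed_field) form) \<Rightarrow> nat list \<Rightarrow> ('v, 'a) form" where
  "word T [] = (\<lambda>x e. 1)"
| "word T (i # l) = wedge 1 (length l) (T i) (word T l)"

lemma word_Cons: "word T (i # l) x = ewedge 1 (length l) (T i x) (word T l x)"
  by (simp add: wedge_ewedge)

text \<open>The sign of the permutation that sorts a list, \<open>0\<close> if the list has repetitions.\<close>

primrec wsgn :: "nat list \<Rightarrow> int" where
  "wsgn [] = 1"
| "wsgn (i # l) = (if i \<in> set l then 0 else (-1) ^ length (filter (\<lambda>j. j < i) l)) * wsgn l"

lemma smooth_form_word:
  fixes T :: "nat \<Rightarrow> ('v::real_normed_vector, 'a::real_normed_field) form"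
  assumes "open X" "\<And>i. smooth_form X 1 (T i)"
  shows "smooth_form X (length l) (word T l)"
proof (induction l)
  case Nil then show ?case by (simp add: smooth_form_def covector_0_const)
next
  case (Cons i l)
  then show ?case using smooth_form_wedge[OF assms(1) assms(2)[of i] Cons] by simp
qed

text \<open>
  \<open>dual T x n E z\<close> says that \<open>T 0, \<dots>, T (n - 1)\<close> span the dual space: \<open>\<Sum>\<^sub>m z A m E\<^sub>m\<close> are the dual
  vectors, in the complexification if \<open>'a\<close> is the complex field.
\<close>

definition dual ::
  "(nat \<Rightarrow> ('v::real_vector, 'a::real_normed_field) form) \<Rightarrow> 'v \<Rightarrow> nat \<Rightarrow> (nat \<Rightarrow> 'v) \<Rightarrow> (nat \<Rightarrow> nat \<Rightarrow> 'a) \<Rightarrow> bool"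
  where
  "dual T x n E z \<longleftrightarrow> (\<forall>g :: 'v \<Rightarrow> 'a. linear g \<longrightarrow>
     (\<forall>v. g v = (\<Sum>A<n. T A x (\<lambda>_. v) * (\<Sum>m<n. z A m * g (E m)))))"

context
  fixes T :: "nat \<Rightarrow> ('v::real_vector, 'a::real_normed_field) form" and x :: 'v
  assumes T: "\<And>i. covector 1 (T i x)"
begin

lemma covector_word: "covector (length l) (word T l x)"
proof (induction l)
  case Nil then show ?case by (simp add: covector_0_const)
next
  case (Cons i l)
  then show ?case using covector_ewedge[OF T[of i] Cons] by (simp add: wedge_ewedge)
qed

lemma word_append:
  assumes "length l = k" "length m = n"
  shows "ewedge k n (word T l x) (word T m x) = word T (l @ m) x"
  using assms(1)
proof (induction l arbitrary: k)
  case Nil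
  have "ewedge 0 (length m) (\<lambda>e. 1) (word T m x) = word T m x"
    by (simp add: fun_eq_iff ewedge_0_left[OF covector_0_const covector_word])
  then show ?case using assms(2) Nil by simp
next
  case (Cons i l)
  have "ewedge (1 + length l) (length m) (ewedge 1 (length l) (T i x) (word T l x)) (word T m x) =
    ewedge 1 (length l + length m) (T i x) (ewedge (length l) (length m) (word T l x) (word T m x))"
    by (rule ewedge_assoc[OF T covector_word covector_word])
  then show ?case using Cons assms(2) by (simp add: wedge_ewedge)
qed

lemma word_single: "word T [i] x = T i x"
  using ewedge_0_right[OF T covector_0_const] by (simp add: wedge_ewedge fun_eq_iff)

lemma word_swap: "word T (i # j # l) x e = - word T (j # i # l) x e"
proof -
  have a: "ewedge 1 (Suc (length l)) (T i x) (ewedge 1 (length l) (T j x) (word T l x)) =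
      ewedge 2 (length l) (ewedge 1 1 (T i x) (T j x)) (word T l x)" for i j
    using ewedge_assoc[OF T[of i] T[of j] covector_word[of l]] by (simp add: numeral_2_eq_2)
  have m: "ewedge 1 1 (T i x) (T j x) = (\<lambda>e. - ewedge 1 1 (T j x) (T i x) e)"
    using ewedge_commute[OF T[of i] T[of j]] by simp
  show ?thesis by (simp add: wedge_ewedge a m ewedge_minus_left)
qed

lemma word_dup: "word T (i # i # l) x e = 0"
proof -
  have "2 * word T (i # i # l) x e = 0" using word_swap[of i i l e] by (metis add.right_inverse mult_2)
  then show ?thesis by simp
qed

lemma word_insort:
  assumes "sorted l"
  shows "word T (i # l) x e =
    of_int (if i \<in> set l then 0 else (-1) ^ length (filter (\<lambda>j. j < i) l)) * word T (insort i l) x e"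
  using assms
proof (induction l arbitrary: e)
  case Nil then show ?case by simp
next
  case (Cons j l)
  consider "i = j" | "i < j" | "j < i" by linarith
  then show ?case
  proof cases
    case 1 then show ?thesis using word_dup by (simp del: word.simps)
  next
    case 2
    then have "filter (\<lambda>k. k < i) (j # l) = []" "i \<notin> set (j # l)"
      using Cons.prems by (auto simp: filter_empty_conv)
    then show ?thesis using 2 by (simp del: word.simps filter.simps)
  next
    case 3
    let ?c = "of_int (if i \<in> set l then 0 else (-1) ^ length (filter (\<lambda>j. j < i) l)) :: 'a"
    have IH: "word T (i # l) x = (\<lambda>e. ?c * word T (insort i l) x e)"
      using Cons by (simp add: fun_eq_iff del: word.simps)
    have "word T (i # j # l) x e = - word T (j # i # l) x e" by (rule word_swap)
    also have "\<dots> = - (?c * word T (j # insort i l) x e)"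
      unfolding word_Cons[of T j "i # l"] IH by (simp add: word_Cons ewedge_mult_right del: word.simps)
    finally show ?thesis using 3 by (simp del: word.simps)
  qed
qed

text \<open>Insertion sort with signs. It turns identities between explicit monomials into
  computations: words with repetitions vanish, all others are brought to sorted form.\<close>

lemma word_sort: "word T l x e = of_int (wsgn l) * word T (sort l) x e"
proof (induction l arbitrary: e)
  case Nil then show ?case by simp
next
  case (Cons i l)
  have IH: "word T l x = (\<lambda>e. of_int (wsgn l) * word T (sort l) x e)" using Cons by blast
  have f: "length (filter (\<lambda>j. j < i) (sort l)) = length (filter (\<lambda>j. j < i) l)"
    by (simp add: filter_sort)
  have "word T (i # l) x e = of_int (wsgn l) * word T (i # sort l) x e"
    unfolding word_Cons[of T i l] IH by (simp add: word_Cons ewedge_mult_right del: word.simps)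
  also have "\<dots> = of_int (wsgn l) *
      (of_int (if i \<in> set l then 0 else (-1) ^ length (filter (\<lambda>j. j < i) l)) * word T (insort i (sort l)) x e)"
    by (subst word_insort) (simp_all add: f del: word.simps)
  finally show ?case by (simp del: word.simps)
qed

text \<open>Euler's identity: summing \<open>T A\<close> wedged with the contraction by its dual
  vector multiplies a form by its degree. Contraction with \<open>v\<close> yields the form itself
  from \<open>dual\<close>, and the rest from the induction hypothesis since two contractions
  anticommute.\<close>

lemma euler:
  assumes d: "dual T x n E z" and g: "covector (Suc k) g"
  shows "of_nat (Suc k) * g e =
    (\<Sum>A<n. ewedge 1 k (T A x) (\<lambda>e. \<Sum>m<n. z A m * g (case_nat (E m) e)) e)"
  using g
proof (induction k arbitrary: g e)
  case 0
  have "linear (\<lambda>v. g (\<lambda>_. v))" using 0 covector_1_linear by (simp add: One_nat_def)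
  then have "g (\<lambda>_. e 0) = (\<Sum>A<n. T A x (\<lambda>_. e 0) * (\<Sum>m<n. z A m * g (\<lambda>_. E m)))"
    using d unfolding dual_def by blast
  moreover have "g e = g (\<lambda>_. e 0)" using 0 by (rule covector_cong) auto
  moreover have "g (case_nat (E m) e) = g (\<lambda>_. E m)" for m e using 0 by (rule covector_cong) auto
  moreover have "T A x e = T A x (\<lambda>_. e 0)" for A by (rule covector_cong[OF T]) auto
  ultimately show ?case
    using ewedge_0_right[OF T covector_0_const] by simp
next
  case (Suc k)
  let ?Z = "\<lambda>A e. \<Sum>m<n. z A m * g (case_nat (E m) e)"
  have cZ: "covector (Suc k) (?Z A)" for A
    by (intro covector_sum covector_mult_left covector_contract Suc.prems)
  show ?case
  proof (rule fun_cong[of _ _ e], rule covector_contract_ext)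
    fix v e
    have cg: "covector (Suc k) (\<lambda>e. g (case_nat v e))" by (rule covector_contract[OF Suc.prems])
    have sw: "g (case_nat w (case_nat v e)) = - g (case_nat v (case_nat w e))" for w e
    proof -
      have "case_nat w (case_nat v e) = case_nat v (case_nat w e) \<circ> Transposition.transpose 0 1"
        by (auto simp: fun_eq_iff Transposition.transpose_def One_nat_def split: nat.splits)
      then show ?thesis using covector_swap[OF Suc.prems, of 0 1 "case_nat v (case_nat w e)"]
        by (metis One_nat_def Suc_less_eq zero_less_Suc zero_neq_one)
    qed
    have lin: "linear (\<lambda>w. g (case_nat w e))"
    proof -
      define e0 where "e0 = case_nat v e"
      have "case_nat w e = e0(0 := w)" for w
        by (auto simp: fun_eq_iff e0_def split: nat.splits)
      then show ?thesis using covector_linear[OF Suc.prems, of 0 e0] by (simp del: fun_upd_apply)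
    qed
    have "(\<Sum>A<n. ewedge 1 (Suc k) (T A x) (?Z A) (case_nat v e)) =
      (\<Sum>A<n. T A x (\<lambda>_. v) * ?Z A e - ewedge 1 k (T A x) (\<lambda>e. ?Z A (case_nat v e)) e)"
    proof (rule sum.cong[OF refl])
      fix A
      have 0: "covector 0 (\<lambda>e. T A x (case_nat v e))"
        by (rule covector_contract, fold One_nat_def) (rule T)
      have tv: "T A x (case_nat v e) = T A x (\<lambda>_. v)" by (rule covector_cong[OF T]) auto
      show "ewedge 1 (Suc k) (T A x) (?Z A) (case_nat v e) =
        T A x (\<lambda>_. v) * ?Z A e - ewedge 1 k (T A x) (\<lambda>e. ?Z A (case_nat v e)) e"
        by (subst ewedge_contract[OF T cZ, of "Suc k"]) (simp_all add: ewedge_0_left[OF 0 cZ] tv)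
    qed
    also have "\<dots> = (\<Sum>A<n. T A x (\<lambda>_. v) * ?Z A e) +
      (\<Sum>A<n. ewedge 1 k (T A x) (\<lambda>e. \<Sum>m<n. z A m * g (case_nat v (case_nat (E m) e))) e)"
      by (simp add: sw sum_negf ewedge_minus_right sum.distrib[symmetric])
    also have "(\<Sum>A<n. T A x (\<lambda>_. v) * ?Z A e) = g (case_nat v e)"
      by (rule d[unfolded dual_def, rule_format, OF lin, symmetric])
    also have "(\<Sum>A<n. ewedge 1 k (T A x) (\<lambda>e. \<Sum>m<n. z A m * g (case_nat v (case_nat (E m) e))) e) =
      of_nat (Suc k) * g (case_nat v e)"
      using Suc.IH[OF cg] by simp
    finally show "of_nat (Suc (Suc k)) * g (case_nat v e) =
      (\<Sum>A<n. ewedge 1 (Suc k) (T A x) (?Z A) (case_nat v e))"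
      by (simp add: algebra_simps)
  qed
qed

text \<open>The monomials span: dividing \<open>euler\<close> by the degree writes a covector
  through products of \<open>T A\<close> with covectors of one degree less. As an induction rule it
  spares naming the coefficients.\<close>

lemma covector_word_induct:
  assumes d: "dual T x n E z" and g: "covector k g"
    and 0: "P (\<lambda>e. 0)" and add: "\<And>f g. P f \<Longrightarrow> P g \<Longrightarrow> P (\<lambda>e. f e + g e)"
    and mult: "\<And>c f. P f \<Longrightarrow> P (\<lambda>e. c * f e)"
    and w: "\<And>l. length l = k \<Longrightarrow> set l \<subseteq> {..<n} \<Longrightarrow> P (word T l x)"
  shows "P g"
  using g 0 add mult w
proof (induction k arbitrary: g P)
  case 0
  have "g = (\<lambda>e. g undefined * word T [] x e)" using covector_0[OF 0(1)] by auto
  then show ?case using 0(4)[OF 0(5)[of "[]"], of "g undefined"] by simp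
next
  case (Suc k)
  note P0 = Suc.prems(2) and Padd = Suc.prems(3) and Pmult = Suc.prems(4) and Pw = Suc.prems(5)
  have Psum: "P (\<lambda>e. \<Sum>A\<in>I. f A e)" if "\<And>A. A \<in> I \<Longrightarrow> P (f A)" for I :: "nat set" and f
    using that by (induction I rule: infinite_finite_induct) (auto intro: P0 Padd)
  have "P (ewedge 1 k (T A x) h)" if A: "A < n" and h: "covector k h" for A h
  proof (rule Suc.IH[OF h, of "\<lambda>h. P (ewedge 1 k (T A x) h)"])
    show "P (ewedge 1 k (T A x) (\<lambda>e. 0))" using P0 by simp
    show "P (ewedge 1 k (T A x) (\<lambda>e. f e + g e))"
      if "P (ewedge 1 k (T A x) f)" "P (ewedge 1 k (T A x) g)" for f g
      using Padd[OF that] by (simp add: ewedge_add_right[abs_def])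
    show "P (ewedge 1 k (T A x) (\<lambda>e. c * f e))" if "P (ewedge 1 k (T A x) f)" for c f
      using Pmult[OF that] by (simp add: ewedge_mult_right[abs_def])
    show "P (ewedge 1 k (T A x) (word T l x))" if "length l = k" "set l \<subseteq> {..<n}" for l
      using Pw[of "A # l"] that A by (simp add: wedge_ewedge)
  qed
  then have P: "P (\<lambda>e. inverse (of_nat (Suc k)) *
      (\<Sum>A<n. ewedge 1 k (T A x) (\<lambda>e. \<Sum>m<n. z A m * g (case_nat (E m) e)) e))"
    by (intro Pmult Psum) (simp add: covector_sum covector_mult_left covector_contract[OF Suc.prems(1)])
  have nz: "of_nat (Suc k) \<noteq> (0 :: 'a)" by (rule of_nat_neq_0)
  have "(\<lambda>e. inverse (of_nat (Suc k)) *
      (\<Sum>A<n. ewedge 1 k (T A x) (\<lambda>e. \<Sum>m<n. z A m * g (case_nat (E m) e)) e)) = g"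
    unfolding euler[OF d Suc.prems(1), symmetric] using nz by (simp add: fun_eq_iff del: of_nat_Suc)
  then show ?case using P by simp
qed

text \<open>A word of length \<open>n\<close> in \<open>n\<close> letters repeats a letter or sorts
  to \<open>[0..<n]\<close>.\<close>

lemma covector_top_word:
  assumes d: "dual T x n E z" and g: "covector n g"
  shows "\<exists>c. g = (\<lambda>e. c * word T [0..<n] x e)"
proof (rule covector_word_induct[OF d g, of "\<lambda>g. \<exists>c. g = (\<lambda>e. c * word T [0..<n] x e)"])
  show "\<exists>c. (\<lambda>e. 0) = (\<lambda>e. c * word T [0..<n] x e)" by (intro exI[of _ 0]) simp
  show "\<exists>c. (\<lambda>e. f e + g e) = (\<lambda>e. c * word T [0..<n] x e)"
    if "\<exists>c. f = (\<lambda>e. c * word T [0..<n] x e)" "\<exists>c. g = (\<lambda>e. c * word T [0..<n] x e)" for f g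
    using that by (metis (no_types) distrib_right)
  show "\<exists>c'. (\<lambda>e. c * f e) = (\<lambda>e. c' * word T [0..<n] x e)"
    if "\<exists>c. f = (\<lambda>e. c * word T [0..<n] x e)" for f c
    using that by (metis (no_types) mult.assoc)
  fix l :: "nat list" assume l: "length l = n" "set l \<subseteq> {..<n}"
  show "\<exists>c. word T l x = (\<lambda>e. c * word T [0..<n] x e)"
  proof (cases "distinct l")
    case True
    then have "set l = {..<n}" using l by (metis card_lessThan card_subset_eq distinct_card finite_lessThan)
    then have "sort l = [0..<n]"
      using True by (metis sorted_list_of_set_sort_remdups distinct_remdups_id sorted_list_of_set_range atLeast0LessThan)
    then show ?thesis using word_sort[of l] by auto
  next
    case False
    have "wsgn l = 0" if "\<not> distinct l" for l using that by (induction l) auto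
    then show ?thesis using word_sort[of l] False by (intro exI[of _ 0]) (auto simp: fun_eq_iff)
  qed
qed

lemma covector_cotop_word:
  assumes d: "dual T x (Suc n) E z" and g: "covector n g"
  shows "\<exists>c. g = (\<lambda>e. \<Sum>A<Suc n. c A * word T (filter (\<lambda>i. i \<noteq> A) [0..<Suc n]) x e)"
    (is "?P g")
proof (rule covector_word_induct[OF d g, of ?P])
  let ?w = "\<lambda>A. word T (filter (\<lambda>i. i \<noteq> A) [0..<Suc n]) x"
  show "?P (\<lambda>e. 0)" by (intro exI[of _ "\<lambda>_. 0"]) simp
  show "?P (\<lambda>e. f e + g e)" if "?P f" "?P g" for f g
  proof -
    obtain a b where "f = (\<lambda>e. \<Sum>A<Suc n. a A * ?w A e)" "g = (\<lambda>e. \<Sum>A<Suc n. b A * ?w A e)"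
      using \<open>?P f\<close> \<open>?P g\<close> by blast
    then show ?thesis
      by (intro exI[of _ "\<lambda>A. a A + b A"]) (simp only: distrib_right sum.distrib)
  qed
  show "?P (\<lambda>e. c * f e)" if "?P f" for f c
  proof -
    obtain a where "f = (\<lambda>e. \<Sum>A<Suc n. a A * ?w A e)" using \<open>?P f\<close> by blast
    then show ?thesis
      by (intro exI[of _ "\<lambda>A. c * a A"]) (simp only: mult.assoc sum_distrib_left)
  qed
  fix l :: "nat list" assume l: "length l = n" "set l \<subseteq> {..<Suc n}"
  show "?P (word T l x)"
  proof (cases "distinct l")
    case True
    \<comment> \<open>A word of \<open>n\<close> distinct letters out of \<open>Suc n\<close> omits
      exactly one letter \<open>A\<close>, which determines its sorted form.\<close>
    have "card (set l) = n" using l True distinct_card by metis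
    then have "card ({..<Suc n} - set l) = 1"
      using l(2) by (simp add: card_Diff_subset)
    then obtain A where A: "{..<Suc n} - set l = {A}" by (auto simp: card_1_singleton_iff One_nat_def)
    have "set l = {..<Suc n} - {A}" using A l(2) by blast
    also have "\<dots> = set (filter (\<lambda>i. i \<noteq> A) [0..<Suc n])" by auto
    finally have "set l = set (filter (\<lambda>i. i \<noteq> A) [0..<Suc n])" .
    then have "sort l = filter (\<lambda>i. i \<noteq> A) [0..<Suc n]"
      using True by (intro sorted_distinct_set_unique) (auto simp: sorted_filter sorted_wrt_filter simp del: upt_Suc)
    then have "word T l x = (\<lambda>e. of_int (wsgn l) * ?w A e)" using word_sort[of l] by auto
    moreover have "A < Suc n" using A by auto
    then have "(\<Sum>B<Suc n. (if B = A then of_int (wsgn l) else 0) * ?w B e) = of_int (wsgn l) * ?w A e" for e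
      by (subst sum.remove[of _ A]) auto
    ultimately show ?thesis by (intro exI[of _ "\<lambda>B. if B = A then of_int (wsgn l) else 0"]) (simp only:)
  next
    case False
    have "wsgn l = 0" if "\<not> distinct l" for l using that by (induction l) auto
    then show ?thesis using word_sort[of l] False by (intro exI[of _ "\<lambda>_. 0"]) (auto simp: fun_eq_iff)
  qed
qed

end

lemma word_killed:
  fixes T :: "nat \<Rightarrow> ('v::real_vector, 'a::real_normed_field) form"
  assumes T: "\<And>i. covector 1 (T i x)" and "\<And>i e. i \<in> set l \<Longrightarrow> T i x (case_nat v e) = 0"
    and "l \<noteq> []"
  shows "word T l x (case_nat v e) = 0"
  using assms(2,3)
proof (induction l arbitrary: e)
  case Nil then show ?case by simp
next
  case (Cons i l)
  have 0: "(\<lambda>e. T i x (case_nat v e)) = (\<lambda>e. 0)" using Cons.prems by (simp add: fun_eq_iff)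
  have IH: "l = [] \<or> (\<lambda>e. word T l x (case_nat v e)) = (\<lambda>e. 0)"
    using Cons by (auto simp: fun_eq_iff)
  show ?case
    unfolding word_Cons
    by (subst ewedge_contract[OF T[of i] covector_word[of T x l, OF T], where n="length l"]) (use IH in \<open>auto simp: 0\<close>)
qed

text \<open>Contracting with \<open>b m\<close> gives \<open>1\<close> on the first factor and, by
  orthonormality, kills all later ones; the word in the remaining letters is left.\<close>

lemma dx_word_basis:
  fixes b :: "nat \<Rightarrow> 'v::euclidean_space"
  assumes "\<And>i. i < n \<Longrightarrow> b i \<in> Basis" "inj_on b {..<n}" "m \<le> n"
  shows "word (\<lambda>i x. dx (b i)) [m..<n] x (\<lambda>i. b (m + i)) = (1 :: 'a::real_normed_field)"
  using assms(3)
proof (induction "n - m" arbitrary: m)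
  case 0 then show ?case by simp
next
  case (Suc d)
  let ?T = "\<lambda>i x. dx (b i) :: (nat \<Rightarrow> 'v) \<Rightarrow> 'a"
  have m: "m < n" "m \<le> n" using Suc.hyps(2) by auto
  have T: "covector 1 (?T i x)" for i by (rule covector_dx)
  have z: "word ?T [Suc m..<n] x (case_nat (b m) e) = 0" if "[Suc m..<n] \<noteq> []" for e
  proof (rule word_killed[of ?T x, OF T _ that])
    fix i e assume "i \<in> set [Suc m..<n]"
    then have i: "Suc m \<le> i" "i < n" by auto
    then have "b m \<noteq> b i" using inj_onD[OF assms(2), of m i] m by auto
    moreover have "b m \<in> Basis" "b i \<in> Basis" using assms(1) i m by auto
    ultimately show "dx (b i) (case_nat (b m) e) = 0" by (simp add: dx_def inner_Basis)
  qed
  have 0: "covector 0 (\<lambda>e. dx (b m) (case_nat (b m) e) :: 'a)"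
    by (rule covector_contract, fold One_nat_def) (rule covector_dx)
  have e: "(\<lambda>i. b (m + i)) = case_nat (b m) (\<lambda>i. b (Suc m + i))"
    by (auto simp: fun_eq_iff split: nat.splits)
  have "word ?T [m..<n] x (\<lambda>i. b (m + i)) = ewedge 1 (length [Suc m..<n]) (?T m x) (word ?T [Suc m..<n] x) (\<lambda>i. b (m + i))"
    using m(1) by (simp add: upt_conv_Cons wedge_ewedge)
  also have "\<dots> = ewedge 0 (length [Suc m..<n]) (\<lambda>e. dx (b m) (case_nat (b m) e)) (word ?T [Suc m..<n] x) (\<lambda>i. b (Suc m + i))"
    unfolding e by (subst ewedge_contract[OF T[of m] covector_word[of ?T x "[Suc m..<n]", OF T], where n="length [Suc m..<n]"]) (use z in \<open>auto\<close>)
  also have "\<dots> = word ?T [Suc m..<n] x (\<lambda>i. b (Suc m + i))"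
    by (subst ewedge_0_left[OF 0 covector_word[of ?T x, OF T]]) (use assms(1) m in \<open>simp add: dx_def inner_Basis\<close>)
  also have "\<dots> = 1" using Suc.hyps(2) m by (intro Suc.hyps(1)) auto
  finally show ?case .
qed

lemma basis_enum:
  obtains b :: "nat \<Rightarrow> 'v::euclidean_space"
  where "b ` {..<DIM('v)} = Basis" "inj_on b {..<DIM('v)}"
  using ex_bij_betw_nat_finite[of "Basis :: 'v set"]
  by (auto simp: bij_betw_def atLeast0LessThan)

text \<open>The coordinate volume form is a multiple of the monomial and has value 1 on the standard
  basis. If the monomial vanished on one spanning frame, it would vanish on that basis as
  well.\<close>

lemma top_word_nonzero:
  fixes T :: "nat \<Rightarrow> ('v::euclidean_space, 'a::real_normed_field) form"
  assumes T: "\<And>i. covector 1 (T i x)" and d: "dual T x DIM('v) E z"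
    and b: "span (b ` {..<DIM('v)}) = UNIV"
  shows "word T [0..<DIM('v)] x b \<noteq> 0"
proof
  assume 0: "word T [0..<DIM('v)] x b = 0"
  obtain c :: "nat \<Rightarrow> 'v" where c: "c ` {..<DIM('v)} = Basis" "inj_on c {..<DIM('v)}"
    by (rule basis_enum)
  let ?D = "\<lambda>i (x :: 'v). dx (c i) :: (nat \<Rightarrow> 'v) \<Rightarrow> 'a"
  have cD: "covector 1 (?D i x)" for i by (rule covector_dx)
  have cw: "covector DIM('v) (word T [0..<DIM('v)] x)" using covector_word[of T x "[0..<DIM('v)]", OF T] by simp
  obtain k where k: "word ?D [0..<DIM('v)] x = (\<lambda>e. k * word T [0..<DIM('v)] x e)"
    using covector_top_word[of T x, OF T d, of "word ?D [0..<DIM('v)] x"]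
      covector_word[of ?D x "[0..<DIM('v)]", OF cD] by auto
  have "word T [0..<DIM('v)] x c = 0"
    by (rule covector_frame_zero[OF cw 0]) (simp add: b)
  moreover have "word ?D [0..<DIM('v)] x c = 1"
    using dx_word_basis[of "DIM('v)" c 0 x] c by auto
  ultimately show False using k by simp
qed

section \<open>Ideals of forms\<close>

lemma alg_ideal_smooth:
  assumes X: "open X" and G: "\<And>k \<phi>. (k, \<phi>) \<in> G \<Longrightarrow> smooth_form X k \<phi>" and "alg_ideal X G k \<phi>"
  shows "smooth_form X k \<phi>"
  using assms(3)
proof induction
  case (gen k \<phi>) then show ?case by (rule G)
next
  case (zero k) show ?case by simp
next
  case (add k \<phi> \<psi>) then show ?case by (intro smooth_form_add[OF X])
next
  case (mult l \<beta> k \<phi>) then show ?case by (intro smooth_form_wedge[OF X])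
next
  case (cong k \<phi> \<psi>) then show ?case by simp
qed

lemma alg_ideal_scale:
  assumes X: "open X" and G: "\<And>k \<phi>. (k, \<phi>) \<in> G \<Longrightarrow> smooth_form X k \<phi>"
    and \<phi>: "alg_ideal X G k \<phi>" and c: "smooth_on X c"
  shows "alg_ideal X G k (\<lambda>x e. c x * \<phi> x e)"
proof -
  note s = alg_ideal_smooth[OF X G \<phi>]
  have 1: "alg_ideal X G k (wedge 0 k (\<lambda>x e. c x) \<phi>)"
    using alg_ideal.mult[OF smooth_form_0[OF X c] \<phi>] by simp
  have 2: "\<forall>x\<in>X. (\<lambda>e. c x * \<phi> x e) = wedge 0 k (\<lambda>x e. c x) \<phi> x"
    using smooth_formD[OF s] by (auto simp: wedge_ewedge fun_eq_iff ewedge_0_left[OF covector_0_const])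
  show ?thesis
    by (rule alg_ideal.cong[OF 1 smooth_form_scale[OF X c s] 2])
qed

text \<open>By the Leibniz rule the derivative of a multiple of \<open>\<phi>\<close> is a
  combination of multiples of \<open>\<phi>\<close> and of \<open>ext_d k \<phi>\<close>, so only
  the generators matter.\<close>

lemma alg_ideal_d_closed:
  assumes X: "open X" and G: "\<And>k \<phi>. (k, \<phi>) \<in> G \<Longrightarrow> smooth_form X k \<phi>"
    and dG: "\<And>k \<phi>. (k, \<phi>) \<in> G \<Longrightarrow> alg_ideal X G (Suc k) (ext_d k \<phi>)"
  shows "d_closed (alg_ideal (X :: 'v::euclidean_space set) G)"
  unfolding d_closed_def
proof (intro allI impI)
  fix k and \<phi> :: "('v, real) form" assume "alg_ideal X G k \<phi>"
  then show "alg_ideal X G (Suc k) (ext_d k \<phi>)"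
  proof induction
    case (gen k \<phi>) then show ?case by (rule dG)
  next
    case (zero k)
    have "ext_d k (\<lambda>(x :: 'v) e. 0 :: real) = (\<lambda>x e. 0)" by (simp add: ext_d_def fun_eq_iff)
    then show ?case by (simp add: alg_ideal.zero)
  next
    case (add k \<phi> \<psi>)
    note s = alg_ideal_smooth[OF X G add.hyps(1)] alg_ideal_smooth[OF X G add.hyps(2)]
    show ?case
      by (rule alg_ideal.cong[OF alg_ideal.add[OF add.IH] smooth_form_ext_d[OF X smooth_form_add[OF X s]]])
         (auto simp: fun_eq_iff ext_d_add[OF _ s])
  next
    case (mult l \<beta> k \<phi>)
    note s = alg_ideal_smooth[OF X G mult.hyps(2)]
    have 1: "alg_ideal X G (Suc (l + k)) (wedge (Suc l) k (ext_d l \<beta>) \<phi>)"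
      using alg_ideal.mult[OF smooth_form_ext_d[OF X mult.hyps(1)] mult.hyps(2)] by simp
    have 2: "alg_ideal X G (Suc (l + k)) (\<lambda>x e. (-1) ^ l * wedge l (Suc k) \<beta> (ext_d k \<phi>) x e)"
      using alg_ideal_scale[OF X G alg_ideal.mult[OF mult.hyps(1) mult.IH], of "\<lambda>_. (-1) ^ l"] by simp
    show ?case
      by (rule alg_ideal.cong[OF alg_ideal.add[OF 1 2]
            smooth_form_ext_d[OF X smooth_form_wedge[OF X mult.hyps(1) s]]])
         (auto simp: fun_eq_iff ext_d_wedge[OF X _ mult.hyps(1) s])
  next
    case (cong k \<phi> \<psi>)
    note s = alg_ideal_smooth[OF X G cong.hyps(1)]
    show ?case
      by (rule alg_ideal.cong[OF cong.IH smooth_form_ext_d[OF X cong.hyps(2)]])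
         (use ext_d_cong[OF X _ s] cong.hyps(3) in blast)
  qed
qed

text \<open>The complexification of the real ideal. It admits complex monomials as multipliers, and
  it is stable under conjugation.\<close>

definition cideal ::
  "'v::real_normed_vector set \<Rightarrow> (nat \<times> ('v, real) form) set \<Rightarrow> nat \<Rightarrow> ('v, complex) form \<Rightarrow> bool" where
  "cideal X G k \<Phi> \<longleftrightarrow> alg_ideal X G k (Re_form \<Phi>) \<and> alg_ideal X G k (Im_form \<Phi>)"

lemma Re_Im_smooth:
  assumes X: "open X" and R: "smooth_form X k (Re_form \<Phi>)" "smooth_form X k (Im_form \<Phi>)"
  shows "smooth_form X k \<Phi>"
proof -
  have "smooth_form X k (\<lambda>x e. complex_of_real (Re (\<Phi> x e)) + \<i> * complex_of_real (Im (\<Phi> x e)))"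
    by (intro smooth_form_add[OF X] smooth_form_scale[OF X smooth_on_const] smooth_form_of_real[OF X] R)
  then show ?thesis by (simp add: complex_eq[symmetric])
qed

context
  fixes X :: "'v::real_normed_vector set" and G :: "(nat \<times> ('v, real) form) set"
  assumes X: "open X" and G: "\<And>k \<phi>. (k, \<phi>) \<in> G \<Longrightarrow> smooth_form X k \<phi>"
begin

lemma cideal_smooth: "cideal X G k \<Phi> \<Longrightarrow> smooth_form X k \<Phi>"
  unfolding cideal_def using alg_ideal_smooth[OF X G] Re_Im_smooth[OF X] by blast

lemma cideal_add: "cideal X G k \<Phi> \<Longrightarrow> cideal X G k \<Psi> \<Longrightarrow> cideal X G k (\<lambda>x e. \<Phi> x e + \<Psi> x e)"
  by (auto simp: cideal_def intro: alg_ideal.add)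

lemma cideal_zero: "cideal X G k (\<lambda>x e. 0)"
  by (auto simp: cideal_def intro: alg_ideal.zero)

lemma cideal_neg_real: "alg_ideal X G k \<phi> \<Longrightarrow> alg_ideal X G k (\<lambda>x e. - \<phi> x e)"
proof -
  assume "alg_ideal X G k \<phi>"
  from alg_ideal_scale[OF X G this smooth_on_const[where c="-1"]] show ?thesis by simp
qed

lemma cideal_minus: "cideal X G k \<Phi> \<Longrightarrow> cideal X G k (\<lambda>x e. - \<Phi> x e)"
  by (auto simp: cideal_def intro: cideal_neg_real)

lemma cideal_cnj: "cideal X G k \<Phi> \<Longrightarrow> cideal X G k (cnj_form \<Phi>)"
  by (auto simp: cideal_def intro: cideal_neg_real)

lemma cideal_sum: "(\<And>i. i \<in> I \<Longrightarrow> cideal X G k (\<Phi> i)) \<Longrightarrow> cideal X G k (\<lambda>x e. \<Sum>i\<in>I. \<Phi> i x e)"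
proof (induction I rule: infinite_finite_induct)
  case (insert i I)
  then have "cideal X G k (\<lambda>x e. \<Phi> i x e + (\<Sum>i\<in>I. \<Phi> i x e))" by (intro cideal_add) auto
  then show ?case using insert by simp
qed (simp_all add: cideal_zero)

lemma cideal_mult:
  assumes b: "smooth_form X l \<beta>" and \<Phi>: "cideal X G k \<Phi>"
  shows "cideal X G (l + k) (wedge l k \<beta> \<Phi>)"
proof -
  note R = smooth_form_Re[OF X b] and I = smooth_form_Im[OF X b]
  have "alg_ideal X G (l + k) (\<lambda>x e. wedge l k (Re_form \<beta>) (Re_form \<Phi>) x e + - wedge l k (Im_form \<beta>) (Im_form \<Phi>) x e)"
    using \<Phi> by (intro alg_ideal.add cideal_neg_real alg_ideal.mult R I) (auto simp: cideal_def)
  moreover have "alg_ideal X G (l + k) (\<lambda>x e. wedge l k (Re_form \<beta>) (Im_form \<Phi>) x e + wedge l k (Im_form \<beta>) (Re_form \<Phi>) x e)"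
    using \<Phi> by (intro alg_ideal.add alg_ideal.mult R I) (auto simp: cideal_def)
  ultimately show ?thesis by (simp add: cideal_def wedge_ewedge ewedge_Re ewedge_Im)
qed

lemma cideal_cong:
  assumes "cideal X G k \<Phi>" "\<And>x. x \<in> X \<Longrightarrow> \<Psi> x = \<Phi> x"
  shows "cideal X G k \<Psi>"
proof -
  have s: "smooth_form X k \<Psi>" by (rule smooth_form_cong[OF X cideal_smooth[OF assms(1)] assms(2)])
  show ?thesis
    unfolding cideal_def
  proof
    show "alg_ideal X G k (Re_form \<Psi>)"
      by (rule alg_ideal.cong[of X G k "Re_form \<Phi>"])
         (use assms smooth_form_Re[OF X s] in \<open>auto simp: cideal_def\<close>)
    show "alg_ideal X G k (Im_form \<Psi>)"
      by (rule alg_ideal.cong[of X G k "Im_form \<Phi>"])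
         (use assms smooth_form_Im[OF X s] in \<open>auto simp: cideal_def\<close>)
  qed
qed

lemma cideal_scale:
  assumes c: "smooth_on X c" and \<Phi>: "cideal X G k \<Phi>"
  shows "cideal X G k (\<lambda>x e. c x * \<Phi> x e)"
proof (rule cideal_cong)
  show "cideal X G k (wedge 0 k (\<lambda>x e. c x) \<Phi>)"
    using cideal_mult[OF smooth_form_0[OF X c] \<Phi>] by simp
  show "(\<lambda>e. c x * \<Phi> x e) = wedge 0 k (\<lambda>x e. c x) \<Phi> x" if "x \<in> X" for x
    using smooth_formD[OF cideal_smooth[OF \<Phi>] that]
    by (auto simp: wedge_ewedge fun_eq_iff ewedge_0_left[OF covector_0_const])
qed

end

text \<open>The Bianchi identity. The derivative of \<open>A \<and> A\<close> is
  \<open>dA \<and> A - A \<and> dA\<close>, and replacing \<open>dA\<close> by \<open>F\<close> adds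
  two cubic terms that cancel by associativity.\<close>

lemma bianchi:
  fixes A :: "'r::finite \<Rightarrow> 'r \<Rightarrow> ('v::euclidean_space, complex) form"
  assumes X: "open X" and x: "x \<in> X" and A: "\<And>a b. smooth_form X 1 (A a b)"
    and F: "\<And>a b z e. F a b z e = ext_d 1 (A a b) z e + (\<Sum>k\<in>UNIV. wedge 1 1 (A a k) (A k b) z e)"
  shows "ext_d 2 (F a b) x e =
    (\<Sum>k\<in>UNIV. wedge 2 1 (F a k) (A k b) x e - wedge 1 2 (A a k) (F k b) x e)"
proof -
  have dA: "smooth_form X 2 (ext_d 1 (A a b))" for a b
    using smooth_form_ext_d[OF X A[of a b]] by (simp add: numeral_2_eq_2 One_nat_def)
  have AA: "smooth_form X 2 (wedge 1 1 (A a k) (A m b))" for a k m b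
    using smooth_form_wedge[OF X A[of a k] A[of m b]] by simp
  note cA = smooth_formD[OF A x]
  have F2: "F a b = (\<lambda>z e. ext_d 1 (A a b) z e + (\<Sum>k\<in>UNIV. wedge 1 1 (A a k) (A k b) z e))" for a b
    by (simp add: F fun_eq_iff)
  have dd: "ext_d 2 (ext_d 1 (A a b)) x e = 0"
    using ext_d_ext_d[OF X x A[of a b], of e] by (simp add: numeral_2_eq_2 One_nat_def)
  have dAA: "ext_d 2 (wedge 1 1 (A a k) (A k b)) x e =
      wedge 2 1 (ext_d 1 (A a k)) (A k b) x e - wedge 1 2 (A a k) (ext_d 1 (A k b)) x e" for k
    using ext_d_wedge[OF X x A[of a k] A[of k b], of e] by (simp add: numeral_2_eq_2 One_nat_def)
  have "ext_d 2 (F a b) x e =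
    (\<Sum>k\<in>UNIV. wedge 2 1 (ext_d 1 (A a k)) (A k b) x e - wedge 1 2 (A a k) (ext_d 1 (A k b)) x e)"
    unfolding F2 ext_d_add[OF x dA smooth_form_sum[OF X AA]] ext_d_sum[OF X x AA] dd dAA by simp
  moreover have "(\<Sum>k\<in>UNIV. \<Sum>m\<in>UNIV. ewedge 2 1 (ewedge 1 1 (A a m x) (A m k x)) (A k b x) e) =
    (\<Sum>k\<in>UNIV. \<Sum>m\<in>UNIV. ewedge 1 2 (A a k x) (ewedge 1 1 (A k m x) (A m b x)) e)"
  proof -
    have "ewedge 2 1 (ewedge 1 1 (A a m x) (A m k x)) (A k b x) e =
        ewedge 1 2 (A a m x) (ewedge 1 1 (A m k x) (A k b x)) e" for k m
      using ewedge_assoc[OF cA[of a m] cA[of m k] cA[of k b]] by simp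
    then show ?thesis by (subst sum.swap) simp
  qed
  ultimately show ?thesis
    by (simp add: F2 wedge_ewedge ewedge_add_left ewedge_add_right ewedge_sum_left ewedge_sum_right
        sum.distrib sum_subtractf)
qed

section \<open>The universal connection and its curvature\<close>

lemma open_system_domain: "open W \<Longrightarrow> open (system_domain W)"
  by (simp add: system_domain_def open_Times)

lemma smooth_form_pull_sys:
  "open W \<Longrightarrow> smooth_form W k \<phi> \<Longrightarrow> smooth_form (system_domain W) k (pull_fst \<phi>)"
  unfolding system_domain_def by (rule smooth_form_pull)

lemma conn_form_smooth:
  assumes W: "open W" and \<alpha>: "\<And>i. smooth_form W 1 (\<alpha> i)"
  shows "smooth_form (system_domain W) 1 (conn_form \<alpha> (a :: 'r::finite) b)"
proof -
  note X = open_system_domain[OF W, where 'a='r]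
  have c: "smooth_on (system_domain W) (\<lambda>z :: 'r total. snd z $ i $ a $ b)" for i a b
    by (rule smooth_on_bounded_linear)
       (intro bounded_linear_compose[OF bounded_linear_vec_nth] bounded_linear_snd)
  have "smooth_form (system_domain W) 1 (conn_pi \<alpha> (a :: 'r) b)" for a b
    unfolding conn_pi_def[abs_def]
    by (intro smooth_form_sum[OF X] smooth_form_scale[OF X c] smooth_form_pull_sys[OF W \<alpha>])
  then show ?thesis
    unfolding conn_form_def[abs_def] by (intro smooth_form_diff[OF X] smooth_form_cnj[OF X])
qed

lemma curv_form_smooth:
  assumes W: "open W" and \<alpha>: "\<And>i. smooth_form W 1 (\<alpha> i)"
  shows "smooth_form (system_domain W) 2 (curv_form \<alpha> (a :: 'r::finite) b)"
proof -
  note X = open_system_domain[OF W, where 'a='r]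
  note A = conn_form_smooth[where \<alpha>=\<alpha>, OF W \<alpha>]
  have "smooth_form (system_domain W) 2 (ext_d 1 (conn_form \<alpha> a b))"
    using smooth_form_ext_d[OF X A] by (simp add: numeral_2_eq_2 One_nat_def)
  moreover have "smooth_form (system_domain W) 2 (wedge 1 1 (conn_form \<alpha> a k) (conn_form \<alpha> k b))" for k
    using smooth_form_wedge[OF X A A] by simp
  ultimately show ?thesis
    unfolding curv_form_def[abs_def] by (intro smooth_form_add[OF X] smooth_form_sum[OF X])
qed

text \<open>The connection form is skew-Hermitian by construction. In the quadratic term,
  transposition reverses the factors and the anticommutation of 1-forms restores their order with a
  sign.\<close>

lemma curv_form_skew:
  assumes W: "open W" and \<alpha>: "\<And>i. smooth_form W 1 (\<alpha> i)" and z: "z \<in> system_domain W"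
  shows "curv_form \<alpha> (a :: 'r::finite) b z e = - cnj (curv_form \<alpha> b a z e)"
proof -
  note X = open_system_domain[OF W, where 'a='r]
  note A = conn_form_smooth[where \<alpha>=\<alpha>, OF W \<alpha>]
  have skew: "conn_form \<alpha> a b z e = - cnj (conn_form \<alpha> b a z e)" for a b :: 'r and z e
    by (simp add: conn_form_def)
  have "bounded_linear (\<lambda>w. - cnj w)" by (intro bounded_linear_minus bounded_linear_cnj)
  note L = ext_d_linear[OF this z A[of b a]]
  have eq: "conn_form \<alpha> a b = (\<lambda>z e. - cnj (conn_form \<alpha> b a z e))"
    using skew[of a b] by blast
  have d: "ext_d 1 (conn_form \<alpha> a b) z e = - cnj (ext_d 1 (conn_form \<alpha> b a) z e)"
    by (subst eq) (rule L)
  have s: "conn_form \<alpha> a b z = (\<lambda>e. - cnj (conn_form \<alpha> b a z e))" for a b :: 'r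
    using skew by blast
  have "wedge 1 1 (conn_form \<alpha> a k) (conn_form \<alpha> k b) z e =
      - cnj (wedge 1 1 (conn_form \<alpha> b k) (conn_form \<alpha> k a) z e)" for k
  proof -
    have "ewedge 1 1 (conn_form \<alpha> a k z) (conn_form \<alpha> k b z) e =
      - ewedge 1 1 (conn_form \<alpha> k b z) (conn_form \<alpha> a k z) e"
      using ewedge_commute[OF smooth_formD[OF A z, of a k] smooth_formD[OF A z, of k b]] by simp
    also have "\<dots> = - ewedge 1 1 (\<lambda>e. cnj (conn_form \<alpha> b k z e)) (\<lambda>e. cnj (conn_form \<alpha> k a z e)) e"
      unfolding s[of k b] s[of a k] by (simp add: ewedge_minus_left ewedge_minus_right)
    finally show ?thesis by (simp add: wedge_ewedge ewedge_cnj)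
  qed
  then show ?thesis unfolding curv_form_def d by (simp add: sum_negf)
qed

section \<open>Unitary coframings\<close>

text \<open>Rank-nullity on a subspace: \<open>f\<close> is injective on the orthogonal complement
  \<open>?U\<close> of the kernel in \<open>S\<close>, and its image there is the whole image of
  \<open>S\<close>.\<close>

lemma dim_kernel_image:
  fixes f :: "'a::euclidean_space \<Rightarrow> 'b::euclidean_space"
  assumes f: "linear f" and S: "subspace S"
  shows "dim {x \<in> S. f x = 0} + dim (f ` S) = dim S"
proof -
  let ?T = "{x \<in> S. f x = 0}"
  let ?U = "{y \<in> S. \<forall>x\<in>?T. orthogonal x y}"
  have T: "subspace ?T" using S f by (auto simp: subspace_def linear_0 linear_add linear_cmul)
  have U: "subspace ?U"
    using S by (auto simp: subspace_def orthogonal_def inner_right_distrib)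
  have "dim ?U + dim ?T = dim S" by (rule dim_subspace_orthogonal_to_vectors[OF T S]) auto
  moreover have "f ` ?U = f ` S"
  proof (intro equalityI subsetI)
    fix w assume "w \<in> f ` S"
    then obtain s where s: "s \<in> S" "w = f s" by blast
    obtain y z where yz: "y \<in> span ?T" "\<And>w. w \<in> span ?T \<Longrightarrow> orthogonal z w" "s = y + z"
      using orthogonal_subspace_decomp_exists[of ?T s] by blast
    have y: "y \<in> ?T" using yz(1) T by (metis (no_types, lifting) span_eq_iff)
    have "z = s - y" using yz(3) by simp
    then have "z \<in> S" using y s subspace_diff[OF S] by auto
    moreover have "orthogonal x z" if "x \<in> ?T" for x
      using yz(2)[OF span_base[OF that]] by (simp add: orthogonal_commute)
    moreover have "f z = w" using y s yz(3) f by (simp add: linear_add)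
    ultimately show "w \<in> f ` ?U" by blast
  qed auto
  moreover have "inj_on f (span ?U)"
  proof -
    have "x = 0" if "x \<in> ?U" "f x = 0" for x
      using that by (auto simp: orthogonal_self[symmetric])
    then have "inj_on f ?U"
      using linear_injective_on_subspace_0[OF f U] by blast
    then show ?thesis using U by (metis (no_types, lifting) span_eq_iff)
  qed
  then have "dim (f ` ?U) = dim ?U" by (rule dim_image_eq[OF f])
  ultimately show ?thesis by simp
qed

lemma ewedge_1_1:
  fixes a b :: "(nat \<Rightarrow> 'v::real_vector) \<Rightarrow> 'a::real_normed_field"
  assumes a: "covector 1 a" and b: "covector 1 b"
  shows "ewedge 1 1 a b e = a (\<lambda>_. e 0) * b (\<lambda>_. e 1) - a (\<lambda>_. e 1) * b (\<lambda>_. e 0)"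
proof -
  let ?v = "e 0" and ?e = "\<lambda>i. e (Suc i)"
  have 0: "covector 0 (\<lambda>e. a (case_nat ?v e))" "covector 0 (\<lambda>e. b (case_nat ?v e))"
    by (rule covector_contract, fold One_nat_def, rule a) (rule covector_contract, fold One_nat_def, rule b)
  have "ewedge 1 1 a b (case_nat ?v ?e) = a (case_nat ?v ?e) * b ?e - a ?e * b (case_nat ?v ?e)"
    by (subst ewedge_contract[OF a b, of 1]) (simp_all add: ewedge_0_left[OF 0(1) b] ewedge_0_right[OF a 0(2)])
  moreover have "a ?e = a (\<lambda>_. e 1)" "b ?e = b (\<lambda>_. e 1)"
    by (auto intro: covector_cong[OF a] covector_cong[OF b] simp: One_nat_def)
  moreover have "a (case_nat ?v ?e) = a (\<lambda>_. e 0)" "b (case_nat ?v ?e) = b (\<lambda>_. e 0)"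
    by (auto intro: covector_cong[OF a] covector_cong[OF b])
  ultimately show ?thesis by (simp add: case_nat_eta)
qed

lemma type_part_02:
  "type_part J 0 2 \<phi> e = (\<phi> e + \<i> * \<phi> (e(0 := J (e 0))) + \<i> * \<phi> (e(1 := J (e 1)))
     - \<phi> (e(0 := J (e 0), 1 := J (e 1)))) / 4"
proof -
  have S: "{S. S \<subseteq> {0, 1 :: nat} \<and> card S = 0} = {{}}"
    using finite_subset[of _ "{0, 1 :: nat}"] by auto
  have two: "{..<0 + 2 :: nat} = {0, 1}" by auto
  have P: "Pow {0, 1 :: nat} = {{}, {0}, {1}, {0, 1}}" by auto
  have e: "(\<lambda>i. if i = 0 \<or> i = 1 then J (e i) else e i) = e(0 := J (e 0), 1 := J (e 1))"
    "(\<lambda>i. if i = 0 then J (e i) else e i) = e(0 := J (e 0))"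
    "(\<lambda>i. if i = 1 then J (e i) else e i) = e(1 := J (e 1))" by auto
  have d: "{} \<noteq> {0 :: nat}" "{} \<noteq> {1 :: nat}" "{} \<noteq> {0, 1 :: nat}" "{0 :: nat} \<noteq> {1}" "{0 :: nat} \<noteq> {0, 1}" "{1 :: nat} \<noteq> {0, 1}"
    by auto
  show ?thesis
    unfolding type_part_def two S P using d by (simp add: e)
qed

context
  fixes T :: "nat \<Rightarrow> ('v::real_vector, 'a::real_normed_field) form" and x :: 'v
  assumes T: "\<And>i. covector 1 (T i x)"
begin

lemma word_not_distinct: "\<not> distinct l \<Longrightarrow> word T l x e = 0"
proof -
  have "wsgn l = 0" if "\<not> distinct l" for l using that by (induction l) auto
  then show "\<not> distinct l \<Longrightarrow> word T l x e = 0" using word_sort[of T x l e, OF T] by simp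
qed

text \<open>A conditional form of \<open>word_sort\<close> for rewriting: sorted words are the
  normal forms, and words with repetitions are left to \<open>word_not_distinct\<close>.\<close>

lemma word_unsorted:
  "distinct l \<Longrightarrow> \<not> sorted l \<Longrightarrow> word T l x e = of_int (wsgn l) * word T (sort l) x e"
  by (rule word_sort[of T x l e, OF T])

end

lemma word_cong: "(\<And>i. i \<in> set l \<Longrightarrow> T i x = T' i x) \<Longrightarrow> word T l x = word T' l x"
  by (induction l) (simp_all add: wedge_ewedge)

lemma sum_lessThan_3: "(\<Sum>i<3. f i) = f 0 + f 1 + f (2 :: nat)"
  by (simp add: numeral_eq_Suc One_nat_def ac_simps)

lemma sum_lessThan_6: "(\<Sum>i<6. f i) = f 0 + f 1 + f 2 + f 3 + f 4 + f (5 :: nat)"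
  by (simp add: numeral_eq_Suc One_nat_def ac_simps)

definition ix :: "nat \<Rightarrow> 3" where
  "ix i = (if i = 0 then 1 else if i = 1 then 2 else 3)"

lemma ix_simps [simp]: "ix 0 = 1" "ix 1 = 2" "ix (Suc 0) = 2" "ix 2 = 3"
  by (simp_all add: ix_def)

lemma three_neq: "(1 :: 3) \<noteq> 2" "(1 :: 3) \<noteq> 3" "(2 :: 3) \<noteq> 3"
   "(2 :: 3) \<noteq> 1" "(3 :: 3) \<noteq> 1" "(3 :: 3) \<noteq> 2"
  by simp_all

text \<open>The letters \<open>0, 1, 2\<close> are the (1,0)-forms and \<open>3, 4, 5\<close> their
  conjugates in the same order, so the type of a word can be read off its list.\<close>

definition complex_coframing :: "(3 \<Rightarrow> ('v, complex) form) \<Rightarrow> nat \<Rightarrow> ('v, complex) form" where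
  "complex_coframing \<alpha> i = (if i < 3 then \<alpha> (ix i) else cnj_form (\<alpha> (ix (i - 3))))"

section \<open>A coordinate domain with a unitary coframing\<close>

locale unitary_system =
  fixes \<epsilon> :: real and J :: "real^6 \<Rightarrow> real^6 \<Rightarrow> real^6" and \<eta> :: "(real^6, real) form"
    and W :: "(real^6) set" and \<alpha> :: "3 \<Rightarrow> (real^6, complex) form"
  assumes W: "open W" and eps: "\<epsilon> = 1 \<or> \<epsilon> = - 1"
    and coframing: "unitary_coframing \<epsilon> J \<eta> W \<alpha>"
    and torsion: "\<exists>\<mu>. \<forall>x\<in>W. is_torsion_matrix J \<alpha> x (\<chi> j k. if j = k then sig \<epsilon> j * \<mu> x else 0)"
begin

abbreviation "Th \<equiv> complex_coframing \<alpha>"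

lemma Th_simps: "Th 0 = \<alpha> 1" "Th 1 = \<alpha> 2" "Th 2 = \<alpha> 3"
  "Th 3 = cnj_form (\<alpha> 1)" "Th 4 = cnj_form (\<alpha> 2)" "Th 5 = cnj_form (\<alpha> 3)"
  by (simp_all add: complex_coframing_def)

lemma \<alpha>_smooth: "smooth_form W 1 (\<alpha> j)"
  using coframing by (simp add: unitary_coframing_def J_linear_coframing_def)

lemma \<alpha>_J: "x \<in> W \<Longrightarrow> \<alpha> j x (\<lambda>_. J x v) = \<i> * \<alpha> j x (\<lambda>_. v)"
  using coframing by (simp add: unitary_coframing_def J_linear_coframing_def)

lemma \<alpha>_indep: "x \<in> W \<Longrightarrow> (\<And>v. (\<Sum>j\<in>UNIV. a j * \<alpha> j x (\<lambda>_. v)) = 0) \<Longrightarrow> a j = 0"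
  using coframing by (simp add: unitary_coframing_def J_linear_coframing_def)

lemma \<alpha>_covector: "x \<in> W \<Longrightarrow> covector 1 (\<alpha> j x)"
  by (rule smooth_formD[OF \<alpha>_smooth])

lemma \<alpha>_linear: "x \<in> W \<Longrightarrow> linear (\<lambda>v. \<alpha> j x (\<lambda>_. v))"
  by (rule covector_1_linear[OF \<alpha>_covector])

lemma Th_smooth: "smooth_form W 1 (Th i)"
  using \<alpha>_smooth smooth_form_cnj[OF W \<alpha>_smooth] by (simp add: complex_coframing_def)

lemma Th_covector: "x \<in> W \<Longrightarrow> covector 1 (Th i x)"
  by (rule smooth_formD[OF Th_smooth])

text \<open>The coframing is a real isomorphism onto \<open>complex^3\<close>. A vector orthogonal
  to its range would give a linear relation whose real part vanishes at every \<open>v\<close> and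
  at \<open>J x v\<close>, hence a complex relation between the \<open>\<alpha> j\<close>. The
  vectors \<open>u k\<close> and \<open>f k\<close> are the preimages of the unit vectors and of
  their multiples by \<open>\<i>\<close>.\<close>

lemma frame:
  assumes x: "x \<in> W"
  obtains u f where "\<And>j k. \<alpha> j x (\<lambda>_. u k) = (if j = k then 1 else 0)"
    "\<And>j k. \<alpha> j x (\<lambda>_. f k) = (if j = k then \<i> else 0)"
    "\<And>v. v = (\<Sum>k\<in>UNIV. Re (\<alpha> k x (\<lambda>_. v)) *\<^sub>R u k + Im (\<alpha> k x (\<lambda>_. v)) *\<^sub>R f k)"
proof -
  define a where "a v = (\<chi> j. \<alpha> j x (\<lambda>_. v))" for v
  have lin: "linear a"
    by (rule linearI)
       (simp_all add: a_def vec_eq_iff linear_add[OF \<alpha>_linear[OF x]] linear_cmul[OF \<alpha>_linear[OF x]])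
  have sub: "subspace (range a)" by (rule linear_subspace_image[OF lin]) simp
  have full: "dim (range a) = 6"
  proof (rule ccontr)
    assume "dim (range a) \<noteq> 6"
    then have "dim (range a) < DIM(complex^3)" using dim_subset_UNIV[of "range a"] by simp
    then obtain y where y: "y \<noteq> 0" "\<And>w. w \<in> span (range a) \<Longrightarrow> orthogonal y w"
      using orthogonal_to_subspace_exists by blast
    have re: "Re (\<Sum>j\<in>UNIV. cnj (y $ j) * \<alpha> j x (\<lambda>_. v)) = 0" for v
    proof -
      have "y \<bullet> a v = 0" using y(2)[of "a v"] by (simp add: orthogonal_def span_base)
      then show ?thesis by (simp add: inner_vec_def a_def inner_complex_def)
    qed
    have "(\<Sum>j\<in>UNIV. cnj (y $ j) * \<alpha> j x (\<lambda>_. v)) = 0" for v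
    proof -
      have "(\<Sum>j\<in>UNIV. cnj (y $ j) * \<alpha> j x (\<lambda>_. J x v)) = \<i> * (\<Sum>j\<in>UNIV. cnj (y $ j) * \<alpha> j x (\<lambda>_. v))"
        by (simp add: \<alpha>_J[OF x] sum_distrib_left algebra_simps)
      then have "Im (\<Sum>j\<in>UNIV. cnj (y $ j) * \<alpha> j x (\<lambda>_. v)) = 0" using re[of "J x v"] by simp
      then show ?thesis using re[of v] by (simp add: complex_eq_iff)
    qed
    then have "cnj (y $ j) = 0" for j by (rule \<alpha>_indep[OF x])
    then show False using y(1) by (simp add: vec_eq_iff)
  qed
  have surj: "range a = UNIV"
  proof -
    have "dim (range a) = DIM(complex^3)" using full by simp
    then have "span (range a) = UNIV" using dim_eq_full[of "range a"] by simp
    then show ?thesis using sub by (metis span_eq_iff)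
  qed
  have inj: "v = w" if "\<And>j. \<alpha> j x (\<lambda>_. v) = \<alpha> j x (\<lambda>_. w)" for v w
  proof -
    have "dim {v \<in> UNIV. a v = 0} + dim (a ` UNIV) = dim (UNIV :: (real^6) set)"
      by (rule dim_kernel_image[OF lin]) simp
    then have "dim {v. a v = 0} = 0" using full by simp
    then have "{v. a v = 0} \<subseteq> {0}" by (simp add: dim_eq_0)
    moreover have "a (v - w) = 0" using that by (simp add: linear_diff[OF lin]) (simp add: a_def)
    ultimately show "v = w" by auto
  qed
  define u where "u k = inv a (axis k 1)" for k
  define f where "f k = inv a (axis k \<i>)" for k
  have au: "a (u k) = axis k 1" and af: "a (f k) = axis k \<i>" for k
    using surj by (simp_all add: u_def f_def surj_f_inv_f)
  have 1: "\<alpha> j x (\<lambda>_. u k) = (if j = k then 1 else 0)" for j k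
    using arg_cong[OF au[of k], of "\<lambda>w. w $ j"] by (simp add: a_def axis_def)
  have 2: "\<alpha> j x (\<lambda>_. f k) = (if j = k then \<i> else 0)" for j k
    using arg_cong[OF af[of k], of "\<lambda>w. w $ j"] by (simp add: a_def axis_def)
  have 3: "v = (\<Sum>k\<in>UNIV. Re (\<alpha> k x (\<lambda>_. v)) *\<^sub>R u k + Im (\<alpha> k x (\<lambda>_. v)) *\<^sub>R f k)" for v
  proof (rule inj)
    fix j
    have "\<alpha> j x (\<lambda>_. (\<Sum>k\<in>UNIV. Re (\<alpha> k x (\<lambda>_. v)) *\<^sub>R u k + Im (\<alpha> k x (\<lambda>_. v)) *\<^sub>R f k)) =
      (\<Sum>k\<in>UNIV. Re (\<alpha> k x (\<lambda>_. v)) *\<^sub>R \<alpha> j x (\<lambda>_. u k) + Im (\<alpha> k x (\<lambda>_. v)) *\<^sub>R \<alpha> j x (\<lambda>_. f k))"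
      by (simp only: linear_sum[OF \<alpha>_linear[OF x]] linear_add[OF \<alpha>_linear[OF x]] linear_cmul[OF \<alpha>_linear[OF x]])
    also have "\<dots> = (\<Sum>k\<in>UNIV. if j = k then \<alpha> k x (\<lambda>_. v) else 0)"
      by (rule sum.cong[OF refl]) (simp add: 1 2 complex_eq_iff)
    finally show "\<alpha> j x (\<lambda>_. v) =
      \<alpha> j x (\<lambda>_. (\<Sum>k\<in>UNIV. Re (\<alpha> k x (\<lambda>_. v)) *\<^sub>R u k + Im (\<alpha> k x (\<lambda>_. v)) *\<^sub>R f k))" by simp
  qed
  show ?thesis by (rule that[OF 1 2 3])
qed

lemma dual_Th:
  assumes x: "x \<in> W" shows "\<exists>E z. dual Th x 6 E z"
proof -
  obtain u f where "\<And>j k. \<alpha> j x (\<lambda>_. u k) = (if j = k then 1 else 0)"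
    "\<And>j k. \<alpha> j x (\<lambda>_. f k) = (if j = k then \<i> else 0)"
    and uf: "\<And>v. v = (\<Sum>k\<in>UNIV. Re (\<alpha> k x (\<lambda>_. v)) *\<^sub>R u k + Im (\<alpha> k x (\<lambda>_. v)) *\<^sub>R f k)"
    by (rule frame[OF x]) (rule that, assumption+)
  define E where "E m = (if m < 3 then u (ix m) else f (ix (m - 3)))" for m :: nat
  \<comment> \<open>Coefficients of the complex vectors \<open>(u k - \<i> f k) / 2\<close>, dual to
    the (1,0)-forms, and, for the indices \<open>3, 4, 5\<close>, of their conjugates.\<close>
  define z :: "nat \<Rightarrow> nat \<Rightarrow> complex" where
    "z A m = (if m = A then (if A < 3 then 1 / 2 else \<i> / 2) else if m = A + 3 then - \<i> / 2 else if A = m + 3 then 1 / 2 else 0)" for A m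
  have "g v = (\<Sum>A<6. Th A x (\<lambda>_. v) * (\<Sum>m<6. z A m * g (E m)))" if g: "linear g" for g and v
  proof -
    have half: "complex_of_real (Re c) = (c + cnj c) / 2" "complex_of_real (Im c) = - \<i> * (c - cnj c) / 2" for c
      by (simp_all add: complex_eq_iff)
    have "g v = g (\<Sum>k\<in>UNIV. Re (\<alpha> k x (\<lambda>_. v)) *\<^sub>R u k + Im (\<alpha> k x (\<lambda>_. v)) *\<^sub>R f k)"
      by (rule arg_cong[OF uf])
    also have "\<dots> = (\<Sum>k\<in>UNIV. (\<alpha> k x (\<lambda>_. v) + cnj (\<alpha> k x (\<lambda>_. v))) / 2 * g (u k) +
        (- \<i> * (\<alpha> k x (\<lambda>_. v) - cnj (\<alpha> k x (\<lambda>_. v))) / 2) * g (f k))"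
      by (simp only: linear_sum[OF g] linear_add[OF g] linear_cmul[OF g])
         (simp add: scaleR_conv_of_real half)
    finally show ?thesis
      by (simp add: sum_3 sum_lessThan_6 Th_simps E_def z_def field_simps)
  qed
  then show ?thesis unfolding dual_def by meson
qed

lemma alpha123_word: "x \<in> W \<Longrightarrow> alpha123 \<alpha> x = word Th [0, 1, 2] x"
proof -
  assume x: "x \<in> W"
  note c = Th_covector[OF x]
  have w: "word Th [i] x = Th i x" for i by (rule word_single[of Th x, OF c])
  have "\<alpha> 1 x = word Th [0] x" "\<alpha> 2 x = word Th [1] x" "\<alpha> 3 x = word Th [2] x"
    by (simp_all only: w Th_simps)
  then show ?thesis
    unfolding alpha123_def wedge_ewedge by (simp add: word_append[of Th x, OF c] del: word.simps)
qed

lemma \<eta>_word: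
  assumes x: "x \<in> W"
  shows "cplx_form \<eta> x = (\<lambda>e. \<i> / 2 * (word Th [0, 3] x e + \<epsilon> * word Th [1, 4] x e + \<epsilon> * word Th [2, 5] x e))"
proof -
  note c = Th_covector[OF x]
  have w: "word Th [i, j] x = ewedge 1 1 (Th i x) (Th j x)" for i j
    using word_append[of Th x "[i]" 1 "[j]" 1, OF c] word_single[of Th x, OF c] by (simp del: word.simps)
  have eq: "complex_of_real (\<eta> x e) =
        \<i> / 2 * (\<Sum>j\<in>UNIV. sig \<epsilon> j * wedge 1 1 (\<alpha> j) (cnj_form (\<alpha> j)) x e)" for e
    using coframing x by (simp add: unitary_coframing_def)
  show ?thesis
    by (rule ext, unfold eq)
       (simp add: sum_3 w Th_simps wedge_ewedge sig_def three_neq del: word.simps)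
qed

lemma eps2: "complex_of_real \<epsilon> * complex_of_real \<epsilon> = 1"
  using eps by auto

text \<open>Each mixed product occurs twice, the square of \<open>\<i> / 2\<close> is
  \<open>- 1 / 4\<close>, and sorting a word such as \<open>[0, 3, 1, 4]\<close> costs another sign:
  hence the factor \<open>1 / 2\<close>. The word \<open>[1, 2, 4, 5]\<close> has coefficient
  \<open>\<epsilon> * \<epsilon> = 1\<close>.\<close>

lemma \<eta>2_word:
  assumes x: "x \<in> W"
  shows "wedge 2 2 (cplx_form \<eta>) (cplx_form \<eta>) x = (\<lambda>e. 1 / 2 *
    (\<epsilon> * word Th [0, 1, 3, 4] x e + \<epsilon> * word Th [0, 2, 3, 5] x e + word Th [1, 2, 4, 5] x e))"
proof -
  note c = Th_covector[OF x]
  have ii: "\<i> * (\<i> * w) = - w" for w by (simp add: mult.assoc[symmetric])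
  have ee: "complex_of_real \<epsilon> * (complex_of_real \<epsilon> * w) = w" for w
    using eps2 by (simp add: mult.assoc[symmetric])
  show ?thesis
    unfolding wedge_ewedge \<eta>_word[OF x]
    by (simp only: fun_eq_iff ewedge_mult_left ewedge_mult_right ewedge_add_left ewedge_add_right)
       (simp add: word_append[of Th x, OF c] word_not_distinct[of Th x, OF c] word_unsorted[of Th x, OF c]
        field_simps ii ee del: word.simps)
qed

lemma type_part_word:
  assumes x: "x \<in> W" and ij: "i < 6" "j < 6"
  shows "type_part (J x) 0 2 (word Th [i, j] x) e = (if i < 3 \<or> j < 3 then 0 else word Th [i, j] x e)"
proof -
  note c = Th_covector[OF x]
  have w: "word Th [i, j] x e = Th i x (\<lambda>_. e 0) * Th j x (\<lambda>_. e 1) - Th i x (\<lambda>_. e 1) * Th j x (\<lambda>_. e 0)" for e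
  proof -
    have "word Th [i, j] x = ewedge 1 1 (Th i x) (Th j x)"
      using word_append[of Th x "[i]" 1 "[j]" 1, OF c] word_single[of Th x, OF c] by (simp del: word.simps)
    then show ?thesis by (simp add: ewedge_1_1[OF c c])
  qed
  have TJ: "Th i x (\<lambda>_. J x v) = (if i < 3 then \<i> else - \<i>) * Th i x (\<lambda>_. v)" for i v
    by (simp add: complex_coframing_def \<alpha>_J[OF x])
  show ?thesis
    unfolding type_part_02 w by (simp add: TJ algebra_simps)
qed

text \<open>A 2-form without (0,2)-part lies in the ideal of the (1,0)-forms. On words this is
  visible from the letters, and the property is linear. It isolates the torsion in
  \<open>ext_d 1 (\<alpha> j)\<close>.\<close>

lemma two_form_decomposition:
  assumes x: "x \<in> W" and g: "covector 2 g"
  shows "\<exists>\<gamma>. (\<forall>k. covector 1 (\<gamma> k)) \<and>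
    g = (\<lambda>e. type_part (J x) 0 2 g e + (\<Sum>k<3. ewedge 1 1 (Th k x) (\<gamma> k) e))" (is "?P g")
proof -
  note c = Th_covector[OF x]
  obtain E z where d: "dual Th x 6 E z" using dual_Th[OF x] by blast
  show ?thesis
  proof (rule covector_word_induct[of Th x, OF c d g, of ?P])
    show "?P (\<lambda>e. 0)" by (intro exI[of _ "\<lambda>k e. 0"]) (simp add: type_part_02)
    show "?P (\<lambda>e. f e + g e)" if "?P f" "?P g" for f g
    proof -
      from \<open>?P f\<close> obtain a where aa: "(\<forall>k. covector 1 (a k)) \<and> f = (\<lambda>e. type_part (J x) 0 2 f e + (\<Sum>k<3. ewedge 1 1 (Th k x) (a k) e))" ..
      from \<open>?P g\<close> obtain b where bb: "(\<forall>k. covector 1 (b k)) \<and> g = (\<lambda>e. type_part (J x) 0 2 g e + (\<Sum>k<3. ewedge 1 1 (Th k x) (b k) e))" ..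
      note a = conjunct1[OF aa, rule_format] conjunct2[OF aa]
      note b = conjunct1[OF bb, rule_format] conjunct2[OF bb]
      have "f e + g e = type_part (J x) 0 2 (\<lambda>e. f e + g e) e + (\<Sum>k<3. ewedge 1 1 (Th k x) (\<lambda>e. a k e + b k e) e)" for e
      proof -
        have "type_part (J x) 0 2 (\<lambda>e. f e + g e) e = type_part (J x) 0 2 f e + type_part (J x) 0 2 g e"
          by (simp add: type_part_02 field_simps)
        then have "type_part (J x) 0 2 (\<lambda>e. f e + g e) e + (\<Sum>k<3. ewedge 1 1 (Th k x) (\<lambda>e. a k e + b k e) e) =
            (type_part (J x) 0 2 f e + (\<Sum>k<3. ewedge 1 1 (Th k x) (a k) e)) +
            (type_part (J x) 0 2 g e + (\<Sum>k<3. ewedge 1 1 (Th k x) (b k) e))"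
          by (simp add: ewedge_add_right sum.distrib)
        also have "\<dots> = f e + g e"
          by (simp only: fun_cong[OF a(2), of e, symmetric] fun_cong[OF b(2), of e, symmetric])
        finally show ?thesis ..
      qed
      then show ?thesis
        by (intro exI[of _ "\<lambda>k e. a k e + b k e"] conjI allI covector_add a(1) b(1) ext)
    qed
    show "?P (\<lambda>e. s * f e)" if "?P f" for f s
    proof -
      from \<open>?P f\<close> obtain a where aa: "(\<forall>k. covector 1 (a k)) \<and> f = (\<lambda>e. type_part (J x) 0 2 f e + (\<Sum>k<3. ewedge 1 1 (Th k x) (a k) e))" ..
      note a = conjunct1[OF aa, rule_format] conjunct2[OF aa]
      have "s * f e = type_part (J x) 0 2 (\<lambda>e. s * f e) e + (\<Sum>k<3. ewedge 1 1 (Th k x) (\<lambda>e. s * a k e) e)" for e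
      proof -
        have "type_part (J x) 0 2 (\<lambda>e. s * f e) e = s * type_part (J x) 0 2 f e"
          by (simp add: type_part_02 field_simps)
        then have "type_part (J x) 0 2 (\<lambda>e. s * f e) e + (\<Sum>k<3. ewedge 1 1 (Th k x) (\<lambda>e. s * a k e) e) =
            s * (type_part (J x) 0 2 f e + (\<Sum>k<3. ewedge 1 1 (Th k x) (a k) e))"
          by (simp add: ewedge_mult_right sum_distrib_left distrib_left)
        also have "\<dots> = s * f e"
          by (simp only: fun_cong[OF a(2), of e, symmetric])
        finally show ?thesis ..
      qed
      then show ?thesis
        by (intro exI[of _ "\<lambda>k e. s * a k e"] conjI allI covector_mult_left a(1) ext)
    qed
    fix l :: "nat list" assume l: "length l = 2" "set l \<subseteq> {..<6}"
    then obtain i j where ij: "l = [i, j]" "i < 6" "j < 6" by (auto simp: length_Suc_conv numeral_2_eq_2)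
    have w: "word Th [i, j] x = ewedge 1 1 (Th i x) (Th j x)" for i j
      using word_append[of Th x "[i]" 1 "[j]" 1, OF c] word_single[of Th x, OF c] by (simp del: word.simps)
    have w2: "word Th [i, j] x = (\<lambda>e. - ewedge 1 1 (Th j x) (Th i x) e)"
      unfolding w[of j i, symmetric] by (rule ext) (rule word_swap[of Th x, OF c])
    have s: "(\<Sum>k<3. ewedge 1 1 (Th k x) (\<lambda>e. if k = m then h e else 0) e) = ewedge 1 1 (Th m x) h e"
      if "m < 3" for m :: nat and h e
      by (subst sum.remove[of _ m]) (use that in auto)
    have cif: "covector 1 (\<lambda>e. if k = m then h e else 0)" if "covector 1 h" for k m :: nat and h :: "(nat \<Rightarrow> real^6) \<Rightarrow> complex"
      using that by (cases "k = m") simp_all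
    show "?P (word Th l x)"
    proof (cases "i < 3 \<or> j < 3")
      case F: False
      show ?thesis
        by (rule exI[of _ "\<lambda>k e. 0"]) (use F ij type_part_word[OF x ij(2,3)] in \<open>simp del: word.simps\<close>)
    next
      case True
      then consider "i < 3" | "j < 3" by blast
      then show ?thesis
      proof cases
        case 1
        then show ?thesis
          by (intro exI[of _ "\<lambda>k e. if k = i then Th j x e else 0"])
             (use ij type_part_word[OF x ij(2,3)] cif[OF c[of j]] s[of i "Th j x"] w[of i j] in \<open>simp del: word.simps\<close>)
      next
        case 2
        then show ?thesis
          by (intro exI[of _ "\<lambda>k e. if k = j then - Th i x e else 0"])
             (use ij type_part_word[OF x ij(2,3)] cif[OF covector_minus[OF c[of i]]] s[of j "\<lambda>e. - Th i x e"] w2 in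
               \<open>simp add: fun_eq_iff ewedge_minus_right del: word.simps\<close>)
      qed
    qed
  qed
qed

end

section \<open>Closure under the exterior derivative\<close>

context unitary_system
begin

section \<open>Derivatives of the two base forms of the system\<close>

lemma alpha123_smooth: "smooth_form W 3 (alpha123 \<alpha>)"
  using smooth_form_wedge[OF W smooth_form_wedge[OF W \<alpha>_smooth[of 1] \<alpha>_smooth[of 2]] \<alpha>_smooth[of 3]]
  by (simp add: alpha123_def)

lemma word_smooth: "smooth_form W (length l) (word Th l)"
  by (rule smooth_form_word[OF W Th_smooth])

lemma word_smooth': "length l = n \<Longrightarrow> smooth_form W n (word Th l)"
  using word_smooth by blast

lemma \<eta>_smooth: "smooth_form W 2 (cplx_form \<eta>)"
proof -
  have w: "smooth_form W 2 (word Th [i, j])" for i j by (rule word_smooth') simp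
  have "smooth_form W 2 (\<lambda>x e. \<i> / 2 * (word Th [0, 3] x e + \<epsilon> * word Th [1, 4] x e + \<epsilon> * word Th [2, 5] x e))"
    by (intro smooth_form_scale[OF W smooth_on_const] smooth_form_add[OF W] w)
  then show ?thesis by (rule smooth_form_cong[OF W]) (rule \<eta>_word)
qed

lemma \<eta>2_smooth: "smooth_form W 4 (wedge 2 2 (cplx_form \<eta>) (cplx_form \<eta>))"
  using smooth_form_wedge[OF W \<eta>_smooth \<eta>_smooth] by simp

lemma d\<alpha>_02:
  assumes x: "x \<in> W"
  obtains \<mu> :: complex where
    "type_part (J x) 0 2 (ext_d 1 (\<alpha> 1) x) = (\<lambda>e. \<mu> * word Th [4, 5] x e)"
    "type_part (J x) 0 2 (ext_d 1 (\<alpha> 2) x) = (\<lambda>e. \<epsilon> * \<mu> * word Th [5, 3] x e)"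
    "type_part (J x) 0 2 (ext_d 1 (\<alpha> 3) x) = (\<lambda>e. \<epsilon> * \<mu> * word Th [3, 4] x e)"
proof -
  note c = Th_covector[OF x]
  obtain \<mu> where tm: "is_torsion_matrix J \<alpha> x (\<chi> j k. if j = k then sig \<epsilon> j * \<mu> x else 0)"
    using torsion x by blast
  have w: "word Th [i, j] x = ewedge 1 1 (Th i x) (Th j x)" for i j
    using word_append[of Th x "[i]" 1 "[j]" 1, OF c] word_single[of Th x, OF c] by (simp del: word.simps)
  note t = tm[unfolded is_torsion_matrix_def, rule_format]
  \<comment> \<open>The cyclic successors of \<open>2\<close> and \<open>3\<close> in the type
    \<open>3\<close> appear as the numerals \<open>4\<close> and \<open>5\<close>.\<close>
  have m: "(4 :: 3) = 1" "(5 :: 3) = 2" by simp_all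
  show ?thesis
  proof (rule that[of "\<mu> x"])
    show "type_part (J x) 0 2 (ext_d 1 (\<alpha> 1) x) = (\<lambda>e. \<mu> x * word Th [4, 5] x e)"
      by (rule ext, subst t) (simp add: sum_3 three_neq m sig_def wedge_ewedge ewedge_cnj w Th_simps del: word.simps)
    show "type_part (J x) 0 2 (ext_d 1 (\<alpha> 2) x) = (\<lambda>e. \<epsilon> * \<mu> x * word Th [5, 3] x e)"
      by (rule ext, subst t) (simp add: sum_3 three_neq m sig_def wedge_ewedge ewedge_cnj w Th_simps del: word.simps)
    show "type_part (J x) 0 2 (ext_d 1 (\<alpha> 3) x) = (\<lambda>e. \<epsilon> * \<mu> x * word Th [3, 4] x e)"
      by (rule ext, subst t) (simp add: sum_3 three_neq m sig_def wedge_ewedge ewedge_cnj w Th_simps del: word.simps)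
  qed
qed

text \<open>The (0,2)-part of each \<open>ext_d 1 (\<alpha> j)\<close> meets the two other
  (1,0)-forms, and the signs of the torsion matrix are exactly those of the words in
  \<open>\<eta>2_word\<close>. All other parts contain a (1,0)-form and only contribute multiples of
  \<open>alpha123\<close>.\<close>

lemma d_alpha123_pointwise:
  assumes x: "x \<in> W"
  shows "\<exists>r m. ext_d 3 (alpha123 \<alpha>) x = (\<lambda>e. r 3 * word Th [0, 1, 2, 3] x e + r 4 * word Th [0, 1, 2, 4] x e +
    r (5 :: nat) * word Th [0, 1, 2, 5] x e + m * (\<epsilon> * word Th [0, 1, 3, 4] x e + \<epsilon> * word Th [0, 2, 3, 5] x e + word Th [1, 2, 4, 5] x e))"
proof -
  note c = Th_covector[OF x]
  obtain E z where d: "dual Th x 6 E z" using dual_Th[OF x] by blast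
  have c2: "covector 2 (ext_d 1 (\<alpha> j) x)" for j
    using smooth_formD[OF smooth_form_ext_d[OF W \<alpha>_smooth[of j]] x] by simp
  obtain \<mu> :: complex where \<mu>:
    "type_part (J x) 0 2 (ext_d 1 (\<alpha> 1) x) = (\<lambda>e. \<mu> * word Th [4, 5] x e)"
    "type_part (J x) 0 2 (ext_d 1 (\<alpha> 2) x) = (\<lambda>e. \<epsilon> * \<mu> * word Th [5, 3] x e)"
    "type_part (J x) 0 2 (ext_d 1 (\<alpha> 3) x) = (\<lambda>e. \<epsilon> * \<mu> * word Th [3, 4] x e)"
    by (rule d\<alpha>_02[OF x])
  from two_form_decomposition[OF x c2[of 1]] obtain \<gamma>1 where g1: "(\<forall>k. covector 1 (\<gamma>1 k)) \<and>
    ext_d 1 (\<alpha> 1) x = (\<lambda>e. type_part (J x) 0 2 (ext_d 1 (\<alpha> 1) x) e + (\<Sum>k<3. ewedge 1 1 (Th k x) (\<gamma>1 k) e))" ..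
  from two_form_decomposition[OF x c2[of 2]] obtain \<gamma>2 where g2: "(\<forall>k. covector 1 (\<gamma>2 k)) \<and>
    ext_d 1 (\<alpha> 2) x = (\<lambda>e. type_part (J x) 0 2 (ext_d 1 (\<alpha> 2) x) e + (\<Sum>k<3. ewedge 1 1 (Th k x) (\<gamma>2 k) e))" ..
  from two_form_decomposition[OF x c2[of 3]] obtain \<gamma>3 where g3: "(\<forall>k. covector 1 (\<gamma>3 k)) \<and>
    ext_d 1 (\<alpha> 3) x = (\<lambda>e. type_part (J x) 0 2 (ext_d 1 (\<alpha> 3) x) e + (\<Sum>k<3. ewedge 1 1 (Th k x) (\<gamma>3 k) e))" ..
  note c\<gamma> = conjunct1[OF g1, rule_format] conjunct1[OF g2, rule_format] conjunct1[OF g3, rule_format]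
  \<comment> \<open>Adjoins the nine auxiliary 1-forms of the decompositions as the letters
    \<open>6\<close> to \<open>14\<close>, so that the whole expansion is again a matter of sorting
    words.\<close>
  define T' :: "nat \<Rightarrow> (real^6, complex) form" where
    "T' i = (if i < 6 then Th i else if i < 9 then (\<lambda>_. \<gamma>1 (i - 6))
       else if i < 12 then (\<lambda>_. \<gamma>2 (i - 9)) else (\<lambda>_. \<gamma>3 (i - 12)))" for i
  have c': "covector 1 (T' i x)" for i using c c\<gamma> by (simp add: T'_def)
  have w': "word T' [i, j] x = ewedge 1 1 (T' i x) (T' j x)" for i j
    using word_append[of T' x "[i]" 1 "[j]" 1, OF c'] word_single[of T' x, OF c'] by (simp del: word.simps)
  have wT: "word Th l x = word T' l x" if "set l \<subseteq> {..<6}" for l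
    using that by (intro word_cong) (auto simp: T'_def)
  have s1: "word T' [i] x = T' i x" for i by (rule word_single[of T' x, OF c'])
  have \<delta>1: "ext_d 1 (\<alpha> 1) x = (\<lambda>e. \<mu> * word T' [4, 5] x e + (word T' [0, 6] x e + word T' [1, 7] x e + word T' [2, 8] x e))"
    by (subst conjunct2[OF g1]) (simp add: sum_lessThan_3 \<mu> wT w' T'_def fun_eq_iff del: word.simps flip: One_nat_def)
  have \<delta>2: "ext_d 1 (\<alpha> 2) x = (\<lambda>e. \<epsilon> * \<mu> * word T' [5, 3] x e + (word T' [0, 9] x e + word T' [1, 10] x e + word T' [2, 11] x e))"
    by (subst conjunct2[OF g2]) (simp add: sum_lessThan_3 \<mu> wT w' T'_def fun_eq_iff del: word.simps flip: One_nat_def)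
  have \<delta>3: "ext_d 1 (\<alpha> 3) x = (\<lambda>e. \<epsilon> * \<mu> * word T' [3, 4] x e + (word T' [0, 12] x e + word T' [1, 13] x e + word T' [2, 14] x e))"
    by (subst conjunct2[OF g3]) (simp add: sum_lessThan_3 \<mu> wT w' T'_def fun_eq_iff del: word.simps flip: One_nat_def)
  have A: "\<alpha> 1 x = word T' [0] x" "\<alpha> 2 x = word T' [1] x" "\<alpha> 3 x = word T' [2] x"
    by (simp_all only: s1) (simp_all add: T'_def Th_simps)
  have e1: "ext_d 2 (wedge 1 1 (\<alpha> 1) (\<alpha> 2)) x =
      (\<lambda>e. ewedge 2 1 (ext_d 1 (\<alpha> 1) x) (\<alpha> 2 x) e - ewedge 1 2 (\<alpha> 1 x) (ext_d 1 (\<alpha> 2) x) e)"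
    using ext_d_wedge[OF W x \<alpha>_smooth[of 1] \<alpha>_smooth[of 2]] by (simp add: wedge_ewedge fun_eq_iff)
  have s12: "smooth_form W 2 (wedge 1 1 (\<alpha> 1) (\<alpha> 2))"
    using smooth_form_wedge[OF W \<alpha>_smooth[of 1] \<alpha>_smooth[of 2]] by simp
  have e2: "ext_d 3 (alpha123 \<alpha>) x =
      (\<lambda>e. ewedge 3 1 (ext_d 2 (wedge 1 1 (\<alpha> 1) (\<alpha> 2)) x) (\<alpha> 3 x) e +
        ewedge 2 2 (ewedge 1 1 (\<alpha> 1 x) (\<alpha> 2 x)) (ext_d 1 (\<alpha> 3) x) e)"
    using ext_d_wedge[OF W x s12 \<alpha>_smooth[of 3]] by (simp add: wedge_ewedge fun_eq_iff alpha123_def)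
  \<comment> \<open>The trace of the matrix of auxiliary forms: an off-diagonal one comes with a
    (1,0)-form that is already present in the product.\<close>
  define \<rho> where "\<rho> = (\<lambda>e. word T' [6] x e + word T' [10] x e + word T' [14] x e)"
  have D: "ext_d 3 (alpha123 \<alpha>) x = (\<lambda>e. ewedge 3 1 (word T' [0, 1, 2] x) \<rho> e +
      \<mu> * (\<epsilon> * word T' [0, 1, 3, 4] x e + \<epsilon> * word T' [0, 2, 3, 5] x e + word T' [1, 2, 4, 5] x e))"
    unfolding e2 e1 \<delta>1 \<delta>2 \<delta>3 A \<rho>_def
    by (simp only: fun_eq_iff ewedge_mult_left ewedge_mult_right ewedge_add_left ewedge_add_right ewedge_diff_left ewedge_diff_right)
       (simp add: word_append[of T' x, OF c'] ewedge_mult_left ewedge_mult_right ewedge_add_left ewedge_add_right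
         ewedge_diff_left ewedge_diff_right ewedge_minus_left ewedge_minus_right
         word_not_distinct[of T' x, OF c'] word_unsorted[of T' x, OF c']
         algebra_simps del: word.simps)
  have c\<rho>: "covector 1 \<rho>" unfolding \<rho>_def s1 by (intro covector_add c')
  define r where "r A = (\<Sum>m<6. z A m * \<rho> (\<lambda>_. E m))" for A
  have \<rho>: "\<rho> = (\<lambda>e. \<Sum>A<6. r A * word Th [A] x e)"
  proof
    fix e
    have "\<rho> e = \<rho> (\<lambda>_. e 0)" by (rule covector_1_arg[OF c\<rho>])
    also have "\<dots> = (\<Sum>A<6. Th A x (\<lambda>_. e 0) * r A)"
      unfolding r_def by (rule d[unfolded dual_def, rule_format, OF covector_1_linear[OF c\<rho>]])
    also have "\<dots> = (\<Sum>A<6. r A * word Th [A] x e)"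
    proof (rule sum.cong[OF refl])
      fix A
      have "word Th [A] x e = Th A x e" using word_single[of Th x, OF c] by metis
      also have "\<dots> = Th A x (\<lambda>_. e 0)" by (rule covector_1_arg[OF c])
      finally show "Th A x (\<lambda>_. e 0) * r A = r A * word Th [A] x e" by simp
    qed
    finally show "\<rho> e = (\<Sum>A<6. r A * word Th [A] x e)" .
  qed
  have "ewedge 3 1 (word Th [0, 1, 2] x) \<rho> = (\<lambda>e. r 3 * word Th [0, 1, 2, 3] x e + r 4 * word Th [0, 1, 2, 4] x e +
    r 5 * word Th [0, 1, 2, 5] x e)"
    unfolding \<rho> sum_lessThan_6
    by (simp only: fun_eq_iff ewedge_mult_left ewedge_mult_right ewedge_add_left ewedge_add_right)
       (simp add: word_append[of Th x, OF c] word_not_distinct[of Th x, OF c] del: word.simps)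
  then show ?thesis
    unfolding D
    by (intro exI[of _ r] exI[of _ \<mu>]) (simp add: wT del: word.simps)
qed

lemma vol_nonzero:
  assumes x: "x \<in> W" and b: "span (b ` {..<6}) = UNIV"
  shows "word Th [0, 1, 2, 3, 4, 5] x b \<noteq> 0"
proof -
  obtain E z where d: "dual Th x 6 E z" using dual_Th[OF x] by blast
  have "[0..<6] = [0, 1, 2, 3, 4, 5 :: nat]" by (simp add: upt_rec)
  then show ?thesis
    using top_word_nonzero[of Th x E z b, OF Th_covector[OF x]] d b by simp
qed

lemma smooth_coeff:
  assumes "smooth_form W 6 \<Phi>" and b: "span (b ` {..<6}) = UNIV"
  shows "smooth_on W (\<lambda>x. \<Phi> x b / word Th [0, 1, 2, 3, 4, 5] x b)"
  using smooth_on_divide[OF W smooth_form_smooth[OF assms(1)]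
      smooth_form_smooth[OF word_smooth[of "[0, 1, 2, 3, 4, 5]"]]] vol_nonzero[OF _ b]
  by blast

text \<open>The pointwise expansion says nothing about the dependence on \<open>x\<close>, whereas
  multipliers in the ideal must be smooth. Wedging with the complementary word and dividing by the
  volume word, both on a fixed basis, exhibits each coefficient as a quotient of smooth
  functions.\<close>

lemma d_alpha123:
  obtains r m where "\<And>i. smooth_on W (r i)" "smooth_on W m"
    "\<And>x. x \<in> W \<Longrightarrow> ext_d 3 (alpha123 \<alpha>) x = (\<lambda>e. r 3 x * word Th [0, 1, 2, 3] x e + r 4 x * word Th [0, 1, 2, 4] x e +
    r (5 :: nat) x * word Th [0, 1, 2, 5] x e + m x * wedge 2 2 (cplx_form \<eta>) (cplx_form \<eta>) x e)"
proof -
  let ?D = "ext_d 3 (alpha123 \<alpha>)"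
  obtain b :: "nat \<Rightarrow> real^6" where "b ` {..<DIM(real^6)} = Basis" by (rule basis_enum)
  then have b: "span (b ` {..<6}) = UNIV" by simp
  define k where "k l x = wedge 4 2 ?D (word Th l) x b / word Th [0, 1, 2, 3, 4, 5] x b" for l x
  have k: "smooth_on W (k l)" if "length l = 2" for l
    unfolding k_def
    by (rule smooth_coeff[OF _ b])
       (use smooth_form_wedge[OF W smooth_form_ext_d[OF W alpha123_smooth] word_smooth'[OF that]] in simp)
  \<comment> \<open>The minus sign comes from sorting \<open>[0, 1, 2, 4, 3, 5]\<close>, and the
    factor \<open>2\<close> in \<open>m\<close> undoes the \<open>1 / 2\<close> of
    \<open>\<eta>2_word\<close>.\<close>
  define r where "r i x = (if i = (3 :: nat) then k [4, 5] x else if i = 4 then - k [3, 5] x else k [3, 4] x)" for i x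
  define m where "m x = 2 * k [0, 3] x" for x
  show ?thesis
  proof (rule that[of r m])
    show "smooth_on W (r i)" for i
      unfolding r_def[abs_def] using k[of "[4, 5]"] smooth_on_minus[OF W k[of "[3, 5]"]] k[of "[3, 4]"]
      by (cases "i = 3"; cases "i = 4") auto
    show "smooth_on W m" unfolding m_def[abs_def] using k[of "[0, 3]"] by (intro smooth_on_mult[OF W]) auto
    fix x assume x: "x \<in> W"
    note c = Th_covector[OF x]
    from d_alpha123_pointwise[OF x] obtain r' m' where D: "?D x = (\<lambda>e. r' 3 * word Th [0, 1, 2, 3] x e + r' 4 * word Th [0, 1, 2, 4] x e +
      r' (5 :: nat) * word Th [0, 1, 2, 5] x e + m' * (\<epsilon> * word Th [0, 1, 3, 4] x e + \<epsilon> * word Th [0, 2, 3, 5] x e + word Th [1, 2, 4, 5] x e))"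
      by (elim exE)
    note V = vol_nonzero[OF x b]
    have w: "wedge 4 2 ?D (word Th l) x b = r' 3 * ewedge 4 2 (word Th [0, 1, 2, 3] x) (word Th l x) b +
      r' 4 * ewedge 4 2 (word Th [0, 1, 2, 4] x) (word Th l x) b +
      r' 5 * ewedge 4 2 (word Th [0, 1, 2, 5] x) (word Th l x) b +
      m' * (\<epsilon> * ewedge 4 2 (word Th [0, 1, 3, 4] x) (word Th l x) b +
        \<epsilon> * ewedge 4 2 (word Th [0, 2, 3, 5] x) (word Th l x) b + ewedge 4 2 (word Th [1, 2, 4, 5] x) (word Th l x) b)" for l
      unfolding wedge_ewedge D by (simp only: ewedge_mult_left ewedge_add_left)
    note ws = word_append[of Th x, OF c] word_not_distinct[of Th x, OF c] word_unsorted[of Th x, OF c]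
    have "k [4, 5] x = r' 3" using V by (simp add: k_def w ws del: word.simps)
    moreover have "k [3, 5] x = - r' 4" using V by (simp add: k_def w ws del: word.simps)
    moreover have "k [3, 4] x = r' 5" using V by (simp add: k_def w ws del: word.simps)
    moreover have "k [0, 3] x = m'" using V by (simp add: k_def w ws del: word.simps)
    ultimately show "?D x = (\<lambda>e. r 3 x * word Th [0, 1, 2, 3] x e + r 4 x * word Th [0, 1, 2, 4] x e +
      r 5 x * word Th [0, 1, 2, 5] x e + m x * wedge 2 2 (cplx_form \<eta>) (cplx_form \<eta>) x e)"
      unfolding D \<eta>2_word[OF x] by (simp add: r_def m_def del: word.simps)
  qed
qed

text \<open>A 5-form is a combination of the six words that omit one letter. Wedging with
  \<open>Th A\<close> isolates the coefficient of the word without \<open>A\<close>, up to the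
  sorting sign \<open>s A\<close>, and shows that it is smooth.\<close>

lemma d_\<eta>2:
  obtains c where "\<And>A. A < 6 \<Longrightarrow> smooth_on W (c A)"
    "\<And>x. x \<in> W \<Longrightarrow> ext_d 4 (wedge 2 2 (cplx_form \<eta>) (cplx_form \<eta>)) x =
      (\<lambda>e. \<Sum>A<6. c A x * word Th (filter (\<lambda>i. i \<noteq> A) [0..<6]) x e)"
proof -
  let ?P = "ext_d 4 (wedge 2 2 (cplx_form \<eta>) (cplx_form \<eta>))"
  let ?h = "\<lambda>A. filter (\<lambda>i. i \<noteq> A) [0..<6]"
  obtain b :: "nat \<Rightarrow> real^6" where "b ` {..<DIM(real^6)} = Basis" by (rule basis_enum)
  then have b: "span (b ` {..<6}) = UNIV" by simp
  have sP: "smooth_form W 5 ?P" using smooth_form_ext_d[OF W \<eta>2_smooth] by simp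
  define s where "s A = complex_of_int (wsgn (A # ?h A))" for A
  have up: "[0..<6] = [0, 1, 2, 3, 4, 5 :: nat]" by (simp add: upt_rec)
  have A6: "A = 0 \<or> A = 1 \<or> A = 2 \<or> A = 3 \<or> A = 4 \<or> A = 5" if "A < 6" for A :: nat
    using that by linarith
  have s: "s A \<noteq> 0" if "A < 6" for A
    using A6[OF that] by (elim disjE) (simp_all add: s_def up)
  have srt: "sort (A # ?h A) = [0, 1, 2, 3, 4, 5]" if "A < 6" for A
    using A6[OF that] by (elim disjE) (simp_all add: up)
  define k where "k A x = (wedge 1 5 (Th A) ?P x b / word Th [0, 1, 2, 3, 4, 5] x b) / s A" for A x
  show ?thesis
  proof (rule that[of k])
    show "smooth_on W (k A)" if "A < 6" for A
      unfolding k_def[abs_def]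
      by (rule smooth_on_divide[OF W smooth_coeff[OF _ b] smooth_on_const])
         (use smooth_form_wedge[OF W Th_smooth sP] s[OF that] in simp_all)
    fix x assume x: "x \<in> W"
    note c = Th_covector[OF x]
    obtain E z where d: "dual Th x 6 E z" using dual_Th[OF x] by blast
    have d6: "dual Th x (Suc 5) E z" using d by simp
    obtain k' where P: "?P x = (\<lambda>e. \<Sum>A<6. k' A * word Th (?h A) x e)"
      using covector_cotop_word[of Th x, OF c d6 smooth_formD[OF sP x]] by auto
    note V = vol_nonzero[OF x b]
    have "k A x = k' A" if A: "A < 6" for A
    proof -
      have len: "length (?h B) = 5" if "B < 6" for B
        using A6[OF that] by (elim disjE) (simp_all add: up)
      have e: "ewedge 1 5 (Th A x) (word Th (?h B) x) b = word Th (A # ?h B) x b" if "B < 6" for B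
        by (simp only: word_Cons len[OF that])
      have "wedge 1 5 (Th A) ?P x b = (\<Sum>B<6. k' B * ewedge 1 5 (Th A x) (word Th (?h B) x) b)"
        unfolding wedge_ewedge P by (simp only: ewedge_sum_right ewedge_mult_right)
      also have "\<dots> = (\<Sum>B<6. if B = A then k' A * word Th (A # ?h A) x b else 0)"
      proof (rule sum.cong[OF refl])
        fix B :: nat assume "B \<in> {..<6}"
        then have B: "B < 6" by simp
        show "k' B * ewedge 1 5 (Th A x) (word Th (?h B) x) b = (if B = A then k' A * word Th (A # ?h A) x b else 0)"
        proof (cases "B = A")
          case False
          then have "\<not> distinct (A # ?h B)" using A by simp
          from word_not_distinct[of Th x, OF c this, of b] show ?thesis unfolding e[OF B] using False by simp
        qed (simp add: e[OF A] del: word.simps)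
      qed
      also have "\<dots> = k' A * word Th (A # ?h A) x b" using A by simp
      also have "word Th (A # ?h A) x b = s A * word Th [0, 1, 2, 3, 4, 5] x b"
        using word_sort[of Th x "A # ?h A" b, OF c] unfolding s_def srt[OF A] .
      finally show ?thesis using V s[OF A] by (simp add: k_def)
    qed
    then show "?P x = (\<lambda>e. \<Sum>A<6. k A x * word Th (?h A) x e)" unfolding P by simp
  qed
qed

lemma system_generators_smooth:
  assumes "(k, \<phi>) \<in> (system_generators \<alpha> \<eta> :: (nat \<times> ('r::finite total, real) form) set)"
  shows "smooth_form (system_domain W) k \<phi>"
proof -
  note X = open_system_domain[OF W, where 'a='r]
  note F = curv_form_smooth[where \<alpha>=\<alpha>, OF W \<alpha>_smooth]
  have "smooth_form (system_domain W) 5 (F_alpha \<alpha> (a :: 'r) b)" for a b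
    using smooth_form_wedge[OF X F smooth_form_pull_sys[OF W alpha123_smooth]] by (simp add: F_alpha_def)
  moreover have "smooth_form (system_domain W) 6 (F_eta \<alpha> \<eta> (a :: 'r) b)" for a b
    using smooth_form_wedge[OF X F smooth_form_pull_sys[OF W \<eta>2_smooth]] by (simp add: F_eta_def)
  ultimately show ?thesis
    using assms by (auto simp: system_generators_def intro: smooth_form_Re[OF X] smooth_form_Im[OF X])
qed

section \<open>The curvature wedged with monomials\<close>

definition curv_word :: "'r::finite \<Rightarrow> 'r \<Rightarrow> nat list \<Rightarrow> ('r total, complex) form" where
  "curv_word a b l = wedge 2 (length l) (curv_form \<alpha> a b) (pull_fst (word Th l))"

lemma pull_fst_at: "pull_fst \<phi> z = (\<lambda>e. \<phi> (fst z) (\<lambda>i. fst (e i)))"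
  by (simp add: fun_eq_iff pull_fst_def)

lemma curv_word_at:
  "length l = n \<Longrightarrow> curv_word a b l z = ewedge 2 n (curv_form \<alpha> a b z) (\<lambda>e. word Th l (fst z) (\<lambda>i. fst (e i)))"
  by (simp add: curv_word_def wedge_ewedge pull_fst_at)

abbreviation in_ideal :: "nat \<Rightarrow> ('r::finite total, complex) form \<Rightarrow> bool" where
  "in_ideal \<equiv> cideal (system_domain W) (system_generators \<alpha> \<eta>)"

context
  fixes r :: "'r::finite itself"
begin

lemma open_X: "open (system_domain W :: 'r total set)"
  by (rule open_system_domain[OF W])

lemmas gens = system_generators_smooth[where 'r='r]

lemma in_ideal_mult: "smooth_form (system_domain W) l \<beta> \<Longrightarrow> in_ideal k \<Phi> \<Longrightarrow> in_ideal (l + k) (wedge l k \<beta> (\<Phi> :: ('r total, complex) form))"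
  by (rule cideal_mult[OF open_X gens])

lemma in_ideal_cong: "in_ideal k \<Phi> \<Longrightarrow> (\<And>z. z \<in> system_domain W \<Longrightarrow> \<Psi> z = \<Phi> z) \<Longrightarrow> in_ideal k (\<Psi> :: ('r total, complex) form)"
  by (rule cideal_cong[OF open_X gens])

lemma in_ideal_add: "in_ideal k \<Phi> \<Longrightarrow> in_ideal k \<Psi> \<Longrightarrow> in_ideal k (\<lambda>z e. \<Phi> z e + (\<Psi> :: ('r total, complex) form) z e)"
  by (rule cideal_add[OF open_X gens])

lemma in_ideal_smooth: "in_ideal k \<Phi> \<Longrightarrow> smooth_form (system_domain W) k (\<Phi> :: ('r total, complex) form)"
  by (rule cideal_smooth[OF open_X gens])

lemma in_ideal_minus: "in_ideal k \<Phi> \<Longrightarrow> in_ideal k (\<lambda>z e. - (\<Phi> :: ('r total, complex) form) z e)"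
  by (rule cideal_minus[OF open_X gens])

lemma in_ideal_cnj: "in_ideal k \<Phi> \<Longrightarrow> in_ideal k (cnj_form (\<Phi> :: ('r total, complex) form))"
  by (rule cideal_cnj[OF open_X gens])

lemma in_ideal_sum: "(\<And>i. i \<in> I \<Longrightarrow> in_ideal k (\<Phi> i)) \<Longrightarrow> in_ideal k (\<lambda>z e. \<Sum>i\<in>I. (\<Phi> i :: ('r total, complex) form) z e)"
  by (rule cideal_sum[OF open_X gens])

lemma in_ideal_scale: "smooth_on (system_domain W) c \<Longrightarrow> in_ideal k \<Phi> \<Longrightarrow> in_ideal k (\<lambda>z e. c z * (\<Phi> :: ('r total, complex) form) z e)"
  by (rule cideal_scale[OF open_X gens])

lemma F_smooth: "smooth_form (system_domain W) 2 (curv_form \<alpha> (a :: 'r) b)"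
  by (rule curv_form_smooth[where \<alpha>=\<alpha>, OF W \<alpha>_smooth])

lemma A_smooth: "smooth_form (system_domain W) 1 (conn_form \<alpha> (a :: 'r) b)"
  by (rule conn_form_smooth[where \<alpha>=\<alpha>, OF W \<alpha>_smooth])

lemma pull_word_smooth: "length l = n \<Longrightarrow> smooth_form (system_domain W :: 'r total set) n (pull_fst (word Th l))"
  by (rule smooth_form_pull_sys[OF W word_smooth'])

lemma F_eta_in_ideal: "in_ideal 6 (F_eta \<alpha> \<eta> (a :: 'r) b)"
  unfolding cideal_def by (intro conjI alg_ideal.gen) (auto simp: system_generators_def)

lemma F_alpha_in_ideal: "in_ideal 5 (F_alpha \<alpha> (a :: 'r) b)"
  unfolding cideal_def by (intro conjI alg_ideal.gen) (auto simp: system_generators_def)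

lemma curv_word_012: "in_ideal 5 (curv_word (a :: 'r) b [0, 1, 2])"
proof (rule in_ideal_cong[OF F_alpha_in_ideal[of a b]])
  fix z :: "'r total" assume "z \<in> system_domain W"
  then have "alpha123 \<alpha> (fst z) = word Th [0, 1, 2] (fst z)"
    by (intro alpha123_word) (auto simp: system_domain_def)
  then show "curv_word a b [0, 1, 2] z = F_alpha \<alpha> a b z"
    by (simp add: curv_word_at[of _ 3] F_alpha_def wedge_ewedge pull_fst_at del: word.simps)
qed

text \<open>\<open>F\<close> is skew-Hermitian: conjugating the generator for the transposed entry
  \<open>b a\<close> gives minus the product of the entry \<open>a b\<close> with the conjugate
  volume.\<close>

lemma curv_word_345: "in_ideal 5 (curv_word (a :: 'r) b [3, 4, 5])"
proof (rule in_ideal_cong[OF in_ideal_minus[OF in_ideal_cnj[OF curv_word_012[of b a]]]])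
  fix z :: "'r total" assume z: "z \<in> system_domain W"
  have F: "curv_form \<alpha> a b z = (\<lambda>e. - cnj (curv_form \<alpha> b a z e))"
    by (rule ext) (rule curv_form_skew[where \<alpha>=\<alpha>, OF W \<alpha>_smooth z])
  have w: "word Th [3, 4, 5] (fst z) e = cnj (word Th [0, 1, 2] (fst z) e)" for e
    by (simp add: wedge_ewedge ewedge_cnj Th_simps)
  show "curv_word a b [3, 4, 5] z = (\<lambda>e. - cnj (curv_word b a [0, 1, 2] z e))"
    by (simp add: curv_word_at[of _ 3] F w ewedge_cnj ewedge_minus_left fun_eq_iff del: word.simps)
qed

text \<open>\<open>F\<close> has even degree, so the additional letters can be moved to its left,
  where the ideal absorbs them.\<close>

lemma curv_word_append:
  assumes "in_ideal (2 + length p) (curv_word (a :: 'r) b p)"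
  shows "in_ideal (length m + (2 + length p)) (curv_word a b (m @ p))"
proof (rule in_ideal_cong[OF in_ideal_mult[OF pull_word_smooth[OF refl] assms]])
  fix z :: "'r total" assume z: "z \<in> system_domain W"
  note curv_form_covector = smooth_formD[OF F_smooth[of a b] z]
  note cm = smooth_formD[OF pull_word_smooth[OF refl, of m] z]
  note cp = smooth_formD[OF pull_word_smooth[OF refl, of p] z]
  have x: "fst z \<in> W" using z by (auto simp: system_domain_def)
  have mp: "pull_fst (word Th (m @ p)) z = ewedge (length m) (length p) (pull_fst (word Th m) z) (pull_fst (word Th p) z)"
  proof -
    have "ewedge (length m) (length p) (pull_fst (word Th m) z) (pull_fst (word Th p) z) =
      wedge (length m) (length p) (pull_fst (word Th m)) (pull_fst (word Th p)) z"
      by (rule wedge_ewedge[symmetric])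
    also have "\<dots> = pull_fst (wedge (length m) (length p) (word Th m) (word Th p)) z"
      by (simp only: wedge_pull)
    also have "\<dots> = pull_fst (word Th (m @ p)) z"
      by (simp add: pull_fst_at wedge_ewedge word_append[of Th "fst z", OF Th_covector[OF x]] del: word.simps)
    finally show ?thesis ..
  qed
  have "curv_word a b (m @ p) z = ewedge 2 (length m + length p) (curv_form \<alpha> a b z)
      (ewedge (length m) (length p) (pull_fst (word Th m) z) (pull_fst (word Th p) z))"
    by (simp add: curv_word_def wedge_ewedge mp)
  also have "\<dots> = ewedge (2 + length m) (length p) (ewedge 2 (length m) (curv_form \<alpha> a b z) (pull_fst (word Th m) z)) (pull_fst (word Th p) z)"
    by (rule ewedge_assoc[OF curv_form_covector cm cp, symmetric])
  also have "ewedge 2 (length m) (curv_form \<alpha> a b z) (pull_fst (word Th m) z) =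
      ewedge (length m) 2 (pull_fst (word Th m) z) (curv_form \<alpha> a b z)"
    by (subst ewedge_commute[OF curv_form_covector cm]) (simp add: power_mult)
  also have "ewedge (2 + length m) (length p) \<dots> (pull_fst (word Th p) z) =
      ewedge (length m) (2 + length p) (pull_fst (word Th m) z) (ewedge 2 (length p) (curv_form \<alpha> a b z) (pull_fst (word Th p) z))"
    using ewedge_assoc[OF cm curv_form_covector cp] by (simp add: add.commute)
  finally show "curv_word a b (m @ p) z = wedge (length m) (2 + length p) (pull_fst (word Th m)) (curv_word a b p) z"
    by (simp add: curv_word_def wedge_ewedge)
qed

lemma curv_word_sort:
  assumes "in_ideal n (curv_word (a :: 'r) b l)" "distinct l"
  shows "in_ideal n (curv_word a b (sort l))"
proof (rule in_ideal_cong[OF in_ideal_scale[OF smooth_on_const[where c="of_int (wsgn l)"] assms(1)]])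
  fix z :: "'r total" assume z: "z \<in> system_domain W"
  then have x: "fst z \<in> W" by (auto simp: system_domain_def)
  have "wsgn l * wsgn l = 1" if "distinct l" for l
    using that by (induction l) (auto simp: algebra_simps simp flip: power_mult_distrib)
  then have s: "complex_of_int (wsgn l) * of_int (wsgn l) = 1" using assms(2) by (metis of_int_1 of_int_mult)
  have w: "word Th l (fst z) = (\<lambda>e. of_int (wsgn l) * word Th (sort l) (fst z) e)"
    by (rule ext) (rule word_sort[of Th "fst z", OF Th_covector[OF x]])
  show "curv_word a b (sort l) z = (\<lambda>e. of_int (wsgn l) * curv_word a b l z e)"
    unfolding curv_word_def wedge_ewedge pull_fst_def w ewedge_mult_right
    by (simp add: mult.assoc[symmetric] s)
qed

lemma curv_word_in_ideal:
  assumes p: "p = [0, 1, 2] \<or> p = [3, 4, 5]" and "distinct (m @ p)" "l = sort (m @ p)" "n = length m + 5"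
  shows "in_ideal n (curv_word (a :: 'r) b l)"
proof -
  have l: "2 + length p = 5" using p by auto
  have "in_ideal (2 + length p) (curv_word a b p)"
    unfolding l using p curv_word_012[of a b] curv_word_345[of a b] by blast
  from curv_word_append[OF this, of m] have "in_ideal (length m + 5) (curv_word a b (m @ p))"
    unfolding l .
  from curv_word_sort[OF this assms(2)] show ?thesis using assms(3,4) by simp
qed

text \<open>Treats both families of generators. By the Bianchi identity,
  \<open>d (F \<and> y)\<close> consists of products of connection forms with entries of
  \<open>F \<and> y\<close> and of the term \<open>F \<and> dy\<close>; only the latter depends on
  the geometry.\<close>

lemma d_curv_wedge_in_ideal:
  assumes y: "smooth_form W n y"
    and 1: "\<And>a b. in_ideal (n + 2) (wedge 2 n (curv_form \<alpha> (a :: 'r) b) (pull_fst y))"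
    and 2: "\<And>a b. in_ideal (n + 3) (wedge 2 (Suc n) (curv_form \<alpha> (a :: 'r) b) (pull_fst (ext_d n y)))"
  shows "in_ideal (n + 3) (ext_d (2 + n) (wedge 2 n (curv_form \<alpha> (a :: 'r) b) (pull_fst y)))"
proof -
  let ?F = "curv_form \<alpha>" and ?A = "conn_form \<alpha>" and ?Y = "pull_fst y"
  have Y: "smooth_form (system_domain W :: 'r total set) n ?Y" by (rule smooth_form_pull_sys[OF W y])
  have m: "in_ideal (n + 3) (wedge 1 (2 + n) (?A c d) (wedge 2 n (?F e f) ?Y))" for c d e f :: 'r
  proof -
    have eq: "1 + (2 + n) = n + 3" "n + 2 = 2 + n" by simp_all
    show ?thesis
      using in_ideal_mult[OF A_smooth[of c d] 1[of e f, unfolded eq(2)]] unfolding eq(1) .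
  qed
  have "in_ideal (n + 3) (\<lambda>z e. (\<Sum>k\<in>UNIV. wedge 1 (2 + n) (?A k b) (wedge 2 n (?F a k) ?Y) z e +
      - wedge 1 (2 + n) (?A a k) (wedge 2 n (?F k b) ?Y) z e) +
      wedge 2 (Suc n) (?F a b) (pull_fst (ext_d n y)) z e)"
    by (intro in_ideal_add in_ideal_sum in_ideal_minus m 2)
  then show ?thesis
  proof (rule in_ideal_cong)
    fix z :: "'r total" assume z: "z \<in> system_domain W"
    then have x: "fst z \<in> W" by (auto simp: system_domain_def)
    note curv_form_covector = smooth_formD[OF F_smooth z] and cA = smooth_formD[OF A_smooth z] and cY = smooth_formD[OF Y z]
    have dF: "ext_d 2 (?F a b) z = (\<lambda>e. \<Sum>k\<in>UNIV. ewedge 2 1 (?F a k z) (?A k b z) e - ewedge 1 2 (?A a k z) (?F k b z) e)"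
      unfolding wedge_ewedge[symmetric]
      by (rule ext, rule bianchi[OF open_X z A_smooth]) (rule curv_form_def)
    have fa: "ewedge 3 n (ewedge 2 1 (?F a k z) (?A k b z)) (?Y z) = ewedge 1 (2 + n) (?A k b z) (ewedge 2 n (?F a k z) (?Y z))" for k
    proof -
      have "ewedge 2 1 (?F a k z) (?A k b z) = ewedge 1 2 (?A k b z) (?F a k z)"
        by (subst ewedge_commute[OF curv_form_covector cA]) simp
      then show ?thesis using ewedge_assoc[OF cA[of k b] curv_form_covector[of a k] cY] by simp
    qed
    have af: "ewedge 3 n (ewedge 1 2 (?A a k z) (?F k b z)) (?Y z) = ewedge 1 (2 + n) (?A a k z) (ewedge 2 n (?F k b z) (?Y z))" for k
      using ewedge_assoc[OF cA[of a k] curv_form_covector[of k b] cY] by simp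
    have dY: "ext_d n ?Y z = pull_fst (ext_d n y) z" by (rule ext_d_pull[OF y x])
    show "ext_d (2 + n) (wedge 2 n (?F a b) ?Y) z = (\<lambda>e. (\<Sum>k\<in>UNIV. wedge 1 (2 + n) (?A k b) (wedge 2 n (?F a k) ?Y) z e +
      - wedge 1 (2 + n) (?A a k) (wedge 2 n (?F k b) ?Y) z e) +
      wedge 2 (Suc n) (?F a b) (pull_fst (ext_d n y)) z e)"
    proof
      fix e
      have "ext_d (2 + n) (wedge 2 n (?F a b) ?Y) z e = ewedge 3 n (ext_d 2 (?F a b) z) (?Y z) e +
          ewedge 2 (Suc n) (?F a b z) (ext_d n ?Y z) e"
        using ext_d_wedge[OF open_X z F_smooth[of a b] Y, of e] by (simp add: wedge_ewedge)
      then show "ext_d (2 + n) (wedge 2 n (?F a b) ?Y) z e = (\<Sum>k\<in>UNIV. wedge 1 (2 + n) (?A k b) (wedge 2 n (?F a k) ?Y) z e +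
        - wedge 1 (2 + n) (?A a k) (wedge 2 n (?F k b) ?Y) z e) +
        wedge 2 (Suc n) (?F a b) (pull_fst (ext_d n y)) z e"
        unfolding dF dY ewedge_sum_left ewedge_diff_left fa af by (simp add: wedge_ewedge)
    qed
  qed
qed

lemma d_F_alpha_in_ideal: "in_ideal 6 (ext_d 5 (F_alpha \<alpha> (a :: 'r) b))"
proof -
  obtain r m where r: "\<And>i. smooth_on W (r i)" and m: "smooth_on W m"
    and D: "\<And>x. x \<in> W \<Longrightarrow> ext_d 3 (alpha123 \<alpha>) x = (\<lambda>e. r 3 x * word Th [0, 1, 2, 3] x e + r 4 x * word Th [0, 1, 2, 4] x e +
    r (5 :: nat) x * word Th [0, 1, 2, 5] x e + m x * wedge 2 2 (cplx_form \<eta>) (cplx_form \<eta>) x e)"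
    by (rule d_alpha123) (rule that, assumption+)
  have s: "smooth_on (system_domain W) (\<lambda>z :: 'r total. c (fst z))" if "smooth_on W c" for c :: "real^6 \<Rightarrow> complex"
    unfolding system_domain_def by (rule smooth_on_fst[OF W that])
  have w: "in_ideal 6 (curv_word (a :: 'r) b [0, 1, 2, i])" if "i \<in> {3, 4, 5}" for a b i
    by (rule curv_word_in_ideal[of "[0, 1, 2]" "[i]"]) (use that in auto)
  have "in_ideal 6 (wedge 2 4 (curv_form \<alpha> (a :: 'r) b) (pull_fst (ext_d 3 (alpha123 \<alpha>))))" for a b
  proof (rule in_ideal_cong)
    show "in_ideal 6 (\<lambda>z e. r 3 (fst z) * curv_word a b [0, 1, 2, 3] z e + r 4 (fst z) * curv_word a b [0, 1, 2, 4] z e +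
      r 5 (fst z) * curv_word a b [0, 1, 2, 5] z e + m (fst z) * F_eta \<alpha> \<eta> a b z e)"
      by (intro in_ideal_add in_ideal_scale s r m w F_eta_in_ideal) auto
    fix z :: "'r total" assume "z \<in> system_domain W"
    then have x: "fst z \<in> W" by (auto simp: system_domain_def)
    show "wedge 2 4 (curv_form \<alpha> a b) (pull_fst (ext_d 3 (alpha123 \<alpha>))) z = (\<lambda>e. r 3 (fst z) * curv_word a b [0, 1, 2, 3] z e + r 4 (fst z) * curv_word a b [0, 1, 2, 4] z e +
      r 5 (fst z) * curv_word a b [0, 1, 2, 5] z e + m (fst z) * F_eta \<alpha> \<eta> a b z e)"
      unfolding wedge_ewedge[of 2 4] pull_fst_at D[OF x]
      by (rule ext, simp only: ewedge_add_right ewedge_mult_right)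
         (simp add: curv_word_at[of _ 4] F_eta_def wedge_ewedge[of 2 4] pull_fst_at del: word.simps)
  qed
  then show ?thesis
    using d_curv_wedge_in_ideal[OF alpha123_smooth, of a b] F_alpha_in_ideal by (simp add: F_alpha_def)
qed

lemma d_F_eta_in_ideal: "in_ideal 7 (ext_d 6 (F_eta \<alpha> \<eta> (a :: 'r) b))"
proof -
  let ?P = "ext_d 4 (wedge 2 2 (cplx_form \<eta>) (cplx_form \<eta>))"
  let ?h = "\<lambda>A. filter (\<lambda>i. i \<noteq> A) [0..<6]"
  obtain c where c: "\<And>A. A < 6 \<Longrightarrow> smooth_on W (c A)"
    and P: "\<And>x. x \<in> W \<Longrightarrow> ?P x = (\<lambda>e. \<Sum>A<6. c A x * word Th (?h A) x e)"
    by (rule d_\<eta>2) (rule that, assumption+)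
  have s: "smooth_on (system_domain W) (\<lambda>z :: 'r total. c (fst z))" if "smooth_on W c" for c :: "real^6 \<Rightarrow> complex"
    unfolding system_domain_def by (rule smooth_on_fst[OF W that])
  have up: "[0..<6] = [0, 1, 2, 3, 4, 5 :: nat]" by (simp add: upt_rec)
  have h: "in_ideal 7 (curv_word (a :: 'r) b (?h A)) \<and> length (?h A) = 5" if "A < 6" for a b A
  proof -
    have "in_ideal 7 (curv_word a b [1, 2, 3, 4, 5])" "in_ideal 7 (curv_word a b [0, 2, 3, 4, 5])"
      "in_ideal 7 (curv_word a b [0, 1, 3, 4, 5])"
      by (rule curv_word_in_ideal[of "[3, 4, 5]" "[1, 2]"], simp_all)
         (rule curv_word_in_ideal[of "[3, 4, 5]" "[0, 2]"], simp_all,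
          rule curv_word_in_ideal[of "[3, 4, 5]" "[0, 1]"], simp_all)
    moreover have "in_ideal 7 (curv_word a b [0, 1, 2, 4, 5])" "in_ideal 7 (curv_word a b [0, 1, 2, 3, 5])"
      "in_ideal 7 (curv_word a b [0, 1, 2, 3, 4])"
      by (rule curv_word_in_ideal[of "[0, 1, 2]" "[4, 5]"], simp_all)
         (rule curv_word_in_ideal[of "[0, 1, 2]" "[3, 5]"], simp_all,
          rule curv_word_in_ideal[of "[0, 1, 2]" "[3, 4]"], simp_all)
    moreover have "A = 0 \<or> A = 1 \<or> A = 2 \<or> A = 3 \<or> A = 4 \<or> A = 5" using that by linarith
    ultimately show ?thesis by (elim disjE) (simp_all add: up)
  qed
  have "in_ideal 7 (wedge 2 5 (curv_form \<alpha> (a :: 'r) b) (pull_fst ?P))" for a b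
  proof (rule in_ideal_cong)
    show "in_ideal 7 (\<lambda>z e. \<Sum>A<6. c A (fst z) * curv_word a b (?h A) z e)"
      using h c by (intro in_ideal_sum in_ideal_scale s) auto
    fix z :: "'r total" assume "z \<in> system_domain W"
    then have x: "fst z \<in> W" by (auto simp: system_domain_def)
    show "wedge 2 5 (curv_form \<alpha> a b) (pull_fst ?P) z = (\<lambda>e. \<Sum>A<6. c A (fst z) * curv_word a b (?h A) z e)"
      unfolding wedge_ewedge[of 2 5] pull_fst_at P[OF x]
      by (rule ext, simp only: ewedge_sum_right ewedge_mult_right)
         (intro sum.cong refl, use h in \<open>simp add: curv_word_at[of _ 5]\<close>)
  qed
  then show ?thesis
    using d_curv_wedge_in_ideal[OF \<eta>2_smooth, of a b] F_eta_in_ideal by (simp add: F_eta_def)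
qed

lemma system_d_closed: "d_closed (system_ideal W \<alpha> \<eta> :: nat \<Rightarrow> ('r total, real) form \<Rightarrow> bool)"
  unfolding system_ideal_def
proof (rule alg_ideal_d_closed[OF open_X gens])
  fix k and \<phi> :: "('r total, real) form" assume "(k, \<phi>) \<in> system_generators \<alpha> \<eta>"
  then obtain a b where "k = 5 \<and> (\<phi> = Re_form (F_alpha \<alpha> a b) \<or> \<phi> = Im_form (F_alpha \<alpha> a b)) \<or>
     k = 6 \<and> (\<phi> = Re_form (F_eta \<alpha> \<eta> a b) \<or> \<phi> = Im_form (F_eta \<alpha> \<eta> a b))"
    by (auto simp: system_generators_def)
  then obtain \<Phi> where \<Phi>: "in_ideal k \<Phi>" "in_ideal (Suc k) (ext_d k \<Phi>)"
    and \<phi>: "\<phi> = Re_form \<Phi> \<or> \<phi> = Im_form \<Phi>"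
    using F_alpha_in_ideal[of a b] F_eta_in_ideal[of a b] d_F_alpha_in_ideal[of a b] d_F_eta_in_ideal[of a b]
    by (elim disjE conjE) auto
  note s\<Phi> = in_ideal_smooth[OF \<Phi>(1)]
  \<comment> \<open>\<open>L\<close> is the real or the imaginary part; both commute with the
    exterior derivative.\<close>
  obtain L :: "complex \<Rightarrow> real" where L: "bounded_linear L" "\<phi> = (\<lambda>z e. L (\<Phi> z e))"
    "alg_ideal (system_domain W) (system_generators \<alpha> \<eta>) (Suc k) (\<lambda>z e. L (ext_d k \<Phi> z e))"
    using \<phi> \<Phi>(2) bounded_linear_Re bounded_linear_Im unfolding cideal_def by blast
  have eq: "ext_d k \<phi> z = (\<lambda>e. L (ext_d k \<Phi> z e))" if "z \<in> system_domain W" for z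
    unfolding L(2) by (rule ext) (rule ext_d_linear[OF L(1) that s\<Phi>])
  have s\<phi>: "smooth_form (system_domain W) k \<phi>"
    using \<open>(k, \<phi>) \<in> system_generators \<alpha> \<eta>\<close> by (rule gens)
  show "alg_ideal (system_domain W) (system_generators \<alpha> \<eta>) (Suc k) (ext_d k \<phi>)"
    by (rule alg_ideal.cong[OF L(3) smooth_form_ext_d[OF open_X s\<phi>]]) (simp add: eq)
qed

end

end

section \<open>Polar spaces\<close>

lemma ideal_vanish:
  assumes "alg_ideal X G k \<phi>" and z: "z \<in> X"
    and g: "\<And>k \<phi> e. (k, \<phi>) \<in> G \<Longrightarrow> (\<And>i. e i \<in> S) \<Longrightarrow> \<phi> z e = 0"
    and e: "\<And>i. e i \<in> S"
  shows "\<phi> z e = 0"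
  using assms(1) e
proof (induction arbitrary: e)
  case (gen k \<phi>) then show ?case using g by blast
next
  case (mult l \<beta> k \<phi>)
  have "\<phi> z (\<lambda>i. e (\<sigma> (l + i))) = 0" for \<sigma> by (rule mult.IH) (rule mult.prems)
  then show ?case by (simp add: wedge_def)
next
  case (cong k \<phi> \<psi>) then show ?case using z by simp
qed simp_all

text \<open>For polar equations the generators must also vanish on \<open>S\<close> itself:
  contracting a product \<open>\<beta> \<and> \<phi>\<close> with \<open>v\<close> leaves a term in
  which \<open>v\<close> is absorbed by \<open>\<beta>\<close>.\<close>

lemma ideal_vanish_contract:
  assumes X: "open X" and G: "\<And>k \<phi>. (k, \<phi>) \<in> G \<Longrightarrow> smooth_form X k \<phi>"
    and \<phi>: "alg_ideal X G k \<phi>" and z: "z \<in> X"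
    and g: "\<And>k \<phi> e. (k, \<phi>) \<in> G \<Longrightarrow> (\<And>i. e i \<in> S) \<Longrightarrow> \<phi> z e = 0"
    and gv: "\<And>k \<phi> e. (k, \<phi>) \<in> G \<Longrightarrow> (\<And>i. e i \<in> S) \<Longrightarrow> \<phi> z (case_nat v e) = 0"
    and e: "\<And>i. e i \<in> S"
  shows "\<phi> z (case_nat v e) = 0"
  using \<phi> e
proof (induction arbitrary: e)
  case (gen k \<phi>) then show ?case using gv by blast
next
  case (mult l \<beta> k \<phi>)
  note s = alg_ideal_smooth[OF X G mult.hyps(2)]
  have 1: "\<phi> z (\<lambda>i. e (\<sigma> i)) = 0" for \<sigma> :: "nat \<Rightarrow> nat"
    by (rule ideal_vanish[OF mult.hyps(2) z, where S=S], rule g, assumption, assumption, rule mult.prems)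
  have 2: "\<phi> z (case_nat v (\<lambda>i. e (\<sigma> i))) = 0" for \<sigma> :: "nat \<Rightarrow> nat"
    by (rule mult.IH) (rule mult.prems)
  show ?case
  proof (cases "l + k")
    case 0
    then show ?thesis using mult.IH[OF mult.prems] by (simp add: wedge_ewedge ewedge_0_0)
  next
    case (Suc n)
    have a: "ewedge p q f (\<phi> z) e = 0" for p q f
      unfolding ewedge_def by (simp add: 1[of "\<lambda>i. \<sigma> (p + i)" for \<sigma>])
    have b: "ewedge p q f (\<lambda>e. \<phi> z (case_nat v e)) e = 0" for p q f
      unfolding ewedge_def by (simp add: 2[of "\<lambda>i. \<sigma> (p + i)" for \<sigma>])
    have "wedge l k \<beta> \<phi> z (case_nat v e) =
      (if l = 0 then 0 else ewedge (l - 1) k (\<lambda>e. \<beta> z (case_nat v e)) (\<phi> z) e) +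
      (- 1) ^ l * (if k = 0 then 0 else ewedge l (k - 1) (\<beta> z) (\<lambda>e. \<phi> z (case_nat v e)) e)"
      unfolding wedge_ewedge by (rule ewedge_contract[OF smooth_formD[OF mult.hyps(1) z] smooth_formD[OF s z] Suc])
    then show ?thesis unfolding a b by (simp only: if_cancel mult_zero_right add_0)
  qed
next
  case (cong k \<phi> \<psi>) then show ?case using z by simp
qed simp_all

lemma covector_zero_slot:
  assumes "covector k f" "i < k" "e i = 0" shows "f e = 0"
  using linear_0[OF covector_linear[OF assms(1,2), of e]] assms(3) by (metis fun_upd_triv)

lemma linear_contract0: "covector (Suc k) f \<Longrightarrow> linear (\<lambda>v. f (case_nat v e))"
proof -
  assume f: "covector (Suc k) f"
  define e0 where "e0 = case_nat undefined e"
  have eq: "case_nat w e = e0(0 := w)" for w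
    by (auto simp: fun_eq_iff e0_def split: nat.splits)
  show ?thesis unfolding eq using covector_linear[OF f, of 0 e0] by blast
qed

lemma word_contract:
  fixes T :: "nat \<Rightarrow> ('v::real_vector, 'a::real_normed_field) form"
  assumes T: "\<And>i. covector 1 (T i x)"
  shows "word T (i # l) x (case_nat u e) = T i x (\<lambda>_. u) * word T l x e -
    (if l = [] then 0 else ewedge 1 (length l - 1) (T i x) (\<lambda>e. word T l x (case_nat u e)) e)"
proof -
  have 0: "covector 0 (\<lambda>e. T i x (case_nat u e))"
    by (rule covector_contract, fold One_nat_def) (rule T)
  have tv: "T i x (case_nat u e) = T i x (\<lambda>_. u)" by (rule covector_cong[OF T]) auto
  have cw: "covector (length l) (word T l x)" by (rule covector_word[of T x, OF T])
  show ?thesis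
    unfolding word_Cons ewedge_contract[OF T cw, of "length l", simplified]
    by (auto simp: ewedge_0_left[OF 0 cw] tv)
qed

text \<open>Subtracting the conjugate transpose is a map with the Hermitian matrices as kernel and
  the skew-Hermitian ones as image. Multiplication by \<open>\<i>\<close> identifies the two spaces,
  so each has half the real dimension.\<close>

lemma hermitian_dim:
  "dim {A :: complex^'r^'r. \<forall>a b. A $ a $ b = cnj (A $ b $ a)} = CARD('r::finite) ^ 2"
proof -
  let ?H = "{A :: complex^'r^'r. \<forall>a b. A $ a $ b = cnj (A $ b $ a)}"
  let ?K = "{A :: complex^'r^'r. \<forall>a b. A $ a $ b = - cnj (A $ b $ a)}"
  define f :: "complex^'r^'r \<Rightarrow> complex^'r^'r" where "f A = (\<chi> a b. A $ a $ b - cnj (A $ b $ a))" for A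
  have f: "linear f" by (rule linearI) (simp_all add: f_def vec_eq_iff algebra_simps)
  have "{A \<in> UNIV. f A = 0} = ?H" by (auto simp: f_def vec_eq_iff)
  moreover have "f ` UNIV = ?K"
  proof (intro equalityI subsetI)
    fix A assume A: "A \<in> ?K"
    have "f (\<chi> a b. A $ a $ b / 2) = A"
    proof -
      have "A $ a $ b = - cnj (A $ b $ a)" for a b using A by blast
      then have "cnj (A $ b $ a) = - A $ a $ b" for a b by (metis add.inverse_inverse)
      then show ?thesis by (simp add: f_def vec_eq_iff)
    qed
    then show "A \<in> f ` UNIV" by (metis rangeI)
  qed (auto simp: f_def)
  ultimately have "dim ?H + dim ?K = DIM(complex^'r^'r)"
    using dim_kernel_image[OF f subspace_UNIV] by simp
  moreover have "dim ?K = dim ?H"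
  proof -
    define g :: "complex^'r^'r \<Rightarrow> complex^'r^'r" where "g A = (\<chi> a b. \<i> * A $ a $ b)" for A
    have g: "linear g" by (rule linearI) (simp_all add: g_def vec_eq_iff algebra_simps)
    have inj: "inj g" by (rule injI) (simp add: g_def vec_eq_iff)
    have "g ` ?H = ?K"
    proof (intro equalityI subsetI)
      fix A assume A: "A \<in> ?K"
      have k: "A $ a $ b = - cnj (A $ b $ a)" for a b using A by blast
      have c: "cnj (A $ b $ a) = - A $ a $ b" for a b using k[of a b] by (metis add.inverse_inverse)
      have "(\<chi> a b. - \<i> * A $ a $ b) \<in> ?H" by (simp add: c)
      moreover have "g (\<chi> a b. - \<i> * A $ a $ b) = A"
        by (simp add: g_def vec_eq_iff mult.assoc[symmetric])
      ultimately show "A \<in> g ` ?H" by (metis (no_types, lifting) image_eqI)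
    next
      fix A assume "A \<in> g ` ?H"
      then obtain B where B: "B \<in> ?H" "A = g B" by blast
      have h: "B $ a $ b = cnj (B $ b $ a)" for a b using B(1) by blast
      have "A $ a $ b = - cnj (A $ b $ a)" for a b
        unfolding B(2) by (simp add: g_def h[symmetric])
      then show "A \<in> ?K" by blast
    qed
    moreover have "dim (g ` ?H) = dim ?H" by (rule dim_image_eq[OF g]) (rule inj_on_subset[OF inj subset_UNIV])
    ultimately show ?thesis by simp
  qed
  ultimately show ?thesis by (simp add: power2_eq_square)
qed

context unitary_system
begin

text \<open>
  By \<open>vol_contract\<close> below, up to a factor \<open>\<Sum>\<^sub>j cnj \<kappa>\<^sub>j \<alpha>\<^sup>j - \<kappa>\<^sub>j cnj \<alpha>\<^sup>j\<close> is the conormal of the hyperplane spanned by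
  \<open>e 0, \<dots>, e 4\<close>, where \<open>\<kappa>\<^sub>j\<close> is \<open>kap x j e\<close>; \<open>Qf\<close> is its norm with respect to \<open>\<eta>\<close>.
\<close>

definition kap :: "real^6 \<Rightarrow> 3 \<Rightarrow> (nat \<Rightarrow> real^6) \<Rightarrow> complex" where
  "kap x j e = (if j = 1 then word Th [0, 1, 2, 4, 5] x e else if j = 2 then - word Th [0, 1, 2, 3, 5] x e
     else word Th [0, 1, 2, 3, 4] x e)"

text \<open>The coefficient, up to sign, of the conjugate of the vertical coordinate
  \<open>p\<^sub>j\<close> in the contraction of \<open>F_alpha\<close>, see
  \<open>F_alpha_vert\<close>.\<close>

definition chi :: "real^6 \<Rightarrow> 3 \<Rightarrow> (nat \<Rightarrow> real^6) \<Rightarrow> complex" where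
  "chi x j = (if j = 1 then word Th [3, 0, 1, 2] x else if j = 2 then word Th [4, 0, 1, 2] x
     else word Th [5, 0, 1, 2] x)"

definition Qf :: "real^6 \<Rightarrow> (nat \<Rightarrow> real^6) \<Rightarrow> complex" where
  "Qf x e = (\<Sum>j\<in>UNIV. sig \<epsilon> j * (kap x j e * cnj (kap x j e)))"

lemma kap_simps: "kap x 1 = word Th [0, 1, 2, 4, 5] x" "kap x 2 = (\<lambda>e. - word Th [0, 1, 2, 3, 5] x e)"
  "kap x 3 = word Th [0, 1, 2, 3, 4] x"
  by (simp_all add: kap_def three_neq fun_eq_iff del: word.simps)

lemma chi_simps: "chi x 1 = word Th [3, 0, 1, 2] x" "chi x 2 = word Th [4, 0, 1, 2] x"
  "chi x 3 = word Th [5, 0, 1, 2] x"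
  by (simp_all add: chi_def three_neq del: word.simps)

lemma word_covector: "x \<in> W \<Longrightarrow> length l = n \<Longrightarrow> covector n (word Th l x)"
  by (rule smooth_formD[OF word_smooth'])

lemma kap_covector: "x \<in> W \<Longrightarrow> covector 5 (kap x j)"
  using exhaust_3[of j] word_covector covector_minus[OF word_covector]
  by (auto simp: kap_simps simp del: word.simps)

lemma cnj_kap:
  assumes x: "x \<in> W"
  shows "cnj (kap x 1 e) = word Th [1, 2, 3, 4, 5] x e" "cnj (kap x 2 e) = - word Th [0, 2, 3, 4, 5] x e"
    "cnj (kap x 3 e) = word Th [0, 1, 3, 4, 5] x e"
proof -
  note c = Th_covector[OF x]
  have cc: "cnj_form (cnj_form \<phi>) = \<phi>" for \<phi> :: "(real^6, complex) form" by simp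
  have s: "cnj (word Th [0, 1, 2, 4, 5] x e) = word Th [3, 4, 5, 1, 2] x e"
    "cnj (word Th [0, 1, 2, 3, 5] x e) = word Th [3, 4, 5, 0, 2] x e"
    "cnj (word Th [0, 1, 2, 3, 4] x e) = word Th [3, 4, 5, 0, 1] x e"
    by (simp_all add: wedge_ewedge ewedge_cnj Th_simps)
  show "cnj (kap x 1 e) = word Th [1, 2, 3, 4, 5] x e" "cnj (kap x 2 e) = - word Th [0, 2, 3, 4, 5] x e"
    "cnj (kap x 3 e) = word Th [0, 1, 3, 4, 5] x e"
    unfolding kap_simps using s
    by (simp_all add: word_unsorted[of Th x, OF c] del: word.simps)
qed

text \<open>Among the three words of \<open>\<eta>\<^sup>2\<close>, only the one avoiding both
  \<open>\<alpha>\<^sup>j\<close> and its conjugate survives. The minus sign in \<open>kap\<close>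
  for \<open>j = 2\<close> is what makes the result uniform in \<open>j\<close>.\<close>

lemma Th_\<eta>2:
  assumes x: "x \<in> W"
  shows "ewedge 1 4 (\<alpha> j x) (wedge 2 2 (cplx_form \<eta>) (cplx_form \<eta>) x) e = sig \<epsilon> j / 2 * kap x j e"
    "ewedge 1 4 (\<lambda>e. cnj (\<alpha> j x e)) (wedge 2 2 (cplx_form \<eta>) (cplx_form \<eta>) x) e = sig \<epsilon> j / 2 * cnj (kap x j e)"
proof -
  note c = Th_covector[OF x]
  have w: "ewedge 1 4 (Th i x) (wedge 2 2 (cplx_form \<eta>) (cplx_form \<eta>) x) e = 1 / 2 *
    (\<epsilon> * word Th [i, 0, 1, 3, 4] x e + \<epsilon> * word Th [i, 0, 2, 3, 5] x e + word Th [i, 1, 2, 4, 5] x e)" for i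
  proof -
    have l: "ewedge 1 4 (Th i x) (word Th l x) e = word Th (i # l) x e" if "length l = 4" for l
      using that by (simp add: word_Cons del: word.simps)
    show ?thesis
      unfolding \<eta>2_word[OF x] ewedge_mult_right ewedge_add_right by (simp add: l del: word.simps)
  qed
  note ws = word_not_distinct[of Th x, OF c] word_unsorted[of Th x, OF c]
  have "j = 1 \<or> j = 2 \<or> j = 3" by (rule exhaust_3)
  then show "ewedge 1 4 (\<alpha> j x) (wedge 2 2 (cplx_form \<eta>) (cplx_form \<eta>) x) e = sig \<epsilon> j / 2 * kap x j e"
    using w[of 0] w[of 1] w[of 2]
    by (elim disjE) (simp_all add: Th_simps ws kap_simps sig_def three_neq del: word.simps)
  have "j = 1 \<or> j = 2 \<or> j = 3" by (rule exhaust_3)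
  then show "ewedge 1 4 (\<lambda>e. cnj (\<alpha> j x e)) (wedge 2 2 (cplx_form \<eta>) (cplx_form \<eta>) x) e = sig \<epsilon> j / 2 * cnj (kap x j e)"
    using w[of 3] w[of 4] w[of 5]
    by (elim disjE) (simp_all add: Th_simps ws cnj_kap[OF x] sig_def three_neq del: word.simps)
qed

lemma vol_contract:
  assumes x: "x \<in> W"
  shows "word Th [0, 1, 2, 3, 4, 5] x (case_nat u e) =
    (\<Sum>j\<in>UNIV. \<alpha> j x (\<lambda>_. u) * cnj (kap x j e) - cnj (\<alpha> j x (\<lambda>_. u)) * kap x j e)"
proof -
  note c = Th_covector[OF x]
  note wc = word_contract[of Th x, OF c]
  have s: "word Th [i] x = Th i x" for i by (rule word_single[of Th x, OF c])
  have l: "ewedge 1 n (Th i x) (word Th l x) e = word Th (i # l) x e" if "length l = n" for l n i e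
    using that by (simp add: word_Cons del: word.simps)
  \<comment> \<open>The fact \<open>5\<close> contracts the word consisting of the last letter; each
    following fact prepends one more letter.\<close>
  have 5: "(\<lambda>e. word Th [5] x (case_nat u e)) = (\<lambda>e. Th 5 x (\<lambda>_. u) * word Th [] x e)"
    by (rule ext, subst wc) simp
  have 4: "(\<lambda>e. word Th [4, 5] x (case_nat u e)) = (\<lambda>e. Th 4 x (\<lambda>_. u) * word Th [5] x e - Th 5 x (\<lambda>_. u) * word Th [4] x e)"
    by (rule ext, subst wc) (simp add: 5 ewedge_mult_right l del: word.simps)
  have 3: "(\<lambda>e. word Th [3, 4, 5] x (case_nat u e)) = (\<lambda>e. Th 3 x (\<lambda>_. u) * word Th [4, 5] x e - (Th 4 x (\<lambda>_. u) * word Th [3, 5] x e - Th 5 x (\<lambda>_. u) * word Th [3, 4] x e))"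
    by (rule ext, subst wc) (simp add: 4 ewedge_mult_right ewedge_diff_right l del: word.simps)
  have 2: "(\<lambda>e. word Th [2, 3, 4, 5] x (case_nat u e)) = (\<lambda>e. Th 2 x (\<lambda>_. u) * word Th [3, 4, 5] x e - (Th 3 x (\<lambda>_. u) * word Th [2, 4, 5] x e - (Th 4 x (\<lambda>_. u) * word Th [2, 3, 5] x e - Th 5 x (\<lambda>_. u) * word Th [2, 3, 4] x e)))"
    by (rule ext, subst wc) (simp add: 3 ewedge_mult_right ewedge_diff_right l del: word.simps)
  have 1: "(\<lambda>e. word Th [1, 2, 3, 4, 5] x (case_nat u e)) = (\<lambda>e. Th 1 x (\<lambda>_. u) * word Th [2, 3, 4, 5] x e - (Th 2 x (\<lambda>_. u) * word Th [1, 3, 4, 5] x e - (Th 3 x (\<lambda>_. u) * word Th [1, 2, 4, 5] x e - (Th 4 x (\<lambda>_. u) * word Th [1, 2, 3, 5] x e - Th 5 x (\<lambda>_. u) * word Th [1, 2, 3, 4] x e))))"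
    by (rule ext, subst wc) (simp add: 2 ewedge_mult_right ewedge_diff_right l del: word.simps)
  show ?thesis
    by (subst wc, simp add: 1 ewedge_mult_right ewedge_diff_right l del: word.simps)
       (simp add: sum_3 cnj_kap[OF x, unfolded kap_simps complex_cnj_minus neg_equal_iff_equal] kap_simps Th_simps del: word.simps)
qed

text \<open>Conjugation exchanges the two halves of the volume word, an odd permutation. So its
  values are imaginary, and taking the real part after multiplication by \<open>\<i>\<close> loses
  nothing.\<close>

lemma indep_form_nonzero_iff:
  assumes z: "z \<in> system_domain W"
  shows "indep_form \<alpha> z e \<noteq> 0 \<longleftrightarrow> word Th [0, 1, 2, 3, 4, 5] (fst z) (\<lambda>i. fst (e i)) \<noteq> 0"
proof -
  have x: "fst z \<in> W" using z by (auto simp: system_domain_def)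
  note c = Th_covector[OF x]
  let ?V = "word Th [0, 1, 2, 3, 4, 5] (fst z) (\<lambda>i. fst (e i))"
  have cw: "cnj (word Th [0, 1, 2] (fst z) e) = word Th [3, 4, 5] (fst z) e" for e
    by (simp add: wedge_ewedge ewedge_cnj Th_simps)
  have "ewedge 3 3 (word Th [0, 1, 2] (fst z)) (word Th [3, 4, 5] (fst z)) = word Th [0, 1, 2, 3, 4, 5] (fst z)"
    using word_append[of Th "fst z" "[0, 1, 2]" 3 "[3, 4, 5]" 3, OF c] by (simp del: word.simps)
  then have I: "indep_form \<alpha> z e = Re (\<i> * ?V)"
    by (simp add: indep_form_def pull_fst_def wedge_ewedge[of 3 3] alpha123_word[OF x] cw del: word.simps)
  have "cnj ?V = - ?V"
  proof -
    have "cnj ?V = word Th [3, 4, 5, 0, 1, 2] (fst z) (\<lambda>i. fst (e i))"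
      by (simp add: wedge_ewedge ewedge_cnj Th_simps)
    then show ?thesis by (simp add: word_unsorted[of Th "fst z", OF c] del: word.simps)
  qed
  then have "Re ?V = 0" by (simp add: complex_eq_iff del: word.simps)
  then show ?thesis unfolding I by (auto simp: complex_eq_iff simp del: word.simps)
qed

lemma indep_form_smooth: "smooth_form (system_domain W :: 'r::finite total set) 6 (indep_form \<alpha>)"
proof -
  have "smooth_form W 6 (\<lambda>x e. \<i> * wedge 3 3 (alpha123 \<alpha>) (cnj_form (alpha123 \<alpha>)) x e)"
    using smooth_form_wedge[OF W alpha123_smooth smooth_form_cnj[OF W alpha123_smooth]]
    by (intro smooth_form_scale[OF W smooth_on_const]) simp
  then show ?thesis
    unfolding indep_form_def by (intro smooth_form_pull_sys[OF W] smooth_form_Re[OF W])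
qed

text \<open>The forms \<open>\<iota>\<^sub>v F\<close> for vertical \<open>v\<close>.\<close>

definition vert :: "real^6 \<Rightarrow> complex^'r^'r^3 \<Rightarrow> 'r::finite \<Rightarrow> 'r \<Rightarrow> (nat \<Rightarrow> real^6) \<Rightarrow> complex" where
  "vert x pd a b e = (\<Sum>j\<in>UNIV. pd $ j $ a $ b * \<alpha> j x e - cnj (pd $ j $ b $ a) * cnj (\<alpha> j x e))"

text \<open>The connection form vanishes on vertical vectors, which removes the quadratic term and
  one term of Cartan's formula. What remains is the derivative of the coefficients
  \<open>p\<^sub>j\<close> along the fibre.\<close>

lemma curv_form_vertical:
  assumes z: "z \<in> (system_domain W :: 'r::finite total set)"
  shows "curv_form \<alpha> a b z (case_nat (0, pd) e) = vert (fst z) pd a b (\<lambda>i. fst (e i))"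
proof -
  have x: "fst z \<in> W" using z by (auto simp: system_domain_def)
  let ?v = "(0, pd) :: 'r total"
  note A = A_smooth[where 'r='r]
  have A0: "conn_form \<alpha> c d y (case_nat ?v e) = 0" if y: "y \<in> system_domain W" for c d :: 'r and y e
  proof -
    have "fst y \<in> W" using y by (auto simp: system_domain_def)
    then have "\<alpha> j (fst y) (\<lambda>i. fst (case_nat ?v e i)) = 0" for j
      by (intro covector_zero_slot[OF \<alpha>_covector, of _ 0]) auto
    then show ?thesis by (simp add: conn_form_def conn_pi_def pull_fst_def)
  qed
  have "ext_d (Suc 0) (conn_form \<alpha> a b) z (case_nat ?v e) =
      dir_deriv ?v (conn_form \<alpha> a b) z e - ext_d 0 (\<lambda>y e. conn_form \<alpha> a b y (case_nat ?v e)) z e"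
    by (rule ext_d_contract)
  also have "ext_d 0 (\<lambda>y e. conn_form \<alpha> a b y (case_nat ?v e)) z = ext_d 0 (\<lambda>y e. 0) z"
    by (rule ext_d_cong[OF open_X z smooth_form_zero]) (simp add: A0 fun_eq_iff)
  also have "ext_d 0 (\<lambda>(y :: 'r total) e. 0 :: complex) z e = 0" by (simp add: ext_d_def)
  also have "dir_deriv ?v (conn_form \<alpha> a b) z e = vert (fst z) pd a b (\<lambda>i. fst (e i))"
  proof -
    let ?a = "\<lambda>i. fst (e i)"
    have \<alpha>': "((\<lambda>y :: 'r total. \<alpha> j (fst y) ?a) has_derivative (\<lambda>w. frechet_derivative (\<lambda>y. \<alpha> j y ?a) (at (fst z)) (fst w))) (at z)" for j
      by (rule has_derivative_compose[OF has_derivative_fst[OF has_derivative_ident] smooth_on_has_derivative[OF smooth_form_smooth[OF \<alpha>_smooth] x]])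
    have s': "((\<lambda>y :: 'r total. snd y $ j $ c $ d) has_derivative (\<lambda>w. snd w $ j $ c $ d)) (at z)" for j c d
      by (intro bounded_linear_imp_has_derivative bounded_linear_compose[OF bounded_linear_vec_nth] bounded_linear_snd)
    define D where "D j = frechet_derivative (\<lambda>y. \<alpha> j y ?a) (at (fst z))" for j
    have D0: "D j 0 = 0" for j
      using has_derivative_linear[OF smooth_on_has_derivative[OF smooth_form_smooth[OF \<alpha>_smooth] x]] linear_0
      unfolding D_def by blast
    have p: "((\<lambda>y :: 'r total. \<Sum>j\<in>UNIV. snd y $ j $ c $ d * \<alpha> j (fst y) ?a) has_derivative
       (\<lambda>w. \<Sum>j\<in>UNIV. snd z $ j $ c $ d * D j (fst w) + snd w $ j $ c $ d * \<alpha> j (fst z) ?a)) (at z)" for c d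
      unfolding D_def by (intro has_derivative_sum has_derivative_mult s' \<alpha>')
    have "((\<lambda>y. conn_form \<alpha> a b y e) has_derivative
       (\<lambda>w. (\<Sum>j\<in>UNIV. snd z $ j $ a $ b * D j (fst w) + snd w $ j $ a $ b * \<alpha> j (fst z) ?a) -
         cnj (\<Sum>j\<in>UNIV. snd z $ j $ b $ a * D j (fst w) + snd w $ j $ b $ a * \<alpha> j (fst z) ?a))) (at z)"
      unfolding conn_form_def conn_pi_def pull_fst_def
      by (intro has_derivative_diff p bounded_linear.has_derivative[OF bounded_linear_cnj])
    from frechet_derivative_eq[OF this, of ?v] show ?thesis
      by (simp add: dir_deriv_def D0 vert_def sum_subtractf)
  qed
  finally have d: "ext_d 1 (conn_form \<alpha> a b) z (case_nat ?v e) = vert (fst z) pd a b (\<lambda>i. fst (e i))"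
    by (simp add: One_nat_def)
  have w: "wedge 1 1 (conn_form \<alpha> a k) (conn_form \<alpha> k b) z (case_nat ?v e) = 0" for k
    unfolding wedge_ewedge
    by (subst ewedge_contract[OF smooth_formD[OF A z] smooth_formD[OF A z], of 1]) (simp_all add: A0[OF z])
  show ?thesis unfolding curv_form_def d by (simp add: w)
qed

end

lemma ewedge_pull: "ewedge k l (\<lambda>e. f (\<lambda>i. fst (e i))) (\<lambda>e. g (\<lambda>i. fst (e i))) e = ewedge k l f g (\<lambda>i. fst (e i))"
  by (simp add: ewedge_def)

lemma ewedge_1_contract:
  fixes f g :: "(nat \<Rightarrow> 'v::real_vector) \<Rightarrow> 'a::real_normed_field"
  assumes f: "covector 1 f" and g: "covector (Suc n) g"
  shows "ewedge 1 (Suc n) f g (case_nat v e) = f (\<lambda>_. v) * g e - ewedge 1 n f (\<lambda>e. g (case_nat v e)) e"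
proof -
  have 0: "covector 0 (\<lambda>e. f (case_nat v e))"
    by (rule covector_contract, fold One_nat_def) (rule f)
  have fv: "f (case_nat v e) = f (\<lambda>_. v)" by (rule covector_cong[OF f]) auto
  have "ewedge 1 (Suc n) f g (case_nat v e) =
    ewedge 0 (Suc n) (\<lambda>e. f (case_nat v e)) g e - ewedge 1 n f (\<lambda>e. g (case_nat v e)) e"
    by (subst ewedge_contract[OF f g, of "Suc n"]) simp_all
  then show ?thesis by (simp add: ewedge_0_left[OF 0 g] fv)
qed

lemma ewedge_1_killed:
  assumes f: "covector 1 f" and 0: "\<And>i. i < Suc n \<Longrightarrow> f (\<lambda>_. e i) = 0"
  shows "ewedge 1 n f g e = 0"
proof -
  have "f (\<lambda>i. e (\<sigma> i)) = 0" if s: "\<sigma> permutes {..<1 + n}" for \<sigma>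
  proof -
    have "\<sigma> 0 < Suc n" using permutes_in_image[OF s, of 0] by simp
    then have "f (\<lambda>_. e (\<sigma> 0)) = 0" by (rule 0)
    moreover have "f (\<lambda>i. e (\<sigma> i)) = f (\<lambda>_. e (\<sigma> 0))" by (rule covector_cong[OF f]) auto
    ultimately show ?thesis by simp
  qed
  then show ?thesis unfolding ewedge_def by simp
qed

lemma word_step: "length l = n \<Longrightarrow> ewedge 1 n (T i x) (word T l x) = word T (i # l) x"
  by (auto simp: word_Cons simp del: word.simps)

text \<open>One component of the triple product identity (c x m) x k = (k . c) m, valid when k . m =
  0. The other two components follow by cyclic renaming.\<close>

lemma cross_solve:
  fixes k1 k2 k3 c1 c2 c3 m1 m2 m3 n :: complex
  assumes "k1 * m1 + k2 * m2 + k3 * m3 = 0" "n = k1 * c1 + k2 * c2 + k3 * c3" "n \<noteq> 0"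
  shows "(c3 * m1 - c1 * m3) / n * k3 - (c1 * m2 - c2 * m1) / n * k2 = m1"
proof -
  have "(c3 * m1 - c1 * m3) * k3 - (c1 * m2 - c2 * m1) * k2 = m1 * n"
    using assms(1,2) by algebra
  then have "((c3 * m1 - c1 * m3) * k3 - (c1 * m2 - c2 * m1) * k2) / n = m1"
    using assms(3) by simp
  then show ?thesis by (simp only: times_divide_eq_left diff_divide_distrib[symmetric])
qed

context unitary_system
begin

context
  fixes z :: "'r::finite total" and x
  assumes z: "z \<in> system_domain W"
  defines "x \<equiv> fst z"
begin

lemma fst_in_W: "x \<in> W"
  using z by (auto simp: system_domain_def x_def)

lemma curv_form_covector: "covector 2 (curv_form \<alpha> a b z)"
  by (rule smooth_formD[OF F_smooth z])

lemma covector_pull_total: "covector k f \<Longrightarrow> covector k (\<lambda>e :: nat \<Rightarrow> 'r total. f (\<lambda>i. fst (e i)))"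
  by (rule covector_pull)

lemma F_alpha_at: "F_alpha \<alpha> a b z = ewedge 2 3 (curv_form \<alpha> a b z) (\<lambda>e. word Th [0, 1, 2] x (\<lambda>i. fst (e i)))"
  using alpha123_word[OF fst_in_W] by (simp add: F_alpha_def wedge_ewedge pull_fst_at x_def del: word.simps)

lemma F_eta_at: "F_eta \<alpha> \<eta> a b z = ewedge 2 4 (curv_form \<alpha> a b z)
    (\<lambda>e. wedge 2 2 (cplx_form \<eta>) (cplx_form \<eta>) x (\<lambda>i. fst (e i)))"
  by (simp add: F_eta_def wedge_ewedge[of 2 4] pull_fst_at x_def)

lemma alpha123_covector: "covector 3 (word Th [0, 1, 2] x)"
  by (rule word_covector[OF fst_in_W]) simp

lemma \<eta>2_covector: "covector 4 (wedge 2 2 (cplx_form \<eta>) (cplx_form \<eta>) x)"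
  by (rule smooth_formD[OF \<eta>2_smooth fst_in_W])

lemma F_alpha_covector: "covector 5 (F_alpha \<alpha> a b z)"
  unfolding F_alpha_at using covector_ewedge[OF curv_form_covector covector_pull_total[OF alpha123_covector]] by simp

lemma F_eta_covector: "covector 6 (F_eta \<alpha> \<eta> a b z)"
  unfolding F_eta_at using covector_ewedge[OF curv_form_covector covector_pull_total[OF \<eta>2_covector]] by simp

text \<open>\<open>F\<close> is skew-Hermitian and \<open>\<eta>\<close> real. This is why these
  equations count \<open>r^2\<close> real conditions and not twice as many.\<close>

lemma F_eta_skew: "F_eta \<alpha> \<eta> a b z e = - cnj (F_eta \<alpha> \<eta> b a z e)"
proof -
  have F: "curv_form \<alpha> a b z = (\<lambda>e. - cnj (curv_form \<alpha> b a z e))"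
    by (rule ext) (rule curv_form_skew[where \<alpha>=\<alpha>, OF W \<alpha>_smooth z])
  have "cnj (wedge 2 2 (cplx_form \<eta>) (cplx_form \<eta>) x e) = wedge 2 2 (cplx_form \<eta>) (cplx_form \<eta>) x e" for e
    by (simp add: wedge_ewedge ewedge_cnj)
  then show ?thesis unfolding F_eta_at by (subst F) (simp add: ewedge_minus_left ewedge_cnj)
qed

lemma contract_vertical:
  assumes "covector (Suc k) f"
  shows "(\<lambda>e. f (\<lambda>i. fst ((case i of 0 \<Rightarrow> (0, pd) | Suc j \<Rightarrow> e j) :: 'r total))) = (\<lambda>e. 0)"
  by (rule ext, rule covector_zero_slot[OF assms, of 0]) simp_all

text \<open>The (1,0)-half of \<open>vert\<close> dies against \<open>alpha123\<close>, so only the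
  conjugates of the vertical coordinates enter.\<close>

lemma F_alpha_vert:
  "F_alpha \<alpha> a b z (case_nat (0, pd) e) =
    - (\<Sum>j\<in>UNIV. cnj (pd $ j $ b $ a) * chi x j (\<lambda>i. fst (e i)))"
proof -
  note c = Th_covector[OF fst_in_W]
  have c3: "covector (Suc 2) (word Th [0, 1, 2] x)" using alpha123_covector by simp
  have l: "ewedge 1 3 (Th i x) (word Th [0, 1, 2] x) = word Th [i, 0, 1, 2] x" for i
    by (rule word_step) simp
  have \<alpha>0: "ewedge 1 3 (\<alpha> j x) (word Th [0, 1, 2] x) e = 0" for j e
    using exhaust_3[of j] l[of 0] l[of 1] l[of 2] word_not_distinct[of Th x, OF c]
    by (elim disjE) (simp_all add: Th_simps del: word.simps)
  have \<alpha>1: "ewedge 1 3 (\<lambda>e. cnj (\<alpha> j x e)) (word Th [0, 1, 2] x) e = chi x j e" for j e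
    using exhaust_3[of j] l[of 3] l[of 4] l[of 5]
    by (elim disjE) (simp_all add: Th_simps chi_simps del: word.simps)
  have "F_alpha \<alpha> a b z (case_nat (0, pd) e) =
    ewedge 1 3 (\<lambda>e. vert x pd a b (\<lambda>i. fst (e i))) (\<lambda>e. word Th [0, 1, 2] x (\<lambda>i. fst (e i))) e"
    unfolding F_alpha_at
    by (subst ewedge_contract[OF curv_form_covector covector_pull_total[OF alpha123_covector], of 4])
       (simp_all add: curv_form_vertical[OF z, folded x_def] contract_vertical[OF c3] del: word.simps flip: One_nat_def)
  also have "\<dots> = ewedge 1 3 (vert x pd a b) (word Th [0, 1, 2] x) (\<lambda>i. fst (e i))"
    by (rule ewedge_pull)
  also have "\<dots> = - (\<Sum>j\<in>UNIV. cnj (pd $ j $ b $ a) * chi x j (\<lambda>i. fst (e i)))"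
    unfolding vert_def[abs_def] ewedge_sum_left ewedge_diff_left ewedge_mult_left \<alpha>0 \<alpha>1
    by (simp add: sum_negf)
  finally show ?thesis .
qed

lemma F_eta_vert:
  "F_eta \<alpha> \<eta> a b z (case_nat (0, pd) e) = (\<Sum>j\<in>UNIV. sig \<epsilon> j / 2 *
     (pd $ j $ a $ b * kap x j (\<lambda>i. fst (e i)) - cnj (pd $ j $ b $ a) * cnj (kap x j (\<lambda>i. fst (e i)))))"
proof -
  let ?E = "wedge 2 2 (cplx_form \<eta>) (cplx_form \<eta>) x"
  have c4: "covector (Suc 3) ?E" using \<eta>2_covector by simp
  have "F_eta \<alpha> \<eta> a b z (case_nat (0, pd) e) =
    ewedge 1 4 (\<lambda>e. vert x pd a b (\<lambda>i. fst (e i))) (\<lambda>e. ?E (\<lambda>i. fst (e i))) e"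
    unfolding F_eta_at
    by (subst ewedge_contract[OF curv_form_covector covector_pull_total[OF \<eta>2_covector], of 5])
       (simp_all add: curv_form_vertical[OF z, folded x_def] contract_vertical[OF c4] flip: One_nat_def)
  also have "\<dots> = ewedge 1 4 (vert x pd a b) ?E (\<lambda>i. fst (e i))"
    by (rule ewedge_pull)
  also have "\<dots> = (\<Sum>j\<in>UNIV. pd $ j $ a $ b * (sig \<epsilon> j / 2 * kap x j (\<lambda>i. fst (e i))) -
      cnj (pd $ j $ b $ a) * (sig \<epsilon> j / 2 * cnj (kap x j (\<lambda>i. fst (e i)))))"
    unfolding vert_def[abs_def] ewedge_sum_left ewedge_diff_left ewedge_mult_left Th_\<eta>2[OF fst_in_W] ..
  also have "\<dots> = (\<Sum>j\<in>UNIV. sig \<epsilon> j / 2 *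
     (pd $ j $ a $ b * kap x j (\<lambda>i. fst (e i)) - cnj (pd $ j $ b $ a) * cnj (kap x j (\<lambda>i. fst (e i)))))"
    by (rule sum.cong[OF refl]) (simp add: algebra_simps)
  finally show ?thesis .
qed

text \<open>Products of \<open>F_alpha\<close> with 1-forms contribute to the polar equations of
  5-planes. Those with \<open>\<alpha>\<^sup>j\<close> are zero by \<open>\<alpha>_F_alpha\<close>,
  which leaves the conjugates; \<open>F_alpha_contract_zero\<close> shows that they suffice.\<close>

definition Mf :: "3 \<Rightarrow> 'r \<Rightarrow> 'r \<Rightarrow> (nat \<Rightarrow> 'r total) \<Rightarrow> complex" where
  "Mf j a b = ewedge 1 5 (\<lambda>e. cnj (\<alpha> j x (\<lambda>i. fst (e i)))) (F_alpha \<alpha> a b z)"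

lemma \<alpha>_pull_covector: "covector 1 (\<lambda>e :: nat \<Rightarrow> 'r total. \<alpha> j x (\<lambda>i. fst (e i)))"
  by (rule covector_pull_total[OF \<alpha>_covector[OF fst_in_W]])

lemma Mf_covector: "covector 6 (Mf j a b)"
  unfolding Mf_def using covector_ewedge[OF covector_cnj[OF \<alpha>_pull_covector] F_alpha_covector] by simp

lemma \<alpha>_F_alpha: "ewedge 1 5 (\<lambda>e. \<alpha> j x (\<lambda>i. fst (e i))) (F_alpha \<alpha> a b z) = (\<lambda>e. 0)"
proof -
  let ?A = "\<lambda>e :: nat \<Rightarrow> 'r total. \<alpha> j x (\<lambda>i. fst (e i))" and ?P = "\<lambda>e :: nat \<Rightarrow> 'r total. word Th [0, 1, 2] x (\<lambda>i. fst (e i))"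
  note c = Th_covector[OF fst_in_W]
  have l: "ewedge 1 3 (Th i x) (word Th [0, 1, 2] x) = word Th [i, 0, 1, 2] x" for i
    by (rule word_step) simp
  have \<alpha>0: "ewedge 1 3 (\<alpha> j x) (word Th [0, 1, 2] x) e = 0" for e
    using exhaust_3[of j] l[of 0] l[of 1] l[of 2] word_not_distinct[of Th x, OF c]
    by (elim disjE) (simp_all add: Th_simps del: word.simps)
  have AP: "ewedge 1 3 ?A ?P = (\<lambda>e. 0)"
    by (rule ext) (simp only: ewedge_pull \<alpha>0)
  have "ewedge 1 5 ?A (ewedge 2 3 (curv_form \<alpha> a b z) ?P) = ewedge 3 3 (ewedge 1 2 ?A (curv_form \<alpha> a b z)) ?P"
    using ewedge_assoc[OF \<alpha>_pull_covector curv_form_covector covector_pull_total[OF alpha123_covector], of j a b] by (simp del: word.simps)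
  also have "ewedge 1 2 ?A (curv_form \<alpha> a b z) = ewedge 2 1 (curv_form \<alpha> a b z) ?A"
    by (subst ewedge_commute[OF \<alpha>_pull_covector curv_form_covector]) simp
  also have "ewedge 3 3 \<dots> ?P = ewedge 2 4 (curv_form \<alpha> a b z) (ewedge 1 3 ?A ?P)"
    using ewedge_assoc[OF curv_form_covector \<alpha>_pull_covector covector_pull_total[OF alpha123_covector], of a b j] by (simp del: word.simps)
  finally show ?thesis unfolding F_alpha_at AP by simp
qed

text \<open>The right-hand sides are the components of the cross product of the conjugated vertical
  coordinates with \<open>kap\<close>. It vanishes on multiples of \<open>kap\<close>, which is
  where the vertical solutions come from.\<close>

lemma M_vert:
  shows "Mf 1 a b (case_nat (0, pd) e) = cnj (pd $ 2 $ b $ a) * kap x 3 (\<lambda>i. fst (e i)) - cnj (pd $ 3 $ b $ a) * kap x 2 (\<lambda>i. fst (e i))"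
    "Mf 2 a b (case_nat (0, pd) e) = cnj (pd $ 3 $ b $ a) * kap x 1 (\<lambda>i. fst (e i)) - cnj (pd $ 1 $ b $ a) * kap x 3 (\<lambda>i. fst (e i))"
    "Mf 3 a b (case_nat (0, pd) e) = cnj (pd $ 1 $ b $ a) * kap x 2 (\<lambda>i. fst (e i)) - cnj (pd $ 2 $ b $ a) * kap x 1 (\<lambda>i. fst (e i))"
proof -
  note c = Th_covector[OF fst_in_W]
  have c5: "covector (Suc 4) (F_alpha \<alpha> a b z)" using F_alpha_covector by simp
  have a0: "\<alpha> j x (\<lambda>_. 0) = 0" for j by (rule linear_0[OF \<alpha>_linear[OF fst_in_W]])
  have M: "Mf k a b (case_nat (0, pd) e) = (\<Sum>j\<in>UNIV. cnj (pd $ j $ b $ a) *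
      ewedge 1 4 (\<lambda>e. cnj (\<alpha> k x e)) (chi x j) (\<lambda>i. fst (e i)))" for k
  proof -
    have "Mf k a b (case_nat (0, pd) e) = - ewedge 1 4 (\<lambda>e. cnj (\<alpha> k x (\<lambda>i. fst (e i))))
        (\<lambda>e. - (\<Sum>j\<in>UNIV. cnj (pd $ j $ b $ a) * chi x j (\<lambda>i. fst (e i)))) e"
      using ewedge_1_contract[OF covector_cnj[OF \<alpha>_pull_covector] c5] by (simp add: Mf_def a0 F_alpha_vert)
    also have "\<dots> = (\<Sum>j\<in>UNIV. cnj (pd $ j $ b $ a) *
        ewedge 1 4 (\<lambda>e. cnj (\<alpha> k x (\<lambda>i. fst (e i)))) (\<lambda>e. chi x j (\<lambda>i. fst (e i))) e)"
      by (simp only: ewedge_minus_right ewedge_sum_right ewedge_mult_right) simp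
    finally show ?thesis
      by (simp only: ewedge_pull[of 1 4 "\<lambda>e. cnj (\<alpha> k x e)"])
  qed
  have l: "ewedge 1 4 (Th i x) (word Th [j, 0, 1, 2] x) = word Th [i, j, 0, 1, 2] x" for i j
    by (rule word_step) simp
  note ws = word_not_distinct[of Th x, OF c] word_unsorted[of Th x, OF c]
  have l1: "ewedge 1 4 (\<lambda>e. cnj (\<alpha> 1 x e)) (chi x 1) e = 0" "ewedge 1 4 (\<lambda>e. cnj (\<alpha> 1 x e)) (chi x 2) e = kap x 3 e"
    "ewedge 1 4 (\<lambda>e. cnj (\<alpha> 1 x e)) (chi x 3) e = - kap x 2 e" for e
    using l[of 3 3] l[of 3 4] l[of 3 5] by (simp_all add: Th_simps chi_simps kap_simps ws del: word.simps)
  have l2: "ewedge 1 4 (\<lambda>e. cnj (\<alpha> 2 x e)) (chi x 1) e = - kap x 3 e" "ewedge 1 4 (\<lambda>e. cnj (\<alpha> 2 x e)) (chi x 2) e = 0"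
    "ewedge 1 4 (\<lambda>e. cnj (\<alpha> 2 x e)) (chi x 3) e = kap x 1 e" for e
    using l[of 4 3] l[of 4 4] l[of 4 5] by (simp_all add: Th_simps chi_simps kap_simps ws del: word.simps)
  have l3: "ewedge 1 4 (\<lambda>e. cnj (\<alpha> 3 x e)) (chi x 1) e = kap x 2 e" "ewedge 1 4 (\<lambda>e. cnj (\<alpha> 3 x e)) (chi x 2) e = - kap x 1 e"
    "ewedge 1 4 (\<lambda>e. cnj (\<alpha> 3 x e)) (chi x 3) e = 0" for e
    using l[of 5 3] l[of 5 4] l[of 5 5] by (simp_all add: Th_simps chi_simps kap_simps ws del: word.simps)
  show "Mf 1 a b (case_nat (0, pd) e) = cnj (pd $ 2 $ b $ a) * kap x 3 (\<lambda>i. fst (e i)) - cnj (pd $ 3 $ b $ a) * kap x 2 (\<lambda>i. fst (e i))"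
    "Mf 2 a b (case_nat (0, pd) e) = cnj (pd $ 3 $ b $ a) * kap x 1 (\<lambda>i. fst (e i)) - cnj (pd $ 1 $ b $ a) * kap x 3 (\<lambda>i. fst (e i))"
    "Mf 3 a b (case_nat (0, pd) e) = cnj (pd $ 1 $ b $ a) * kap x 2 (\<lambda>i. fst (e i)) - cnj (pd $ 2 $ b $ a) * kap x 1 (\<lambda>i. fst (e i))"
    unfolding M by (simp_all add: sum_3 l1 l2 l3)
qed

text \<open>By \<open>vol_contract\<close> the 1-form \<open>lam\<close> annihilates the frame
  \<open>b\<close>. If \<open>F_alpha\<close> vanishes on \<open>b\<close>, then \<open>lam\<close>
  wedged with \<open>F_alpha\<close> vanishes on \<open>v\<close> and \<open>b\<close>, and its
  expansion is this relation. It is the solvability condition for the cross product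
  equations.\<close>

lemma M_relation:
  assumes "F_alpha \<alpha> a c z b = 0"
  shows "(\<Sum>j\<in>UNIV. kap x j (\<lambda>i. fst (b i)) * Mf j a c (case_nat v b)) = 0"
proof -
  let ?k = "\<lambda>j. kap x j (\<lambda>i. fst (b i))"
  let ?A = "\<lambda>j (e :: nat \<Rightarrow> 'r total). \<alpha> j x (\<lambda>i. fst (e i))"
  define lam where "lam e = (\<Sum>j\<in>UNIV. ?k j * cnj (?A j e) - cnj (?k j) * ?A j e)" for e
  have c: "covector 1 lam"
    unfolding lam_def[abs_def] by (intro covector_sum covector_diff covector_mult_left covector_cnj \<alpha>_pull_covector)
  have c5: "covector (Suc 4) (F_alpha \<alpha> a c z)" using F_alpha_covector by simp
  have "lam (\<lambda>_. b i) = 0" if i: "i < Suc 4" for i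
  proof -
    have c6: "covector 6 (word Th [0, 1, 2, 3, 4, 5] x)" by (rule word_covector[OF fst_in_W]) simp
    have "word Th [0, 1, 2, 3, 4, 5] x (case_nat (fst (b i)) (\<lambda>i. fst (b i))) = 0"
      using i by (intro covector_alt[OF c6, of 0 "Suc i"]) auto
    then show ?thesis
      unfolding vol_contract[OF fst_in_W] lam_def
      by (simp add: sum_3 algebra_simps)
  qed
  then have "ewedge 1 4 lam (\<lambda>e. F_alpha \<alpha> a c z (case_nat v e)) b = 0"
    by (rule ewedge_1_killed[OF c])
  then have "ewedge 1 5 lam (F_alpha \<alpha> a c z) (case_nat v b) = 0"
    using ewedge_1_contract[OF c c5, of v b] assms by simp
  moreover have "ewedge 1 5 lam (F_alpha \<alpha> a c z) (case_nat v b) = (\<Sum>j\<in>UNIV. ?k j * Mf j a c (case_nat v b))"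
    unfolding lam_def[abs_def] ewedge_sum_left ewedge_diff_left ewedge_mult_left \<alpha>_F_alpha Mf_def by simp
  ultimately show ?thesis by simp
qed

text \<open>The cross product equations are solved by \<open>bt\<close>, since \<open>m\<close> is
  orthogonal to \<open>\<kappa>\<close> in the bilinear sense. Their solution is free along
  \<open>\<kappa>\<close>, and this freedom is spent on the remaining equation, which can be met
  because \<open>\<kappa>\<close> is not isotropic.\<close>

lemma vertical_solution:
  fixes \<kappa> :: "3 \<Rightarrow> complex" and m :: "3 \<Rightarrow> 'r \<Rightarrow> 'r \<Rightarrow> complex"
  assumes m: "\<And>a c. (\<Sum>j\<in>UNIV. \<kappa> j * m j a c) = 0" and f: "\<And>a c. f a c = - cnj (f c a)"
    and Q: "(\<Sum>j\<in>UNIV. sig \<epsilon> j * (\<kappa> j * cnj (\<kappa> j))) \<noteq> 0"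
  obtains pd :: "complex^'r^'r^3" where
    "\<And>a c. cnj (pd $ 2 $ c $ a) * \<kappa> 3 - cnj (pd $ 3 $ c $ a) * \<kappa> 2 = m 1 a c"
    "\<And>a c. cnj (pd $ 3 $ c $ a) * \<kappa> 1 - cnj (pd $ 1 $ c $ a) * \<kappa> 3 = m 2 a c"
    "\<And>a c. cnj (pd $ 1 $ c $ a) * \<kappa> 2 - cnj (pd $ 2 $ c $ a) * \<kappa> 1 = m 3 a c"
    "\<And>a c. (\<Sum>j\<in>UNIV. sig \<epsilon> j / 2 * (pd $ j $ a $ c * \<kappa> j - cnj (pd $ j $ c $ a) * cnj (\<kappa> j))) = f a c"
proof -
  define k where "k j = cnj (\<kappa> j)" for j
  \<comment> \<open>Two norms of \<open>\<kappa>\<close> occur: the positive definite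
    \<open>n\<close> is divided by in the cross product formula, while \<open>q\<close> is the one
    belonging to \<open>\<eta>\<close> and may be indefinite. Nonvanishing of \<open>q\<close>
    forces that of \<open>n\<close>.\<close>
  define n where "n = \<kappa> 1 * k 1 + \<kappa> 2 * k 2 + \<kappa> 3 * k 3"
  have n0: "n \<noteq> 0"
  proof
    assume "n = 0"
    moreover have "complex_of_real ((norm (\<kappa> 1))\<^sup>2 + (norm (\<kappa> 2))\<^sup>2 + (norm (\<kappa> 3))\<^sup>2) = n"
      unfolding n_def k_def by (simp only: of_real_add complex_norm_square)
    ultimately have "(norm (\<kappa> 1))\<^sup>2 + (norm (\<kappa> 2))\<^sup>2 + (norm (\<kappa> 3))\<^sup>2 = 0" by (simp only: of_real_eq_0_iff)
    then have "\<kappa> 1 = 0 \<and> \<kappa> 2 = 0 \<and> \<kappa> 3 = 0"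
      by (simp add: add_nonneg_eq_0_iff)
    then show False using Q by (simp add: sum_3)
  qed
  define q where "q = (\<Sum>j\<in>UNIV. sig \<epsilon> j * (\<kappa> j * k j))"
  have q0: "q \<noteq> 0" using Q by (simp add: q_def k_def)
  have q': "q = \<kappa> 1 * k 1 + \<epsilon> * (\<kappa> 2 * k 2) + \<epsilon> * (\<kappa> 3 * k 3)"
    by (simp add: q_def sum_3 sig_def three_neq)
  have qc: "cnj q = q" by (simp add: q' k_def algebra_simps)
  \<comment> \<open>The cross product of the conjugate of \<open>\<kappa>\<close> with
    \<open>m\<close>, divided by \<open>n\<close>, as in \<open>cross_solve\<close>.\<close>
  define bt where "bt j a c = (if j = 1 then k 2 * m 3 a c - k 3 * m 2 a c
     else if j = 2 then k 3 * m 1 a c - k 1 * m 3 a c else k 1 * m 2 a c - k 2 * m 1 a c) / n" for j :: 3 and a c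
  define f0 where "f0 a c = (\<Sum>j\<in>UNIV. sig \<epsilon> j / 2 * (cnj (bt j c a) * \<kappa> j - bt j a c * k j))" for a c
  have f0: "f0 a c = - cnj (f0 c a)" for a c
    by (simp add: f0_def sum_3 sig_def three_neq k_def algebra_simps)
  \<comment> \<open>The defect of \<open>bt\<close> in the last equation. It is skew-Hermitian, so
    shifting \<open>pd\<close> by \<open>s\<close> along the conjugate of \<open>\<kappa>\<close>
    leaves the cross products unchanged and adds \<open>s * q\<close> to the last equation.\<close>
  define s where "s a c = (f a c - f0 a c) / q" for a c
  have s: "cnj (s c a) = - s a c" for a c
    using f[of a c] f0[of a c] by (simp add: s_def qc minus_divide_left)
  define pd :: "complex^'r^'r^3" where "pd = (\<chi> j a c. cnj (bt j c a) + s a c * k j)"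
  have p: "pd $ j $ a $ c = cnj (bt j c a) + s a c * k j" "cnj (pd $ j $ c $ a) = bt j a c - s a c * \<kappa> j" for j a c
    by (simp_all add: pd_def s k_def)
  have mm: "\<kappa> 1 * m 1 a c + \<kappa> 2 * m 2 a c + \<kappa> 3 * m 3 a c = 0" for a c using m[of a c] by (simp add: sum_3)
  show ?thesis
  proof (rule that[of pd])
    fix a c
    have "bt 2 a c * \<kappa> 3 - bt 3 a c * \<kappa> 2 = m 1 a c"
      using cross_solve[OF mm n_def n0] by (simp add: bt_def three_neq)
    then show "cnj (pd $ 2 $ c $ a) * \<kappa> 3 - cnj (pd $ 3 $ c $ a) * \<kappa> 2 = m 1 a c"
      unfolding p(2) by (simp add: algebra_simps)
    have "bt 3 a c * \<kappa> 1 - bt 1 a c * \<kappa> 3 = m 2 a c"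
      using cross_solve[of "\<kappa> 2" "m 2 a c" "\<kappa> 3" "m 3 a c" "\<kappa> 1" "m 1 a c" n "k 2" "k 3" "k 1"] mm n_def n0
      by (simp add: bt_def three_neq add.commute add.left_commute)
    then show "cnj (pd $ 3 $ c $ a) * \<kappa> 1 - cnj (pd $ 1 $ c $ a) * \<kappa> 3 = m 2 a c"
      unfolding p(2) by (simp add: algebra_simps)
    have "bt 1 a c * \<kappa> 2 - bt 2 a c * \<kappa> 1 = m 3 a c"
      using cross_solve[of "\<kappa> 3" "m 3 a c" "\<kappa> 1" "m 1 a c" "\<kappa> 2" "m 2 a c" n "k 3" "k 1" "k 2"] mm n_def n0
      by (simp add: bt_def three_neq add.commute add.left_commute)
    then show "cnj (pd $ 1 $ c $ a) * \<kappa> 2 - cnj (pd $ 2 $ c $ a) * \<kappa> 1 = m 3 a c"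
      unfolding p(2) by (simp add: algebra_simps)
    have "(\<Sum>j\<in>UNIV. sig \<epsilon> j / 2 * (pd $ j $ a $ c * \<kappa> j - cnj (pd $ j $ c $ a) * cnj (\<kappa> j))) = f0 a c + s a c * q"
      unfolding p(2) unfolding p(1) f0_def q_def k_def[symmetric] by (simp add: sum_3 field_simps)
    also have "\<dots> = f a c" using q0 by (simp add: s_def)
    finally show "(\<Sum>j\<in>UNIV. sig \<epsilon> j / 2 * (pd $ j $ a $ c * \<kappa> j - cnj (pd $ j $ c $ a) * cnj (\<kappa> j))) = f a c" .
  qed
qed

section \<open>Polar spaces of 4-planes and 5-planes\<close>

abbreviation "\<I> \<equiv> (system_ideal W \<alpha> \<eta> :: nat \<Rightarrow> ('r total, real) form \<Rightarrow> bool)"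

lemma generator_cases:
  assumes "(k, \<phi>) \<in> (system_generators \<alpha> \<eta> :: (nat \<times> ('r total, real) form) set)"
  obtains a c where "k = 5" "\<phi> = Re_form (F_alpha \<alpha> a c) \<or> \<phi> = Im_form (F_alpha \<alpha> a c)"
  | a c where "k = 6" "\<phi> = Re_form (F_eta \<alpha> \<eta> a c) \<or> \<phi> = Im_form (F_eta \<alpha> \<eta> a c)"
  using assms by (auto simp: system_generators_def)

text \<open>The generators have degrees 5 and 6. A product of degree 5 has a function as first
  factor, or its second factor comes from a degree in which the ideal is zero.\<close>

lemma ideal_low_degree:
  assumes "\<I> k \<phi>"
  shows "(k < 5 \<longrightarrow> \<phi> z = (\<lambda>e. 0)) \<and> (k = 5 \<longrightarrow> (\<forall>e. (\<forall>a c. F_alpha \<alpha> a c z e = 0) \<longrightarrow> \<phi> z e = 0))"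
  using assms unfolding system_ideal_def
proof induction
  case (gen k \<phi>)
  then show ?case by (rule generator_cases) auto
next
  case (mult l \<beta> k \<phi>)
  have s: "smooth_form (system_domain W) k \<phi>"
    by (rule alg_ideal_smooth[OF open_X gens mult.hyps(2)])
  show ?case
  proof (intro conjI impI allI)
    assume "l + k < 5"
    then have "\<phi> z = (\<lambda>e. 0)" using mult.IH by simp
    then show "wedge l k \<beta> \<phi> z = (\<lambda>e. 0)" by (simp add: wedge_ewedge)
  next
    fix e assume lk: "l + k = 5" and F: "\<forall>a c. F_alpha \<alpha> a c z e = 0"
    show "wedge l k \<beta> \<phi> z e = 0"
    proof (cases "l = 0")
      case True
      then have "\<phi> z e = 0" using mult.IH F lk by simp
      moreover have c0: "covector 0 (\<beta> z)" using smooth_formD[OF mult.hyps(1) z] True by simp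
      ultimately show ?thesis
        unfolding wedge_ewedge True by (simp add: ewedge_0_left[OF c0 smooth_formD[OF s z]])
    next
      case False
      then have "\<phi> z = (\<lambda>e. 0)" using mult.IH lk by simp
      then show ?thesis by (simp add: wedge_ewedge)
    qed
  qed
next
  case (cong k \<phi> \<psi>)
  have "\<psi> z = \<phi> z" using cong.hyps(3) z by blast
  then show ?case using cong.IH by simp
qed simp_all

text \<open>Applied to \<open>chi\<close> and \<open>kap\<close>: one covector on the base that is
  nonzero on the projected frame certifies that the frame is independent and transverse to the
  fibre.\<close>

lemma frame_dim:
  fixes f :: "(nat \<Rightarrow> real^6) \<Rightarrow> complex" and b :: "nat \<Rightarrow> 'r total"
  assumes f: "covector k f" and nz: "f (\<lambda>i. fst (b i)) \<noteq> 0"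
  shows "dim (span (b ` {..<k})) = k" "dim (fst ` span (b ` {..<k})) = k"
proof -
  let ?S = "span (b ` {..<k})"
  have "\<not> dim ((\<lambda>i. fst (b i)) ` {..<k}) < k" using covector_dependent_zero[OF f] nz by blast
  then have 1: "k \<le> dim ((\<lambda>i. fst (b i)) ` {..<k})" by simp
  also have "\<dots> \<le> dim (fst ` ?S)" by (rule dim_subset) (auto intro: span_base)
  finally have 2: "k \<le> dim (fst ` ?S)" .
  have 3: "dim (fst ` ?S) \<le> dim ?S" by (rule dim_image_le[OF linear_fst])
  have 4: "dim ?S \<le> k"
    using dim_le_card'[of "b ` {..<k}"] card_image_le[of "{..<k}" b] by simp
  show "dim ?S = k" "dim (fst ` ?S) = k" using 2 3 4 by linarith+
qed

lemma chi_covector: "covector 4 (chi x j)"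
  using exhaust_3[of j] by (auto simp: chi_simps simp del: word.simps intro!: word_covector[OF fst_in_W])

lemma polar_space_4:
  fixes b :: "nat \<Rightarrow> 'r total"
  assumes d: "dim (span (b ` {..<4})) = 4"
  shows "polar_space \<I> z (span (b ` {..<4})) = {v. \<forall>a c. F_alpha \<alpha> a c z (case_nat v b) = 0}"
proof (intro equalityI subsetI CollectI allI)
  fix v a c assume v: "v \<in> polar_space \<I> z (span (b ` {..<4}))"
  \<comment> \<open>Polar spaces quantify over sequences with all entries in the plane, but
    \<open>b\<close> is arbitrary from index 4 on; those irrelevant entries are set to zero.\<close>
  define e where "e i = (if i < 4 then b i else 0)" for i
  have e: "\<forall>i. e i \<in> span (b ` {..<4})" by (auto simp: e_def span_base span_zero)
  have I: "\<I> (Suc (dim (span (b ` {..<4})))) \<phi> \<Longrightarrow> \<phi> z (case_nat v e) = 0" for \<phi>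
    using v e unfolding polar_space_def by blast
  have "\<I> 5 (Re_form (F_alpha \<alpha> a c))" "\<I> 5 (Im_form (F_alpha \<alpha> a c))"
    using F_alpha_in_ideal[of a c] by (simp_all add: cideal_def system_ideal_def)
  then have "Re (F_alpha \<alpha> a c z (case_nat v e)) = 0" "Im (F_alpha \<alpha> a c z (case_nat v e)) = 0"
    using I[of "Re_form (F_alpha \<alpha> a c)"] I[of "Im_form (F_alpha \<alpha> a c)"] unfolding d by simp_all
  then have "F_alpha \<alpha> a c z (case_nat v e) = 0" by (simp add: complex_eq_iff)
  moreover have "F_alpha \<alpha> a c z (case_nat v e) = F_alpha \<alpha> a c z (case_nat v b)"
    by (rule covector_cong[OF F_alpha_covector]) (auto simp: e_def split: nat.splits)
  ultimately show "F_alpha \<alpha> a c z (case_nat v b) = 0" by simp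
next
  fix v assume "v \<in> {v. \<forall>a c. F_alpha \<alpha> a c z (case_nat v b) = 0}"
  then have v: "F_alpha \<alpha> a c z (case_nat v b) = 0" for a c by blast
  have "F_alpha \<alpha> a c z (case_nat v e) = 0" if "\<forall>i. e i \<in> span (b ` {..<4})" for a c e
  proof (rule covector_frame_zero[of 4 "\<lambda>e. F_alpha \<alpha> a c z (case_nat v e)" b])
    show "covector 4 (\<lambda>e. F_alpha \<alpha> a c z (case_nat v e))"
      by (rule covector_contract) (use F_alpha_covector in simp)
  qed (use v that in auto)
  then show "v \<in> polar_space \<I> z (span (b ` {..<4}))"
    unfolding polar_space_def d using ideal_low_degree by auto
qed

text \<open>The polar equations form a linear map \<open>\<Phi>\<close> into the complex
  \<open>r \<times> r\<close> matrices. It is onto already on the vertical vectors with only the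
  \<open>j\<close>-th coordinate, which enters with the nonzero factor \<open>?c\<close>.\<close>

lemma polar_space_4_dim:
  fixes b :: "nat \<Rightarrow> 'r total"
  assumes ch: "chi x j (\<lambda>i. fst (b i)) \<noteq> 0"
  shows "dim (polar_space \<I> z (span (b ` {..<4}))) + 2 * CARD('r) ^ 2 = DIM('r total)"
proof -
  let ?c = "chi x j (\<lambda>i. fst (b i))"
  define \<Phi> :: "'r total \<Rightarrow> complex^'r^'r" where "\<Phi> v = (\<chi> a c. F_alpha \<alpha> a c z (case_nat v b))" for v
  have c5: "covector (Suc 4) (F_alpha \<alpha> a c z)" for a c using F_alpha_covector by simp
  have lin: "linear \<Phi>"
    by (rule linearI)
       (simp_all add: \<Phi>_def vec_eq_iff linear_add[OF linear_contract0[OF c5]] linear_cmul[OF linear_contract0[OF c5]])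
  have "M \<in> range \<Phi>" for M
  proof -
    define pd :: "complex^'r^'r^3" where "pd = (\<chi> i c a. if i = j then - cnj (M $ a $ c / ?c) else 0)"
    have "\<Phi> (0, pd) = M"
    proof -
      have "(\<Sum>i\<in>UNIV. cnj (pd $ i $ c $ a) * chi x i (\<lambda>i. fst (b i))) = - M $ a $ c" for a c
        by (subst sum.remove[of _ j]) (use ch in \<open>auto simp: pd_def\<close>)
      then show ?thesis by (simp add: \<Phi>_def vec_eq_iff F_alpha_vert)
    qed
    then show ?thesis by (metis rangeI)
  qed
  then have "\<Phi> ` UNIV = UNIV" by blast
  then have "dim {v \<in> UNIV. \<Phi> v = 0} + DIM(complex^'r^'r) = DIM('r total)"
    using dim_kernel_image[OF lin subspace_UNIV] by (simp only: dim_UNIV)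
  moreover have "{v \<in> UNIV. \<Phi> v = 0} = polar_space \<I> z (span (b ` {..<4}))"
    unfolding polar_space_4[OF frame_dim(1)[where b=b, OF chi_covector ch]]
    by (auto simp: \<Phi>_def vec_eq_iff)
  ultimately show ?thesis by (simp add: power2_eq_square)
qed

text \<open>Equations of degree 6 imply those of degree 5. For four vectors \<open>e\<close> of the
  plane, take a base covector \<open>\<xi>\<close> that kills them but not a further vector
  \<open>n\<close> of the plane. The wedge of \<open>\<xi>\<close> with the contraction of
  \<open>F_alpha\<close> by \<open>v\<close>, evaluated on \<open>n\<close> and \<open>e\<close>, is
  then \<open>\<xi>\<close> of \<open>n\<close> times the value sought, and it vanishes because
  \<open>\<xi>\<close> is a combination of the coframing.\<close>

lemma F_alpha_contract_zero:
  fixes b :: "nat \<Rightarrow> 'r total"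
  assumes int: "\<And>e. (\<And>i. e i \<in> span (b ` {..<5})) \<Longrightarrow> F_alpha \<alpha> a c z e = 0"
    and d: "dim (fst ` span (b ` {..<5})) = 5"
    and M: "\<And>j. Mf j a c (case_nat v b) = 0"
    and e: "\<And>i. e i \<in> span (b ` {..<5})"
  shows "F_alpha \<alpha> a c z (case_nat v e) = 0"
proof -
  let ?E = "span (b ` {..<5})"
  let ?g = "\<lambda>e. F_alpha \<alpha> a c z (case_nat v e)"
  have c5: "covector (Suc 4) (F_alpha \<alpha> a c z)" using F_alpha_covector by simp
  have cg: "covector (Suc 3) ?g" using covector_contract[OF c5] by simp
  have Fb: "F_alpha \<alpha> a c z b = 0"
  proof -
    have "F_alpha \<alpha> a c z b = F_alpha \<alpha> a c z (\<lambda>i. if i < 5 then b i else 0)"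
      by (rule covector_cong[OF F_alpha_covector]) simp
    also have "\<dots> = 0" by (rule int) (auto simp: span_base span_zero)
    finally show ?thesis .
  qed
  have \<alpha>: "ewedge 1 4 (\<lambda>e. \<alpha> j x (\<lambda>i. fst (e i))) ?g b = 0" for j
    using ewedge_1_contract[OF \<alpha>_pull_covector[of j] c5, of v b] \<alpha>_F_alpha[of j a c] Fb by simp
  have \<alpha>': "ewedge 1 4 (\<lambda>e. cnj (\<alpha> j x (\<lambda>i. fst (e i)))) ?g b = 0" for j
    using ewedge_1_contract[OF covector_cnj[OF \<alpha>_pull_covector[of j]] c5, of v b] M[of j] Fb by (simp add: Mf_def)
  obtain E z' where du: "dual Th x 6 E z'" using dual_Th[OF fst_in_W] by blast
  let ?D = "span ((\<lambda>i. fst (e i)) ` {..<4})"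
  have "dim ?D < dim (fst ` ?E)"
    using dim_le_card'[of "(\<lambda>i. fst (e i)) ` {..<4}"] card_image_le[of "{..<4}" "\<lambda>i. fst (e i)"] d by simp
  then have "\<not> fst ` ?E \<subseteq> ?D" using dim_subset[of "fst ` ?E" ?D] by linarith
  \<comment> \<open>The projected plane has dimension 5 while four vectors span at most dimension 4.
    The component \<open>w\<close> of this vector orthogonal to that span will define
    \<open>\<xi>\<close>.\<close>
  then obtain n where n: "n \<in> ?E" "fst n \<notin> ?D" by blast
  obtain y w where yw: "y \<in> span ((\<lambda>i. fst (e i)) ` {..<4})"
    "\<And>u. u \<in> span ((\<lambda>i. fst (e i)) ` {..<4}) \<Longrightarrow> orthogonal w u" "fst n = y + w"
    using orthogonal_subspace_decomp_exists[of "(\<lambda>i. fst (e i)) ` {..<4}" "fst n"] by blast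
  have "w \<noteq> 0" using yw n by auto
  define \<xi> :: "(nat \<Rightarrow> 'r total) \<Rightarrow> complex" where "\<xi> e = complex_of_real (w \<bullet> fst (e 0))" for e
  have lw: "linear (\<lambda>u. complex_of_real (w \<bullet> u))" by (rule linearI) (simp_all add: inner_add_right scaleR_conv_of_real[where 'a=complex])
  have c\<xi>: "covector 1 \<xi>"
    unfolding \<xi>_def[abs_def]
    by (rule covector_1) (auto intro!: linearI simp: inner_add_right scaleR_conv_of_real[where 'a=complex])
  have \<xi>e: "\<xi> (\<lambda>_. e i) = 0" if "i < 4" for i
    using yw(2)[of "fst (e i)"] that by (auto simp: \<xi>_def orthogonal_def span_base)
  have \<xi>n: "\<xi> (\<lambda>_. n) \<noteq> 0"
    using yw(2)[OF yw(1)] yw(3) \<open>w \<noteq> 0\<close> by (simp add: \<xi>_def orthogonal_def inner_add_right)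
  have "\<xi> e' = (\<Sum>A<6. (\<Sum>m<6. z' A m * complex_of_real (w \<bullet> E m)) * Th A x (\<lambda>i. fst (e' i)))" for e'
  proof -
    have "Th A x (\<lambda>i. fst (e' i)) = Th A x (\<lambda>_. fst (e' 0))" for A
      by (rule covector_cong[OF Th_covector[OF fst_in_W]]) auto
    then show ?thesis
      using du[unfolded dual_def, rule_format, OF lw, of "fst (e' 0)"] by (simp add: \<xi>_def mult.commute)
  qed
  then have \<xi>: "\<xi> = (\<lambda>e'. \<Sum>A<6. (\<Sum>m<6. z' A m * complex_of_real (w \<bullet> E m)) * Th A x (\<lambda>i. fst (e' i)))"
    by blast
  have ThA: "ewedge 1 4 (\<lambda>e. Th A x (\<lambda>i. fst (e i))) ?g b = 0" for A
    using \<alpha>[of "ix A"] \<alpha>'[of "ix (A - 3)"] by (simp add: complex_coframing_def)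
  have zb: "ewedge 1 4 \<xi> ?g b = 0"
    unfolding \<xi> ewedge_sum_left ewedge_mult_left ThA by simp
  have c\<xi>g: "covector 5 (ewedge 1 4 \<xi> ?g)" using covector_ewedge[OF c\<xi> cg] by simp
  have "ewedge 1 4 \<xi> ?g (case_nat n e) = 0"
    by (rule covector_frame_zero[OF c\<xi>g zb]) (use n e in \<open>auto split: nat.splits\<close>)
  moreover have "ewedge 1 3 \<xi> (\<lambda>e. ?g (case_nat n e)) e = 0"
    by (rule ewedge_1_killed[OF c\<xi>]) (use \<xi>e in simp)
  moreover have "ewedge 1 4 \<xi> ?g (case_nat n e) = \<xi> (\<lambda>_. n) * ?g e - ewedge 1 3 \<xi> (\<lambda>e. ?g (case_nat n e)) e"
    using ewedge_1_contract[OF c\<xi> cg, of n e] by simp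
  ultimately show ?thesis using \<xi>n by simp
qed

text \<open>The condition on \<open>kap\<close> makes the plane transverse, so that
  \<open>F_alpha_contract_zero\<close> applies. Then all generators vanish on the plane with and
  without the additional vector, and \<open>ideal_vanish_contract\<close> extends this to the
  ideal.\<close>

lemma polar_space_5:
  fixes b :: "nat \<Rightarrow> 'r total"
  assumes int: "\<And>a c e. (\<And>i. e i \<in> span (b ` {..<5})) \<Longrightarrow> F_alpha \<alpha> a c z e = 0"
    and k: "kap x j (\<lambda>i. fst (b i)) \<noteq> 0"
  shows "polar_space \<I> z (span (b ` {..<5})) = {v. (\<forall>j a c. Mf j a c (case_nat v b) = 0) \<and> (\<forall>a c. F_eta \<alpha> \<eta> a c z (case_nat v b) = 0)}"
proof (intro equalityI subsetI)
  note d = frame_dim[where b=b, OF kap_covector[OF fst_in_W] k]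
  fix v assume v: "v \<in> polar_space \<I> z (span (b ` {..<5}))"
  define e where "e i = (if i < 5 then b i else 0)" for i
  have e: "\<forall>i. e i \<in> span (b ` {..<5})" by (auto simp: e_def span_base span_zero)
  have I: "\<Phi> z (case_nat v e) = 0" if "in_ideal 6 \<Phi>" for \<Phi>
  proof -
    have "\<I> (Suc (dim (span (b ` {..<5})))) (Re_form \<Phi>)" "\<I> (Suc (dim (span (b ` {..<5})))) (Im_form \<Phi>)"
      unfolding d using that by (simp_all add: cideal_def system_ideal_def)
    then have "Re (\<Phi> z (case_nat v e)) = 0" "Im (\<Phi> z (case_nat v e)) = 0"
      using v e unfolding polar_space_def by blast+
    then show ?thesis by (simp add: complex_eq_iff)
  qed
  have eb: "f (case_nat v e) = f (case_nat v b)" if "covector 6 f" for f :: "(nat \<Rightarrow> 'r total) \<Rightarrow> complex"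
    by (rule covector_cong[OF that]) (auto simp: e_def split: nat.splits)
  have "Mf j a c (case_nat v b) = 0" for j a c
  proof -
    have "smooth_form (system_domain W) 1 (pull_fst (cnj_form (\<alpha> j)) :: ('r total, complex) form)"
      by (rule smooth_form_pull_sys[OF W smooth_form_cnj[OF W \<alpha>_smooth]])
    from in_ideal_mult[OF this F_alpha_in_ideal[of a c]]
    have "in_ideal 6 (wedge 1 5 (pull_fst (cnj_form (\<alpha> j))) (F_alpha \<alpha> a c))" by simp
    from I[OF this] show ?thesis
      unfolding eb[OF Mf_covector, symmetric] by (simp add: Mf_def wedge_ewedge pull_fst_at x_def)
  qed
  moreover have "F_eta \<alpha> \<eta> a c z (case_nat v b) = 0" for a c
    using I[OF F_eta_in_ideal[of a c]] unfolding eb[OF F_eta_covector] .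
  ultimately show "v \<in> {v. (\<forall>j a c. Mf j a c (case_nat v b) = 0) \<and> (\<forall>a c. F_eta \<alpha> \<eta> a c z (case_nat v b) = 0)}" by blast
next
  note d = frame_dim[where b=b, OF kap_covector[OF fst_in_W] k]
  fix v assume "v \<in> {v. (\<forall>j a c. Mf j a c (case_nat v b) = 0) \<and> (\<forall>a c. F_eta \<alpha> \<eta> a c z (case_nat v b) = 0)}"
  then have M: "Mf j a c (case_nat v b) = 0" and Fe: "F_eta \<alpha> \<eta> a c z (case_nat v b) = 0" for j a c by blast+
  have F1: "F_alpha \<alpha> a c z (case_nat v e) = 0" if "\<And>i. e i \<in> span (b ` {..<5})" for a c e
    by (rule F_alpha_contract_zero[OF int d(2) M that])
  have F2: "F_eta \<alpha> \<eta> a c z (case_nat v e) = 0" if "\<And>i. e i \<in> span (b ` {..<5})" for a c e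
  proof (rule covector_frame_zero[of 5 "\<lambda>e. F_eta \<alpha> \<eta> a c z (case_nat v e)" b])
    show "covector 5 (\<lambda>e. F_eta \<alpha> \<eta> a c z (case_nat v e))"
      by (rule covector_contract) (use F_eta_covector in simp)
  qed (use Fe that in auto)
  have F3: "F_eta \<alpha> \<eta> a c z e = 0" if e: "\<And>i. e i \<in> span (b ` {..<5})" for a c e
  proof (rule covector_dependent_zero[OF F_eta_covector])
    have "dim (e ` {..<6}) \<le> dim (span (b ` {..<5}))" by (rule dim_subset) (use e in auto)
    then show "dim (e ` {..<6}) < 6" using d(1) by linarith
  qed
  have "\<phi> z (case_nat v e) = 0" if \<phi>: "\<I> k \<phi>" and e: "\<forall>i. e i \<in> span (b ` {..<5})" for k \<phi> e
  proof (rule ideal_vanish_contract[OF open_X gens \<phi>[unfolded system_ideal_def] z, of "span (b ` {..<5})" v e])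
    show "\<phi>' z e' = 0" if "(k', \<phi>') \<in> system_generators \<alpha> \<eta>" "\<And>i. e' i \<in> span (b ` {..<5})" for k' \<phi>' e'
      using that(1) by (rule generator_cases) (use int[OF that(2)] F3[OF that(2)] in auto)
    show "\<phi>' z (case_nat v e') = 0" if "(k', \<phi>') \<in> system_generators \<alpha> \<eta>" "\<And>i. e' i \<in> span (b ` {..<5})" for k' \<phi>' e'
      using that(1) by (rule generator_cases) (use F1[OF that(2)] F2[OF that(2)] in auto)
  qed (use e in blast)+
  then show "v \<in> polar_space \<I> z (span (b ` {..<5}))" unfolding polar_space_def by blast
qed

text \<open>Rank-nullity for the projection to the base. It is onto: the values of the equations on
  \<open>(u, 0)\<close> obey \<open>M_relation\<close> and \<open>F_eta_skew\<close>, so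
  \<open>vertical_solution\<close> provides a vertical vector that cancels them. The kernel is
  parametrized by Hermitian matrices through \<open>g\<close>.\<close>

lemma polar_space_5_dim:
  fixes b :: "nat \<Rightarrow> 'r total"
  assumes int: "\<And>a c e. (\<And>i. e i \<in> span (b ` {..<5})) \<Longrightarrow> F_alpha \<alpha> a c z e = 0"
    and Q: "Qf x (\<lambda>i. fst (b i)) \<noteq> 0"
  shows "dim (polar_space \<I> z (span (b ` {..<5}))) = 6 + CARD('r) ^ 2"
proof -
  define \<kappa> where "\<kappa> j = kap x j (\<lambda>i. fst (b i))" for j
  have Q': "(\<Sum>j\<in>UNIV. sig \<epsilon> j * (\<kappa> j * cnj (\<kappa> j))) \<noteq> 0"
    using Q by (simp add: Qf_def \<kappa>_def)
  have "\<exists>j0. \<kappa> j0 \<noteq> 0"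
  proof (rule ccontr)
    assume "\<nexists>j0. \<kappa> j0 \<noteq> 0"
    then have "\<kappa> j = 0" for j by blast
    then show False using Q' by simp
  qed
  then obtain j0 where j0: "\<kappa> j0 \<noteq> 0" ..
  let ?K = "{v. (\<forall>j a c. Mf j a c (case_nat v b) = 0) \<and> (\<forall>a c. F_eta \<alpha> \<eta> a c z (case_nat v b) = 0)}"
  have P: "polar_space \<I> z (span (b ` {..<5})) = ?K"
    using polar_space_5[OF int] j0 unfolding \<kappa>_def by blast
  have Fb: "F_alpha \<alpha> a c z b = 0" for a c
  proof -
    have "F_alpha \<alpha> a c z b = F_alpha \<alpha> a c z (\<lambda>i. if i < 5 then b i else 0)"
      by (rule covector_cong[OF F_alpha_covector]) simp
    also have "\<dots> = 0" by (rule int) (auto simp: span_base span_zero)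
    finally show ?thesis .
  qed
  have c6: "covector (Suc 5) (Mf j a c)" "covector (Suc 5) (F_eta \<alpha> \<eta> a c z)" for j a c using Mf_covector F_eta_covector by simp_all
  note lM = linear_contract0[OF c6(1)] and lF = linear_contract0[OF c6(2)]
  have K: "subspace ?K"
    by (simp add: subspace_def linear_0[OF lM] linear_0[OF lF] linear_add[OF lM] linear_add[OF lF] linear_cmul[OF lM] linear_cmul[OF lF])
  have all3: "(\<forall>j :: 3. P j) \<longleftrightarrow> P 1 \<and> P 2 \<and> P 3" for P by (rule forall_3)
  have vert: "(0, pd) \<in> ?K \<longleftrightarrow> (\<forall>a c. cnj (pd $ 2 $ c $ a) * \<kappa> 3 - cnj (pd $ 3 $ c $ a) * \<kappa> 2 = 0 \<and>
      cnj (pd $ 3 $ c $ a) * \<kappa> 1 - cnj (pd $ 1 $ c $ a) * \<kappa> 3 = 0 \<and>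
      cnj (pd $ 1 $ c $ a) * \<kappa> 2 - cnj (pd $ 2 $ c $ a) * \<kappa> 1 = 0 \<and>
      (\<Sum>j\<in>UNIV. sig \<epsilon> j / 2 * (pd $ j $ a $ c * \<kappa> j - cnj (pd $ j $ c $ a) * cnj (\<kappa> j))) = 0)" for pd
    by (simp only: mem_Collect_eq all3 M_vert F_eta_vert \<kappa>_def[symmetric]) blast
  have "fst ` ?K = UNIV"
  proof (intro equalityI subsetI)
    fix u :: "real^6"
    let ?v = "(u, 0) :: 'r total"
    obtain pd :: "complex^'r^'r^3" where pd:
      "\<And>a c. cnj (pd $ 2 $ c $ a) * \<kappa> 3 - cnj (pd $ 3 $ c $ a) * \<kappa> 2 = Mf 1 a c (case_nat ?v b)"
      "\<And>a c. cnj (pd $ 3 $ c $ a) * \<kappa> 1 - cnj (pd $ 1 $ c $ a) * \<kappa> 3 = Mf 2 a c (case_nat ?v b)"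
      "\<And>a c. cnj (pd $ 1 $ c $ a) * \<kappa> 2 - cnj (pd $ 2 $ c $ a) * \<kappa> 1 = Mf 3 a c (case_nat ?v b)"
      "\<And>a c. (\<Sum>j\<in>UNIV. sig \<epsilon> j / 2 * (pd $ j $ a $ c * \<kappa> j - cnj (pd $ j $ c $ a) * cnj (\<kappa> j))) = F_eta \<alpha> \<eta> a c z (case_nat ?v b)"
    proof (rule vertical_solution[of \<kappa> "\<lambda>j a c. Mf j a c (case_nat ?v b)" "\<lambda>a c. F_eta \<alpha> \<eta> a c z (case_nat ?v b)"])
      show "(\<Sum>j\<in>UNIV. \<kappa> j * Mf j a c (case_nat ?v b)) = 0" for a c
        unfolding \<kappa>_def by (rule M_relation[OF Fb])
      show "F_eta \<alpha> \<eta> a c z (case_nat ?v b) = - cnj (F_eta \<alpha> \<eta> c a z (case_nat ?v b))" for a c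
        by (rule F_eta_skew)
    qed (rule Q', rule that, assumption+)
    have "Mf j a c (case_nat (0, pd) b) = Mf j a c (case_nat ?v b)" for j a c
      using exhaust_3[of j] by (auto simp: M_vert pd(1-3)[unfolded \<kappa>_def])
    moreover have "F_eta \<alpha> \<eta> a c z (case_nat (0, pd) b) = F_eta \<alpha> \<eta> a c z (case_nat ?v b)" for a c
      unfolding F_eta_vert by (rule pd(4)[unfolded \<kappa>_def])
    ultimately have "?v - (0, pd) \<in> ?K"
      by (simp only: mem_Collect_eq linear_diff[OF lM] linear_diff[OF lF]) simp
    then show "u \<in> fst ` ?K" by (rule rev_image_eqI) simp
  qed simp
  then have fstK: "dim (fst ` ?K) = 6" by simp
  define g :: "complex^'r^'r \<Rightarrow> 'r total" where "g s = (0, \<chi> j a c. s $ a $ c * cnj (\<kappa> j))" for s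
  let ?H = "{A :: complex^'r^'r. \<forall>a b. A $ a $ b = cnj (A $ b $ a)}"
  have lg: "linear g" by (rule linearI) (simp_all add: g_def vec_eq_iff algebra_simps)
  have ig: "inj g"
    by (rule injI) (use j0 in \<open>auto simp: g_def vec_eq_iff\<close>)
  define q where "q = (\<Sum>j\<in>UNIV. sig \<epsilon> j * (\<kappa> j * cnj (\<kappa> j)))"
  have q: "q = \<kappa> 1 * cnj (\<kappa> 1) + \<epsilon> * (\<kappa> 2 * cnj (\<kappa> 2)) + \<epsilon> * (\<kappa> 3 * cnj (\<kappa> 3))"
    by (simp add: q_def sum_3 sig_def three_neq)
  have gK: "(\<Sum>j\<in>UNIV. sig \<epsilon> j / 2 * (s * cnj (\<kappa> j) * \<kappa> j - t * \<kappa> j * cnj (\<kappa> j))) = q / 2 * (s - t)" for s t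
    by (simp add: q sum_3 sig_def three_neq field_simps)
  have "{v \<in> ?K. fst v = 0} = g ` ?H"
  proof (intro equalityI subsetI)
    fix v assume "v \<in> g ` ?H"
    then obtain s where s: "s \<in> ?H" "v = g s" by blast
    have s': "cnj (s $ c $ a) = s $ a $ c" for a c using s(1) by (metis (mono_tags, lifting) mem_Collect_eq)
    have "g s \<in> ?K" unfolding g_def vert by (simp add: s' gK)
    then show "v \<in> {v \<in> ?K. fst v = 0}" using s(2) by (simp add: g_def)
  next
    fix v assume v: "v \<in> {v \<in> ?K. fst v = 0}"
    then obtain pd where pd: "v = (0, pd)" by (metis (mono_tags, lifting) mem_Collect_eq prod.collapse)
    have eqs: "cnj (pd $ 2 $ c $ a) * \<kappa> 3 - cnj (pd $ 3 $ c $ a) * \<kappa> 2 = 0"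
      "cnj (pd $ 3 $ c $ a) * \<kappa> 1 - cnj (pd $ 1 $ c $ a) * \<kappa> 3 = 0"
      "cnj (pd $ 1 $ c $ a) * \<kappa> 2 - cnj (pd $ 2 $ c $ a) * \<kappa> 1 = 0"
      "(\<Sum>j\<in>UNIV. sig \<epsilon> j / 2 * (pd $ j $ a $ c * \<kappa> j - cnj (pd $ j $ c $ a) * cnj (\<kappa> j))) = 0" for a c
      using v vert[of pd] pd by blast+
    \<comment> \<open>Vanishing cross products make the conjugated entries of \<open>pd\<close>
      proportional to \<open>\<kappa>\<close>; the factor is read off at the index \<open>j0\<close>
      where \<open>\<kappa>\<close> is nonzero.\<close>
    define s :: "complex^'r^'r" where "s = (\<chi> c a. pd $ j0 $ c $ a / cnj (\<kappa> j0))"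
    have pds: "cnj (pd $ j $ c $ a) = cnj (s $ c $ a) * \<kappa> j" for j a c
    proof -
      have e: "cnj (pd $ j $ c $ a) * \<kappa> i = cnj (pd $ i $ c $ a) * \<kappa> j" for i j
      proof -
        note eqs(1)[of c a] eqs(2)[of c a] eqs(3)[of c a]
        then show ?thesis using exhaust_3[of i] exhaust_3[of j] by auto
      qed
      show ?thesis using e[of j j0] j0 by (simp add: s_def field_simps)
    qed
    then have pds': "pd $ j $ a $ c = s $ a $ c * cnj (\<kappa> j)" for j a c
      by (metis complex_cnj_cnj complex_cnj_mult)
    have "q / 2 * (s $ a $ c - cnj (s $ c $ a)) = 0" for a c
    proof -
      have "(\<Sum>j\<in>UNIV. sig \<epsilon> j / 2 * (pd $ j $ a $ c * \<kappa> j - cnj (pd $ j $ c $ a) * cnj (\<kappa> j))) = 0" by (rule eqs(4))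
      moreover have "pd $ j $ a $ c * \<kappa> j - cnj (pd $ j $ c $ a) * cnj (\<kappa> j) =
          s $ a $ c * cnj (\<kappa> j) * \<kappa> j - cnj (s $ c $ a) * \<kappa> j * cnj (\<kappa> j)" for j
        unfolding pds by (simp only: pds')
      ultimately show ?thesis by (simp only: gK)
    qed
    moreover have "q \<noteq> 0" using Q' unfolding q_def .
    ultimately have "s $ a $ c = cnj (s $ c $ a)" for a c
      by (metis divide_eq_0_iff mult_eq_0_iff right_minus_eq zero_neq_numeral)
    then have "s \<in> ?H" by blast
    moreover have "v = g s" unfolding pd g_def by (simp add: vec_eq_iff pds')
    ultimately show "v \<in> g ` ?H" by blast
  qed
  moreover have "dim (g ` ?H) = dim ?H" by (rule dim_image_eq[OF lg]) (rule inj_on_subset[OF ig subset_UNIV])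
  ultimately have "dim {v \<in> ?K. fst v = 0} = CARD('r) ^ 2" using hermitian_dim[where 'r='r] by simp
  then show ?thesis unfolding P using dim_kernel_image[OF linear_fst K] fstK by simp
qed

end

end

section \<open>Ordinary and regular integral elements\<close>

lemma continuous_on_coordinate:
  "continuous_on S (\<lambda>p :: 'a::topological_space \<times> (nat \<Rightarrow> 'b::topological_space). snd p i)"
  by (rule continuous_on_compose2[OF continuous_on_product_coordinates[where i=i] continuous_on_snd[OF continuous_on_id]]) simp

lemma continuous_on_shift:
  "continuous_on S (\<lambda>p :: 'a::topological_space \<times> (nat \<Rightarrow> 'b::topological_space). (fst p, \<lambda>i. snd p (Suc i)))"
  by (intro continuous_on_Pair continuous_on_fst continuous_on_id continuous_on_coordinatewise_then_product
      continuous_on_coordinate)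

text \<open>A smooth form is smooth in the point for each fixed tuple of vectors. Continuity in
  point and frame together follows by expanding one slot after the other in the standard
  basis.\<close>

lemma smooth_form_continuous:
  fixes \<phi> :: "('v::euclidean_space, 'a::real_normed_vector) form"
  assumes "smooth_form X k \<phi>"
  shows "continuous_on (X \<times> UNIV) (\<lambda>p. \<phi> (fst p) (snd p))"
  using assms
proof (induction k arbitrary: \<phi>)
  case 0
  have "continuous_on (X \<times> UNIV) (\<lambda>p :: 'v \<times> (nat \<Rightarrow> 'v). \<phi> (fst p) (\<lambda>_. 0))"
    by (rule continuous_on_compose2[OF smooth_on_continuous[OF smooth_form_smooth[OF 0]] continuous_on_fst[OF continuous_on_id]]) auto
  then show ?case
  proof (rule continuous_on_eq)
    show "\<phi> (fst p) (\<lambda>_. 0) = \<phi> (fst p) (snd p)" if "p \<in> X \<times> UNIV" for p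
      by (rule covector_0[OF smooth_formD[OF 0]]) (use that in auto)
  qed
next
  case (Suc k)
  have 1: "continuous_on (X \<times> UNIV) (\<lambda>p. \<phi> (fst p) (case_nat v (\<lambda>i. snd p (Suc i))))" for v
  proof -
    have "continuous_on (X \<times> UNIV) (\<lambda>p. (\<lambda>q. \<phi> (fst q) (case_nat v (snd q))) (fst p, \<lambda>i. snd p (Suc i)))"
      by (rule continuous_on_compose2[OF Suc.IH[OF smooth_form_contract[OF Suc.prems]] continuous_on_shift]) auto
    then show ?thesis by simp
  qed
  have "continuous_on (X \<times> UNIV) (\<lambda>p. \<Sum>v\<in>Basis. (snd p 0 \<bullet> v) *\<^sub>R \<phi> (fst p) (case_nat v (\<lambda>i. snd p (Suc i))))"
    by (intro continuous_on_sum continuous_on_scaleR 1 continuous_on_inner continuous_on_coordinate continuous_on_const)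
  then show ?case
  proof (rule continuous_on_eq)
    fix p :: "'v \<times> (nat \<Rightarrow> 'v)" assume "p \<in> X \<times> UNIV"
    then have "covector (Suc k) (\<phi> (fst p))" using smooth_formD[OF Suc.prems] by auto
    note l = linear_contract0[OF this, of "\<lambda>i. snd p (Suc i)"]
    have "snd p = case_nat (snd p 0) (\<lambda>i. snd p (Suc i))" by (auto split: nat.split)
    then have "\<phi> (fst p) (snd p) = \<phi> (fst p) (case_nat (\<Sum>v\<in>Basis. (snd p 0 \<bullet> v) *\<^sub>R v) (\<lambda>i. snd p (Suc i)))"
      by (simp only: euclidean_representation)
    also have "\<dots> = (\<Sum>v\<in>Basis. (snd p 0 \<bullet> v) *\<^sub>R \<phi> (fst p) (case_nat v (\<lambda>i. snd p (Suc i))))"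
      by (simp only: linear_sum[OF l] linear_cmul[OF l])
    finally show "(\<Sum>v\<in>Basis. (snd p 0 \<bullet> v) *\<^sub>R \<phi> (fst p) (case_nat v (\<lambda>i. snd p (Suc i)))) = \<phi> (fst p) (snd p)" ..
  qed
qed

lemma smooth_form_continuous_shift:
  fixes \<phi> :: "('v::euclidean_space, 'a::real_normed_vector) form"
  assumes "smooth_form X k \<phi>"
  shows "continuous_on (X \<times> UNIV) (\<lambda>p. \<phi> (fst p) (\<lambda>i. snd p (Suc i)))"
proof -
  have "continuous_on (X \<times> UNIV) (\<lambda>p. (\<lambda>q. \<phi> (fst q) (snd q)) (fst p, \<lambda>i. snd p (Suc i)))"
    by (rule continuous_on_compose2[OF smooth_form_continuous[OF assms] continuous_on_shift]) auto
  then show ?thesis by simp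
qed

lemma open_nonzero:
  fixes f :: "'a::topological_space \<times> 'b::topological_space \<Rightarrow> 'c::real_normed_vector"
  assumes "open X" "continuous_on (X \<times> UNIV) f"
  shows "open {p. fst p \<in> X \<and> f p \<noteq> 0}"
proof -
  have "open (X \<times> UNIV \<inter> f -` (- {0}))"
    by (rule continuous_open_preimage[OF assms(2) open_Times[OF assms(1) open_UNIV]]) auto
  moreover have "X \<times> UNIV \<inter> f -` (- {0}) = {p. fst p \<in> X \<and> f p \<noteq> 0}" by auto
  ultimately show ?thesis by simp
qed

lemma smooth_form_contracts:
  "smooth_form X (m + k) \<phi> \<Longrightarrow> smooth_form X k (\<lambda>x b. \<phi> x (\<lambda>i. if i < m then w i else b (i - m)))"
proof (induction m arbitrary: \<phi> w)
  case 0 then show ?case by simp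
next
  case (Suc m)
  have "smooth_form X (m + k) (\<lambda>x e. \<phi> x (case_nat (w 0) e))"
    by (rule smooth_form_contract) (use Suc.prems in simp)
  from Suc.IH[OF this, of "\<lambda>i. w (Suc i)"]
  have "smooth_form X k (\<lambda>x b. \<phi> x (case_nat (w 0) (\<lambda>i. if i < m then w (Suc i) else b (i - m))))" .
  moreover have "case_nat (w 0) (\<lambda>i. if i < m then w (Suc i) else b (i - m)) = (\<lambda>i. if i < Suc m then w i else b (i - Suc m))" for b
    by (auto split: nat.split)
  ultimately show ?case by simp
qed

text \<open>The vectors are only rotated, so \<open>covector_frame_zero\<close> for the rotated
  frame would force the original value to vanish.\<close>

lemma covector_rotate_nonzero:
  assumes f: "covector (m + k) f" and e: "f e \<noteq> 0"
  shows "f (\<lambda>i. if i < m then e (k + i) else e (i - m)) \<noteq> 0"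
proof
  let ?b = "\<lambda>i. if i < m then e (k + i) else e (i - m)"
  assume 0: "f ?b = 0"
  have "f e = 0"
  proof (rule covector_frame_zero[OF f 0])
    fix i assume i: "i < m + k"
    define j where "j = (if i < k then m + i else i - k)"
    have "j < m + k" using i less_imp_diff_less[of i "m + k" k] by (auto simp: j_def)
    moreover have "e i = ?b j" using i by (cases "i < k") (auto simp: j_def)
    ultimately have "e i \<in> ?b ` {..<m + k}" by blast
    then show "e i \<in> span (?b ` {..<m + k})" by (rule span_base)
  qed
  then show False using e by simp
qed

text \<open>Each further vector raises the dimension by at most one, so a full final dimension
  leaves no room for a loss earlier.\<close>

lemma dim_frame_initial:
  fixes b :: "nat \<Rightarrow> 'v::euclidean_space"
  assumes "dim (b ` {..<n}) = n" "k \<le> n"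
  shows "dim (b ` {..<k}) = k"
proof -
  have s: "dim (b ` {..<Suc m}) \<le> Suc (dim (b ` {..<m}))" for m
    by (simp add: lessThan_Suc dim_insert)
  have u: "dim (b ` {..<m}) \<le> m" for m
  proof (induction m)
    case (Suc m) then show ?case using s[of m] by linarith
  qed simp
  show ?thesis using assms(2)
  proof (induction rule: inc_induct)
    case base show ?case by (rule assms)
  next
    case (step m) then show ?case using s[of m] u[of m] by simp
  qed
qed

text \<open>Multilinearity: each slot contributes a factor that is affine in \<open>t\<close>. The
  polynomial is complex because \<open>chi\<close> and \<open>kap\<close> are, while the parameter
  stays real.\<close>

lemma covector_line_poly:
  fixes f :: "(nat \<Rightarrow> 'v::real_vector) \<Rightarrow> complex"
  assumes "covector k f"
  shows "\<exists>p. \<forall>t. f (\<lambda>i. e i + t *\<^sub>R w i) = poly p (of_real t)"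
  using assms
proof (induction k arbitrary: f e w)
  case 0
  then have "f (\<lambda>i. e i + t *\<^sub>R w i) = poly [:f e:] (of_real t)" for t
    by (simp, rule covector_0)
  then show ?case by blast
next
  case (Suc k)
  let ?r = "\<lambda>t i. e (Suc i) + t *\<^sub>R w (Suc i)"
  obtain p where p: "\<And>t. f (case_nat (e 0) (?r t)) = poly p (of_real t)"
    using Suc.IH[OF covector_contract[OF Suc.prems, of "e 0"], of "\<lambda>i. e (Suc i)" "\<lambda>i. w (Suc i)"] by blast
  obtain q where q: "\<And>t. f (case_nat (w 0) (?r t)) = poly q (of_real t)"
    using Suc.IH[OF covector_contract[OF Suc.prems, of "w 0"], of "\<lambda>i. e (Suc i)" "\<lambda>i. w (Suc i)"] by blast
  have "f (\<lambda>i. e i + t *\<^sub>R w i) = poly (p + [:0, 1:] * q) (of_real t)" for t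
  proof -
    note l = linear_contract0[OF Suc.prems, of "?r t"]
    have "(\<lambda>i. e i + t *\<^sub>R w i) = case_nat (e 0 + t *\<^sub>R w 0) (?r t)" by (auto split: nat.split)
    then have "f (\<lambda>i. e i + t *\<^sub>R w i) = f (case_nat (e 0) (?r t)) + t *\<^sub>R f (case_nat (w 0) (?r t))"
      by (simp only: linear_add[OF l] linear_cmul[OF l])
    then show ?thesis by (simp add: p q scaleR_conv_of_real[where 'a=complex])
  qed
  then show ?case by blast
qed

text \<open>
  A polynomial condition satisfied at the end of a segment of frames holds at frames arbitrarily
  close to its beginning.
\<close>

lemma frame_perturb:
  fixes e w :: "nat \<Rightarrow> 'v::euclidean_space" and p :: "complex poly"
  assumes N: "open N" "(z, e) \<in> N" and s: "poly p (of_real s) \<noteq> 0"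
  obtains t where "(z, \<lambda>i. e i + t *\<^sub>R w i) \<in> N" "poly p (of_real t) \<noteq> 0"
proof -
  have "continuous_on UNIV (\<lambda>t. (z, \<lambda>i. e i + t *\<^sub>R w i))"
    by (intro continuous_on_Pair continuous_on_const continuous_on_coordinatewise_then_product continuous_intros)
  from open_vimage[OF N(1) this] have "open ((\<lambda>t. (z, \<lambda>i. e i + t *\<^sub>R w i)) -` N)" .
  moreover have "0 \<in> (\<lambda>t. (z, \<lambda>i. e i + t *\<^sub>R w i)) -` N" using N(2) by simp
  ultimately obtain \<delta> where \<delta>: "\<delta> > 0" "ball 0 \<delta> \<subseteq> (\<lambda>t. (z, \<lambda>i. e i + t *\<^sub>R w i)) -` N"
    by (meson openE)
  have "p \<noteq> 0" using s by auto
  then have fin: "finite {x. poly p x = 0}" by (rule poly_roots_finite)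
  have "\<exists>t\<in>{0<..<\<delta>}. poly p (of_real t) \<noteq> 0"
  proof (rule ccontr)
    assume "\<not> ?thesis"
    then have "complex_of_real ` {0<..<\<delta>} \<subseteq> {x. poly p x = 0}" by auto
    then have "finite (complex_of_real ` {0<..<\<delta>})" using fin finite_subset by blast
    then have "finite {0<..<\<delta>}" by (rule finite_imageD) (simp add: inj_on_def)
    then show False using infinite_Ioo[OF \<delta>(1)] by simp
  qed
  then obtain t where t: "0 < t" "t < \<delta>" "poly p (of_real t) \<noteq> 0" by auto
  then have "t \<in> ball 0 \<delta>" by simp
  then show ?thesis using that \<delta>(2) t(3) by blast
qed

context unitary_system
begin

context
  fixes r :: "'r::finite itself"
begin

section \<open>Integral and ordinary elements of the system\<close>

abbreviation "TX \<equiv> (system_domain W :: 'r total set)"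
abbreviation "TI \<equiv> (system_ideal W \<alpha> \<eta> :: nat \<Rightarrow> ('r total, real) form \<Rightarrow> bool)"
abbreviation "\<Omega>6 \<equiv> (indep_form \<alpha> :: ('r total, real) form)"

lemma integral_elementI:
  assumes z: "z \<in> TX" and E: "subspace E"
    and 1: "\<And>a c e. (\<And>i. e i \<in> E) \<Longrightarrow> F_alpha \<alpha> a c z e = 0"
    and 2: "\<And>a c e. (\<And>i. e i \<in> E) \<Longrightarrow> F_eta \<alpha> \<eta> a c z e = 0"
  shows "integral_element TX TI z E"
  unfolding integral_element_def
proof (intro conjI allI impI z E)
  fix k \<phi> and e :: "nat \<Rightarrow> 'r total" assume \<phi>: "TI k \<phi>" and e: "\<forall>i. e i \<in> E"
  show "\<phi> z e = 0"
  proof (rule ideal_vanish[where S=E, OF \<phi>[unfolded system_ideal_def] z])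
    show "\<phi>' z e' = 0" if "(k', \<phi>') \<in> system_generators \<alpha> \<eta>" "\<And>i. e' i \<in> E" for k' \<phi>' e'
      using that(1) by (rule generator_cases[OF z]) (use 1[OF that(2)] 2[OF that(2)] in auto)
  qed (use e in blast)
qed

lemma F_alpha_TI: "TI 5 (Re_form (F_alpha \<alpha> a c))" "TI 5 (Im_form (F_alpha \<alpha> a c))"
  unfolding system_ideal_def system_generators_def by (rule alg_ideal.gen; blast)+

lemma integral_element_F_alpha:
  assumes "integral_element TX TI z E" "\<And>i. e i \<in> E"
  shows "F_alpha \<alpha> a c z e = 0"
proof -
  have "\<phi> z e = 0" if "TI 5 \<phi>" for \<phi> using assms that unfolding integral_element_def by blast
  from this[OF F_alpha_TI(1)[of a c]] this[OF F_alpha_TI(2)[of a c]]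
  show ?thesis by (simp add: complex_eq_iff)
qed

lemma integral_element_subset:
  "integral_element TX TI z E \<Longrightarrow> subspace F \<Longrightarrow> F \<subseteq> E \<Longrightarrow> integral_element TX TI z F"
  unfolding integral_element_def by blast

lemma integral_element_small:
  assumes z: "z \<in> TX" and E: "subspace E" "dim E \<le> 4"
  shows "integral_element TX TI z E"
proof (rule integral_elementI[OF z E(1)])
  fix a c :: 'r and e :: "nat \<Rightarrow> 'r total" assume e: "\<And>i. e i \<in> E"
  have d: "dim (e ` {..<k}) \<le> 4" for k
    using dim_subset[of "e ` {..<k}" E] e E(2) by force
  show "F_alpha \<alpha> a c z e = 0" by (rule covector_dependent_zero[OF F_alpha_covector[OF z]]) (use d[of 5] in simp)
  show "F_eta \<alpha> \<eta> a c z e = 0" by (rule covector_dependent_zero[OF F_eta_covector[OF z]]) (use d[of 6] in simp)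
qed

lemma indep_frame:
  assumes z: "z \<in> TX" and b: "\<Omega>6 z b \<noteq> 0"
  shows "k \<le> 6 \<Longrightarrow> dim (span (b ` {..<k})) = k" "dim (fst ` span (b ` {..<6})) = 6"
proof -
  have "word Th [0, 1, 2, 3, 4, 5] (fst z) (\<lambda>i. fst (b i)) \<noteq> 0" using indep_form_nonzero_iff[OF z] b by blast
  note d = frame_dim[OF z word_covector[OF fst_in_W[OF z]] this]
  show "dim (fst ` span (b ` {..<6})) = 6" by (rule d(2)) simp
  have "dim (b ` {..<6}) = 6" using d(1)[of 6] by simp
  then show "k \<le> 6 \<Longrightarrow> dim (span (b ` {..<k})) = k" using dim_frame_initial[of b 6 k] by simp
qed

text \<open>Supplies the \<open>k\<close>-form required for an ordinary element: the first
  \<open>6 - k\<close> slots of the volume form are filled with the vectors of a fixed 6-frame that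
  lie beyond the plane. Being pulled back from the base, it does not see vertical changes of the
  frame.\<close>

definition \<Omega>_part :: "nat \<Rightarrow> (nat \<Rightarrow> 'r total) \<Rightarrow> ('r total, real) form" where
  "\<Omega>_part k e y b = \<Omega>6 y (\<lambda>i. if i < 6 - k then e (k + i) else b (i - (6 - k)))"

lemma \<Omega>_part_smooth: "k \<le> 6 \<Longrightarrow> smooth_form TX k (\<Omega>_part k e)"
  unfolding \<Omega>_part_def[abs_def] by (rule smooth_form_contracts) (simp add: indep_form_smooth)

lemma \<Omega>_part_nonzero:
  assumes z: "z \<in> TX" and b: "\<Omega>6 z b \<noteq> 0" and k: "k \<le> 6"
  shows "\<Omega>_part k b z b \<noteq> 0"
  unfolding \<Omega>_part_def
  by (rule covector_rotate_nonzero[where m="6 - k" and k=k and f="\<Omega>6 z"])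
     (use smooth_formD[OF indep_form_smooth z] b k in auto)

lemma \<Omega>_part_cong: "(\<And>i. fst (b i) = fst (b' i)) \<Longrightarrow> \<Omega>_part k e y b = \<Omega>_part k e y b'"
proof -
  assume h: "\<And>i. fst (b i) = fst (b' i)"
  have "(\<lambda>i. fst (if i < 6 - k then e (k + i) else b (i - (6 - k)))) = (\<lambda>i. fst (if i < 6 - k then e (k + i) else b' (i - (6 - k))))"
    by (simp add: fun_eq_iff h)
  then show ?thesis unfolding \<Omega>_part_def indep_form_def pull_fst_def by simp
qed

text \<open>The ideal is zero in degrees up to 4, so every plane near the given one is a common zero
  and the empty family, \<open>q = 0\<close>, describes them.\<close>

lemma kaehler_ordinary_small:
  assumes z: "z \<in> TX" and b: "\<Omega>6 z b \<noteq> 0" and k: "k \<le> 4"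
  shows "kaehler_ordinary TX TI z (span (b ` {..<k}))"
proof -
  have d: "dim (span (b ` {..<k})) = k" by (rule indep_frame(1)[OF z b]) (use k in simp)
  let ?N = "{p. fst p \<in> TX \<and> \<Omega>_part k b (fst p) (snd p) \<noteq> 0}"
  have s: "smooth_form TX k (\<Omega>_part k b)" by (rule \<Omega>_part_smooth) (use k in simp)
  have nz: "\<Omega>_part k b z b \<noteq> 0" by (rule \<Omega>_part_nonzero[OF z b]) (use k in simp)
  show ?thesis
    unfolding kaehler_ordinary_def d
  proof (intro conjI exI)
    show "integral_element TX TI z (span (b ` {..<k}))" by (rule integral_element_small[OF z subspace_span]) (use d k in simp)
    show "smooth_form TX k (\<Omega>_part k b)" by (rule s)
    show "span (b ` {..<k}) = span (b ` {..<k})" ..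
    show "\<Omega>_part k b z b \<noteq> 0" by (rule nz)
    show "\<forall>i<0 :: nat. TI k ((\<lambda>_ _ _. 0) i)" by simp
    show "open ?N" by (rule open_nonzero[OF open_X smooth_form_continuous[OF s]])
    show "(z, b) \<in> ?N" using z nz by simp
    have v: "\<phi> y c = 0" if "y \<in> TX" "TI k \<phi>" for \<phi> y c using ideal_low_degree[OF that] k by simp
    show "\<forall>(y, c)\<in>?N. y \<in> TX \<and> \<Omega>_part k b y c \<noteq> 0 \<and>
      ((\<forall>\<phi>. TI k \<phi> \<longrightarrow> \<phi> y c / \<Omega>_part k b y c = 0) \<longleftrightarrow> (\<forall>i<0 :: nat. (\<lambda>_ _ _. 0) i y c / \<Omega>_part k b y c = 0)) \<and>
      independent_differentials 0 (\<lambda>i z a. (\<lambda>_ _ _. 0) i z a / \<Omega>_part k b z a) y c"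
      using v by (auto simp: independent_differentials_def)
  qed
qed

lemma F_alpha_vert_surj:
  assumes z: "z \<in> TX" and c: "chi (fst z) j (\<lambda>i. fst (e i)) \<noteq> 0"
  obtains pd :: "complex^'r^'r^3" where "\<And>a c. F_alpha \<alpha> a c z (case_nat (0, pd) e) = v a c"
proof -
  let ?c = "chi (fst z) j (\<lambda>i. fst (e i))"
  define pd :: "complex^'r^'r^3" where "pd = (\<chi> i c a. if i = j then - cnj (v a c / ?c) else 0)"
  have "F_alpha \<alpha> a c z (case_nat (0, pd) e) = v a c" for a c
  proof -
    have "F_alpha \<alpha> a c z (case_nat (0, pd) e) = - (\<Sum>i\<in>UNIV. if i = j then - (v a c / ?c) * ?c else 0)"
      unfolding F_alpha_vert[OF z] by (intro arg_cong[where f=uminus] sum.cong) (auto simp: pd_def)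
    then show ?thesis using c by simp
  qed
  then show ?thesis by (rule that)
qed

lemma chi_smooth: "smooth_form TX 4 (pull_fst (\<lambda>x. chi x j))"
proof (rule smooth_form_pull_sys[OF W])
  show "smooth_form W 4 (\<lambda>x. chi x j)" 
    using exhaust_3[of j] by (auto simp: chi_simps word_smooth' simp del: word.simps)
qed

lemma kap_smooth: "smooth_form TX 5 (pull_fst (\<lambda>x. kap x j))"
proof (rule smooth_form_pull_sys[OF W])
  show "smooth_form W 5 (\<lambda>x. kap x j)" 
    using exhaust_3[of j] by (auto simp: kap_simps word_smooth' smooth_form_minus[OF W] simp del: word.simps)
qed

text \<open>The integral 5-planes are cut out by the real and imaginary parts of all entries of
  \<open>F_alpha\<close>. Their differentials are independent because moving only the first frame
  vector, vertically, changes these values arbitrarily and linearly while the normalizing form stays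
  fixed. The condition on \<open>chi\<close> therefore concerns the other four vectors, whence the
  shift by \<open>Suc\<close>.\<close>

lemma kaehler_ordinary_5:
  assumes z: "z \<in> TX" and b: "\<Omega>6 z b \<noteq> 0" and ch: "chi (fst z) j (\<lambda>i. fst (b (Suc i))) \<noteq> 0"
    and int: "integral_element TX TI z (span (b ` {..<5}))"
  shows "kaehler_ordinary TX TI z (span (b ` {..<5}))"
proof -
  have d: "dim (span (b ` {..<5})) = 5" by (rule indep_frame(1)[OF z b]) simp
  let ?O = "\<Omega>_part 5 b"
  let ?N = "{p. fst p \<in> TX \<and> ?O (fst p) (snd p) \<noteq> 0} \<inter>
    {p. fst p \<in> TX \<and> pull_fst (\<lambda>x. chi x j) (fst p) (\<lambda>i. snd p (Suc i)) \<noteq> 0}"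
  have s: "smooth_form TX 5 ?O" by (rule \<Omega>_part_smooth) simp
  have nz: "?O z b \<noteq> 0" by (rule \<Omega>_part_nonzero[OF z b]) simp
  \<comment> \<open>One function for each entry; the boolean separates real and imaginary
    parts.\<close>
  define q where "q = CARD('r \<times> 'r \<times> bool)"
  obtain h :: "nat \<Rightarrow> 'r \<times> 'r \<times> bool" where h: "bij_betw h {0..<q} UNIV"
    unfolding q_def using ex_bij_betw_nat_finite[of "UNIV :: ('r \<times> 'r \<times> bool) set"] by auto
  define g :: "'r \<times> 'r \<times> bool \<Rightarrow> ('r total, real) form" where
    "g = (\<lambda>(a, c, s). if s then Re_form (F_alpha \<alpha> a c) else Im_form (F_alpha \<alpha> a c))"
  have gT: "TI 5 (g i)" for i using F_alpha_TI by (auto simp: g_def split: prod.split)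
  have gF: "F_alpha \<alpha> a c y e = 0" if "\<And>i. i < q \<Longrightarrow> g (h i) y e = 0" for a c y e
  proof -
    have "g u y e = 0" for u
    proof -
      have "u \<in> h ` {0..<q}" using h by (simp add: bij_betw_def)
      then show ?thesis using that by auto
    qed
    from this[of "(a, c, True)"] this[of "(a, c, False)"] show ?thesis by (simp add: g_def complex_eq_iff)
  qed
  show ?thesis
    unfolding kaehler_ordinary_def d
  proof (intro conjI exI)
    show "integral_element TX TI z (span (b ` {..<5}))" by (rule int)
    show "smooth_form TX 5 ?O" by (rule s)
    show "span (b ` {..<5}) = span (b ` {..<5})" ..
    show "?O z b \<noteq> 0" by (rule nz)
    show "\<forall>i<q. TI 5 (g (h i))" using gT by blast
    show "open ?N"
      by (intro open_Int open_nonzero[OF open_X smooth_form_continuous[OF s]]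
          open_nonzero[OF open_X smooth_form_continuous_shift[OF chi_smooth]])
    show "(z, b) \<in> ?N" using z nz ch by (simp add: pull_fst_def)
    have "y \<in> TX \<and> ?O y c \<noteq> 0 \<and> ((\<forall>\<phi>. TI 5 \<phi> \<longrightarrow> \<phi> y c / ?O y c = 0) \<longleftrightarrow> (\<forall>i<q. g (h i) y c / ?O y c = 0)) \<and>
      independent_differentials q (\<lambda>i z a. g (h i) z a / ?O z a) y c" if N: "(y, c) \<in> ?N" for y c
    proof (intro conjI)
      show y: "y \<in> TX" and O: "?O y c \<noteq> 0" using N by auto
      have chi: "chi (fst y) j (\<lambda>i. fst (c (Suc i))) \<noteq> 0" using N by (simp add: pull_fst_def)
      have low: "\<phi> y c = 0" if "TI 5 \<phi>" "\<And>i. i < q \<Longrightarrow> g (h i) y c = 0" for \<phi>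
        using ideal_low_degree[OF y that(1)] gF[OF that(2)] by simp
      show "(\<forall>\<phi>. TI 5 \<phi> \<longrightarrow> \<phi> y c / ?O y c = 0) \<longleftrightarrow> (\<forall>i<q. g (h i) y c / ?O y c = 0)"
      proof (intro iffI allI impI)
        show "g (h i) y c / ?O y c = 0" if "\<forall>\<phi>. TI 5 \<phi> \<longrightarrow> \<phi> y c / ?O y c = 0" for i using that gT by blast
        show "\<phi> y c / ?O y c = 0" if a: "\<forall>i<q. g (h i) y c / ?O y c = 0" and "TI 5 \<phi>" for \<phi>
          using low[OF that(2)] a O by simp
      qed
      show "independent_differentials q (\<lambda>i z a. g (h i) z a / ?O z a) y c"
        unfolding independent_differentials_def
      proof (intro allI impI)
        fix cc :: "nat \<Rightarrow> real" and i0
        assume D: "\<forall>\<xi> \<beta>. ((\<lambda>t. \<Sum>i<q. cc i * (g (h i) (y + t *\<^sub>R \<xi>) (\<lambda>j. c j + t *\<^sub>R \<beta> j) / ?O (y + t *\<^sub>R \<xi>) (\<lambda>j. c j + t *\<^sub>R \<beta> j)))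
                 has_real_derivative 0) (at 0)" and i0: "i0 < q"
        obtain a0 c0 s0 where hi: "h i0 = (a0, c0, s0)" by (cases "h i0")
        \<comment> \<open>A vertical direction along which exactly the function number
          \<open>i0\<close> changes, with derivative 1 before normalization: the value
          \<open>1\<close> or \<open>\<i>\<close> addresses its real or imaginary part.\<close>
        obtain pd where pd: "\<And>a c'. F_alpha \<alpha> a c' y (case_nat (0, pd) (\<lambda>i. c (Suc i))) =
            (if a = a0 \<and> c' = c0 then if s0 then 1 else \<i> else 0)"
          by (rule F_alpha_vert_surj[where v="\<lambda>a c'. if a = a0 \<and> c' = c0 then if s0 then 1 else \<i> else 0", OF y chi]) (rule that, assumption)
        have gpd: "g u y (case_nat (0, pd) (\<lambda>i. c (Suc i))) = (if u = h i0 then 1 else 0)" for u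
          by (cases u) (auto simp: g_def pd hi)
        have gl: "g u y (\<lambda>j. c j + t *\<^sub>R (if j = 0 then (0, pd) else 0)) = g u y c + t * (if u = h i0 then 1 else 0)" for u t
        proof -
          have cg: "covector (Suc 4) (g u y)"
            using covector_Re[OF F_alpha_covector[OF y]] covector_Im[OF F_alpha_covector[OF y]] by (cases u) (simp add: g_def)
          note l = linear_contract0[OF cg, of "\<lambda>i. c (Suc i)"]
          have eq: "(\<lambda>j. c j + t *\<^sub>R (if j = 0 then (0, pd) else 0)) = case_nat (c 0 + t *\<^sub>R (0, pd)) (\<lambda>i. c (Suc i))"
            by (auto split: nat.split)
          have c: "case_nat (c 0) (\<lambda>i. c (Suc i)) = c" by (auto split: nat.split)
          have "g u y (\<lambda>j. c j + t *\<^sub>R (if j = 0 then (0, pd) else 0)) =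
              g u y (case_nat (c 0) (\<lambda>i. c (Suc i))) + t *\<^sub>R g u y (case_nat (0, pd) (\<lambda>i. c (Suc i)))"
            unfolding eq by (simp only: linear_add[OF l] linear_cmul[OF l])
          then show ?thesis unfolding c gpd real_scaleR_def .
        qed
        have Ol: "?O y (\<lambda>j. c j + t *\<^sub>R (if j = 0 then (0, pd) else 0)) = ?O y c" for t
          by (rule \<Omega>_part_cong) simp
        have inj: "h i = h i0 \<longleftrightarrow> i = i0" if "i < q" for i
          using h i0 that by (auto simp: bij_betw_def inj_on_def)
        have "((\<lambda>t. \<Sum>i<q. cc i * ((g (h i) y c + t * (if h i = h i0 then 1 else 0)) / ?O y c)) has_real_derivative 0) (at 0)"
          using D[rule_format, of 0 "\<lambda>j. if j = 0 then (0, pd) else 0"] by (simp only: gl Ol scaleR_zero_right add_0_right)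
        moreover have "((\<lambda>t. \<Sum>i<q. cc i * ((g (h i) y c + t * (if h i = h i0 then 1 else 0)) / ?O y c)) has_real_derivative
            (\<Sum>i<q. cc i * ((if h i = h i0 then 1 else 0) / ?O y c))) (at 0)"
          by (intro DERIV_sum DERIV_cmult DERIV_cdivide) (auto intro!: derivative_eq_intros)
        ultimately have "(\<Sum>i<q. cc i * ((if h i = h i0 then 1 else 0) / ?O y c)) = 0" by (rule DERIV_unique[rotated])
        also have "(\<Sum>i<q. cc i * ((if h i = h i0 then 1 else 0) / ?O y c)) = (\<Sum>i<q. if i = i0 then cc i / ?O y c else 0)"
          by (rule sum.cong) (auto simp: inj)
        also have "\<dots> = cc i0 / ?O y c" using i0 by simp
        finally show "cc i0 = 0" using O by simp
      qed
    qed
    then show "\<forall>(y, c)\<in>?N. y \<in> TX \<and> ?O y c \<noteq> 0 \<and>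
      ((\<forall>\<phi>. TI 5 \<phi> \<longrightarrow> \<phi> y c / ?O y c = 0) \<longleftrightarrow> (\<forall>i<q. g (h i) y c / ?O y c = 0)) \<and>
      independent_differentials q (\<lambda>i z a. g (h i) z a / ?O z a) y c" by blast
  qed
qed

section \<open>Regularity in dimensions up to 5\<close>

lemma polar_space_small:
  assumes z: "z \<in> TX" and "dim E \<le> 3" shows "polar_space TI z E = UNIV"
proof -
  have "\<phi> z e = 0" if "TI (Suc (dim E)) \<phi>" for \<phi> e
    using ideal_low_degree[OF z that] assms(2) by simp
  then show ?thesis unfolding polar_space_def by blast
qed

lemma kaehler_regular_small:
  assumes z: "z \<in> TX" and b: "\<Omega>6 z b \<noteq> 0" and k: "k \<le> 3"
  shows "kaehler_regular TX TI z (span (b ` {..<k}))"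
proof -
  have d: "dim (span (b ` {..<k})) = k" by (rule indep_frame(1)[OF z b]) (use k in simp)
  have o: "open (TX \<times> UNIV :: ('r total \<times> (nat \<Rightarrow> 'r total)) set)" by (rule open_Times[OF open_X open_UNIV])
  have p: "polar_space TI y E = UNIV" if "y \<in> TX" "dim E = k" for y E
    by (rule polar_space_small) (use that k in auto)
  show ?thesis
    unfolding kaehler_regular_def d
  proof (intro conjI exI)
    show "kaehler_ordinary TX TI z (span (b ` {..<k}))" by (rule kaehler_ordinary_small[OF z b]) (use k in simp)
    show "open (TX \<times> UNIV :: ('r total \<times> (nat \<Rightarrow> 'r total)) set)" by (rule o)
    show "(z, b) \<in> TX \<times> UNIV" using z by simp
    show "\<forall>(y, c)\<in>TX \<times> UNIV. integral_element TX TI y (span (c ` {..<k})) \<and> dim (span (c ` {..<k})) = k \<longrightarrow>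
      dim (polar_space TI y (span (c ` {..<k}))) = dim (polar_space TI z (span (b ` {..<k})))"
      using p[OF z d] p by auto
  qed simp
qed

text \<open>Nonvanishing of \<open>chi\<close> is an open condition on frames, and by
  \<open>polar_space_4_dim\<close> it alone fixes the dimension of the polar space.\<close>

lemma kaehler_regular_4:
  assumes z: "z \<in> TX" and b: "\<Omega>6 z b \<noteq> 0" and ch: "chi (fst z) j (\<lambda>i. fst (b i)) \<noteq> 0"
  shows "kaehler_regular TX TI z (span (b ` {..<4}))"
proof -
  have d: "dim (span (b ` {..<4})) = 4" by (rule indep_frame(1)[OF z b]) simp
  let ?N = "{p. fst p \<in> TX \<and> pull_fst (\<lambda>x. chi x j) (fst p) (snd p) \<noteq> 0}"
  show ?thesis
    unfolding kaehler_regular_def d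
  proof (intro conjI exI)
    show "kaehler_ordinary TX TI z (span (b ` {..<4}))" by (rule kaehler_ordinary_small[OF z b]) simp
    show "open ?N" by (rule open_nonzero[OF open_X smooth_form_continuous[OF chi_smooth]])
    show "(z, b) \<in> ?N" using z ch by (simp add: pull_fst_def)
    have "dim (polar_space TI y (span (c ` {..<4}))) = dim (polar_space TI z (span (b ` {..<4})))" if "(y, c) \<in> ?N" for y c
    proof -
      have y: "y \<in> TX" "chi (fst y) j (\<lambda>i. fst (c i)) \<noteq> 0" using that by (simp_all add: pull_fst_def)
      show ?thesis using polar_space_4_dim[OF y] polar_space_4_dim[OF z ch] by simp
    qed
    then show "\<forall>(y, c)\<in>?N. integral_element TX TI y (span (c ` {..<4})) \<and> dim (span (c ` {..<4})) = 4 \<longrightarrow>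
      dim (polar_space TI y (span (c ` {..<4}))) = dim (polar_space TI z (span (b ` {..<4})))" by blast
  qed simp
qed

lemma Qf_continuous: "continuous_on (TX \<times> UNIV) (\<lambda>p :: 'r total \<times> (nat \<Rightarrow> 'r total). Qf (fst (fst p)) (\<lambda>i. fst (snd p i)))"
proof -
  have "continuous_on (TX \<times> UNIV) (\<lambda>p :: 'r total \<times> (nat \<Rightarrow> 'r total). kap (fst (fst p)) j (\<lambda>i. fst (snd p i)))" for j
    using smooth_form_continuous[OF kap_smooth[of j]] by (simp add: pull_fst_def)
  then show ?thesis unfolding Qf_def by (intro continuous_intros)
qed

text \<open>Nonvanishing of \<open>Qf\<close> is likewise open, and \<open>polar_space_5_dim\<close>
  gives the same dimension at all nearby integral 5-planes.\<close>

lemma kaehler_regular_5: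
  assumes z: "z \<in> TX" and o: "kaehler_ordinary TX TI z (span (b ` {..<5}))" and d: "dim (span (b ` {..<5})) = 5"
    and Q: "Qf (fst z) (\<lambda>i. fst (b i)) \<noteq> 0"
  shows "kaehler_regular TX TI z (span (b ` {..<5}))"
proof -
  let ?N = "{p :: 'r total \<times> (nat \<Rightarrow> 'r total). fst p \<in> TX \<and> Qf (fst (fst p)) (\<lambda>i. fst (snd p i)) \<noteq> 0}"
  have i: "integral_element TX TI z (span (b ` {..<5}))" using o unfolding kaehler_ordinary_def by blast
  have p: "dim (polar_space TI y (span (c ` {..<5}))) = 6 + CARD('r) ^ 2"
    if "y \<in> TX" "integral_element TX TI y (span (c ` {..<5}))" "Qf (fst y) (\<lambda>i. fst (c i)) \<noteq> 0" for y c
    by (rule polar_space_5_dim[OF that(1) integral_element_F_alpha[OF that(2)] that(3)])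
  show ?thesis
    unfolding kaehler_regular_def d
  proof (intro conjI exI)
    show "kaehler_ordinary TX TI z (span (b ` {..<5}))" by (rule o)
    show "open ?N" by (rule open_nonzero[OF open_X Qf_continuous])
    show "(z, b) \<in> ?N" using z Q by simp
    have "dim (polar_space TI y (span (c ` {..<5}))) = dim (polar_space TI z (span (b ` {..<5})))"
      if "(y, c) \<in> ?N" "integral_element TX TI y (span (c ` {..<5}))" for y c
      using p[of y c] p[OF z i Q] that by simp
    then show "\<forall>(y, c)\<in>?N. integral_element TX TI y (span (c ` {..<5})) \<and> dim (span (c ` {..<5})) = 5 \<longrightarrow>
      dim (polar_space TI y (span (c ` {..<5}))) = dim (polar_space TI z (span (b ` {..<5})))" by blast
  qed simp
qed

end

end

section \<open>Flags\<close>

lemma covector_reframe_nonzero: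
  assumes f: "covector k f" and e: "f e \<noteq> 0" and s: "\<And>i. i < k \<Longrightarrow> e i \<in> e' ` {..<k}"
  shows "f e' \<noteq> 0"
  using covector_frame_zero[OF f, of e' e] e span_base[OF s] by blast

text \<open>A block triangular determinant: the first two vectors pair only with earlier factors, so
  contracting them one after the other leaves a 2 by 2 minor.\<close>

lemma word_triangular:
  fixes T :: "nat \<Rightarrow> ('v::real_vector, 'a::real_normed_field) form"
  assumes T: "\<And>i. covector 1 (T i x)"
    and 0: "T j x (\<lambda>_. e 0) = 0" "T k x (\<lambda>_. e 0) = 0" "T l x (\<lambda>_. e 0) = 0"
    and 1: "T k x (\<lambda>_. e 1) = 0" "T l x (\<lambda>_. e 1) = 0"
  shows "word T [i, j, k, l] x e = T i x (\<lambda>_. e 0) * (T j x (\<lambda>_. e 1) *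
    (T k x (\<lambda>_. e 2) * T l x (\<lambda>_. e 3) - T k x (\<lambda>_. e 3) * T l x (\<lambda>_. e 2)))"
proof -
  have a: "T i x (case_nat v e) = T i x (\<lambda>_. v)" for i v e
    using covector_1_arg[OF T, of i "case_nat v e"] by simp
  define e1 where "e1 i = e (Suc i)" for i
  define e2 where "e2 i = e1 (Suc i)" for i
  have s: "e = case_nat (e 0) e1" "e1 = case_nat (e1 0) e2" by (auto simp: e1_def e2_def split: nat.split)
  have v: "e1 0 = e 1" "e2 0 = e 2" "e2 1 = e 3" by (simp_all add: e1_def e2_def numeral_eq_Suc One_nat_def)
  have k0: "(\<lambda>e'. word T [j, k, l] x (case_nat (e 0) e')) = (\<lambda>e'. 0)"
    by (rule ext, rule word_killed[of T x, OF T]) (use 0 a in auto)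
  have k1: "(\<lambda>e'. word T [k, l] x (case_nat (e1 0) e')) = (\<lambda>e'. 0)"
    by (rule ext, rule word_killed[of T x, OF T]) (use 1 a v in auto)
  have "word T [i, j, k, l] x e = T i x (\<lambda>_. e 0) * word T [j, k, l] x e1"
    by (subst s(1), subst word_contract[of T x, OF T]) (simp add: k0 del: word.simps)
  also have "word T [j, k, l] x e1 = T j x (\<lambda>_. e1 0) * word T [k, l] x e2"
    by (subst s(2), subst word_contract[of T x, OF T]) (simp add: k1 del: word.simps)
  also have "word T [k, l] x e2 = ewedge 1 1 (T k x) (T l x) e2"
    using word_single[of T x l, OF T] by (simp add: word_Cons One_nat_def del: word.simps)
  also have "\<dots> = T k x (\<lambda>_. e2 0) * T l x (\<lambda>_. e2 1) - T k x (\<lambda>_. e2 1) * T l x (\<lambda>_. e2 0)"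
    by (rule ewedge_1_1[OF T T])
  finally show ?thesis by (simp only: v)
qed

context unitary_system
begin

text \<open>A single frame for all conditions on the flag: \<open>chi x 2\<close> on the first four
  vectors for the 4-plane, \<open>chi x 3\<close> on the vectors with indices 1 to 4 for ordinarity
  of the 5-plane, and \<open>Qf\<close> on the first five for its regularity.\<close>

lemma adapted_frame:
  assumes x: "x \<in> W"
  obtains U :: "nat \<Rightarrow> real^6" where "word Th [0, 1, 2, 3, 4, 5] x U \<noteq> 0" "chi x 2 U \<noteq> 0"
    "chi x 3 (\<lambda>i. U (Suc i)) \<noteq> 0" "Qf x U \<noteq> 0"
proof -
  note c = Th_covector[OF x]
  \<comment> \<open>\<open>chi_covector\<close> refers to a point of the total space over
    \<open>x\<close>; the zero point for rank one serves.\<close>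
  have z': "(x, 0) \<in> (TX :: unit total set)" using x by (simp add: system_domain_def)
  note cc = chi_covector[OF z', simplified]
  obtain u f where u: "\<And>j k. \<alpha> j x (\<lambda>_. u k) = (if j = k then 1 else 0)"
    and f: "\<And>j k. \<alpha> j x (\<lambda>_. f k) = (if j = k then \<i> else 0)"
    and ex: "\<And>v. v = (\<Sum>k\<in>UNIV. Re (\<alpha> k x (\<lambda>_. v)) *\<^sub>R u k + Im (\<alpha> k x (\<lambda>_. v)) *\<^sub>R f k)"
    by (rule frame[OF x]) (rule that, assumption+)
  \<comment> \<open>The first four vectors contain the complex line of index 2 together with
    \<open>u 1\<close> and \<open>u 3\<close>; those with indices 1 to 4 contain the line of index 3
    together with \<open>u 1\<close> and \<open>f 2\<close>. The first five omit only
    \<open>f 1\<close>, so the conormal lies along \<open>\<alpha>\<^sup>1\<close>, which is not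
    isotropic in either signature.\<close>
  define U :: "nat \<Rightarrow> real^6" where "U i = (if i = 0 then u 2 else if i = 1 then u 1 else if i = 2 then u 3
    else if i = 3 then f 2 else if i = 4 then f 3 else f 1)" for i
  have m: "u 2 \<in> U ` {..<4}" "u 1 \<in> U ` {..<4}" "u 3 \<in> U ` {..<4}" "f 2 \<in> U ` {..<4}"
    by (rule image_eqI[of _ _ 0] image_eqI[of _ _ 1] image_eqI[of _ _ 2] image_eqI[of _ _ 3]; simp add: U_def)+
  have m6: "u k \<in> U ` {..<6}" "f k \<in> U ` {..<6}" for k
  proof -
    have "U 4 = f 3" "U 5 = f 1" by (simp_all add: U_def)
    then have "f 3 \<in> U ` {..<6}" "f 1 \<in> U ` {..<6}" 
      using image_eqI[of "f 3" U 4 "{..<6}"] image_eqI[of "f 1" U 5 "{..<6}"] by simp_all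
    moreover have "U ` {..<4} \<subseteq> U ` {..<6}" by (rule image_mono) auto
    ultimately show "u k \<in> U ` {..<6}" "f k \<in> U ` {..<6}" using m exhaust_3[of k] by blast+
  qed
  have span: "span (U ` {..<6}) = UNIV"
  proof -
    have "v \<in> span (U ` {..<6})" for v
      by (subst ex[of v], intro span_sum span_add span_scale span_base m6)
    then show ?thesis by blast
  qed
  have V: "word Th [0, 1, 2, 3, 4, 5] x U \<noteq> 0" by (rule vol_nonzero[OF x span])
  have four: "i = 0 \<or> i = 1 \<or> i = 2 \<or> i = 3" if "i < 4" for i :: nat using that by linarith
  have chi2: "chi x 2 U \<noteq> 0"
  proof -
    define E where "E i = (if i = 0 then u 1 else if i = 1 then u 3 else if i = 2 then u 2 else f 2)" for i :: nat
    have "word Th [0, 2, 4, 1] x E \<noteq> 0"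
      by (subst word_triangular[of Th x, OF c]) (simp_all add: E_def Th_simps u f three_neq)
    then have "chi x 2 E \<noteq> 0"
      by (simp add: chi_simps word_unsorted[of Th x, OF c] del: word.simps)
    then show ?thesis
      by (rule covector_reframe_nonzero[OF cc])
         (use four m in \<open>auto simp: E_def\<close>)
  qed
  have chi3: "chi x 3 (\<lambda>i. U (Suc i)) \<noteq> 0"
  proof -
    define E where "E i = (if i = 0 then u 1 else if i = 1 then f 2 else if i = 2 then u 3 else f 3)" for i :: nat
    have "word Th [0, 1, 5, 2] x E \<noteq> 0"
      by (subst word_triangular[of Th x, OF c]) (simp_all add: E_def Th_simps u f three_neq)
    then have E: "chi x 3 E \<noteq> 0"
      by (simp add: chi_simps word_unsorted[of Th x, OF c] del: word.simps)
    have mem: "u 1 \<in> (\<lambda>i. U (Suc i)) ` {..<4}" "u 3 \<in> (\<lambda>i. U (Suc i)) ` {..<4}"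
      "f 2 \<in> (\<lambda>i. U (Suc i)) ` {..<4}" "f 3 \<in> (\<lambda>i. U (Suc i)) ` {..<4}"
    proof -
      have "U (Suc 0) = u 1" "U (Suc 1) = u 3" "U (Suc 2) = f 2" "U (Suc 3) = f 3"
        by (simp_all add: U_def One_nat_def)
      then show "u 1 \<in> (\<lambda>i. U (Suc i)) ` {..<4}" "u 3 \<in> (\<lambda>i. U (Suc i)) ` {..<4}"
        "f 2 \<in> (\<lambda>i. U (Suc i)) ` {..<4}" "f 3 \<in> (\<lambda>i. U (Suc i)) ` {..<4}"
        using imageI[of 0 "{..<4}" "\<lambda>i. U (Suc i)"] imageI[of 1 "{..<4}" "\<lambda>i. U (Suc i)"]
          imageI[of 2 "{..<4}" "\<lambda>i. U (Suc i)"] imageI[of 3 "{..<4}" "\<lambda>i. U (Suc i)"]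
        by simp_all
    qed
    show ?thesis
      by (rule covector_reframe_nonzero[OF cc E])
         (use four mem in \<open>auto simp: E_def\<close>)
  qed
  let ?V = "\<lambda>v. word Th [0, 1, 2, 3, 4, 5] x (case_nat v U)"
  have c6: "covector 6 (word Th [0, 1, 2, 3, 4, 5] x)" by (rule word_covector[OF x]) simp
  have V0: "?V (U i) = 0" if "i < 5" for i
    by (rule covector_alt[OF c6, of 0 "Suc i"]) (use that in auto)
  have Vf: "?V (f 1) \<noteq> 0"
  proof (rule covector_reframe_nonzero[OF c6 V])
    fix i :: nat assume i: "i < 6"
    show "U i \<in> case_nat (f 1) U ` {..<6}"
    proof (cases "i = 5")
      case True
      then have "U i = case_nat (f 1) U 0" by (simp add: U_def)
      then show ?thesis by (rule image_eqI) simp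
    next
      case False
      have "U i = case_nat (f 1) U (Suc i)" by simp
      then show ?thesis by (rule image_eqI) (use i False in simp)
    qed
  qed
  define \<kappa> where "\<kappa> j = kap x j U" for j
  have vc: "?V v = (\<Sum>j\<in>UNIV. \<alpha> j x (\<lambda>_. v) * cnj (\<kappa> j) - cnj (\<alpha> j x (\<lambda>_. v)) * \<kappa> j)" for v
    unfolding \<kappa>_def by (rule vol_contract[OF x])
  \<comment> \<open>The values on \<open>u k\<close> and \<open>f k\<close> together determine the
    coefficient \<open>\<kappa> k\<close>, so it vanishes when both vectors lie in the
    hyperplane.\<close>
  have vu: "?V (u k) = cnj (\<kappa> k) - \<kappa> k" and vf: "?V (f k) = \<i> * cnj (\<kappa> k) + \<i> * \<kappa> k" for k
    using exhaust_3[of k] unfolding vc by (auto simp: sum_3 u f three_neq three_neq[symmetric])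
  have U: "U 0 = u 2" "U 2 = u 3" "U 3 = f 2" "U 4 = f 3" by (simp_all add: U_def)
  have z0: "\<kappa> k = 0" if "?V (u k) = 0" "?V (f k) = 0" for k
    using that unfolding vu vf by (simp add: complex_eq_iff)
  have "\<kappa> 2 = 0" using z0[of 2] V0[of 0] V0[of 3] by (simp add: U del: word.simps)
  moreover have "\<kappa> 3 = 0" using z0[of 3] V0[of 2] V0[of 4] by (simp add: U del: word.simps)
  moreover have "\<kappa> 1 \<noteq> 0" using Vf unfolding vf by auto
  ultimately have "Qf x U \<noteq> 0"
    unfolding Qf_def \<kappa>_def[symmetric] by (simp add: sum_3 sig_def three_neq)
  with V chi2 chi3 show ?thesis by (rule that)
qed

context
  fixes z :: "'r::finite total"
  assumes z: "z \<in> TX"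
begin

section \<open>Integral elements over every point\<close>

lemma curv_pair_linear:
  "linear (\<lambda>v. curv_form \<alpha> (a :: 'r) b z (case_nat v (\<lambda>_. w)))"
  "linear (\<lambda>w. curv_form \<alpha> (a :: 'r) b z (case_nat v (\<lambda>_. w)))"
proof -
  have c: "covector (Suc 1) (curv_form \<alpha> a b z)" using curv_form_covector[OF z] by (simp add: numeral_2_eq_2 One_nat_def)
  show "linear (\<lambda>v. curv_form \<alpha> a b z (case_nat v (\<lambda>_. w)))" by (rule linear_contract0[OF c])
  show "linear (\<lambda>w. curv_form \<alpha> a b z (case_nat v (\<lambda>_. w)))" by (rule covector_1_linear[OF covector_contract[OF c]])
qed

lemma curv_pair_skew:
  "curv_form \<alpha> (a :: 'r) b z (case_nat v (\<lambda>_. w)) = - curv_form \<alpha> a b z (case_nat w (\<lambda>_. v))"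
proof -
  let ?B = "\<lambda>v w. curv_form \<alpha> a b z (case_nat v (\<lambda>_. w))"
  have 0: "?B v v = 0" for v by (rule covector_alt[OF curv_form_covector[OF z], of 0 1]) (simp_all add: One_nat_def)
  have "?B (v + w) (v + w) = ?B v v + ?B v w + ?B w v + ?B w w"
    by (simp only: linear_add[OF curv_pair_linear(1)] linear_add[OF curv_pair_linear(2)] ac_simps)
  then have "?B v w + ?B w v = 0" unfolding 0 by simp
  then show ?thesis by (simp add: eq_neg_iff_add_eq_0)
qed

text \<open>Bilinear expansion: the curvature vanishes on two vertical vectors and is given by
  \<open>vert\<close> on mixed pairs.\<close>

lemma curv_pair:
  "curv_form \<alpha> (a :: 'r) b z (case_nat (v, pd) (\<lambda>_. (w, qd))) =
    curv_form \<alpha> a b z (case_nat (v, 0) (\<lambda>_. (w, 0))) + vert (fst z) pd a b (\<lambda>_. w) - vert (fst z) qd a b (\<lambda>_. v)"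
proof -
  let ?B = "\<lambda>v w. curv_form \<alpha> a b z (case_nat v (\<lambda>_. w))"
  have s: "?B (v, pd) w' = ?B (v, 0) w' + vert (fst z) pd a b (\<lambda>_. fst w')" for v pd w'
  proof -
    have "?B (v, pd) w' = ?B ((v, 0) + (0, pd)) w'" by simp
    also have "\<dots> = ?B (v, 0) w' + ?B (0, pd) w'" by (rule linear_add[OF curv_pair_linear(1)])
    finally show ?thesis by (simp only: curv_form_vertical[OF z])
  qed
  have "?B (v, pd) (w, qd) = - ?B (w, qd) (v, 0) + vert (fst z) pd a b (\<lambda>_. w)"
    using s[of v pd "(w, qd)"] curv_pair_skew[of a b "(v, 0)" "(w, qd)"] by simp
  also have "?B (w, qd) (v, 0) = - ?B (v, 0) (w, 0) + vert (fst z) qd a b (\<lambda>_. v)"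
    using s[of w qd "(v, 0)"] curv_pair_skew[of a b "(w, 0)" "(v, 0)"] by simp
  finally show ?thesis by simp
qed

text \<open>It suffices that \<open>vert\<close> of \<open>L v\<close> on \<open>w\<close> be half
  of \<open>- F a b v w\<close>: by skew-symmetry in \<open>v\<close> and \<open>w\<close>, the two
  corrections in \<open>curv_pair\<close> then cancel the horizontal value.\<close>

lemma flat_graph:
  obtains L :: "real^6 \<Rightarrow> complex^'r^'r^3" where "linear L"
    "\<And>a b v w. curv_form \<alpha> a b z (case_nat (v, L v) (\<lambda>_. (w, L w))) = 0"
proof -
  obtain u f where u: "\<And>j k. \<alpha> j (fst z) (\<lambda>_. u k) = (if j = k then 1 else 0)"
    and f: "\<And>j k. \<alpha> j (fst z) (\<lambda>_. f k) = (if j = k then \<i> else 0)"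
    and ex: "\<And>v. v = (\<Sum>k\<in>UNIV. Re (\<alpha> k (fst z) (\<lambda>_. v)) *\<^sub>R u k + Im (\<alpha> k (fst z) (\<lambda>_. v)) *\<^sub>R f k)"
    by (rule frame[OF fst_in_W[OF z]]) (rule that, assumption+)
  define F where "F a b v w = curv_form \<alpha> a b z (case_nat (v, 0) (\<lambda>_. (w, 0)))" for a b :: 'r and v w
  have l0: "linear (\<lambda>v :: real^6. (v, 0 :: complex^'r^'r^3))" by (rule linearI) simp_all
  have l1: "linear (\<lambda>v. F a b v w)" for a b w
    using linear_compose[OF l0 curv_pair_linear(1)] by (simp add: F_def o_def)
  have l2: "linear (\<lambda>w. F a b v w)" for a b v
    using linear_compose[OF l0 curv_pair_linear(2)] by (simp add: F_def o_def)
  have skew: "cnj (F b a v w) = - F a b v w" for a b v w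
    unfolding F_def by (subst (2) curv_form_skew[OF W \<alpha>_smooth z]) simp
  \<comment> \<open>The (1,0)-coefficients of the 1-form \<open>w \<mapsto> - F a b v w / 2\<close>:
    one factor 2 in the denominator stems from this half, the other from the
    (1,0)-projection.\<close>
  define L :: "real^6 \<Rightarrow> complex^'r^'r^3" where
    "L v = (\<chi> j a b. - (F a b v (u j) - \<i> * F a b v (f j)) / 4)" for v
  have "linear L"
    by (rule linearI)
       (simp_all add: L_def vec_eq_iff linear_add[OF l1] linear_cmul[OF l1] scaleR_conv_of_real[where 'a=complex] field_simps)
  have ve: "vert (fst z) (L v) a b (\<lambda>_. w) = - F a b v w / 2" for v w a b
  proof -
    have "F a b v w = F a b v (\<Sum>k\<in>UNIV. Re (\<alpha> k (fst z) (\<lambda>_. w)) *\<^sub>R u k + Im (\<alpha> k (fst z) (\<lambda>_. w)) *\<^sub>R f k)"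
      using ex[of w] by simp
    also have "\<dots> = (\<Sum>k\<in>UNIV. Re (\<alpha> k (fst z) (\<lambda>_. w)) *\<^sub>R F a b v (u k) + Im (\<alpha> k (fst z) (\<lambda>_. w)) *\<^sub>R F a b v (f k))"
      by (simp only: linear_sum[OF l2] linear_add[OF l2] linear_cmul[OF l2])
    finally have F: "F a b v w = \<dots>" .
    \<comment> \<open>One summand of \<open>vert\<close>: since \<open>F\<close> is skew-Hermitian,
      the subtracted conjugate is the (0,1)-part of the same 1-form.\<close>
    have t: "- (p - \<i> * q) / 4 * A - cnj (- (p' - \<i> * q') / 4) * cnj A = - (Re A *\<^sub>R p + Im A *\<^sub>R q) / 2"
      if "cnj p' = - p" "cnj q' = - q" for p q p' q' A :: complex
    proof -
      have "p' = - cnj p" "q' = - cnj q" using that by (metis complex_cnj_cnj complex_cnj_minus)+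
      then show ?thesis by (simp add: complex_eq_iff field_simps)
    qed
    have "vert (fst z) (L v) a b (\<lambda>_. w) =
        (\<Sum>k\<in>UNIV. - (Re (\<alpha> k (fst z) (\<lambda>_. w)) *\<^sub>R F a b v (u k) + Im (\<alpha> k (fst z) (\<lambda>_. w)) *\<^sub>R F a b v (f k)) / 2)"
      unfolding vert_def
    proof (rule sum.cong[OF refl])
      fix j :: 3
      have 1: "L v $ j $ a $ b = - (F a b v (u j) - \<i> * F a b v (f j)) / 4"
        "L v $ j $ b $ a = - (F b a v (u j) - \<i> * F b a v (f j)) / 4"
        by (simp_all add: L_def)
      show "L v $ j $ a $ b * \<alpha> j (fst z) (\<lambda>_. w) - cnj (L v $ j $ b $ a) * cnj (\<alpha> j (fst z) (\<lambda>_. w)) =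
          - (Re (\<alpha> j (fst z) (\<lambda>_. w)) *\<^sub>R F a b v (u j) + Im (\<alpha> j (fst z) (\<lambda>_. w)) *\<^sub>R F a b v (f j)) / 2"
        unfolding 1 by (rule t) (rule skew)+
    qed
    also have "\<dots> = - F a b v w / 2" unfolding F by (simp only: sum_negf[symmetric] sum_divide_distrib)
    finally show ?thesis .
  qed
  have "curv_form \<alpha> a b z (case_nat (v, L v) (\<lambda>_. (w, L w))) = 0" for a b v w
  proof -
    have "F a b w v = - F a b v w" unfolding F_def by (rule curv_pair_skew)
    moreover have "curv_form \<alpha> a b z (case_nat (v, L v) (\<lambda>_. (w, L w))) =
        F a b v w + vert (fst z) (L v) a b (\<lambda>_. w) - vert (fst z) (L w) a b (\<lambda>_. v)"
      unfolding F_def by (rule curv_pair)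
    ultimately show ?thesis unfolding ve by simp
  qed
  with \<open>linear L\<close> show ?thesis by (rule that)
qed

text \<open>The graph of \<open>L\<close> projects isomorphically to the base, and the curvature
  itself vanishes on it, hence so does every product with the curvature.\<close>

lemma admissible_exists: "\<exists>E. admissible_element TX TI 6 \<Omega>6 z E"
proof -
  obtain L :: "real^6 \<Rightarrow> complex^'r^'r^3" where L: "linear L"
    and F: "\<And>a b v w. curv_form \<alpha> a b z (case_nat (v, L v) (\<lambda>_. (w, L w))) = 0"
    by (rule flat_graph) (rule that, assumption+)
  define g where "g v = (v, L v)" for v
  have lg: "linear g" by (rule linearI) (simp_all add: g_def linear_add[OF L] linear_cmul[OF L])
  have curv0: "curv_form \<alpha> a b z e = 0" if "\<And>i. e i \<in> range g" for a b e
  proof -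
    have "curv_form \<alpha> a b z e = curv_form \<alpha> a b z (case_nat (e 0) (\<lambda>_. e 1))"
      by (rule covector_cong[OF curv_form_covector[OF z]]) (auto simp: One_nat_def less_Suc_eq numeral_2_eq_2)
    also have "\<dots> = 0"
    proof -
      from that[of 0] that[of 1] obtain v w where "e 0 = g v" "e 1 = g w" by blast
      then show ?thesis by (simp only: g_def F)
    qed
    finally show ?thesis .
  qed
  have w0: "ewedge 2 n (curv_form \<alpha> a b z) h e = 0" if "\<And>i. e i \<in> range g" for n a b h e
  proof -
    have "curv_form \<alpha> a b z (\<lambda>i. e (\<sigma> i)) = 0" for \<sigma> :: "nat \<Rightarrow> nat" by (rule curv0) (rule that)
    then show ?thesis by (simp add: ewedge_def)
  qed
  have 1: "integral_element TX TI z (range g)"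
    by (rule integral_elementI[OF z linear_subspace_image[OF lg subspace_UNIV]])
       (simp_all only: F_alpha_at[OF z] F_eta_at[OF z] w0)
  have 2: "dim (range g) = 6"
    using dim_image_eq[OF lg, of UNIV] by (simp add: inj_on_def g_def)
  obtain b :: "nat \<Rightarrow> real^6" where "b ` {..<DIM(real^6)} = Basis" by (rule basis_enum)
  then have 3: "\<Omega>6 z (\<lambda>i. g (b i)) \<noteq> 0"
    unfolding indep_form_nonzero_iff[OF z] using vol_nonzero[OF fst_in_W[OF z], of b] by (simp add: g_def del: word.simps)
  show ?thesis
    unfolding admissible_element_def
    by (intro exI[of _ "range g"] conjI 1 2 exI[of _ "\<lambda>i. g (b i)"] allI rangeI 3)
qed

text \<open>The independence condition makes \<open>E\<close> project onto the base, so the adapted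
  frame there lifts to \<open>E\<close>; all conditions on it depend only on the projection.\<close>

lemma adapted_basis:
  assumes E: "admissible_element TX TI 6 \<Omega>6 z E"
  obtains b where "\<And>i. b i \<in> E" "span (b ` {..<6}) = E" "\<Omega>6 z b \<noteq> 0" "chi (fst z) 2 (\<lambda>i. fst (b i)) \<noteq> 0"
    "chi (fst z) 3 (\<lambda>i. fst (b (Suc i))) \<noteq> 0" "Qf (fst z) (\<lambda>i. fst (b i)) \<noteq> 0"
proof -
  obtain U :: "nat \<Rightarrow> real^6" where U: "word Th [0, 1, 2, 3, 4, 5] (fst z) U \<noteq> 0" "chi (fst z) 2 U \<noteq> 0"
    "chi (fst z) 3 (\<lambda>i. U (Suc i)) \<noteq> 0" "Qf (fst z) U \<noteq> 0"
    by (rule adapted_frame[OF fst_in_W[OF z]]) (rule that, assumption+)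
  have sE: "subspace E" and dE: "dim E = 6" using E by (auto simp: admissible_element_def integral_element_def)
  obtain e where e: "\<And>i. e i \<in> E" "\<Omega>6 z e \<noteq> 0" using E unfolding admissible_element_def by blast
  have "fst ` span (e ` {..<6}) \<subseteq> fst ` E" by (intro image_mono span_minimal sE) (use e in blast)
  from dim_subset[OF this] have "6 \<le> dim (fst ` E)" unfolding indep_frame(2)[OF z e(2)] .
  then have "dim (fst ` E) = DIM(real^6)" using dim_subset_UNIV[of "fst ` E"] by simp
  then have "span (fst ` E) = UNIV" by (simp only: dim_eq_full)
  moreover have "span (fst ` E) = fst ` E" by (rule span_eq_iff[THEN iffD2]) (rule linear_subspace_image[OF linear_fst sE])
  ultimately have "\<forall>i. \<exists>v. v \<in> E \<and> fst v = U i" by (metis UNIV_I imageE)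
  then obtain b where b: "\<And>i. b i \<in> E" "\<And>i. fst (b i) = U i" by metis
  have \<Omega>: "\<Omega>6 z b \<noteq> 0" unfolding indep_form_nonzero_iff[OF z] b(2) by (rule U)
  have "span (b ` {..<6}) = E"
  proof (rule subspace_dim_equal[OF subspace_span sE])
    show "span (b ` {..<6}) \<subseteq> E" by (rule span_minimal[OF _ sE]) (use b(1) in blast)
    show "dim E \<le> dim (span (b ` {..<6}))" unfolding dE using indep_frame(1)[OF z \<Omega>, of 6] by simp
  qed
  then show ?thesis using that[of b] b(1) \<Omega> U(2-4) unfolding b(2) by blast
qed

text \<open>The flag is spanned by the initial segments of an adapted basis; its members are
  integral as subspaces of \<open>E\<close>.\<close>

lemma ordinary_flag_exists:
  assumes E: "admissible_element TX TI 6 \<Omega>6 z E"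
  shows "\<exists>Fl. ordinary_flag TX TI 6 z Fl \<and> Fl 6 = E"
proof -
  obtain b where b: "\<And>i. b i \<in> E" "span (b ` {..<6}) = E" "\<Omega>6 z b \<noteq> 0" "chi (fst z) 2 (\<lambda>i. fst (b i)) \<noteq> 0"
    "chi (fst z) 3 (\<lambda>i. fst (b (Suc i))) \<noteq> 0" "Qf (fst z) (\<lambda>i. fst (b i)) \<noteq> 0"
    by (rule adapted_basis[OF E]) (rule that, assumption+)
  define Fl where "Fl k = span (b ` {..<k})" for k
  have iE: "integral_element TX TI z E" and sE: "subspace E"
    using E by (auto simp: admissible_element_def integral_element_def)
  have i: "integral_element TX TI z (Fl k)" for k
    unfolding Fl_def by (rule integral_element_subset[OF iE subspace_span span_minimal[OF _ sE]]) (use b(1) in blast)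
  have d: "dim (Fl k) = k" if "k \<le> 6" for k unfolding Fl_def by (rule indep_frame(1)[OF z b(3) that])
  have "kaehler_regular TX TI z (Fl k)" if k: "k < 6" for k
  proof -
    consider "k \<le> 3" | "k = 4" | "k = 5" using k by linarith
    then show ?thesis
    proof cases
      case 1 then show ?thesis unfolding Fl_def by (rule kaehler_regular_small[OF z b(3)])
    next
      case 2 then show ?thesis unfolding Fl_def using kaehler_regular_4[OF z b(3,4)] by simp
    next
      case 3
      have "kaehler_ordinary TX TI z (span (b ` {..<5}))"
        by (rule kaehler_ordinary_5[OF z b(3,5)]) (use i[of 5] in \<open>simp add: Fl_def\<close>)
      then show ?thesis using kaehler_regular_5[OF z _ _ b(6)] d[of 5] 3 by (simp add: Fl_def)
    qed
  qed
  moreover have "Fl k \<subseteq> Fl (Suc k)" for k unfolding Fl_def by (intro span_mono image_mono) auto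
  ultimately have "ordinary_flag TX TI 6 z Fl" using i d unfolding ordinary_flag_def integral_flag_def by blast
  then show ?thesis using b(2) by (auto simp: Fl_def)
qed

text \<open>The given flag may violate the conditions on \<open>chi\<close> and \<open>Qf\<close>
  under which the dimensions were computed. Regularity keeps the dimension constant on nearby
  integral elements, so the frame is moved slightly towards an adapted basis \<open>d\<close> of
  \<open>Fl 6\<close>, after which the formulas apply.\<close>

lemma regular_polar_dims:
  assumes Fl: "ordinary_flag TX TI 6 z Fl" and E: "admissible_element TX TI 6 \<Omega>6 z (Fl 6)"
  shows "dim (polar_space TI z (Fl 4)) + 2 * CARD('r) ^ 2 = DIM('r total)"
    and "dim (polar_space TI z (Fl 5)) = 6 + CARD('r) ^ 2"
proof -
  obtain d where d: "\<And>i. d i \<in> Fl 6" "chi (fst z) 2 (\<lambda>i. fst (d i)) \<noteq> 0" "Qf (fst z) (\<lambda>i. fst (d i)) \<noteq> 0"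
    by (rule adapted_basis[OF E]) (rule that, assumption+)
  have flag: "integral_element TX TI z (Fl k)" "dim (Fl k) = k" if "k \<le> 6" for k
    using Fl that by (auto simp: ordinary_flag_def integral_flag_def)
  have reg: "\<exists>e N. span (e ` {..<k}) = Fl k \<and> open N \<and> (z, e) \<in> N \<and>
        (\<forall>(y, b)\<in>N. integral_element TX TI y (span (b ` {..<k})) \<and> dim (span (b ` {..<k})) = k \<longrightarrow>
           dim (polar_space TI y (span (b ` {..<k}))) = dim (polar_space TI z (Fl k)))" if k: "k < 6" for k
  proof -
    have "kaehler_regular TX TI z (Fl k)" using Fl k by (simp add: ordinary_flag_def)
    then show ?thesis using flag(2)[of k] k unfolding kaehler_regular_def by simp
  qed
  have at1: "e i + 1 *\<^sub>R (d i - e i) = d i" for e :: "nat \<Rightarrow> 'r total" and i by simp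
  show "dim (polar_space TI z (Fl 4)) + 2 * CARD('r) ^ 2 = DIM('r total)"
  proof -
    have "4 < (6 :: nat)" by simp
    from reg[OF this] obtain e :: "nat \<Rightarrow> 'r total" and N where se: "span (e ` {..<4}) = Fl 4" and N: "open N" "(z, e) \<in> N"
      and P0: "\<forall>(y, b)\<in>N. integral_element TX TI y (span (b ` {..<4})) \<and> dim (span (b ` {..<4})) = 4 \<longrightarrow>
         dim (polar_space TI y (span (b ` {..<4}))) = dim (polar_space TI z (Fl 4))"
      by (elim exE conjE) (rule that, assumption+)
    have P: "dim (polar_space TI z (span (b ` {..<4}))) = dim (polar_space TI z (Fl 4))"
      if "(z, b) \<in> N" "integral_element TX TI z (span (b ` {..<4}))" "dim (span (b ` {..<4})) = 4" for b :: "nat \<Rightarrow> 'r total"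
      using P0 that by blast
    obtain p where p: "\<And>t. chi (fst z) 2 (\<lambda>i. fst (e i + t *\<^sub>R (d i - e i))) = poly p (of_real t)"
      using covector_line_poly[OF covector_pull_total[OF z chi_covector[OF z]], of 2 e "\<lambda>i. d i - e i"] by blast
    \<comment> \<open>At parameter 1 the frame is \<open>d\<close>, where the polynomial is nonzero;
      so it is nonzero for some parameter that leaves the frame in the neighbourhood
      \<open>N\<close>.\<close>
    have "poly p (of_real 1) \<noteq> 0" using d(2) p[of 1] unfolding at1 by simp
    then obtain t where t: "(z, \<lambda>i. e i + t *\<^sub>R (d i - e i)) \<in> N" "poly p (of_real t) \<noteq> 0"
      by (rule frame_perturb[OF N]) (rule that, assumption+)
    let ?b = "\<lambda>i. e i + t *\<^sub>R (d i - e i)"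
    have c: "chi (fst z) 2 (\<lambda>i. fst (?b i)) \<noteq> 0" using t(2) p by simp
    have dim4: "dim (span (?b ` {..<4})) = 4" by (rule frame_dim(1)[OF z chi_covector[OF z] c])
    have "integral_element TX TI z (span (?b ` {..<4}))"
      by (rule integral_element_small[OF z subspace_span]) (simp only: dim4)
    from P[OF t(1) this dim4] polar_space_4_dim[OF z c] show ?thesis by simp
  qed
  show "dim (polar_space TI z (Fl 5)) = 6 + CARD('r) ^ 2"
  proof -
    have "5 < (6 :: nat)" by simp
    from reg[OF this] obtain e :: "nat \<Rightarrow> 'r total" and N where se: "span (e ` {..<5}) = Fl 5" and N: "open N" "(z, e) \<in> N"
      and P0: "\<forall>(y, b)\<in>N. integral_element TX TI y (span (b ` {..<5})) \<and> dim (span (b ` {..<5})) = 5 \<longrightarrow>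
         dim (polar_space TI y (span (b ` {..<5}))) = dim (polar_space TI z (Fl 5))"
      by (elim exE conjE) (rule that, assumption+)
    have P: "dim (polar_space TI z (span (b ` {..<5}))) = dim (polar_space TI z (Fl 5))"
      if "(z, b) \<in> N" "integral_element TX TI z (span (b ` {..<5}))" "dim (span (b ` {..<5})) = 5" for b :: "nat \<Rightarrow> 'r total"
      using P0 that by blast
    note cp = covector_pull_total[OF z kap_covector[OF fst_in_W[OF z]]]
    \<comment> \<open>\<open>Qf\<close> involves conjugates, but along a real line both
      \<open>kap\<close> and its conjugate are polynomials in the parameter, and hence so is
      \<open>Qf\<close>.\<close>
    have "\<exists>p. \<forall>t. kap (fst z) j (\<lambda>i. fst (e i + t *\<^sub>R (d i - e i))) = poly p (of_real t)" for j
      by (rule covector_line_poly[OF cp])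
    then obtain p where p: "\<And>j t. kap (fst z) j (\<lambda>i. fst (e i + t *\<^sub>R (d i - e i))) = poly (p j) (of_real t)" by metis
    have "\<exists>p. \<forall>t. cnj (kap (fst z) j (\<lambda>i. fst (e i + t *\<^sub>R (d i - e i)))) = poly p (of_real t)" for j
      by (rule covector_line_poly[OF covector_cnj[OF cp]])
    then obtain q where q: "\<And>j t. cnj (kap (fst z) j (\<lambda>i. fst (e i + t *\<^sub>R (d i - e i)))) = poly (q j) (of_real t)" by metis
    have Qp: "Qf (fst z) (\<lambda>i. fst (e i + t *\<^sub>R (d i - e i))) = poly (\<Sum>j\<in>UNIV. smult (sig \<epsilon> j) (p j * q j)) (of_real t)" for t
      unfolding Qf_def q unfolding p by (simp add: poly_sum)
    have "poly (\<Sum>j\<in>UNIV. smult (sig \<epsilon> j) (p j * q j)) (of_real 1) \<noteq> 0"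
      using d(3) Qp[of 1] unfolding at1 by simp
    then obtain t where t: "(z, \<lambda>i. e i + t *\<^sub>R (d i - e i)) \<in> N" "poly (\<Sum>j\<in>UNIV. smult (sig \<epsilon> j) (p j * q j)) (of_real t) \<noteq> 0"
      by (rule frame_perturb[OF N]) (rule that, assumption+)
    let ?b = "\<lambda>i. e i + t *\<^sub>R (d i - e i)"
    have Q: "Qf (fst z) (\<lambda>i. fst (?b i)) \<noteq> 0" using t(2) Qp by simp
    have "\<exists>j. kap (fst z) j (\<lambda>i. fst (?b i)) \<noteq> 0"
    proof (rule ccontr)
      assume "\<nexists>j. kap (fst z) j (\<lambda>i. fst (?b i)) \<noteq> 0"
      then have "kap (fst z) j (\<lambda>i. fst (?b i)) = 0" for j by blast
      then show False using Q by (simp only: Qf_def mult_zero_left mult_zero_right sum.neutral_const)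
    qed
    then obtain j where j: "kap (fst z) j (\<lambda>i. fst (?b i)) \<noteq> 0" ..
    have dim5: "dim (span (?b ` {..<5})) = 5" by (rule frame_dim(1)[OF z kap_covector[OF fst_in_W[OF z]] j])
    \<comment> \<open>In dimension 5 a nearby plane need not be integral. Here the old frame and
      \<open>d\<close> both lie in \<open>Fl 6\<close>, so the moved plane is a subspace of an
      integral element.\<close>
    have s6: "subspace (Fl 6)" using flag(1)[of 6] by (simp add: integral_element_def)
    have "Fl 5 \<subseteq> Fl 6" using Fl by (auto simp: ordinary_flag_def integral_flag_def numeral_eq_Suc)
    then have "e i \<in> Fl 6" if "i < 5" for i using se span_base[of "e i" "e ` {..<5}"] that by blast
    then have "?b i \<in> Fl 6" if "i < 5" for i
      using that d(1) s6 by (intro subspace_add subspace_scale subspace_diff) auto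
    then have "span (?b ` {..<5}) \<subseteq> Fl 6" by (intro span_minimal s6) blast
    then have int: "integral_element TX TI z (span (?b ` {..<5}))"
      by (rule integral_element_subset[OF flag(1)[of 6] subspace_span, rotated]) simp
    show ?thesis using P[OF t(1) int dim5] polar_space_5_dim[OF z integral_element_F_alpha[OF int] Q] by simp
  qed
qed

end

section \<open>Involutivity and the characters\<close>

theorem system_involutive:
  "involutive (TX :: 'r::finite total set) TI 6 \<Omega>6"
  unfolding involutive_def
proof (intro conjI ballI allI impI)
  show "d_closed (TI :: nat \<Rightarrow> ('r total, real) form \<Rightarrow> bool)" by (rule system_d_closed)
  show "\<exists>E. admissible_element TX TI 6 \<Omega>6 z E" if "z \<in> TX" for z :: "'r total" by (rule admissible_exists[OF that])
  show "\<exists>Fl. ordinary_flag TX TI 6 z Fl \<and> Fl 6 = E" if E: "admissible_element TX TI 6 \<Omega>6 z E" for z :: "'r total" and E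
    by (rule ordinary_flag_exists[OF _ E]) (use E in \<open>simp add: admissible_element_def integral_element_def\<close>)
qed

theorem system_characters:
  "has_cartan_characters (TX :: 'r::finite total set) TI 6 \<Omega>6
     [0, 0, 0, 0, 2 * int CARD('r) ^ 2, 3 * int CARD('r) ^ 2, int CARD('r) ^ 2]"
  unfolding has_cartan_characters_def
proof (intro allI impI)
  fix z :: "'r total" and Fl
  assume "ordinary_flag TX TI 6 z Fl \<and> admissible_element TX TI 6 \<Omega>6 z (Fl 6)"
  then have Fl: "ordinary_flag TX TI 6 z Fl" and E: "admissible_element TX TI 6 \<Omega>6 z (Fl 6)" by blast+
  have z: "z \<in> TX" using E by (simp add: admissible_element_def integral_element_def)
  \<comment> \<open>The fibre consists of three complex \<open>r \<times> r\<close> matrices; its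
    real dimension \<open>6r^2\<close> is also the last codimension.\<close>
  have D: "DIM('r total) = 6 + 6 * CARD('r) ^ 2" by (simp add: power2_eq_square)
  have 0: "dim (polar_space TI z (Fl k)) = DIM('r total)" if "k \<le> 3" for k
  proof -
    have "dim (Fl k) = k" using Fl that by (simp add: ordinary_flag_def integral_flag_def)
    then have "polar_space TI z (Fl k) = UNIV" by (intro polar_space_small[OF z]) (use that in simp)
    then show ?thesis by (simp only: dim_UNIV)
  qed
  note R = regular_polar_dims[OF z Fl E]
  let ?c = "polar_codim TI 6 z Fl"
  have c0: "?c k = 0" if "k \<le> 3" for k using 0[OF that] that by (simp add: polar_codim_def del: DIM_prod)
  have c4: "?c 4 = 2 * int CARD('r) ^ 2"
  proof -
    have "int (dim (polar_space TI z (Fl 4))) + 2 * int CARD('r) ^ 2 = int DIM('r total)"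
      using arg_cong[OF R(1), of int] by (simp only: of_nat_add of_nat_mult of_nat_power of_nat_numeral)
    then show ?thesis by (simp add: polar_codim_def del: DIM_prod)
  qed
  have c5: "?c 5 = 5 * int CARD('r) ^ 2" unfolding polar_codim_def R(2) D by simp
  have c6: "?c 6 = 6 * int CARD('r) ^ 2" unfolding polar_codim_def D by simp
  have l: "[0..<Suc 6] = [0, 1, 2, 3, 4, 5, 6]" by (simp add: upt_rec)
  show "map (flag_character TI 6 z Fl) [0..<Suc 6] =
      [0, 0, 0, 0, 2 * int CARD('r) ^ 2, 3 * int CARD('r) ^ 2, int CARD('r) ^ 2]"
    unfolding l by (simp add: flag_character_def c0 c4 c5 c6)
qed

end

theorem proposition7:
  fixes A :: "'m::{t2_space, second_countable_topology} chart set"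
    and J :: "'m chart \<Rightarrow> real^6 \<Rightarrow> real^6 \<Rightarrow> real^6"
    and \<eta> :: "'m chart \<Rightarrow> (real^6, real) form"
    and \<epsilon> :: real
    and pr :: "'e \<Rightarrow> 'm"
    and \<T> :: "('m, 'e, 'r::finite) triv set"
    and h :: "'e \<Rightarrow> 'e \<Rightarrow> complex"
    and c :: "'m chart"
    and W :: "(real^6) set"
    and \<alpha> :: "3 \<Rightarrow> (real^6, complex) form"
    and \<sigma> :: "'r \<Rightarrow> 'm \<Rightarrow> 'e"
  assumes "smooth_atlas A"
    and "\<epsilon> = 1 \<and> U3_structure A J \<eta> \<or> \<epsilon> = - 1 \<and> U12_structure A J \<eta>"
    and "quasi_integrable \<epsilon> A J \<eta>"
    and "vector_bundle A pr \<T>"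
    and "hermitian_metric A pr \<T> h"
    and "c \<in> A" and "open W" and "W \<subseteq> chart_image c"
    and "unitary_coframing \<epsilon> (J c) (\<eta> c) W \<alpha>"
    and "unitary_frame A pr \<T> h (chart_inv c ` W) \<sigma>"
  shows "involutive (system_domain W :: 'r total set) (system_ideal W \<alpha> (\<eta> c)) 6 (indep_form \<alpha>) \<and>
         has_cartan_characters (system_domain W :: 'r total set) (system_ideal W \<alpha> (\<eta> c)) 6
             (indep_form \<alpha>)
             [0, 0, 0, 0, 2 * int CARD('r) ^ 2, 3 * int CARD('r) ^ 2, int CARD('r) ^ 2]"
proof -
  have eps: "\<epsilon> = 1 \<or> \<epsilon> = - 1" using assms(2) by blast
  \<comment> \<open>Quasi-integrability speaks of all local unitary coframings; for
    \<open>\<alpha>\<close> over \<open>W\<close> it is the torsion assumption of the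
    locale.\<close>
  have "\<exists>\<mu>. \<forall>x\<in>W. is_torsion_matrix (J c) \<alpha> x (\<chi> j k. if j = k then sig \<epsilon> j * \<mu> x else 0)"
    using assms(3,6-9) unfolding quasi_integrable_def by blast
  then interpret unitary_system \<epsilon> "J c" "\<eta> c" W \<alpha>
    by (unfold_locales) (use assms(7,9) eps in blast)+
  show ?thesis using system_involutive[where 'r='r] system_characters[where 'r='r] by blast
qed

end
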